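(* Let $d\geq 2$ and let $B=B_1\cup B_2\cup B_3$ be a 3C-curve of degree $b\geq 4$, with $b_i=\deg B_i$ and $b_1\leq b_2\leq b_3$, such that $\mathrm{Hyp}_d(B,2)$ is not empty. Then $b_1=1$ and the following hold. (a) If $b_2=1$, setting $B_1\cap B_2=\{p\}$, we have $$\mathrm{Hyp}_d(B,2)=\bigcup_{\substack{\{i,j\}=\{1,2\}\\ q\in B_j\cap B_3}}\mathrm{Hyp}_d^{d-1}(B_i;p)\cap\mathrm{Hyp}_d(B_3;q).$$ (b) If $b_2\geq 2$ then $\mathrm{Hyp}_{d'}(B,2)$ is empty for every $d'\geq 3$, and $$\mathrm{Hyp}_2(B,2)=\bigcup_{\substack{p\in B_1\cap B_2\\ q\in B_1\cap B_3}}\mathrm{Hyp}_2(B_2;p)\cap\mathrm{Hyp}_2(B_3;q).$$ (c) Every $C\in\mathrm{Hyp}_d(B,2)$ is rational (hence $\mathcal{E}(B)=\mathrm{Hyp}(B,2)$).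
   Context: We work over $\mathbb{C}$; a curve is integral if it is reduced and irreducible. A 3C-curve is a reduced plane curve $B=B_1\cup B_2\cup B_3\subset\mathbb{P}^2$ with each $B_i$ integral of degree $b_i\geq 1$, such that for all $i\neq j$ every point of $B_i\cap B_j$ is a node of $B$ (so the components meet only pairwise and transversally); one always assumes $b_1\leq b_2\leq b_3$. For an integral plane curve $C$, $\nu_C:C^\nu\to C$ is the normalization, and $C$ is rational if $C^\nu$ has genus $0$. For a reduced plane curve $D$ and $q\in D$ define $$\mathrm{Hyp}(D;q)=\{C\subset\mathbb{P}^2:\ C\text{ integral},\ C\cap D=\{q\},\ |\nu_C^{-1}(q)|=1\},$$ let $\mathrm{Hyp}_d(D;q)$ be the subset of curves of degree $d$, and let $\mathrm{Hyp}_d^m(D;q)$ be the subset of $\mathrm{Hyp}_d(D;q)$ of curves $C$ with $\mathrm{mult}_q(C)=m$. Also $$\mathrm{Hyp}(D,2)=\{C\subset\mathbb{P}^2:\ C\text{ integral},\ |\nu_C^{-1}(C\cap D)|\leq 2\},$$ $\mathrm{Hyp}_d(D,2)$ is its subset of curves of degree $d$, and $\mathcal{E}(D)$ is the set of rational curves belonging to $\mathrm{Hyp}(D,2)$. *)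

theory Defs
  imports
    "HOL-Algebra.Embedded_Algebras"
    "HOL-Analysis.Analysis"
    "HOL-Computational_Algebra.Computational_Algebra"
begin

section \<open>The projective plane and ternary forms\<close>

text \<open>A point of the complex projective plane is a line through the origin of complex 3-space.\<close>

typedef proj_plane = "{l :: (complex^3) set. \<exists>v. v \<noteq> 0 \<and> l = range (\<lambda>c. c *s v)}"
proof -
  have "axis 1 1 \<noteq> (0 :: complex^3)" by (simp add: axis_eq_0_iff)
  then show ?thesis by blast
qed

text \<open>Polynomials in x, y, z with complex coefficients are represented as elements of
  \<open>C[x][y][z]\<close>; the coefficient of \<open>x^i y^j z^k\<close> in \<open>F\<close> is
  \<open>coeff (coeff (coeff F k) j) i\<close>.\<close>

type_synonym cpoly3 = "complex poly poly poly"

definition homogeneous :: "nat \<Rightarrow> cpoly3 \<Rightarrow> bool" where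
  "homogeneous n F \<longleftrightarrow>
     (\<forall>i j k. Polynomial.coeff (Polynomial.coeff (Polynomial.coeff F k) j) i \<noteq> 0 \<longrightarrow> i + j + k = n)"

text \<open>The value \<open>F(a, b, c)\<close> in a complex algebra with structure map \<open>h\<close>.\<close>

definition subst3 :: "(complex \<Rightarrow> 'a::comm_ring_1) \<Rightarrow> cpoly3 \<Rightarrow> 'a \<Rightarrow> 'a \<Rightarrow> 'a \<Rightarrow> 'a" where
  "subst3 h F a b c =
     poly (map_poly (\<lambda>G. poly (map_poly (\<lambda>H. poly (map_poly h H) a) G) b) F) c"

definition vanishes_at :: "cpoly3 \<Rightarrow> proj_plane \<Rightarrow> bool" where
  "vanishes_at F q \<longleftrightarrow> (\<forall>v\<in>Rep_proj_plane q. subst3 id F (v $ 1) (v $ 2) (v $ 3) = 0)"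


section \<open>Reduced plane curves\<close>

text \<open>A reduced plane curve is identified with its set of points. It determines its reduced
  equation up to a nonzero constant, so degree, multiplicities and nodes are read off
  from any such equation.\<close>

definition reduced_equation :: "cpoly3 \<Rightarrow> proj_plane set \<Rightarrow> bool" where
  "reduced_equation F D \<longleftrightarrow>
     (\<exists>n>0. homogeneous n F) \<and> squarefree F \<and> D = {q. vanishes_at F q}"

definition integral_curve :: "proj_plane set \<Rightarrow> bool" where
  "integral_curve C \<longleftrightarrow>
     (\<exists>F n. homogeneous n F \<and> Factorial_Ring.irreducible F \<and> C = {q. vanishes_at F q})"

definition curve_degree :: "proj_plane set \<Rightarrow> nat" where
  "curve_degree D = (THE n. \<exists>F. reduced_equation F D \<and> homogeneous n F)"

text \<open>For \<open>q\<close> on \<open>D\<close>, choose projective coordinates in which \<open>q = [0:0:1]\<close> (the columns of an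
  invertible matrix \<open>A\<close>, the last one representing \<open>q\<close>) and dehomogenise an equation of \<open>D\<close>.
  The result is a polynomial in \<open>C[s][t]\<close> with \<open>q\<close> at the origin; multiplicity and tangent
  directions do not depend on the choices.\<close>

definition local_equation :: "proj_plane set \<Rightarrow> proj_plane \<Rightarrow> complex poly poly" where
  "local_equation D q =
     (let F = (SOME F. reduced_equation F D);
          A = (SOME A :: complex^3^3. invertible A \<and> column 3 A \<in> Rep_proj_plane q);
          L = (\<lambda>i. [:[:A $ i $ 3, A $ i $ 1:], [:A $ i $ 2:]:])
      in subst3 (\<lambda>c. [:[:c:]:]) F (L 1) (L 2) (L 3))"

definition mult_at :: "proj_plane \<Rightarrow> proj_plane set \<Rightarrow> nat" where
  "mult_at q D =
     (LEAST m. \<exists>i j. i + j = m \<and> Polynomial.coeff (Polynomial.coeff (local_equation D q) j) i \<noteq> 0)"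

text \<open>A node is a double point at which the quadratic part of the local equation is a product
  of two non-proportional linear forms \<open>\<alpha> s + \<beta> t\<close> and \<open>\<gamma> s + \<delta> t\<close>.\<close>

definition is_node :: "proj_plane set \<Rightarrow> proj_plane \<Rightarrow> bool" where
  "is_node D q \<longleftrightarrow> q \<in> D \<and> mult_at q D = 2 \<and>
     (let f = local_equation D q in
      \<exists>\<alpha> \<beta> \<gamma> \<delta>. \<alpha> * \<delta> - \<beta> * \<gamma> \<noteq> 0 \<and>
        Polynomial.coeff (Polynomial.coeff f 0) 2 = \<alpha> * \<gamma> \<and>
        Polynomial.coeff (Polynomial.coeff f 1) 1 = \<alpha> * \<delta> + \<beta> * \<gamma> \<and>
        Polynomial.coeff (Polynomial.coeff f 2) 0 = \<beta> * \<delta>)"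

text \<open>Distinctness of the components expresses that \<open>B 1 + B 2 + B 3\<close> is reduced.\<close>

definition three_C_curve :: "(nat \<Rightarrow> proj_plane set) \<Rightarrow> bool" where
  "three_C_curve B \<longleftrightarrow>
     (\<forall>i\<in>{1,2,3}. integral_curve (B i)) \<and>
     (\<forall>i\<in>{1,2,3}. \<forall>j\<in>{1,2,3}. i \<noteq> j \<longrightarrow>
        B i \<noteq> B j \<and> (\<forall>q\<in>B i \<inter> B j. is_node (B 1 \<union> B 2 \<union> B 3) q)) \<and>
     curve_degree (B 1) \<le> curve_degree (B 2) \<and> curve_degree (B 2) \<le> curve_degree (B 3)"


section \<open>Function field and local rings of an integral curve\<close>

text \<open>The local ring of the plane at the generic point of \<open>C\<close>: fractions of forms of equal degree
  whose denominator does not vanish identically on \<open>C\<close>.\<close>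

definition generic_ring :: "proj_plane set \<Rightarrow> cpoly3 fract ring" where
  "generic_ring C =
     \<lparr>carrier = {Fract G H |G H. (\<exists>n. homogeneous n G \<and> homogeneous n H) \<and>
                   \<not> (\<forall>q\<in>C. vanishes_at H q)},
      monoid.mult = (*), one = 1, zero = 0, add = (+)\<rparr>"

definition generic_ideal :: "proj_plane set \<Rightarrow> cpoly3 fract set" where
  "generic_ideal C =
     {Fract G H |G H. (\<exists>n. homogeneous n G \<and> homogeneous n H) \<and>
        \<not> (\<forall>q\<in>C. vanishes_at H q) \<and> (\<forall>q\<in>C. vanishes_at G q)}"

definition function_field :: "proj_plane set \<Rightarrow> cpoly3 fract set ring" where
  "function_field C = generic_ring C Quot generic_ideal C"

definition restrict_to_curve :: "proj_plane set \<Rightarrow> cpoly3 fract \<Rightarrow> cpoly3 fract set" where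
  "restrict_to_curve C f = generic_ideal C +>\<^bsub>generic_ring C\<^esub> f"

definition constants :: "proj_plane set \<Rightarrow> cpoly3 fract set set" where
  "constants C = range (\<lambda>c. restrict_to_curve C (Fract [:[:[:c:]:]:] 1))"

definition local_ring :: "proj_plane set \<Rightarrow> proj_plane \<Rightarrow> cpoly3 fract set set" where
  "local_ring C q =
     {restrict_to_curve C (Fract G H) |G H.
        (\<exists>n. homogeneous n G \<and> homogeneous n H) \<and> \<not> vanishes_at H q}"


section \<open>Normalization\<close>

definition integral_closure :: "('a, 'b) ring_scheme \<Rightarrow> 'a set \<Rightarrow> 'a set" where
  "integral_closure K A =
     {x \<in> carrier K. \<exists>(n::nat) a. (\<forall>i<n. a i \<in> A) \<and>
        (x [^]\<^bsub>K\<^esub> n) \<oplus>\<^bsub>K\<^esub> (\<Oplus>\<^bsub>K\<^esub>i\<in>{..<n}. a i \<otimes>\<^bsub>K\<^esub> (x [^]\<^bsub>K\<^esub> i)) = \<zero>\<^bsub>K\<^esub>}"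

definition normal_ring :: "proj_plane set \<Rightarrow> proj_plane \<Rightarrow> cpoly3 fract set set" where
  "normal_ring C q = integral_closure (function_field C) (local_ring C q)"

text \<open>Over the local ring of \<open>C\<close> at \<open>q\<close> the normalization is the spectrum of the integral closure of
  that ring in the function field. Hence a (closed) point of the normalization is a pair of a
  point \<open>q\<close> of \<open>C\<close> and a maximal ideal of the integral closure, and the normalization map is the
  first projection.\<close>

type_synonym npoint = "proj_plane \<times> cpoly3 fract set set"

definition normalization :: "proj_plane set \<Rightarrow> npoint set" where
  "normalization C =
     {(q, M). q \<in> C \<and> maximalideal M ((function_field C)\<lparr>carrier := normal_ring C q\<rparr>)}"

definition normalization_preimage :: "proj_plane set \<Rightarrow> proj_plane set \<Rightarrow> npoint set" where
  "normalization_preimage C S = {P \<in> normalization C. fst P \<in> S}"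


section \<open>Genus\<close>

text \<open>The local ring of the normalization at a point: the integral closure localized
  at the maximal ideal.\<close>

definition point_ring :: "proj_plane set \<Rightarrow> npoint \<Rightarrow> cpoly3 fract set set" where
  "point_ring C P =
     {a \<otimes>\<^bsub>function_field C\<^esub> inv\<^bsub>function_field C\<^esub> b |a b.
        a \<in> normal_ring C (fst P) \<and> b \<in> normal_ring C (fst P) - snd P}"

text \<open>The order at \<open>P\<close> of a nonzero rational function \<open>f\<close>: \<open>f = u t^n\<close> with \<open>u\<close> a unit and \<open>t\<close> a
  generator of the maximal ideal of the local ring at \<open>P\<close>.\<close>

definition order_at :: "proj_plane set \<Rightarrow> npoint \<Rightarrow> cpoly3 fract set \<Rightarrow> int" where
  "order_at C P f =
     (let K = function_field C; R = K\<lparr>carrier := point_ring C P\<rparr> in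
      THE n. \<exists>t u. t \<in> carrier R \<and> PIdl\<^bsub>R\<^esub> t = carrier R - Units R \<and> u \<in> Units R \<and>
               f = u \<otimes>\<^bsub>K\<^esub> (t [^]\<^bsub>K\<^esub> n))"

definition divisor :: "proj_plane set \<Rightarrow> (npoint \<Rightarrow> int) \<Rightarrow> bool" where
  "divisor C D \<longleftrightarrow> finite {P \<in> normalization C. D P \<noteq> 0}"

definition divisor_degree :: "proj_plane set \<Rightarrow> (npoint \<Rightarrow> int) \<Rightarrow> int" where
  "divisor_degree C D = (\<Sum>P | P \<in> normalization C \<and> D P \<noteq> 0. D P)"

definition riemann_roch_space :: "proj_plane set \<Rightarrow> (npoint \<Rightarrow> int) \<Rightarrow> cpoly3 fract set set" where
  "riemann_roch_space C D =
     {f \<in> carrier (function_field C). f = \<zero>\<^bsub>function_field C\<^esub> \<or>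
        (\<forall>P\<in>normalization C. order_at C P f \<ge> - D P)}"

definition ell :: "proj_plane set \<Rightarrow> (npoint \<Rightarrow> int) \<Rightarrow> nat" where
  "ell C D = (THE n. ring.dimension (function_field C) n (constants C) (riemann_roch_space C D))"

text \<open>The genus of the normalization of \<open>C\<close>, as given by Riemann's theorem.\<close>

definition genus :: "proj_plane set \<Rightarrow> nat" where
  "genus C = (LEAST g. \<forall>D. divisor C D \<longrightarrow> int (ell C D) \<ge> divisor_degree C D + 1 - int g)"

definition rational_curve :: "proj_plane set \<Rightarrow> bool" where
  "rational_curve C \<longleftrightarrow> integral_curve C \<and> genus C = 0"


section \<open>The sets Hyp and E\<close>

definition Hyp_pt :: "proj_plane set \<Rightarrow> proj_plane \<Rightarrow> proj_plane set set" where
  "Hyp_pt D q =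
     {C. integral_curve C \<and> C \<inter> D = {q} \<and> card (normalization_preimage C {q}) = 1}"

definition Hyp_pt_deg :: "nat \<Rightarrow> proj_plane set \<Rightarrow> proj_plane \<Rightarrow> proj_plane set set" where
  "Hyp_pt_deg d D q = {C \<in> Hyp_pt D q. curve_degree C = d}"

definition Hyp_pt_deg_mult :: "nat \<Rightarrow> nat \<Rightarrow> proj_plane set \<Rightarrow> proj_plane \<Rightarrow> proj_plane set set" where
  "Hyp_pt_deg_mult d m D q = {C \<in> Hyp_pt_deg d D q. mult_at q C = m}"

definition Hyp2 :: "proj_plane set \<Rightarrow> proj_plane set set" where
  "Hyp2 D =
     {C. integral_curve C \<and> finite (normalization_preimage C (C \<inter> D)) \<and>
         card (normalization_preimage C (C \<inter> D)) \<le> 2}"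

definition Hyp2_deg :: "nat \<Rightarrow> proj_plane set \<Rightarrow> proj_plane set set" where
  "Hyp2_deg d D = {C \<in> Hyp2 D. curve_degree C = d}"

definition E_set :: "proj_plane set \<Rightarrow> proj_plane set set" where
  "E_set D = {C \<in> Hyp2 D. rational_curve C}"

end

theory Submission
  imports Defs "HOL-Algebra.Algebraic_Closure_Type"
begin

text \<open>
  Let \<open>C\<close> be in \<open>Hyp(B,2)\<close>, of degree at least 2. A rational function that is regular on the
  normalization of \<open>C\<close> is constant. Applied to quotients of forms this shows that \<open>C\<close> meets every
  \<open>B\<^sub>i\<close>, hence that \<open>C\<close> has exactly two places over \<open>B\<close>, at points \<open>P\<close> and \<open>Q\<close>. As \<open>B\<close> has only
  nodes there, one of the two components through \<open>P\<close> has contact order with \<open>C\<close> equal to the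
  multiplicity of \<open>C\<close> at \<open>P\<close>, while a component meeting \<open>C\<close> only at \<open>P\<close> has larger contact; so some
  \<open>B\<^sub>i\<close> is the line \<open>PQ\<close>, \<open>C \<inter> B\<^sub>j = {P}\<close> and \<open>C \<inter> B\<^sub>k = {Q}\<close>.
  If \<open>b\<^sub>j, b\<^sub>k \<ge> 2\<close>, the tangents \<open>x\<close> at \<open>P\<close>, \<open>y\<close> at \<open>Q\<close> and the line \<open>z = PQ\<close> make \<open>xy/z\<^sup>2\<close> regular,
  so \<open>C\<close> is a conic. If \<open>b\<^sub>j = 1\<close>, then \<open>B\<^sub>k\<close> is approximated at \<open>Q\<close> by a graph \<open>\<zeta> = \<phi>(v)\<close>, where \<open>v\<close> is
  the quotient of the lines \<open>B\<^sub>i\<close> and \<open>B\<^sub>j\<close>; comparing orders at \<open>P\<close> and \<open>Q\<close> shows that \<open>\<zeta> - \<phi>(v)\<close>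
  vanishes on \<open>C\<close>.

  Valuations of the function field are used with values in the rationals, normalised by one nonzero
  nonunit, so that discreteness is not needed.
\<close>


section \<open>Ternary forms\<close>

hide_const (open) Polynomials.degree Polynomials.lead_coeff UnivPoly.coeff UnivPoly.monom
 Divisibility.irreducible Divisibility.prime Coset.order

no_notation fps_nth (infixl \<open>$\<close> 75)

text \<open>The definitions speak of quotients of rings of fractions, where computation is awkward.
  Everything is therefore moved into one field: a point \<open>xi\<close> over an algebraic closure
  of C(x,y), at which exactly the multiples of F vanish, turns the function field into the subfield
  \<open>K\<close> of ratios of values of forms. Valuation rings are taken in the whole big field,
  where Chevalley's theorem provides them. The degree of a principal divisor never enters. Its place
  is taken by one principle: a ratio of forms of equal degree that is regular over the zeros of its
  denominator is a constant, and this constant is 0 as soon as the ratio vanishes at a place. The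
  auxiliary forms are products of powers, with exponents dictated by relations between the orders at
  P and Q; rational orders are what makes such integral exponents exist. Genus 0 is not deduced from
  the singularities: in every case K turns out to be C(t), and the spaces L(D) are computed there
  explicitly.\<close>

locale comm_hom =
 fixes h :: "'a::comm_ring_1 => 'b::comm_ring_1"
 assumes add: "h (x + y) = h x + h y"
  and mult: "h (x * y) = h x * h y"
  and one: "h 1 = 1"
begin

lemma zero [simp]: "h 0 = 0"
 using add[of 0 0] by simp

lemma uminus: "h (- x) = - h x"
 using add[of x "- x"] by (simp add: eq_neg_iff_add_eq_0 add.commute)

lemma diff: "h (x - y) = h x - h y"
 using add[of x "- y"] by (simp add: uminus)

lemma sum: "h (\<Sum>i\<in>I. f i) = (\<Sum>i\<in>I. h (f i))"
 by (induction I rule: infinite_finite_induct) (auto simp: add)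

lemma power: "h (x ^ n) = h x ^ n"
 by (induction n) (auto simp: mult one)

lemma map_poly_add: "map_poly h (p + q) = map_poly h p + map_poly h q"
 by (intro poly_eqI) (simp add: coeff_map_poly add)

lemma map_poly_smult': "map_poly h (smult a p) = smult (h a) (map_poly h p)"
 by (intro poly_eqI) (simp add: coeff_map_poly mult)

lemma map_poly_mult: "map_poly h (p * q) = map_poly h p * map_poly h q"
 by (intro poly_eqI) (simp add: coeff_map_poly coeff_mult sum mult)

text \<open>Iterated three times along \<open>complex poly poly poly\<close>, this makes
  \<open>subst3 h\<close> a homomorphism in its polynomial argument.\<close>

lemma comm_hom_eval: "comm_hom (%p. poly (map_poly h p) a)"
 by unfold_locales (auto simp: map_poly_add map_poly_mult one)

end

abbreviation cst :: "complex => cpoly3" where "cst c \<equiv> [:[:[:c:]:]:]"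
abbreviation vx :: cpoly3 where "vx \<equiv> [:[:[:0, 1:]:]:]"
abbreviation vy :: cpoly3 where "vy \<equiv> [:[:0, 1:]:]"
abbreviation vz :: cpoly3 where "vz \<equiv> [:0, 1:]"

lemma comm_hom_comp: "comm_hom f ==> comm_hom g ==> comm_hom (%x. f (g x))"
 by (simp add: comm_hom_def)

locale cpx_hom = comm_hom h for h :: "complex => 'b::comm_ring_1"
begin

lemma comm_hom_subst3: "comm_hom (%F. subst3 h F a b c)"
 unfolding subst3_def by (intro comm_hom.comm_hom_eval) (rule comm_hom_axioms)

lemma subst3_cst [simp]: "subst3 h (cst e) a b c = h e"
 by (simp add: subst3_def map_poly_pCons)
lemma subst3_1 [simp]: "subst3 h 1 a b c = 1"
 by (rule comm_hom.one[OF comm_hom_subst3])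
lemma subst3_0 [simp]: "subst3 h 0 a b c = 0"
 by (rule comm_hom.zero[OF comm_hom_subst3])
lemma subst3_vx [simp]: "subst3 h vx a b c = a"
 by (simp add: subst3_def map_poly_pCons one)
lemma subst3_vy [simp]: "subst3 h vy a b c = b"
 by (simp add: subst3_def map_poly_pCons one)
lemma subst3_vz [simp]: "subst3 h vz a b c = c"
 by (simp add: subst3_def map_poly_pCons one)
lemma subst3_add: "subst3 h (F + G) a b c = subst3 h F a b c + subst3 h G a b c"
 by (rule comm_hom.add[OF comm_hom_subst3])
lemma subst3_diff: "subst3 h (F - G) a b c = subst3 h F a b c - subst3 h G a b c"
 by (rule comm_hom.diff[OF comm_hom_subst3])
lemma subst3_mult: "subst3 h (F * G) a b c = subst3 h F a b c * subst3 h G a b c"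
 by (rule comm_hom.mult[OF comm_hom_subst3])
lemma subst3_power: "subst3 h (F ^ n) a b c = subst3 h F a b c ^ n"
 by (rule comm_hom.power[OF comm_hom_subst3])
lemma subst3_sum: "subst3 h (\<Sum>i\<in>I. f i) a b c = (\<Sum>i\<in>I. subst3 h (f i) a b c)"
 by (rule comm_hom.sum[OF comm_hom_subst3])

lemmas subst3_simps = subst3_add subst3_diff subst3_mult subst3_power subst3_sum

end

lemma cpx_hom_cst: "cpx_hom cst"
 by unfold_locales (auto simp: one_pCons)

lemma cpx_hom_id: "cpx_hom id"
 by unfold_locales auto

interpretation cst: cpx_hom cst by (rule cpx_hom_cst)
interpretation idc: cpx_hom id by (rule cpx_hom_id)

text \<open>Constants and variables generate the ring, so an identity between substitutions needs
  checking only on these generators and on sums and products.\<close>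

lemma cpoly3_induct [case_names cst vx vy vz add mult]:
 assumes c: "!!c. P (cst c)" and x: "P vx" and y: "P vy" and z: "P vz"
  and add: "!!F G. P F ==> P G ==> P (F + G)"
  and mult: "!!F G. P F ==> P G ==> P (F * G)"
 shows "P F"
proof -
 have 1: "P [:[:H:]:]" for H
 proof (induction H)
  case 0 show ?case using c[of 0] by simp
 next
  case (pCons a H)
  have "[:[:pCons a H:]:] = cst a + vx * [:[:H:]:]" by simp
  then show ?case using add[OF c mult[OF x pCons(2)]] by metis
 qed
 have 2: "P [:G:]" for G
 proof (induction G)
  case 0 show ?case using c[of 0] by simp
 next
  case (pCons a G)
  have "[:pCons a G:] = [:[:a:]:] + vy * [:G:]" by simp
  then show ?case using add[OF 1 mult[OF y pCons(2)]] by metis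
 qed
 show ?thesis
 proof (induction F)
  case 0 show ?case using c[of 0] by simp
 next
  case (pCons a F)
  have "pCons a F = [:a:] + vz * F" by simp
  then show ?case using add[OF 2 mult[OF z pCons(2)]] by metis
 qed
qed

lemma subst3_comp:
 assumes h: "cpx_hom h" and g: "comm_hom g"
 shows "subst3 (%x. g (h x)) F (g a) (g b) (g c) = g (subst3 h F a b c)"
proof -
 interpret h: cpx_hom h by fact
 interpret g: comm_hom g by fact
 interpret gh: cpx_hom "%x. g (h x)"
  by (simp add: cpx_hom_def comm_hom_comp g h.comm_hom_axioms)
 show ?thesis
  by (induction F rule: cpoly3_induct) (simp_all add: h.subst3_simps gh.subst3_simps g.add g.mult)
qed

lemma subst3_cst_ident: "subst3 cst F vx vy vz = F"
 by (induction F rule: cpoly3_induct)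
  (simp_all only: cst.subst3_cst cst.subst3_vx cst.subst3_vy cst.subst3_vz cst.subst3_simps)

lemma cpoly3_expand:
 fixes F :: cpoly3
 shows "F = (\<Sum>k\<le>degree F. \<Sum>j\<le>degree (coeff F k). \<Sum>i\<le>degree (coeff (coeff F k) j).
      monom (monom (monom (coeff (coeff (coeff F k) j) i) i) j) k)"
proof -
 have m: "monom (sum f A) n = (\<Sum>i\<in>A. monom (f i) n)" for f :: "nat => 'b::comm_monoid_add" and A n
  by (induction A rule: infinite_finite_induct) (auto simp: add_monom[symmetric])
 have "coeff (coeff F k) j = (\<Sum>i\<le>degree (coeff (coeff F k) j). monom (coeff (coeff (coeff F k) j) i) i)" for k j
  by (simp add: poly_as_sum_of_monoms)
 moreover have "coeff F k = (\<Sum>j\<le>degree (coeff F k). monom (coeff (coeff F k) j) j)" for k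
  by (simp add: poly_as_sum_of_monoms)
 moreover have "F = (\<Sum>k\<le>degree F. monom (coeff F k) k)"
  by (simp add: poly_as_sum_of_monoms)
 ultimately show ?thesis by (simp add: m[symmetric])
qed

lemma monom3: "monom (monom (monom e i) j) k = cst e * vx ^ i * vy ^ j * vz ^ k"
proof -
 have "[:[:0,1:]:] ^ n = [:[:0,1:] ^ n:]" for n and x :: "'b::comm_ring_1"
  by (induction n) auto
 have *: "[:p:] ^ n = [:p ^ n:]" for n and p :: "'b::comm_ring_1"
  by (induction n) (auto simp: one_pCons)
 show ?thesis
  by (simp add: * monom_altdef)
qed

lemma (in cpx_hom) subst3_expand:
 "subst3 h F a b c = (\<Sum>k\<le>degree F. \<Sum>j\<le>degree (coeff F k). \<Sum>i\<le>degree (coeff (coeff F k) j).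
      h (coeff (coeff (coeff F k) j) i) * a ^ i * b ^ j * c ^ k)"
 by (subst cpoly3_expand) (simp add: monom3 subst3_simps del: mult_pCons_left mult_pCons_right smult_pCons add_pCons)

lemma homogeneous_0 [simp]: "homogeneous n 0"
 by (simp add: homogeneous_def)
lemma homogeneous_cst [simp]: "homogeneous 0 (cst c)"
 by (auto simp: homogeneous_def coeff_pCons split: nat.splits)
lemma homogeneous_1 [simp]: "homogeneous 0 1"
 using homogeneous_cst[of 1] by (simp add: one_pCons)
lemma homogeneous_vx [simp]: "homogeneous 1 vx"
 by (auto simp: homogeneous_def coeff_pCons split: nat.splits)
lemma homogeneous_vy [simp]: "homogeneous 1 vy"
 by (auto simp: homogeneous_def coeff_pCons split: nat.splits)
lemma homogeneous_vz [simp]: "homogeneous 1 vz"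
 by (auto simp: homogeneous_def coeff_pCons split: nat.splits)
lemma homogeneous_add: "homogeneous n F ==> homogeneous n G ==> homogeneous n (F + G)"
 unfolding homogeneous_def by (metis add.right_neutral coeff_add)
lemma homogeneous_uminus: "homogeneous n F ==> homogeneous n (- F)"
 by (auto simp: homogeneous_def)
lemma homogeneous_diff: "homogeneous n F ==> homogeneous n G ==> homogeneous n (F - G)"
 using homogeneous_add[of n F "- G"] homogeneous_uminus[of n G] by simp
lemma homogeneous_sum: "(!!i. i \<in> I ==> homogeneous n (f i)) ==> homogeneous n (\<Sum>i\<in>I. f i)"
 by (induction I rule: infinite_finite_induct) (auto intro: homogeneous_add)

lemma homogeneous_mult:
 assumes "homogeneous m F" "homogeneous n G"
 shows "homogeneous (m + n) (F * G)"
 unfolding homogeneous_def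
proof (intro allI impI)
 fix i j k
 assume nz: "coeff (coeff (coeff (F * G) k) j) i ~= 0"
 have "coeff (coeff (coeff (F * G) k) j) i =
   (\<Sum>k'\<le>k. \<Sum>j'\<le>j. \<Sum>i'\<le>i. coeff (coeff (coeff F k') j') i' * coeff (coeff (coeff G (k-k')) (j-j')) (i-i'))"
  by (simp add: coeff_mult coeff_sum)
 then obtain k' j' i' where *: "k' \<le> k" "j' \<le> j" "i' \<le> i"
   "coeff (coeff (coeff F k') j') i' * coeff (coeff (coeff G (k-k')) (j-j')) (i-i') ~= 0"
  using nz by (metis (no_types, lifting) atMost_iff sum.neutral)
 then have "i' + j' + k' = m" "(i-i') + (j-j') + (k-k') = n"
  using assms *(4) unfolding homogeneous_def mult_eq_0_iff de_Morgan_disj by blast+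
 then show "i + j + k = m + n" using * by linarith
qed

lemma homogeneous_power: "homogeneous m F ==> homogeneous (m * n) (F ^ n)"
 by (induction n) (auto intro: homogeneous_mult simp: homogeneous_mult)

lemma homogeneous_cst_mult: "homogeneous n F ==> homogeneous n (cst c * F)"
 using homogeneous_mult[of 0 "cst c" n F] by simp

lemma (in cpx_hom) homogeneous_scale:
 assumes "homogeneous n F"
 shows "subst3 h F (l * a) (l * b) (l * c) = l ^ n * subst3 h F a b c"
 unfolding subst3_expand sum_distrib_left
proof (intro sum.cong refl)
 fix k j i
 have "coeff (coeff (coeff F k) j) i = 0 \<or> n = i + j + k"
  using assms by (auto simp: homogeneous_def)
 then show "h (coeff (coeff (coeff F k) j) i) * (l * a) ^ i * (l * b) ^ j * (l * c) ^ k =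
  l ^ n * (h (coeff (coeff (coeff F k) j) i) * a ^ i * b ^ j * c ^ k)"
  by (auto simp: power_add power_mult_distrib mult_ac)
qed

lemma homogeneous_unique: "homogeneous m F ==> homogeneous n F ==> F ~= 0 ==> m = n"
 unfolding homogeneous_def by (metis leading_coeff_0_iff)

lemma order_0_unit:
 fixes p :: "'a::idom poly"
 assumes "p ~= 0" "order 0 p = degree p" shows "p = monom (lead_coeff p) (degree p)"
proof -
 have "[:-0,1:] ^ degree p dvd p" using order_1[of 0 p] assms by simp
 then have "monom 1 (degree p) dvd p" by (simp add: monom_altdef)
 then obtain q where q: "p = monom 1 (degree p) * q" by blast
 then have "degree p = degree p + degree q" using assms(1)
  by (metis degree_monom_eq degree_mult_eq mult_zero_left mult_zero_right one_neq_zero)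
 then obtain c where "q = [:c:]" by (metis add_cancel_right_right degree_0_id degree_eq_zeroE)
 with q have p: "p = monom c (degree p)" by (simp add: monom_altdef)
 then show ?thesis by (metis coeff_monom)
qed

text \<open>Order at 0 and degree are both additive, the first is at most the second, and they agree
  for the product. Hence they agree for each factor.\<close>

lemma monom_factor:
 fixes p q :: "'a::idom poly"
 assumes "p * q = monom c n" "c ~= 0"
 shows "p = monom (lead_coeff p) (degree p)"
proof -
 have nz: "p ~= 0" "q ~= 0" using assms by auto
 have o: "order 0 p \<le> degree p" "order 0 q \<le> degree q" using nz order_degree by blast+
 have "degree p + degree q = n" using assms nz
  by (metis degree_monom_eq degree_mult_eq)
 moreover have "order 0 p + order 0 q = n"
 proof -
  have "order 0 (p * q) = n"
   unfolding assms(1) using assms(2)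
   by (rule order_0_monom)
  then show ?thesis using order_mult nz by (metis mult_eq_0_iff)
 qed
 ultimately have "order 0 p = degree p" using o by linarith
 then show ?thesis using order_0_unit nz by blast
qed

section \<open>Homogeneous components, and why factors of forms are forms\<close>

definition grading :: "cpoly3 => cpoly3 poly" where
 "grading F = subst3 (%c. [:cst c:]) F [:0, vx:] [:0, vy:] [:0, vz:]"

lemma cpx_hom_grading: "cpx_hom (%c. [:cst c:])"
 by unfold_locales (auto simp: one_pCons)

interpretation grd: cpx_hom "%c. [:cst c:]" by (rule cpx_hom_grading)

lemma grading_add: "grading (F + G) = grading F + grading G"
 and grading_mult: "grading (F * G) = grading F * grading G"
 by (simp_all add: grading_def grd.subst3_simps)

lemma grading_homogeneous:
 assumes "homogeneous n F" shows "grading F = monom F n"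
proof -
 interpret c: comm_hom "%F::cpoly3. [:F:]" by unfold_locales auto
 have 1: "[:0, p:] = [:0, 1:] * [:p:]" for p :: cpoly3 by simp
 have "grading F = [:0,1:] ^ n * subst3 (%c. [:cst c:]) F [:vx:] [:vy:] [:vz:]"
  unfolding grading_def 1[of vx] 1[of vy] 1[of vz] by (rule grd.homogeneous_scale) fact
 also have "subst3 (%c. [:cst c:]) F [:vx:] [:vy:] [:vz:] = [:F:]"
  using subst3_comp[OF cpx_hom_cst c.comm_hom_axioms, of F vx vy vz] by (simp only: subst3_cst_ident)
 finally show ?thesis by (simp add: monom_altdef mult.commute)
qed

lemma poly_grading: "poly (grading F) 1 = F"
proof -
 interpret c: comm_hom "%p::cpoly3 poly. poly p 1" by unfold_locales auto
 have "subst3 (%x. poly [:cst x:] 1) F (poly [:0,vx:] 1) (poly [:0,vy:] 1) (poly [:0,vz:] 1) = poly (grading F) 1"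
  unfolding grading_def by (rule subst3_comp[OF cpx_hom_grading c.comm_hom_axioms])
 then show ?thesis using subst3_cst_ident by simp
qed

text \<open>The substitution (x,y,z) -> (Tx,Ty,Tz) behind \<open>grading\<close> collects the terms
  of total degree m in the coefficient of T^m.\<close>

lemma coeff_grading:
 "coeff (coeff (coeff (coeff (grading F) m) k) j) i =
  (if i + j + k = m then coeff (coeff (coeff F k) j) i else 0)"
proof -
 define Q where "Q F \<longleftrightarrow> (\<forall>m k j i. coeff (coeff (coeff (coeff (grading F) m) k) j) i =
  (if i + j + k = m then coeff (coeff (coeff F k) j) i else 0))" for F
 have Q0: "Q 0" by (simp add: Q_def grading_def)
 have Qadd: "Q (F + G)" if "Q F" "Q G" for F G using that by (auto simp: Q_def grading_add)
 have Qsum: "Q (\<Sum>x\<in>A. f x)" if "!!x. x \<in> A ==> Q (f x)" for A and f :: "nat => cpoly3"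
  using that by (induction A rule: infinite_finite_induct) (auto simp: Q0 Qadd)
 have Qm: "Q (monom (monom (monom e i) j) k)" for e i j k
 proof -
  have "homogeneous (i + j + k) (monom (monom (monom e i) j) k)"
   by (auto simp: homogeneous_def coeff_monom split: if_splits)
  then show ?thesis by (auto simp: Q_def grading_homogeneous coeff_monom)
 qed
 have "Q F" by (subst cpoly3_expand) (intro Qsum Qm)
 then show ?thesis by (simp add: Q_def)
qed

lemma homogeneous_coeff_grading: "homogeneous m (coeff (grading F) m)"
 by (auto simp: homogeneous_def coeff_grading split: if_splits)

text \<open>\<open>grading\<close> sends the product to a monomial in the new variable over the
  domain C[x,y,z]. Its factors are then monomials too, so P has a single homogeneous
  component.\<close>

lemma homogeneous_factor:
 assumes "homogeneous n (P * Q)" "P * Q ~= 0"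
 shows "\<exists>k. homogeneous k P"
proof -
 have "grading P * grading Q = monom (P * Q) n"
  using grading_homogeneous[OF assms(1)] by (simp add: grading_mult)
 then have "grading P = monom (lead_coeff (grading P)) (degree (grading P))"
  using monom_factor assms(2) by blast
 moreover have "poly (grading P) 1 = P" by (rule poly_grading)
 ultimately have "P = lead_coeff (grading P)" by (metis poly_monom mult.right_neutral power_one)
 then show ?thesis using homogeneous_coeff_grading by metis
qed

lemma homogeneous_dvd: "homogeneous n F ==> F ~= 0 ==> P dvd F ==> \<exists>k. homogeneous k P"
 by (auto elim!: dvdE intro: homogeneous_factor)

section \<open>Evaluation at vectors, points and frames\<close>

definition vec3 :: "'a => 'a => 'a => 'a ^ 3" where
 "vec3 a b c = (\<chi> i. if i = 1 then a else if i = 2 then b else c)"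

lemma vec3_nth [simp]: "vec3 a b c $ 1 = a" "vec3 a b c $ 2 = b" "vec3 a b c $ 3 = c"
 by (simp_all add: vec3_def)

definition cols :: "'a ^ 3 => 'a ^ 3 => 'a ^ 3 => 'a ^ 3 ^ 3" where
 "cols u v w = (\<chi> i. vec3 (u $ i) (v $ i) (w $ i))"

lemma cols_nth [simp]: "cols u v w $ i = vec3 (u $ i) (v $ i) (w $ i)"
 by (simp add: cols_def)

definition ev :: "(complex => 'a::comm_ring_1) => cpoly3 => 'a ^ 3 => 'a" where
 "ev h F v = subst3 h F (v $ 1) (v $ 2) (v $ 3)"

context cpx_hom
begin
lemma ev_cst [simp]: "ev h (cst e) v = h e" by (simp add: ev_def)
lemma ev_1 [simp]: "ev h 1 v = 1" by (simp add: ev_def)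
lemma ev_0 [simp]: "ev h 0 v = 0" by (simp add: ev_def)
lemma ev_vx [simp]: "ev h vx v = v $ 1" by (simp add: ev_def)
lemma ev_vy [simp]: "ev h vy v = v $ 2" by (simp add: ev_def)
lemma ev_vz [simp]: "ev h vz v = v $ 3" by (simp add: ev_def)
lemma ev_add: "ev h (F + G) v = ev h F v + ev h G v" by (simp add: ev_def subst3_add)
lemma ev_diff: "ev h (F - G) v = ev h F v - ev h G v" by (simp add: ev_def subst3_diff)
lemma ev_mult: "ev h (F * G) v = ev h F v * ev h G v" by (simp add: ev_def subst3_mult)
lemma ev_power: "ev h (F ^ n) v = ev h F v ^ n" by (simp add: ev_def subst3_power)
lemma ev_sum: "ev h (\<Sum>i\<in>I. f i) v = (\<Sum>i\<in>I. ev h (f i) v)" by (simp add: ev_def subst3_sum)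
lemmas ev_simps = ev_add ev_diff ev_mult ev_power ev_sum
lemma ev_scale: "homogeneous n F ==> ev h F (l *s v) = l ^ n * ev h F v"
 by (simp add: ev_def homogeneous_scale)
lemma ev_homogeneous_0: "homogeneous n F ==> n > 0 ==> ev h F 0 = 0"
 using ev_scale[of n F 0 0] by (simp add: zero_power)
end

lemma ev_comp:
 assumes "cpx_hom h" "comm_hom g"
 shows "ev (%x. g (h x)) F (\<chi> i. g (v $ i)) = g (ev h F v)"
 unfolding ev_def by (simp add: subst3_comp[OF assms])

definition lin :: "complex ^ 3 => cpoly3" where
 "lin a = cst (a $ 1) * vx + cst (a $ 2) * vy + cst (a $ 3) * vz"

lemma homogeneous_lin [simp]: "homogeneous 1 (lin a)"
 unfolding lin_def by (intro homogeneous_add homogeneous_cst_mult homogeneous_vx homogeneous_vy homogeneous_vz)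

lemma (in cpx_hom) ev_lin: "ev h (lin a) v = h (a$1) * v$1 + h (a$2) * v$2 + h (a$3) * v$3"
 unfolding lin_def by (simp only: ev_simps ev_cst ev_vx ev_vy ev_vz)

text \<open>The polynomial F composed with the linear map A, that is, F in the coordinates whose
  base points are the columns of A.\<close>

definition frame :: "complex ^ 3 ^ 3 => cpoly3 => cpoly3" where
 "frame A F = ev cst F (\<chi> i. lin (A $ i))"

definition mv :: "(complex => 'a::comm_ring_1) => complex ^ 3 ^ 3 => 'a ^ 3 => 'a ^ 3" where
 "mv h A v = (\<chi> i. h (A $ i $ 1) * v $ 1 + h (A $ i $ 2) * v $ 2 + h (A $ i $ 3) * v $ 3)"

lemma (in cpx_hom) ev_frame: "ev h (frame A F) v = ev h F (mv h A v)"
proof -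
 have "comm_hom (%G. ev h G v)" unfolding ev_def by (rule comm_hom_subst3)
 from ev_comp[OF cpx_hom_cst this, of F "\<chi> i. lin (A $ i)"]
 show ?thesis by (simp add: frame_def mv_def ev_lin)
qed

lemma frame_add: "frame A (F + G) = frame A F + frame A G"
 and frame_mult: "frame A (F * G) = frame A F * frame A G"
 and frame_0: "frame A 0 = 0"
 and frame_1: "frame A 1 = 1"
 by (simp_all add: frame_def cst.ev_simps)

lemma mv_mv: "cpx_hom h ==> mv h A (mv h B v) = mv h (A ** B) v"
proof -
 assume "cpx_hom h" then interpret cpx_hom h .
 show ?thesis by (simp add: mv_def vec_eq_iff matrix_matrix_mult_def sum_3 add mult algebra_simps)
qed

lemma mv_1: "cpx_hom h ==> mv h (mat 1) v = v"
proof -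
 assume "cpx_hom h" then interpret cpx_hom h .
 show ?thesis by (simp add: mv_def vec_eq_iff forall_3 mat_def one)
qed

lemma (in cpx_hom) mv_scale: "mv h A (c *s v) = c *s mv h A v"
 by (simp add: mv_def vec_eq_iff algebra_simps)

lemma ev_cst_ident: "ev cst F (vec3 vx vy vz) = F"
 by (simp add: ev_def subst3_cst_ident)

lemma frame_frame: "frame A (frame B F) = frame (B ** A) F"
proof -
 have "frame A (frame B F) = ev cst (frame A (frame B F)) (vec3 vx vy vz)"
  by (rule ev_cst_ident[symmetric])
 also have "\<dots> = ev cst (frame (B ** A) F) (vec3 vx vy vz)"
  by (simp only: cst.ev_frame mv_mv[OF cpx_hom_cst])
 finally show ?thesis by (simp only: ev_cst_ident)
qed

lemma frame_mat_1: "frame (mat 1) F = F"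
proof -
 have "frame (mat 1) F = ev cst (frame (mat 1) F) (vec3 vx vy vz)"
  by (rule ev_cst_ident[symmetric])
 also have "\<dots> = ev cst F (vec3 vx vy vz)"
  by (simp only: cst.ev_frame mv_1[OF cpx_hom_cst])
 finally show ?thesis by (simp only: ev_cst_ident)
qed

lemma frame_dvd_iff:
 assumes "A ** A' = mat 1" "A' ** A = mat 1"
 shows "frame A F dvd frame A G \<longleftrightarrow> F dvd G"
proof
 assume "frame A F dvd frame A G"
 then obtain H where "frame A G = frame A F * H" by blast
 then have "frame A' (frame A G) = frame A' (frame A F) * frame A' H" by (simp add: frame_mult)
 then show "F dvd G" by (simp add: frame_frame assms frame_mat_1)
qed (auto simp: frame_mult)

abbreviation irred :: "'a::comm_semiring_1 => bool" where "irred \<equiv> Factorial_Ring.irreducible"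

lemma frame_irreducible:
 assumes A: "A ** A' = mat 1" "A' ** A = mat 1" and F: "irred F"
 shows "irred (frame A F)"
proof (rule Factorial_Ring.irreducibleI)
 have u: "is_unit (frame A G) \<longleftrightarrow> is_unit G" for G
  using frame_dvd_iff[OF A, of G 1] by (simp add: frame_1)
 have inv: "frame A (frame A' G) = G" "frame A' (frame A G) = G" for G
  by (simp_all add: frame_frame A frame_mat_1)
 show "frame A F ~= 0" using F inv(2)[of F] by (auto simp: frame_0)
 show "~ is_unit (frame A F)" using F u by (simp add: Factorial_Ring.irreducible_not_unit)
 fix G H assume "frame A F = G * H"
 then have "F = frame A' G * frame A' H" by (metis inv(2) frame_mult)
 then have "is_unit (frame A' G) \<or> is_unit (frame A' H)" using F by (meson Factorial_Ring.irreducibleD)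
 then show "is_unit G \<or> is_unit H" using u[of "frame A' G"] u[of "frame A' H"] by (simp add: inv)
qed

lemma homogeneous_subst:
 assumes F: "homogeneous n F" and a: "homogeneous 1 a" and b: "homogeneous 1 b" and c: "homogeneous 1 c"
 shows "homogeneous n (subst3 cst F a b c)"
 unfolding cst.subst3_expand
proof (intro homogeneous_sum)
 fix k j i
 let ?f = "coeff (coeff (coeff F k) j) i"
 have "homogeneous (0 + 1 * i + 1 * j + 1 * k) (cst ?f * a ^ i * b ^ j * c ^ k)"
  by (intro homogeneous_mult homogeneous_power a b c homogeneous_cst)
 moreover have "?f = 0 \<or> n = i + j + k" using F by (auto simp: homogeneous_def)
 ultimately show "homogeneous n (cst ?f * a ^ i * b ^ j * c ^ k)" by (auto simp del: mult_pCons_left)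
qed

lemma homogeneous_frame: "homogeneous n F ==> homogeneous n (frame A F)"
proof -
 assume F: "homogeneous n F"
 have "homogeneous 1 ((\<chi> i. lin (A $ i)) $ j)" for j :: 3 unfolding vec_lambda_beta by (rule homogeneous_lin)
 then show ?thesis unfolding frame_def ev_def by (intro homogeneous_subst[OF F])
qed

definition pt :: "complex ^ 3 => proj_plane" where
 "pt v = Abs_proj_plane (range (%c. c *s v))"

lemma Rep_pt: "v ~= 0 ==> Rep_proj_plane (pt v) = range (%c. c *s v)"
 unfolding pt_def by (rule Abs_proj_plane_inverse) auto

lemma pt_cases: obtains v where "v ~= 0" "q = pt v"
proof -
 from Rep_proj_plane[of q] obtain v where "v ~= 0" "Rep_proj_plane q = range (%c. c *s v)" by blast
 then show ?thesis using that[of v] by (metis pt_def Rep_proj_plane_inverse)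
qed

lemma vsmult_eq_0: "c *s (v :: complex ^ 3) = 0 \<longleftrightarrow> c = 0 \<or> v = 0"
 by (auto simp: vec_eq_iff)

lemma pt_eq_iff:
 assumes "v ~= 0" "w ~= 0"
 shows "pt v = pt w \<longleftrightarrow> (\<exists>c. c ~= 0 & w = c *s v)"
proof
 assume "pt v = pt w"
 then have "range (%c. c *s v) = range (%c. c *s w)" using Rep_pt[OF assms(1)] Rep_pt[OF assms(2)] by simp
 moreover have "1 *s w \<in> range (%c. c *s w)" by (rule rangeI)
 ultimately obtain c where c: "w = c *s v" by auto
 with assms have "c ~= 0" by (auto simp: vsmult_eq_0)
 with c show "\<exists>c. c ~= 0 & w = c *s v" by blast
next
 assume "\<exists>c. c ~= 0 & w = c *s v"
 then obtain c where c: "c ~= 0" "w = c *s v" by blast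
 have "range (%e. e *s v) = range (%e. e *s w)"
 proof (intro subset_antisym subsetI; clarsimp simp: c(2))
  fix e show "e *s v \<in> range (%e. (e * c) *s v)"
   by (rule image_eqI[of _ _ "e / c"]) (use c in auto)
 qed (rule rangeI)
 then show "pt v = pt w" by (simp add: pt_def)
qed

lemma vanishes_at_pt:
 assumes "homogeneous n F" "v ~= 0"
 shows "vanishes_at F (pt v) \<longleftrightarrow> ev id F v = 0"
proof
 assume "vanishes_at F (pt v)"
 moreover have "v \<in> Rep_proj_plane (pt v)" by (subst Rep_pt) (use assms in \<open>auto intro!: image_eqI[of _ _ 1]\<close>)
 ultimately show "ev id F v = 0" by (simp add: vanishes_at_def ev_def)
next
 assume z: "ev id F v = 0"
 have "ev id F (c *s v) = 0" for c
  using idc.ev_scale[OF assms(1), of c v] z by (simp only: mult_zero_right)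
 then show "vanishes_at F (pt v)" using assms(2)
  by (auto simp: vanishes_at_def Rep_pt ev_def)
qed

lemma (in cpx_hom) ev_dvd:
 assumes "F dvd G" "ev h F v = 0" shows "ev h G v = 0"
proof -
 obtain H where "G = F * H" using assms(1) by (rule dvdE)
 then show ?thesis using assms(2) by (simp add: ev_mult)
qed

section \<open>Elimination and the Nullstellensatz for plane curves\<close>

text \<open>A substitute for the resultant. A nonzero element R of least degree in the ideal (F, G)
  divides constant multiples of F and of G by pseudo-division. If R had positive degree, the prime F
  would divide R, hence G, or else the cofactor of R, which leaves R no degree.\<close>

lemma prime_elimination:
 fixes F G :: "'a::idom_divide poly"
 assumes F: "prime_elem F" and deg: "degree F > 0" and ndvd: "~ F dvd G"
 shows "\<exists>U V r. r ~= 0 & U * F + V * G = [:r:]"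
proof -
 define I where "I = {R. R ~= 0 & (\<exists>U V. R = U * F + V * G)}"
 have "F = 1 * F + 0 * G" by simp
 moreover have "F ~= 0" using deg by auto
 ultimately have "F \<in> I" unfolding I_def by blast
 then obtain R where R: "R \<in> I" and min: "!!S. S \<in> I ==> degree R \<le> degree S"
  using ex_has_least_nat[of "%S. S \<in> I" F degree] by blast
 then obtain U V where RUV: "R = U * F + V * G" and R0: "R ~= 0" by (auto simp: I_def)
 have div: "\<exists>c Q. c ~= 0 & smult c H = R * Q" if H: "H = U' * F + V' * G" for H U' V'
 proof -
  obtain Q S where QS: "pseudo_divmod H R = (Q, S)" by fastforce
  define c where "c = lead_coeff R ^ (Suc (degree H) - degree R)"
  have 1: "smult c H = R * Q + S" and 2: "S = 0 \<or> degree S < degree R"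
   using pseudo_divmod[OF R0 QS] by (auto simp: c_def)
  have "S = (smult c U' - U * Q) * F + (smult c V' - V * Q) * G"
   using 1 by (simp add: H RUV algebra_simps smult_add_right)
  then have "S = 0" using min[of S] 2 by (force simp: I_def)
  then show ?thesis using 1 R0 by (intro exI[of _ c] exI[of _ Q]) (auto simp: c_def)
 qed
 have "degree R = 0"
 proof (rule ccontr)
  assume dR: "degree R ~= 0"
  from div[of F 1 0] obtain c Q where c: "c ~= 0" "smult c F = R * Q" by auto
  from div[of G 0 1] obtain e S where e: "e ~= 0" "smult e G = R * S" by auto
  have nF: "~ F dvd [:x:]" if "x ~= 0" for x
   using dvd_imp_degree_le[of F "[:x:]"] deg that by auto
  have "F dvd R * Q" using c(2) by (metis dvd_refl dvd_smult)
  then consider "F dvd R" | "F dvd Q" using F prime_elem_dvd_multD by blast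
  then show False
  proof cases
   case 1
   then have "F dvd [:e:] * G" using e by simp
   then show False using F nF[OF e(1)] ndvd prime_elem_dvd_multD by blast
  next
   case 2
   then obtain Q' where Q': "Q = F * Q'" by blast
   have "F ~= 0" using F by auto
   moreover have "F * [:c:] = F * (R * Q')" using c(2) Q' by (simp add: mult_ac)
   ultimately have "[:c:] = R * Q'" by (metis mult_cancel_left)
   then have "degree R + degree Q' = 0" using c(1)
    by (metis degree_mult_eq degree_pCons_0 mult_eq_0_iff pCons_eq_0_iff)
   with dR show False by simp
  qed
 qed
 then obtain r where "R = [:r:]" by (metis degree_eq_zeroE)
 with RUV R0 show ?thesis by (intro exI[of _ U] exI[of _ V] exI[of _ r]) auto
qed

lemma exists_poly_nonzero:
 fixes p :: "complex poly" assumes "p ~= 0" shows "\<exists>x. poly p x ~= 0"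
 using assms poly_all_0_iff_0 by blast

lemma exists_poly2_nonzero:
 fixes p :: "complex poly poly" assumes "p ~= 0"
 shows "\<exists>x y. poly (map_poly (%q. poly q x) p) y ~= 0"
proof -
 obtain k where "coeff p k ~= 0" using assms by (metis leading_coeff_0_iff)
 then obtain x where "poly (coeff p k) x ~= 0" using exists_poly_nonzero by blast
 then have "coeff (map_poly (%q. poly q x) p) k ~= 0" by (simp add: coeff_map_poly)
 then have "map_poly (%q. poly q x) p ~= 0" by (metis coeff_0)
 then show ?thesis using exists_poly_nonzero by blast
qed

lemma exists_ev_nonzero:
 assumes "F ~= 0" shows "\<exists>v. ev id F v ~= 0"
proof -
 obtain k where "coeff F k ~= 0" using assms by (metis leading_coeff_0_iff)
 then obtain x y where "poly (map_poly (%q. poly q x) (coeff F k)) y ~= 0" using exists_poly2_nonzero by blast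
 then have "coeff (map_poly (%G. poly (map_poly (%q. poly q x) G) y) F) k ~= 0" by (simp add: coeff_map_poly)
 then have "map_poly (%G. poly (map_poly (%q. poly q x) G) y) F ~= 0" by (metis coeff_0)
 then obtain z where "poly (map_poly (%G. poly (map_poly (%q. poly q x) G) y) F) z ~= 0"
  using exists_poly_nonzero by blast
 then have "ev id F (vec3 x y z) ~= 0" by (simp add: ev_def subst3_def map_poly_id)
 then show ?thesis by blast
qed

lemma exists_frame:
 fixes v :: "complex ^ 3" assumes "v ~= 0"
 shows "\<exists>A A' :: complex ^ 3 ^ 3. A ** A' = mat 1 & A' ** A = mat 1 & column 3 A = v"
proof -
 have "\<exists>A :: complex ^ 3 ^ 3. det A ~= 0 & column 3 A = v"
 proof -
  from assms consider "v $ 1 ~= 0" | "v $ 2 ~= 0" | "v $ 3 ~= 0" by (auto simp: vec_eq_iff forall_3)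
  then show ?thesis
  proof cases
   case 1 then show ?thesis
    by (intro exI[of _ "cols (axis 2 1) (axis 3 1) v"])
      (simp add: det_3 axis_def column_def vec_eq_iff forall_3)
  next
   case 2 then show ?thesis
    by (intro exI[of _ "cols (axis 3 1) (axis 1 1) v"])
      (simp add: det_3 axis_def column_def vec_eq_iff forall_3)
  next
   case 3 then show ?thesis
    by (intro exI[of _ "cols (axis 1 1) (axis 2 1) v"])
      (simp add: det_3 axis_def column_def vec_eq_iff forall_3)
  qed
 qed
 then show ?thesis by (metis invertible_det_nz invertible_def)
qed

lemma mv_e3: "mv id A (vec3 0 0 1) = column 3 A"
 by (simp add: mv_def column_def vec_eq_iff forall_3)

text \<open>Once a coordinate change has moved [0:0:1] off the curve, the equation is monic in z up
  to a constant. Every elimination of z below starts from this normalization.\<close>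

lemma homogeneous_monic:
 assumes F: "homogeneous n F" and e: "ev id F (vec3 0 0 1) = e" "e ~= 0"
 shows "degree F = n" "coeff F n = [:[:e:]:]"
proof -
 have 1: "coeff (coeff (coeff F n) j) i = (if i = 0 & j = 0 then coeff (coeff (coeff F n) 0) 0 else 0)" for i j
 proof -
  have "i + j + n = n" if "coeff (coeff (coeff F n) j) i ~= 0"
   using F that unfolding homogeneous_def by blast
  then show ?thesis by (cases "i = 0"; cases "j = 0") auto
 qed
 have le: "degree F \<le> n"
 proof (rule degree_le, intro allI impI)
  fix k assume "n < k"
  then show "coeff F k = 0" using F by (intro poly_eqI) (force simp: homogeneous_def)
 qed
 have "ev id F (vec3 0 0 1) = poly (map_poly (%G. coeff (coeff G 0) 0) F) 1"
  by (simp add: ev_def subst3_def poly_0_coeff_0 coeff_map_poly)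
 also have "\<dots> = (\<Sum>k\<le>n. coeff (coeff (coeff F k) 0) 0)"
 proof -
  let ?P = "map_poly (%G. coeff (coeff G 0) 0) F"
  have "degree ?P \<le> n" using le by (intro degree_le) (auto simp: coeff_map_poly coeff_eq_0)
  then have "poly ?P 1 = (\<Sum>k\<le>n. coeff ?P k)"
   by (auto simp: poly_altdef intro!: sum.mono_neutral_left coeff_eq_0)
  then show ?thesis by (simp add: coeff_map_poly)
 qed
 also have "\<dots> = (\<Sum>k\<in>{n}. coeff (coeff (coeff F k) 0) 0)"
 proof -
  have "0 + 0 + k = n" if "coeff (coeff (coeff F k) 0) 0 ~= 0" for k
   using F that unfolding homogeneous_def by blast
  then show ?thesis by (intro sum.mono_neutral_right) auto
 qed
 finally have c: "coeff (coeff (coeff F n) 0) 0 = e" using e by simp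
 show "coeff F n = [:[:e:]:]"
  by (intro poly_eqI) (subst 1, auto simp: c coeff_pCons split: nat.splits)
 then have "coeff F n ~= 0" using e by simp
 then show "degree F = n" using le le_degree by (metis le_antisym)
qed

lemma is_unit_cpoly3: "is_unit (F :: cpoly3) \<longleftrightarrow> (\<exists>c. c ~= 0 & F = cst c)"
proof
 assume "is_unit F"
 then obtain G where G: "F = [:G:]" "is_unit G" by (metis is_unit_poly_iff)
 then obtain H where H: "G = [:H:]" "is_unit H" by (metis is_unit_poly_iff)
 then obtain c where "H = [:c:]" "is_unit c" by (metis is_unit_poly_iff)
 then show "\<exists>c. c ~= 0 & F = cst c" using G H by auto
qed (auto simp: is_unit_const_poly_iff dvd_field_iff)

lemma irreducible_degree_pos:
 assumes "irred F" "homogeneous n F" shows "n > 0"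
proof (rule ccontr)
 assume "~ n > 0"
 then have h: "homogeneous 0 F" using assms by simp
 have "F ~= 0" using assms by auto
 then obtain v where v: "ev id F v ~= 0" using exists_ev_nonzero by blast
 have "ev id F (vec3 0 0 1) = ev id F v"
  using idc.ev_scale[OF h, of 0 v] idc.ev_scale[OF h, of 0 "vec3 0 0 1"] by simp
 with v homogeneous_monic[OF h refl] have "degree F = 0" "coeff F 0 = [:[:ev id F v:]:]" by auto
 then have "F = cst (ev id F v)" by (metis degree_0_id)
 then show False using v assms Factorial_Ring.irreducible_not_unit is_unit_cpoly3 by metis
qed

text \<open>In a frame whose third base point is off the curve, F has a root z above every (x,y). If
  F did not divide G, elimination would put a nonzero r(x,y) into the ideal (F, G). Above a point
  with r(x,y) nonzero, F has a zero at which G, hence also r, would have to vanish.\<close>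

lemma nullstellensatz:
 assumes F: "irred F" "homogeneous n F"
  and vanish: "!!v. v ~= 0 ==> ev id F v = 0 ==> ev id G v = 0"
 shows "F dvd G"
proof -
 have n: "n > 0" using F irreducible_degree_pos by blast
 have "F ~= 0" using F by auto
 then obtain v where v: "ev id F v ~= 0" using exists_ev_nonzero by blast
 then have "v ~= 0" using idc.ev_homogeneous_0[OF F(2) n] by auto
 then obtain A A' :: "complex ^ 3 ^ 3" where A: "A ** A' = mat 1" "A' ** A = mat 1" "column 3 A = v"
  using exists_frame by blast
 let ?F = "frame A F" and ?G = "frame A G"
 have hF: "homogeneous n ?F" "irred ?F" using homogeneous_frame frame_irreducible A F by blast+
 have "ev id ?F (vec3 0 0 1) ~= 0" using v by (simp add: idc.ev_frame mv_e3 A)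
 then have deg: "degree ?F = n" and lc: "coeff ?F n = [:[:ev id ?F (vec3 0 0 1):]:]" "ev id ?F (vec3 0 0 1) ~= 0"
  using homogeneous_monic[OF hF(1) refl] by auto
 have "?F dvd ?G"
 proof (rule ccontr)
  assume "~ ?F dvd ?G"
  then obtain U V r where r: "r ~= 0" "U * ?F + V * ?G = [:r:]"
   using prime_elimination[of ?F ?G] hF deg n by (auto simp: irreducible_imp_prime_elem)
  \<comment> \<open>The extra factor x makes the chosen x nonzero, so that (x,y,z) represents a
    projective point.\<close>
  then have "r * [:[:0, 1:]:] ~= 0" by simp
  then obtain x y where xy: "poly (map_poly (%q. poly q x) (r * [:[:0, 1:]:])) y ~= 0"
   using exists_poly2_nonzero by blast
  let ?g = "%H. poly (map_poly (%q::complex poly. poly q x) H) y"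
  interpret px: comm_hom "%q::complex poly. poly q x" by unfold_locales auto
  interpret g: comm_hom ?g by (rule px.comm_hom_eval)
  interpret gg: comm_hom "%p. poly (map_poly ?g p) z" for z by (rule g.comm_hom_eval)
  have x: "x ~= 0" and gr: "?g r ~= 0" using xy by (auto simp: map_poly_pCons g.mult simp del: mult_pCons_right)
  have co: "coeff (map_poly ?g ?F) n ~= 0" using lc by (simp add: coeff_map_poly map_poly_pCons)
  then have "degree (map_poly ?g ?F) > 0" using n le_degree by fastforce
  then have "~ constant (poly (map_poly ?g ?F))" using constant_degree by (metis less_nat_zero_code)
  then obtain z where z: "poly (map_poly ?g ?F) z = 0" using fundamental_theorem_of_algebra by blast
  let ?w = "vec3 x y z :: complex ^ 3"
  have ev: "ev id H ?w = poly (map_poly ?g H) z" for H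
   by (simp add: ev_def subst3_def map_poly_id)
  have "?w ~= 0" using x by (auto simp: vec_eq_iff forall_3)
  moreover have "mv id A' (mv id A ?w) = ?w" by (simp add: mv_mv[OF cpx_hom_id] A mv_1[OF cpx_hom_id])
  moreover have "mv id A' 0 = 0" by (simp add: mv_def vec_eq_iff)
  ultimately have "mv id A ?w ~= 0" by metis
  moreover have "ev id F (mv id A ?w) = 0" using ev[of ?F] z by (simp add: idc.ev_frame)
  ultimately have "ev id G (mv id A ?w) = 0" by (rule vanish)
  then have "poly (map_poly ?g ?G) z = 0" using ev[of ?G] by (simp add: idc.ev_frame)
  then have "poly (map_poly ?g [:r:]) z = 0" unfolding r(2)[symmetric] gg.add gg.mult using z by simp
  then show False using gr by (simp add: map_poly_pCons)
 qed
 then show ?thesis using frame_dvd_iff A by blast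
qed

lemma squarefree_dvd:
 fixes G :: "'a::factorial_semiring"
 assumes "squarefree G" "G' ~= 0" "!!P. prime P ==> P dvd G ==> P dvd G'"
 shows "G dvd G'"
proof -
 have "G ~= 0" using assms by auto
 moreover have "prime_factorization G \<subseteq># prime_factorization G'"
 proof (rule mset_subset_eqI)
  fix P
  show "count (prime_factorization G) P \<le> count (prime_factorization G') P"
  proof (cases "P \<in># prime_factorization G")
   case True
   then have P: "prime P" "P dvd G" by auto
   have "multiplicity P G \<le> 1"
    using assms(1) P \<open>G ~= 0\<close> by (metis squarefree_factorial_semiring'' One_nat_def)
   moreover have "P \<in># prime_factorization G'" using assms P by (intro prime_factorsI) auto
   then have "count (prime_factorization G') P \<ge> 1" by simp
   ultimately show ?thesis using P by (simp add: count_prime_factorization)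
  qed (simp add: not_in_iff)
 qed
 ultimately show ?thesis by (rule prime_factorization_subset_imp_dvd)
qed

lemma reduced_equation_dvd:
 assumes F: "reduced_equation F D" and G: "reduced_equation G D"
 shows "F dvd G"
proof (rule squarefree_dvd)
 show "squarefree F" using F by (simp add: reduced_equation_def)
 show "G ~= 0" using G by (auto simp: reduced_equation_def)
 fix P assume P: "prime P" "P dvd F"
 obtain m n where mn: "homogeneous m F" "homogeneous n G"
  and eq: "{q. vanishes_at F q} = {q. vanishes_at G q}"
  using F G by (auto simp: reduced_equation_def)
 have "F ~= 0" using F by (auto simp: reduced_equation_def)
 then obtain k where k: "homogeneous k P" using homogeneous_dvd mn P by blast
 have "irred P" using P(1) prime_elem_imp_irreducible prime_imp_prime_elem by blast
 then show "P dvd G"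
 proof (rule nullstellensatz[OF _ k])
  fix v :: "complex ^ 3" assume v: "v ~= 0" "ev id P v = 0"
  then have "ev id F v = 0" using P(2) idc.ev_dvd by blast
  then show "ev id G v = 0" using eq vanishes_at_pt[OF mn(1) v(1)] vanishes_at_pt[OF mn(2) v(1)] by auto
 qed
qed

text \<open>With this, the description in \<open>curve_degree\<close> is well defined and the choice
  of an equation in \<open>local_equation\<close> matters only up to a constant factor.\<close>

lemma reduced_equation_unique:
 assumes F: "reduced_equation F D" and G: "reduced_equation G D"
 obtains c where "c ~= 0" "G = cst c * F"
proof -
 obtain a where a: "G = F * a" using reduced_equation_dvd[OF F G] by (rule dvdE)
 obtain b where b: "F = G * b" using reduced_equation_dvd[OF G F] by (rule dvdE)
 have "F ~= 0" using F by (auto simp: reduced_equation_def)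
 have "F = F * a * b" using b unfolding a .
 then have "F * 1 = F * (a * b)" by (simp add: mult.assoc)
 then have "1 = a * b" using \<open>F ~= 0\<close> by (metis mult_cancel_left)
 then have "is_unit a" by (metis dvd_triv_left)
 then obtain c where c: "c ~= 0" "a = cst c" using is_unit_cpoly3 by blast
 have "G = cst c * F" unfolding a c(2) by (rule mult.commute)
 then show ?thesis using that c(1) by blast
qed

lemma curve_degree_eq:
 assumes F: "reduced_equation F D" and h: "homogeneous n F"
 shows "curve_degree D = n"
 unfolding curve_degree_def
proof (rule the_equality)
 show "\<exists>F. reduced_equation F D & homogeneous n F" using F h by blast
 fix m assume "\<exists>G. reduced_equation G D & homogeneous m G"
 then obtain G where G: "reduced_equation G D" "homogeneous m G" by blast
 then obtain c where c: "c ~= 0" "G = cst c * F" using reduced_equation_unique[OF F G(1)] by blast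
 have "G ~= 0" using G by (auto simp: reduced_equation_def)
 moreover have "homogeneous n G" unfolding c by (rule homogeneous_cst_mult[OF h])
 ultimately show "m = n" using G homogeneous_unique by blast
qed

lemma reduced_equation_irreducible:
 assumes "irred F" "homogeneous n F"
 shows "reduced_equation F {q. vanishes_at F q}"
proof -
 have "squarefree F"
  using assms(1) by (metis irreducible_imp_prime_elem squarefree_prime_elem)
 then show ?thesis using assms irreducible_degree_pos unfolding reduced_equation_def by blast
qed

lemma vanishing_iff_dvd:
 assumes F: "irred F" "homogeneous n F" and G: "homogeneous m G"
 shows "(\<forall>q\<in>{q. vanishes_at F q}. vanishes_at G q) \<longleftrightarrow> F dvd G"
proof
 assume *: "\<forall>q\<in>{q. vanishes_at F q}. vanishes_at G q"
 show "F dvd G"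
 proof (rule nullstellensatz[OF F])
  fix v :: "complex ^ 3" assume v: "v ~= 0" "ev id F v = 0"
  then show "ev id G v = 0" using * vanishes_at_pt[OF F(2) v(1)] vanishes_at_pt[OF G v(1)] by auto
 qed
next
 assume d: "F dvd G"
 show "\<forall>q\<in>{q. vanishes_at F q}. vanishes_at G q"
 proof
  fix q assume "q \<in> {q. vanishes_at F q}"
  moreover obtain v where v: "v ~= 0" "q = pt v" by (rule pt_cases)
  ultimately have "ev id F v = 0" using vanishes_at_pt[OF F(2) v(1)] by auto
  then have "ev id G v = 0" using d idc.ev_dvd by blast
  then show "vanishes_at G q" using vanishes_at_pt[OF G v(1)] v by simp
 qed
qed

section \<open>Valuation rings and integral closure\<close>

definition is_subring :: "'a::comm_ring_1 set => bool" where
 "is_subring A \<longleftrightarrow> 1 \<in> A & (\<forall>x\<in>A. \<forall>y\<in>A. x - y \<in> A & x * y \<in> A)"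

context
 fixes A :: "'a::comm_ring_1 set"
 assumes A: "is_subring A"
begin

lemma subring_1: "1 \<in> A" and subring_diff: "x \<in> A ==> y \<in> A ==> x - y \<in> A"
 and subring_mult: "x \<in> A ==> y \<in> A ==> x * y \<in> A"
 using A by (auto simp: is_subring_def)

lemma subring_0: "0 \<in> A"
 using subring_diff[of 1 1] subring_1 by simp

lemma subring_uminus: "x \<in> A ==> - x \<in> A"
 using subring_diff[of 0 x] subring_0 by simp

lemma subring_add: "x \<in> A ==> y \<in> A ==> x + y \<in> A"
 using subring_diff[of x "- y"] subring_uminus by simp

lemma subring_sum: "(!!i. i \<in> I ==> f i \<in> A) ==> (\<Sum>i\<in>I. f i) \<in> A"
 by (induction I rule: infinite_finite_induct) (auto intro: subring_0 subring_add)

lemma subring_prod: "(!!i. i \<in> I ==> f i \<in> A) ==> (\<Prod>i\<in>I. f i) \<in> A"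
 by (induction I rule: infinite_finite_induct) (auto intro: subring_1 subring_mult)

lemma subring_power: "x \<in> A ==> x ^ n \<in> A"
 by (induction n) (auto intro: subring_1 subring_mult)

end

lemmas subring_closed = subring_1 subring_0 subring_diff subring_uminus subring_add subring_mult subring_sum
 subring_prod subring_power

definition coeffs_in :: "'a::zero set => 'a poly => bool" where
 "coeffs_in A p \<longleftrightarrow> (\<forall>i. coeff p i \<in> A)"

lemma poly_in_subring: "is_subring A ==> coeffs_in A p ==> x \<in> A ==> poly p x \<in> A"
 unfolding poly_altdef by (auto intro!: subring_closed simp: coeffs_in_def)

text \<open>For a subring B containing I this is the ideal generated by I. The ring is a parameter
  because the same I is followed through growing rings in Chevalley's theorem.\<close>

inductive_set ideal_span :: "'a::comm_ring_1 set => 'a set => 'a set" for I B where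
 zero: "0 \<in> ideal_span I B"
| step: "x \<in> I ==> b \<in> B ==> y \<in> ideal_span I B ==> x * b + y \<in> ideal_span I B"

lemma ideal_span_base: "x \<in> I ==> b \<in> B ==> x * b \<in> ideal_span I B"
 using ideal_span.step[of x I b B 0] ideal_span.zero by auto

lemma ideal_span_mono: "x \<in> ideal_span I B ==> B \<subseteq> B' ==> x \<in> ideal_span I B'"
 by (induction rule: ideal_span.induct) (auto intro: ideal_span.intros)

lemma ideal_span_add: "x \<in> ideal_span I B ==> y \<in> ideal_span I B ==> x + y \<in> ideal_span I B"
 by (induction rule: ideal_span.induct) (auto intro: ideal_span.intros simp: add.assoc)

lemma ideal_span_mult: "is_subring B ==> x \<in> ideal_span I B ==> b \<in> B ==> x * b \<in> ideal_span I B"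
proof (rotate_tac 1, induction rule: ideal_span.induct)
 case (step x c y)
 then show ?case using ideal_span.step[of x I "c * b" B "y * b"]
  by (auto simp: algebra_simps intro: subring_closed)
qed (auto intro: ideal_span.zero)

lemma ideal_span_diff: "is_subring B ==> x \<in> ideal_span I B ==> y \<in> ideal_span I B ==> x - y \<in> ideal_span I B"
 using ideal_span_add[of x I B "y * (-1)"] ideal_span_mult[of B y I "-1"]
 by (simp add: subring_closed)

lemma ideal_span_subset: "is_subring B ==> I \<subseteq> B ==> x \<in> ideal_span I B ==> x \<in> B"
 by (rotate_tac 2, induction rule: ideal_span.induct) (auto intro: subring_closed)

lemma coeffs_in_mult: "is_subring A ==> coeffs_in A p ==> coeffs_in A q ==> coeffs_in A (p * q)"
 by (auto simp: coeffs_in_def coeff_mult intro!: subring_closed)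

definition adjoin :: "'a::comm_ring_1 set => 'a => 'a set" where
 "adjoin B f = {poly p f |p. coeffs_in B p}"

lemma adjoin_subring: assumes "is_subring B" shows "is_subring (adjoin B f)"
 unfolding is_subring_def
proof (intro conjI ballI)
 have "coeffs_in B 1" using assms by (auto simp: coeffs_in_def subring_closed)
 then show "1 \<in> adjoin B f" by (auto simp: adjoin_def intro!: exI[of _ 1])
 fix x y assume "x \<in> adjoin B f" "y \<in> adjoin B f"
 then obtain p q where pq: "coeffs_in B p" "coeffs_in B q" "x = poly p f" "y = poly q f" by (auto simp: adjoin_def)
 have "coeffs_in B (p - q)" using pq assms by (auto simp: coeffs_in_def subring_closed)
 then show "x - y \<in> adjoin B f" using pq by (auto simp: adjoin_def intro!: exI[of _ "p - q"])
 show "x * y \<in> adjoin B f" using pq coeffs_in_mult[OF assms pq(1,2)]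
  by (auto simp: adjoin_def intro!: exI[of _ "p * q"])
qed

lemma adjoin_base: "is_subring B ==> x \<in> B ==> x \<in> adjoin B f"
 unfolding adjoin_def coeffs_in_def mem_Collect_eq
 by (rule exI[of _ "[:x:]"]) (auto simp: coeff_pCons subring_closed split: nat.splits)

lemma adjoin_gen: "is_subring B ==> f \<in> adjoin B f"
 unfolding adjoin_def coeffs_in_def mem_Collect_eq
 by (rule exI[of _ "[:0, 1:]"]) (auto simp: coeff_pCons subring_closed split: nat.splits)

lemma ideal_span_adjoin:
 assumes B: "is_subring B" and x: "x \<in> ideal_span I (adjoin B f)"
 shows "\<exists>p. coeffs_in (ideal_span I B) p & poly p f = x"
 using x
proof (induction rule: ideal_span.induct)
 case zero then show ?case by (intro exI[of _ 0]) (auto simp: coeffs_in_def ideal_span.zero)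
next
 case (step x b y)
 then obtain p q where pq: "coeffs_in (ideal_span I B) p" "y = poly p f" "coeffs_in B q" "b = poly q f"
  by (auto simp: adjoin_def)
 have "coeffs_in (ideal_span I B) (smult x q + p)"
  using pq step(1) by (auto simp: coeffs_in_def intro!: ideal_span_add ideal_span_base)
 then show ?case using pq by (intro exI[of _ "smult x q + p"]) auto
qed

text \<open>A valuation ring of the whole field type. The function field is a subfield of that type,
  and only the trace of V on it says something about the curve.\<close>

definition valuation_ring :: "'a::field set => bool" where
 "valuation_ring V \<longleftrightarrow> is_subring V & (\<forall>f. f \<in> V \<or> inverse f \<in> V)"

text \<open>The two relations say that J generates the unit ideal in B[f] and in B[1/f]. As 1 minus
  the constant term of q is a unit of B, the second relation expresses f^m, m = degree q, by lower
  powers of f with coefficients in J. Substituted into the leading term of p, it lowers the degree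
  of p.\<close>

lemma chevalley_step:
 fixes f :: "'a::field"
 assumes J: "1 \<notin> J" "0 \<in> J" "!!x y. x \<in> J ==> y \<in> J ==> x + y \<in> J" "!!x y. x \<in> J ==> y \<in> J ==> x - y \<in> J"
   "!!x b. x \<in> J ==> b \<in> B ==> x * b \<in> J" "J \<subseteq> B"
  and unit: "!!c. c \<in> J ==> inverse (1 - c) \<in> B"
  and p: "coeffs_in J p" "poly p f = 1" and q: "coeffs_in J q" "poly q (inverse f) = 1"
  and le: "degree q \<le> degree p"
 shows "\<exists>p'. degree p' < degree p & coeffs_in J p' & poly p' f = 1"
proof -
 define m where "m = degree q"
 define n where "n = degree p"
 define c where "c = inverse (1 - coeff q 0)"
 \<comment> \<open>The relation q(1/f) = 1, with its constant term moved to the right, divided by 1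
   - \<open>coeff q 0\<close> and multiplied by f^m, reads f^m = r(f).\<close>
 define r where "r = (\<Sum>j\<in>{1..m}. monom (c * coeff q j) (m - j))"
 define p' where "p' = p - monom (lead_coeff p) n + monom (lead_coeff p) (n - m) * r"
 have "m > 0"
 proof (rule ccontr)
  assume "~ m > 0"
  then obtain a where "q = [:a:]" unfolding m_def by (metis degree_eq_zeroE gr0I)
  then show False using q J(1) unfolding coeffs_in_def by (metis coeff_pCons_0 poly_const_conv poly_pCons add.right_neutral mult_zero_right poly_0)
 qed
 have qJ: "coeff q j \<in> J" for j using q by (simp add: coeffs_in_def)
 have c1: "1 - coeff q 0 ~= 0" using J(1) qJ[of 0] by auto
 have cB: "c \<in> B" using unit qJ c_def by auto
 have f0: "f ~= 0"
 proof
  assume "f = 0" then have "coeff q 0 = 1" using q(2) by (simp add: poly_0_coeff_0)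
  then show False using qJ[of 0] J(1) by auto
 qed
 have "poly r f = (\<Sum>j\<in>{1..m}. c * coeff q j * f ^ (m - j))" by (simp add: r_def poly_sum poly_monom)
 also have "\<dots> = c * f ^ m * (\<Sum>j\<in>{1..m}. coeff q j * inverse f ^ j)"
  unfolding sum_distrib_left using f0
  by (intro sum.cong refl) (auto simp: power_diff field_simps)
 also have "(\<Sum>j\<in>{1..m}. coeff q j * inverse f ^ j) = 1 - coeff q 0"
 proof -
  have "1 = (\<Sum>j\<le>m. coeff q j * inverse f ^ j)" using q(2) by (simp add: poly_altdef m_def)
  also have "{..m} = insert 0 {1..m}" by auto
  finally have "1 = coeff q 0 + (\<Sum>j\<in>{1..m}. coeff q j * inverse f ^ j)" by simp
  then show ?thesis by (simp only: eq_diff_eq add.commute)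
 qed
 finally have rf: "poly r f = f ^ m" using c1 by (simp add: c_def)
 have mon: "coeffs_in J (monom x k)" if "x \<in> J" for x k
  using that J(2) by (auto simp: coeffs_in_def coeff_monom)
 have rJ: "coeffs_in J r"
 proof -
  have "coeffs_in J (\<Sum>j\<in>S. monom (c * coeff q j) (m - j))" for S
   by (induction S rule: infinite_finite_induct)
    (use J(2) mon J(5)[OF qJ cB] in \<open>auto simp: coeffs_in_def mult.commute intro!: J(3)\<close>)
  then show ?thesis unfolding r_def .
 qed
 have dr: "degree r < m"
 proof -
  have "coeff r k = 0" if "k \<ge> m" for k
   using that \<open>m > 0\<close> by (auto simp: r_def coeff_sum coeff_monom intro!: sum.neutral)
  then show ?thesis using \<open>m > 0\<close> by (intro degree_lessI) auto
 qed
 have lc: "lead_coeff p \<in> J" using p by (simp add: coeffs_in_def)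
 have "coeff p' k = 0" if "k \<ge> n" for k
  using that dr le \<open>m > 0\<close> unfolding p'_def
  by (auto simp: coeff_monom coeff_monom_mult coeff_eq_0 n_def m_def)
 moreover have "n > 0" using \<open>m > 0\<close> le by (simp add: n_def m_def)
 ultimately have "degree p' < n" by (metis degree_lessI le_eq_less_or_eq degree_0 leading_coeff_0_iff linorder_not_less)
 moreover have "coeffs_in J p'"
 proof -
  have "coeff r i \<in> J" for i using rJ by (simp add: coeffs_in_def)
  then have "lead_coeff p * coeff r i \<in> J" for i using J(5)[OF lc] J(6) by blast
  then have "coeff (monom (lead_coeff p) (n - m) * r) i \<in> J" for i
   using J(2) by (simp add: coeff_monom_mult)
  moreover have "coeff p i \<in> J" for i using p by (simp add: coeffs_in_def)
  moreover have "coeff (monom (lead_coeff p) n) i \<in> J" for i using lc J(2) by (simp add: coeff_monom)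
  ultimately show ?thesis unfolding p'_def coeffs_in_def coeff_add coeff_diff by (blast intro: J(3,4))
 qed
 moreover have "poly p' f = 1"
 proof -
  have "f ^ (n - m) * f ^ m = f ^ n" using le by (simp add: n_def m_def flip: power_add)
  then show ?thesis by (simp add: p'_def poly_monom rf p(2) mult.assoc)
 qed
 ultimately show ?thesis unfolding n_def by blast
qed

text \<open>Zorn's lemma gives a maximal ring B above A in which I still generates a proper ideal J.
  Maximality against B[1/(1-c)] makes 1 - c a unit for c in J. If neither f nor 1/f were in B,
  maximality against B[f] and B[1/f] would give two relations as in \<open>chevalley_step\<close>,
  and a pair of least total degree is impossible.\<close>

theorem chevalley:
 fixes A :: "'a::field set"
 assumes A: "is_subring A" and I: "I \<subseteq> A" "1 \<notin> ideal_span I A"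
 shows "\<exists>V. valuation_ring V & A \<subseteq> V & 1 \<notin> ideal_span I V"
proof -
 define T where "T = {B. is_subring B & A \<subseteq> B & 1 \<notin> ideal_span I B}"
 have "\<exists>M\<in>T. \<forall>Q1\<in>T. M \<subseteq> Q1 \<longrightarrow> Q1 = M"
 proof (rule subset_Zorn_nonempty)
  show "T ~= {}" using A I by (auto simp: T_def)
  fix C assume C: "C ~= {}" "subset.chain T C"
  then have CT: "C \<subseteq> T" by (auto simp: subset.chain_def)
  have tot: "Q1 \<subseteq> Y \<or> Y \<subseteq> Q1" if "Q1 \<in> C" "Y \<in> C" for Q1 Y
   using C that by (auto simp: subset_chain_def)
  have sub: "is_subring (\<Union>C)" unfolding is_subring_def
  proof (intro conjI ballI)
   show "1 \<in> \<Union>C" using C(1) CT by (auto simp: T_def intro: subring_closed)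
   fix x y assume "x \<in> \<Union>C" "y \<in> \<Union>C"
   then obtain Q1 where Q1: "Q1 \<in> C" "x \<in> Q1" "y \<in> Q1" using tot by blast
   then have "is_subring Q1" using CT by (auto simp: T_def)
   then show "x - y \<in> \<Union>C" "x * y \<in> \<Union>C" using Q1 by (auto intro: subring_closed)
  qed
  have "\<exists>Q1\<in>C. x \<in> ideal_span I Q1" if "x \<in> ideal_span I (\<Union>C)" for x
   using that
  proof (induction rule: ideal_span.induct)
   case zero then show ?case using C(1) by (auto intro: ideal_span.zero)
  next
   case (step x b y)
   then obtain Q1 Y where *: "Q1 \<in> C" "y \<in> ideal_span I Q1" "Y \<in> C" "b \<in> Y" by blast
   have "\<exists>Z\<in>C. y \<in> ideal_span I Z & b \<in> Z"
   proof (cases "Q1 \<subseteq> Y")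
    case True then show ?thesis using * ideal_span_mono[of y I Q1 Y] by auto
   next
    case False then have "Y \<subseteq> Q1" using tot * by auto
    then show ?thesis using * by auto
   qed
   then obtain Z where "Z \<in> C" "y \<in> ideal_span I Z" "b \<in> Z" by blast
   then show ?case using step by (auto intro: ideal_span.step)
  qed
  then show "\<Union>C \<in> T" using sub CT C(1) by (fastforce simp: T_def)
 qed
 then obtain B where B: "B \<in> T" and max: "!!Q1. Q1 \<in> T ==> B \<subseteq> Q1 ==> Q1 = B" by blast
 then have sB: "is_subring B" "A \<subseteq> B" "1 \<notin> ideal_span I B" by (auto simp: T_def)
 define J where "J = ideal_span I B"
 have J: "1 \<notin> J" "0 \<in> J" "!!x y. x \<in> J ==> y \<in> J ==> x + y \<in> J" "!!x y. x \<in> J ==> y \<in> J ==> x - y \<in> J"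
   "!!x b. x \<in> J ==> b \<in> B ==> x * b \<in> J" "J \<subseteq> B"
 proof -
  show "J \<subseteq> B" unfolding J_def using ideal_span_subset[OF sB(1), of I] I(1) sB(2) by (meson order_trans subsetI)
 qed (simp_all add: J_def sB(3) ideal_span.zero ideal_span_add ideal_span_diff[OF sB(1)] ideal_span_mult[OF sB(1)])
 have unit: "inverse (1 - c) \<in> B" if c: "c \<in> J" for c
 proof -
  define e where "e = 1 - c"
  have e0: "e ~= 0" using c J(1) by (auto simp: e_def)
  have eB: "e \<in> B" using c J(6) sB(1) by (auto simp: e_def intro: subring_closed)
  \<comment> \<open>This is B[1/e]. Powers of e are congruent to 1 modulo J, so J does not become
    the unit ideal there, and maximality forces 1/e into B.\<close>
  define Q1 where "Q1 = {b / e ^ k |b k. b \<in> B}"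
  have pw: "\<exists>j\<in>J. e ^ k = 1 - j" for k
  proof (induction k)
   case (Suc k)
   then obtain j where j: "j \<in> J" "e ^ k = 1 - j" by blast
   have "e ^ Suc k = e * (1 - j)" using j by simp
   also have "\<dots> = 1 - (j + c * (1 - j))" by (simp add: e_def algebra_simps)
   finally have "e ^ Suc k = 1 - (j + c * (1 - j))" .
   moreover have "j + c * (1 - j) \<in> J" using j c J(6) sB(1) by (intro J(3) J(5)) (auto intro: subring_closed)
   ultimately show ?case by blast
  qed (use J(2) in auto)
  have "is_subring Q1" unfolding is_subring_def
  proof (intro conjI ballI)
   show "1 \<in> Q1" unfolding Q1_def mem_Collect_eq using sB(1) by (intro exI[of _ 1] exI[of _ 0]) (auto intro: subring_closed)
   fix x y assume "x \<in> Q1" "y \<in> Q1"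
   then obtain a b k l where *: "x = a / e ^ k" "y = b / e ^ l" "a \<in> B" "b \<in> B" by (auto simp: Q1_def)
   show "x - y \<in> Q1" unfolding Q1_def mem_Collect_eq
    by (rule exI[of _ "a * e ^ l - b * e ^ k"], rule exI[of _ "k + l"])
      (use * e0 eB sB(1) in \<open>auto simp: field_simps power_add intro!: subring_closed\<close>)
   show "x * y \<in> Q1" unfolding Q1_def mem_Collect_eq
    by (rule exI[of _ "a * b"], rule exI[of _ "k + l"])
      (use * e0 eB sB(1) in \<open>auto simp: field_simps power_add intro!: subring_closed\<close>)
  qed
  moreover have "B \<subseteq> Q1"
  proof
   fix x assume "x \<in> B"
   then show "x \<in> Q1" unfolding Q1_def mem_Collect_eq by (intro exI[of _ x] exI[of _ 0]) simp
  qed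
  moreover have "1 \<notin> ideal_span I Q1"
  proof
   have "\<exists>j\<in>J. \<exists>k. x = j / e ^ k" if "x \<in> ideal_span I Q1" for x
    using that
   proof (induction rule: ideal_span.induct)
    case zero then show ?case using J(2) by (auto intro!: bexI[of _ 0])
   next
    case (step x b y)
    then obtain a k j l where *: "b = a / e ^ k" "a \<in> B" "y = j / e ^ l" "j \<in> J" by (auto simp: Q1_def)
    have xa: "x * a \<in> J" using step(1) * by (auto simp: J_def intro: ideal_span_base)
    have pwB: "e ^ i \<in> B" for i using eB sB(1) by (auto intro: subring_closed)
    have "x * a * e ^ l + j * e ^ k \<in> J" by (intro J(3) J(5) xa *(4) pwB)
    moreover have "x * b + y = (x * a * e ^ l + j * e ^ k) / e ^ (k + l)"
     using * e0 by (simp add: field_simps power_add)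
    ultimately show ?case by blast
   qed
   moreover assume "1 \<in> ideal_span I Q1"
   ultimately obtain j k where "j \<in> J" "1 = j / e ^ k" by blast
   then have "e ^ k \<in> J" using e0 by (simp add: field_simps)
   then show False using pw[of k] J(1) J(3) by fastforce
  qed
  ultimately have "Q1 = B" using max sB(2) by (auto simp: T_def)
  moreover have "inverse e \<in> Q1" unfolding Q1_def mem_Collect_eq using sB(1)
   by (intro exI[of _ 1] exI[of _ "Suc 0"]) (auto simp: inverse_eq_divide intro: subring_closed)
  ultimately show ?thesis by (simp add: e_def)
 qed
 have "f \<in> B \<or> inverse f \<in> B" for f
 proof (rule ccontr)
  assume *: "~ ?thesis"
  have ex: "\<exists>p. coeffs_in J p & poly p g = 1" if "g \<notin> B" for g
  proof -
   have "adjoin B g \<notin> T" using max[of "adjoin B g"] adjoin_base[OF sB(1)] adjoin_gen[OF sB(1)] that by blast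
   then have "1 \<in> ideal_span I (adjoin B g)"
    using adjoin_subring[OF sB(1)] adjoin_base[OF sB(1)] sB(2) by (auto simp: T_def)
   then show ?thesis using ideal_span_adjoin[OF sB(1)] by (auto simp: J_def)
  qed
  define P where "P pq \<longleftrightarrow> coeffs_in J (fst pq) & poly (fst pq) f = 1 & coeffs_in J (snd pq) & poly (snd pq) (inverse f) = 1" for pq
  have "\<exists>pq. P pq" using ex[of f] ex[of "inverse f"] * by (auto simp: P_def)
  then obtain pq where pq: "P pq" and min: "!!y. P y ==> degree (fst pq) + degree (snd pq) \<le> degree (fst y) + degree (snd y)"
   using ex_has_least_nat[of P _ "%pq. degree (fst pq) + degree (snd pq)"] by blast
  obtain p q where [simp]: "pq = (p, q)" by (cases pq)
  show False
  proof (cases "degree q \<le> degree p")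
   case True
   obtain p' where "degree p' < degree p" "coeffs_in J p'" "poly p' f = 1"
    using chevalley_step[of J B p f q, OF J unit] pq True unfolding P_def by auto
   then show False using min[of "(p', q)"] pq by (auto simp: P_def)
  next
   case False
   obtain q' where "degree q' < degree q" "coeffs_in J q'" "poly q' (inverse f) = 1"
    using chevalley_step[of J B q "inverse f" p, OF J unit] pq False unfolding P_def by auto
   then show False using min[of "(p, q')"] pq by (auto simp: P_def)
  qed
 qed
 then show ?thesis using sB by (auto simp: valuation_ring_def)
qed

definition integral :: "'a::comm_ring_1 set => 'a => bool" where
 "integral A u \<longleftrightarrow> (\<exists>p. lead_coeff p = 1 & coeffs_in A p & poly p u = 0)"

text \<open>If u is not in V then 1/u is, and dividing the equation by u^(degree p - 1) writes the
  product as a combination of powers of 1/u. The leading coefficient is kept because non-monic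
  equations occur as well.\<close>

lemma valuation_ring_root:
 assumes V: "valuation_ring V" and p: "coeffs_in V p" "poly p u = 0"
 shows "lead_coeff p * u \<in> V"
proof (cases "u \<in> V \<or> degree p = 0")
 case True
 have sV: "is_subring V" using V by (simp add: valuation_ring_def)
 have "p = 0" if "degree p = 0" using p(2) that by (metis degree_eq_zeroE mult_zero_right add.right_neutral poly_0 poly_pCons pCons_0_0)
 then show ?thesis using True sV p(1) by (auto simp: coeffs_in_def intro: subring_closed)
next
 case False
 have sV: "is_subring V" using V by (simp add: valuation_ring_def)
 have iV: "inverse u \<in> V" and u0: "u ~= 0" using V False subring_0[OF sV] by (auto simp: valuation_ring_def)
 obtain n where n: "degree p = Suc n" using False by (meson not0_implies_Suc)
 have "0 = (\<Sum>i\<le>Suc n. coeff p i * u ^ i)" using p(2) n by (simp add: poly_altdef)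
 also have "\<dots> = lead_coeff p * u * u ^ n + (\<Sum>i\<le>n. coeff p i * u ^ i)" using n by simp
 also have "(\<Sum>i\<le>n. coeff p i * u ^ i) = u ^ n * (\<Sum>i\<le>n. coeff p i * inverse u ^ (n - i))"
  unfolding sum_distrib_left using u0 by (intro sum.cong refl) (auto simp: power_diff field_simps)
 finally have "u ^ n * (lead_coeff p * u + (\<Sum>i\<le>n. coeff p i * inverse u ^ (n - i))) = 0"
  by (simp add: algebra_simps)
 then have "lead_coeff p * u = - (\<Sum>i\<le>n. coeff p i * inverse u ^ (n - i))"
  using u0 by (simp add: add_eq_0_iff2)
 also have "\<dots> \<in> V" using p(1) iV by (auto simp: coeffs_in_def intro!: subring_closed sV)
 finally show ?thesis .
qed

text \<open>The integral closure is the intersection of the valuation rings above A. For u not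
  integral, 1/u generates a proper ideal of A[1/u], since a relation 1 = b/u with b in A[1/u]
  becomes a monic equation of u over A. Chevalley's theorem then provides a V in which 1/u is not
  invertible.\<close>

theorem integral_iff:
 fixes u :: "'a::field"
 assumes A: "is_subring A"
 shows "integral A u \<longleftrightarrow> (\<forall>V. valuation_ring V & A \<subseteq> V \<longrightarrow> u \<in> V)"
proof (intro iffI allI impI)
 fix V assume "integral A u" and V: "valuation_ring V & A \<subseteq> V"
 then obtain p where p: "lead_coeff p = 1" "coeffs_in A p" "poly p u = 0" by (auto simp: integral_def)
 then have "coeffs_in V p" using V by (auto simp: coeffs_in_def)
 then show "u \<in> V" using valuation_ring_root[of V p u] V p by simp
next
 assume *: "\<forall>V. valuation_ring V & A \<subseteq> V \<longrightarrow> u \<in> V"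
 show "integral A u"
 proof (rule ccontr)
  assume ni: "~ integral A u"
  define B where "B = adjoin A (inverse u)"
  have sB: "is_subring B" unfolding B_def by (rule adjoin_subring[OF A])
  have u0: "u ~= 0"
  proof
   assume "u = 0"
   then have "integral A u" unfolding integral_def
    by (intro exI[of _ "[:0, 1:]"]) (auto simp: coeffs_in_def coeff_pCons subring_closed A split: nat.splits)
   with ni show False by simp
  qed
  have "1 \<notin> ideal_span {inverse u} B"
  proof
   assume "1 \<in> ideal_span {inverse u} B"
   moreover have "\<exists>b\<in>B. x = inverse u * b" if "x \<in> ideal_span {inverse u} B" for x
    using that
   proof (induction rule: ideal_span.induct)
    case zero then show ?case using sB by (auto intro!: bexI[of _ 0] subring_closed)
   next
    case (step x b y)
    then obtain c where "c \<in> B" "y = inverse u * c" by blast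
    with step show ?case using sB by (auto intro!: bexI[of _ "b + c"] subring_closed simp: distrib_left)
   qed
   ultimately obtain q where q: "coeffs_in A q" "1 = inverse u * poly q (inverse u)"
    unfolding B_def adjoin_def by blast
   define n where "n = degree q"
   define p where "p = monom 1 (Suc n) - (\<Sum>i\<le>n. monom (coeff q i) (n - i))"
   have "u * u ^ n = u ^ n * poly q (inverse u)" using q(2) u0 by (simp add: field_simps)
   also have "\<dots> = (\<Sum>i\<le>n. coeff q i * u ^ (n - i))"
    unfolding poly_altdef n_def[symmetric] sum_distrib_left using u0
    by (intro sum.cong refl) (auto simp: power_diff field_simps)
   finally have "poly p u = 0" by (simp add: p_def poly_monom poly_sum)
   moreover have "coeffs_in A p" using q(1) unfolding p_def coeffs_in_def
    by (auto simp: coeff_sum coeff_monom intro!: subring_closed A)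
   moreover have "lead_coeff p = 1"
   proof -
    have "degree (\<Sum>i\<le>n. monom (coeff q i) (n - i)) \<le> n"
     by (intro degree_sum_le) (auto intro: order_trans[OF degree_monom_le])
    then have 1: "coeff (\<Sum>i\<le>n. monom (coeff q i) (n - i)) k = 0" if "k > n" for k using that by (simp add: coeff_eq_0)
    then have c: "coeff p (Suc n) = 1" by (simp add: p_def)
    have "degree p \<le> Suc n" by (rule degree_le) (auto simp: p_def 1)
    moreover have "degree p \<ge> Suc n" using c by (intro le_degree) auto
    ultimately show ?thesis using c by simp
   qed
   ultimately show False using ni by (auto simp: integral_def)
  qed
  then obtain V where V: "valuation_ring V" "B \<subseteq> V" "1 \<notin> ideal_span {inverse u} V"
   using chevalley[OF sB, of "{inverse u}"] adjoin_gen[OF A] by (auto simp: B_def)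
  have "A \<subseteq> V" using V(2) adjoin_base[OF A] by (auto simp: B_def)
  then have "u \<in> V" using * V by blast
  then have "inverse u * u \<in> ideal_span {inverse u} V" by (intro ideal_span_base) auto
  then show False using u0 V(3) by simp
 qed
qed

lemma valuation_ring_subring: "valuation_ring V ==> is_subring V" by (simp add: valuation_ring_def)

context
 fixes A :: "'a::field set"
 assumes A: "is_subring A"
begin

lemma integral_base: "x \<in> A ==> integral A x"
 by (auto simp: integral_iff[OF A])

lemma integral_subring: "is_subring {x. integral A x}"
 unfolding is_subring_def integral_iff[OF A] by (blast dest: valuation_ring_subring intro: subring_closed)

lemma integral_trans:
 assumes "is_subring B" "!!x. x \<in> B ==> integral A x" "integral B u"
 shows "integral A u"
 using assms by (fastforce simp: integral_iff[OF A] integral_iff[OF assms(1)])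

end

text \<open>This is how localizations of a normal ring become valuation rings. With a the leading
  coefficient of p, the product a u is integral, hence in S. If a is outside M, then u = (a u)/a.
  Otherwise a u is absorbed into the next coefficient, which lowers the degree, unless all
  coefficients of the new polynomial fall into M. In that case a u is outside M and 1/u = a/(a
  u).\<close>

lemma localization_dichotomy:
 fixes u :: "'a::field"
 assumes S: "is_subring S" and closed: "!!x. x \<in> K ==> integral S x ==> x \<in> S"
  and K: "is_subring K" "S \<subseteq> K"
  and M: "0 \<in> M" "!!x y. x \<in> M ==> y \<in> M ==> x - y \<in> M"
  and u: "u \<in> K"
  and p: "coeffs_in S p" "poly p u = 0" "coeff p i \<notin> M"
 shows "\<exists>a\<in>S. \<exists>b\<in>S - M. u * b = a \<or> (u ~= 0 & inverse u * b = a)"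
proof -
 have "\<exists>a\<in>S. \<exists>b\<in>S - M. u * b = a \<or> (u ~= 0 & inverse u * b = a)"
  if "degree p \<le> N" "coeffs_in S p" "poly p u = 0" "\<exists>i. coeff p i \<notin> M" for N p
  using that
 proof (induction N arbitrary: p)
  case 0
  then have "p = 0" by (metis degree_eq_zeroE le_zero_eq mult_zero_right add.right_neutral poly_0 poly_pCons pCons_0_0)
  then show ?case using 0 M by simp
 next
  case (Suc N)
  show ?case
  proof (cases "degree p \<le> N")
   case True then show ?thesis using Suc by blast
  next
   case False
   then have deg: "degree p = Suc N" using Suc by simp
   define a where "a = lead_coeff p"
   have aS: "a \<in> S" using Suc by (auto simp: a_def coeffs_in_def)
   have "integral S (a * u)" unfolding integral_iff[OF S]
    using valuation_ring_root[of _ p u] Suc.prems by (auto simp: a_def coeffs_in_def)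
   then have auS: "a * u \<in> S" using closed u aS K by (auto intro: subring_closed)
   show ?thesis
   proof (cases "a \<in> M")
    case False
    then show ?thesis using aS auS by (intro bexI[of _ "a * u"] bexI[of _ a]) (auto simp: mult.commute)
   next
    case aM: True
    define p' where "p' = p - monom a (Suc N) + monom (a * u) N"
    have c: "coeff p' k = (if k = N then a * u + coeff p N else if k < N then coeff p k else 0)" for k
     using deg by (auto simp: p'_def a_def coeff_eq_0 le_less_Suc_eq)
    have d: "degree p' \<le> N" by (rule degree_le) (auto simp: c)
    have pS: "coeffs_in S p'" using Suc.prems auS unfolding coeffs_in_def c by (auto intro!: subring_closed S)
    have pu: "poly p' u = 0" using Suc.prems by (simp add: p'_def poly_monom)
    show ?thesis
    proof (cases "\<exists>i. coeff p' i \<notin> M")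
     case True then show ?thesis using Suc.IH d pS pu by blast
    next
     case False
     then have all: "coeff p' k \<in> M" for k by blast
     have low: "coeff p k \<in> M" if "k < N" for k using all[of k] that by (simp add: c)
     have high: "coeff p k \<in> M" if "k > N" for k
     proof (cases "k = Suc N")
      case True then show ?thesis using aM deg by (simp add: a_def)
     next
      case False then show ?thesis using that deg M(1) by (simp add: coeff_eq_0)
     qed
     have N: "coeff p N \<notin> M" using low high Suc.prems(4) by (metis linorder_neqE_nat)
     have "a * u \<notin> M"
     proof
      assume "a * u \<in> M"
      then have "coeff p' N - a * u \<in> M" using all M(2) by blast
      then show False using N by (simp add: c)
     qed
     moreover from this M(1) have "u ~= 0" by auto
     ultimately show ?thesis using aS auS
      by (intro bexI[of _ a] bexI[of _ "a * u"]) (auto simp: mult.commute)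
    qed
   qed
  qed
 qed
 then show ?thesis using p by blast
qed

section \<open>Places of the function field\<close>

lemma valuation_ring_cases: "valuation_ring V ==> f \<in> V \<or> inverse f \<in> V"
 by (simp add: valuation_ring_def)

definition nonunits :: "'a::field set => 'a set" where
 "nonunits V = {f \<in> V. f = 0 \<or> inverse f \<notin> V}"

context
 fixes V :: "'a::field set"
 assumes V: "valuation_ring V"
begin

lemmas sV = valuation_ring_subring[OF V]

lemma nonunits_mult: "f \<in> nonunits V ==> g \<in> V ==> f * g \<in> nonunits V"
proof -
 assume f: "f \<in> nonunits V" and g: "g \<in> V"
 have "inverse f \<in> V" if "inverse (f * g) \<in> V" "f * g ~= 0"
 proof -
  have "inverse f = g * inverse (f * g)" using that(2) by (simp add: field_simps)
  then show ?thesis using that g subring_closed[OF sV] by metis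
 qed
 then show ?thesis using f g subring_closed[OF sV] by (auto simp: nonunits_def)
qed

lemma nonunits_0: "0 \<in> nonunits V" by (simp add: nonunits_def subring_closed[OF sV])

lemma nonunits_1: "1 \<notin> nonunits V" by (simp add: nonunits_def subring_closed[OF sV])

lemma nonunits_subset: "f \<in> nonunits V ==> f \<in> V" by (simp add: nonunits_def)

lemma not_nonunit: "f \<in> V ==> f \<notin> nonunits V ==> f ~= 0 & inverse f \<in> V" by (auto simp: nonunits_def)

lemma nonunits_add: "f \<in> nonunits V ==> g \<in> nonunits V ==> f + g \<in> nonunits V"
proof -
 assume f: "f \<in> nonunits V" and g: "g \<in> nonunits V"
 consider "g = 0" | "f = 0" | "g ~= 0" "f * inverse g \<in> V" | "f ~= 0" "g ~= 0" "g * inverse f \<in> V"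
  using valuation_ring_cases[OF V, of "f * inverse g"] by (cases "f = 0"; cases "g = 0") (auto simp: mult.commute)
 then show ?thesis
 proof cases
  case 3
  have "f + g = g * (f * inverse g + 1)" using 3 by (simp add: field_simps)
  then show ?thesis using nonunits_mult[OF g] 3 subring_closed[OF sV] by metis
 next
  case 4
  have "f + g = f * (g * inverse f + 1)" using 4 by (simp add: field_simps)
  then show ?thesis using nonunits_mult[OF f] 4 subring_closed[OF sV] by metis
 qed (use f g in auto)
qed

lemma nonunits_uminus: "f \<in> nonunits V ==> - f \<in> nonunits V"
 using nonunits_mult[of f "-1"] subring_closed[OF sV] by force

lemma nonunits_diff: "f \<in> nonunits V ==> g \<in> nonunits V ==> f - g \<in> nonunits V"
 using nonunits_add[of f "- g"] nonunits_uminus by simp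

lemma nonunits_sum: "(!!i. i \<in> I ==> f i \<in> nonunits V) ==> (\<Sum>i\<in>I. f i) \<in> nonunits V"
 by (induction I rule: infinite_finite_induct) (auto intro: nonunits_0 nonunits_add)

lemma unit_add_nonunit: "f \<in> V ==> f \<notin> nonunits V ==> g \<in> nonunits V ==> f + g \<in> V & f + g \<notin> nonunits V"
 using nonunits_diff[of "f + g" g] nonunits_subset subring_closed[OF sV] by auto

end

definition max_ideal :: "'a::comm_ring_1 set => 'a set => bool" where
 "max_ideal M S \<longleftrightarrow> M \<subseteq> S & 0 \<in> M & (\<forall>x\<in>M. \<forall>y\<in>M. x - y \<in> M) & (\<forall>x\<in>M. \<forall>s\<in>S. x * s \<in> M) & 1 \<notin> M &
   (\<forall>r\<in>S - M. \<exists>s\<in>S. 1 - r * s \<in> M)"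

definition localization :: "'a::field set => 'a set => 'a set" where
 "localization S M = {a / b |a b. a \<in> S & b \<in> S - M}"

text \<open>In a frame whose third base point is off the curve, every y has a root z, and the points
  [1:y:z] are distinct.\<close>

lemma infinite_curve:
 assumes F: "homogeneous n F" "n > 0" "F ~= 0"
 shows "infinite {q. vanishes_at F q}"
proof -
 obtain v where v: "ev id F v ~= 0" using exists_ev_nonzero F by blast
 then have "v ~= 0" using idc.ev_homogeneous_0[OF F(1) F(2)] by auto
 then obtain A A' :: "complex ^ 3 ^ 3" where A: "A ** A' = mat 1" "A' ** A = mat 1" "column 3 A = v"
  using exists_frame by blast
 let ?F = "frame A F"
 have hF: "homogeneous n ?F" by (rule homogeneous_frame[OF F(1)])
 have "ev id ?F (vec3 0 0 1) ~= 0" using v by (simp add: idc.ev_frame mv_e3 A)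
 then have deg: "degree ?F = n" and lc: "coeff ?F n = [:[:ev id ?F (vec3 0 0 1):]:]" "ev id ?F (vec3 0 0 1) ~= 0"
  using homogeneous_monic[OF hF refl] by auto
 have "\<exists>z. ev id ?F (vec3 1 y z) = 0" for y
 proof -
  let ?g = "%H. poly (map_poly (%q::complex poly. poly q 1) H) y"
  have co: "coeff (map_poly ?g ?F) n ~= 0" using lc by (simp add: coeff_map_poly map_poly_pCons)
  then have "degree (map_poly ?g ?F) > 0" using F(2) le_degree by fastforce
  then have "~ constant (poly (map_poly ?g ?F))" using constant_degree by (metis less_nat_zero_code)
  then obtain z where z: "poly (map_poly ?g ?F) z = 0" using fundamental_theorem_of_algebra by blast
  then show ?thesis by (intro exI[of _ z]) (simp add: ev_def subst3_def map_poly_id)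
 qed
 then obtain z where z: "!!y. ev id ?F (vec3 1 y (z y)) = 0" by metis
 define P where "P y = pt (mv id A (vec3 1 y (z y)))" for y
 have bk: "mv id A' (mv id A w) = w" for w by (simp add: mv_mv[OF cpx_hom_id] A mv_1[OF cpx_hom_id])
 have nz: "mv id A (vec3 1 y w) ~= 0" for y w
 proof
  assume "mv id A (vec3 1 y w) = 0"
  then have "mv id A' 0 = vec3 1 y w" using bk[of "vec3 1 y w"] by simp
  then show False by (simp add: mv_def vec_eq_iff forall_3)
 qed
 have "P y \<in> {q. vanishes_at F q}" for y
  using vanishes_at_pt[OF F(1) nz[of y "z y"]] z[of y] by (simp add: P_def idc.ev_frame)
 then have "range P \<subseteq> {q. vanishes_at F q}" by blast
 moreover have "inj P"
 proof
  fix x y assume "P x = P y"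
  then obtain c where c: "mv id A (vec3 1 y (z y)) = c *s mv id A (vec3 1 x (z x))"
   using pt_eq_iff[OF nz nz] unfolding P_def by blast
  then have "vec3 1 y (z y) = c *s vec3 1 x (z x)"
   using bk by (metis idc.mv_scale id_apply)
  then show "x = y" by (simp add: vec_eq_iff forall_3)
 qed
 ultimately show ?thesis using infinite_UNIV_char_0 finite_imageD finite_subset by metis
qed

lemma exists_two_points:
 assumes "infinite C" shows "\<exists>y\<in>C. y ~= x"
 using assms by (metis finite.emptyI finite.insertI finite_subset singletonI subsetI subset_insertI insertCI)

lemma vanishes_at_mult:
 assumes "homogeneous m G" "homogeneous k H"
 shows "vanishes_at (G * H) q \<longleftrightarrow> vanishes_at G q \<or> vanishes_at H q"
proof -
 obtain v where v: "v ~= 0" "q = pt v" by (rule pt_cases)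
 show ?thesis unfolding v(2) vanishes_at_pt[OF homogeneous_mult[OF assms] v(1)]
  vanishes_at_pt[OF assms(1) v(1)] vanishes_at_pt[OF assms(2) v(1)] by (simp add: idc.ev_mult)
qed

text \<open>The condition \<open>gen\<close> ranges over all polynomials, not only over forms, so
  \<open>xi\<close> is a generic point of the affine cone over the curve. Only ratios of forms of
  equal degree are independent of its scaling, and these make up \<open>K\<close>.\<close>

locale generic_point = cpx_hom emb for emb :: "complex => 'k::field" +
 fixes xi :: "'k ^ 3" and F :: cpoly3 and n :: nat
 assumes irr: "irred F" and hom: "homogeneous n F"
  and gen: "!!G. ev emb G xi = 0 \<longleftrightarrow> F dvd G"
begin

definition C :: "proj_plane set" where "C = {q. vanishes_at F q}"

definition K :: "'k set" where
 "K = {ev emb G xi / ev emb H xi |G H m. homogeneous m G & homogeneous m H & ev emb H xi ~= 0}"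

definition Ol :: "proj_plane => 'k set" where
 "Ol q = {ev emb G xi / ev emb H xi |G H m. homogeneous m G & homogeneous m H & ~ vanishes_at H q}"

definition mOl :: "proj_plane => 'k set" where
 "mOl q = {ev emb G xi / ev emb H xi |G H m. homogeneous m G & homogeneous m H & ~ vanishes_at H q & vanishes_at G q}"

text \<open>The ring of the normalization over q. It need not be local: its maximal ideals are the
  points of the normalization above q.\<close>

definition Rn :: "proj_plane => 'k set" where
 "Rn q = {u \<in> K. integral (Ol q) u}"

lemma n_pos: "n > 0" using irreducible_degree_pos[OF irr hom] .

lemma F_nz: "F ~= 0" using irr by auto

lemma infinite_C: "infinite C" unfolding C_def using infinite_curve[OF hom n_pos F_nz] .

lemma C_iff: "homogeneous m G ==> (\<forall>q\<in>C. vanishes_at G q) \<longleftrightarrow> ev emb G xi = 0"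
 unfolding C_def gen using vanishing_iff_dvd[OF irr hom] .

lemma nonvanishing: "q \<in> C ==> homogeneous m H ==> ~ vanishes_at H q ==> ev emb H xi ~= 0"
 using C_iff by blast

lemma emb_eq_0: "emb c = 0 \<longleftrightarrow> c = 0"
proof
 assume "emb c = 0"
 then have "ev emb (cst c) xi = 0" by simp
 then have "F dvd cst c" using gen by blast
 show "c = 0"
 proof (rule ccontr)
  assume "c ~= 0"
  then have "is_unit (cst c)" using is_unit_cpoly3 by blast
  then have "is_unit F" using \<open>F dvd cst c\<close> dvd_trans by blast
  then show False using irr Factorial_Ring.irreducible_not_unit by blast
 qed
qed simp

lemma emb_inverse: "emb (inverse c) = inverse (emb c)"
proof (cases "c = 0")
 case False
 have "emb c * emb (inverse c) = 1" using False by (simp flip: mult add: one)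
 then show ?thesis by (metis inverse_unique)
qed simp

lemma fraction_diff:
 assumes "homogeneous m G" "homogeneous m H" "homogeneous k G'" "homogeneous k H'" "ev emb H xi ~= 0" "ev emb H' xi ~= 0"
 shows "homogeneous (m + k) (G * H' - G' * H)" "homogeneous (m + k) (H * H')"
  "ev emb G xi / ev emb H xi - ev emb G' xi / ev emb H' xi = ev emb (G * H' - G' * H) xi / ev emb (H * H') xi"
proof -
 show "homogeneous (m + k) (G * H' - G' * H)"
  using homogeneous_mult[OF assms(1,4)] homogeneous_mult[OF assms(3,2)]
  by (intro homogeneous_diff) (auto simp: add.commute)
 show "homogeneous (m + k) (H * H')" by (rule homogeneous_mult[OF assms(2,4)])
qed (use assms in \<open>simp add: ev_simps field_simps\<close>)

lemma K_intro: "homogeneous m G ==> homogeneous m H ==> ev emb H xi ~= 0 ==> ev emb G xi / ev emb H xi \<in> K"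
 unfolding K_def by blast

lemma K_subring: "is_subring K"
 unfolding is_subring_def
proof (intro conjI ballI)
 show "1 \<in> K" using K_intro[of 0 1 1] by simp
 fix x y assume "x \<in> K" "y \<in> K"
 then obtain G H m G' H' k where *: "homogeneous m G" "homogeneous m H" "homogeneous k G'" "homogeneous k H'"
   "ev emb H xi ~= 0" "ev emb H' xi ~= 0" "x = ev emb G xi / ev emb H xi" "y = ev emb G' xi / ev emb H' xi"
  unfolding K_def by blast
 have nz: "ev emb (H * H') xi ~= 0" using * by (simp add: ev_simps)
 show "x - y \<in> K" unfolding *(7,8) fraction_diff(3)[OF *(1-6)]
  by (rule K_intro[OF fraction_diff(1,2)[OF *(1-6)] nz])
 have "x * y = ev emb (G * G') xi / ev emb (H * H') xi" using * by (simp add: ev_simps)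
 then show "x * y \<in> K" using K_intro[OF homogeneous_mult[OF *(1,3)] homogeneous_mult[OF *(2,4)] nz] by simp
qed

lemma K_inverse: "x \<in> K ==> inverse x \<in> K"
proof (cases "x = 0")
 case False
 assume "x \<in> K"
 then obtain G H m where *: "homogeneous m G" "homogeneous m H" "ev emb H xi ~= 0" "x = ev emb G xi / ev emb H xi"
  unfolding K_def by blast
 then show ?thesis using K_intro[of m H G] False by (auto simp: inverse_eq_divide)
qed simp

lemma K_divide: "x \<in> K ==> y \<in> K ==> x / y \<in> K"
 using K_inverse subring_closed[OF K_subring] by (simp add: field_class.field_divide_inverse)

lemma K_emb: "emb c \<in> K"
 using K_intro[of 0 "cst c" 1] by simp

lemma O_K: "q \<in> C ==> Ol q \<subseteq> K"
 unfolding Ol_def using nonvanishing K_intro by blast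

lemma vanishes_diff:
 assumes "homogeneous m G" "homogeneous m H" "vanishes_at G q" "vanishes_at H q"
 shows "vanishes_at (G - H) q"
 using assms(3,4) by (simp add: vanishes_at_def idc.subst3_diff)

lemma O_intro: "homogeneous m G ==> homogeneous m H ==> ~ vanishes_at H q ==> ev emb G xi / ev emb H xi \<in> Ol q"
 unfolding Ol_def by blast

lemma mO_intro: "homogeneous m G ==> homogeneous m H ==> ~ vanishes_at H q ==> vanishes_at G q ==> ev emb G xi / ev emb H xi \<in> mOl q"
 unfolding mOl_def by blast

lemma not_vanishes_cst: "c ~= 0 ==> ~ vanishes_at (cst c) q"
proof -
 assume "c ~= 0"
 obtain v where v: "v ~= 0" "q = pt v" by (rule pt_cases)
 show ?thesis unfolding v(2) vanishes_at_pt[OF homogeneous_cst v(1)] using \<open>c ~= 0\<close> by simp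
qed

lemma O_emb: "emb c \<in> Ol q"
 using O_intro[of 0 "cst c" "cst 1" q] not_vanishes_cst[of 1 q] by (simp add: one)

context
 fixes q assumes q: "q \<in> C"
begin

lemma O_subring: "is_subring (Ol q)"
 unfolding is_subring_def
proof (intro conjI ballI)
 show "1 \<in> Ol q" using O_emb[of 1] by (simp add: one)
 fix x y assume "x \<in> Ol q" "y \<in> Ol q"
 then obtain G H m G' H' k where *: "homogeneous m G" "homogeneous m H" "homogeneous k G'" "homogeneous k H'"
   "~ vanishes_at H q" "~ vanishes_at H' q" "x = ev emb G xi / ev emb H xi" "y = ev emb G' xi / ev emb H' xi"
  unfolding Ol_def by blast
 have nz: "ev emb H xi ~= 0" "ev emb H' xi ~= 0" using * nonvanishing q by blast+
 have nv: "~ vanishes_at (H * H') q" using * vanishes_at_mult by blast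
 show "x - y \<in> Ol q" unfolding *(7,8) fraction_diff(3)[OF *(1-4) nz]
  by (rule O_intro[OF fraction_diff(1,2)[OF *(1-4) nz] nv])
 have "x * y = ev emb (G * G') xi / ev emb (H * H') xi" using * by (simp add: ev_simps)
 then show "x * y \<in> Ol q" using O_intro[OF homogeneous_mult[OF *(1,3)] homogeneous_mult[OF *(2,4)] nv] by simp
qed

lemma mO_subset: "mOl q \<subseteq> Ol q" unfolding mOl_def Ol_def by blast

lemma mO_mult: "x \<in> mOl q ==> y \<in> Ol q ==> x * y \<in> mOl q"
proof -
 assume "x \<in> mOl q" "y \<in> Ol q"
 then obtain G H m G' H' k where *: "homogeneous m G" "homogeneous m H" "homogeneous k G'" "homogeneous k H'"
   "~ vanishes_at H q" "~ vanishes_at H' q" "x = ev emb G xi / ev emb H xi" "y = ev emb G' xi / ev emb H' xi" "vanishes_at G q"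
  unfolding Ol_def mOl_def by blast
 have nv: "~ vanishes_at (H * H') q" "vanishes_at (G * G') q" using * vanishes_at_mult by blast+
 have "x * y = ev emb (G * G') xi / ev emb (H * H') xi" using * by (simp add: ev_simps)
 then show ?thesis using mO_intro[OF homogeneous_mult[OF *(1,3)] homogeneous_mult[OF *(2,4)] nv] by simp
qed

lemma mO_diff: "x \<in> mOl q ==> y \<in> mOl q ==> x - y \<in> mOl q"
proof -
 assume "x \<in> mOl q" "y \<in> mOl q"
 then obtain G H m G' H' k where *: "homogeneous m G" "homogeneous m H" "homogeneous k G'" "homogeneous k H'"
   "~ vanishes_at H q" "~ vanishes_at H' q" "x = ev emb G xi / ev emb H xi" "y = ev emb G' xi / ev emb H' xi"
   "vanishes_at G q" "vanishes_at G' q"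
  unfolding mOl_def by blast
 have nz: "ev emb H xi ~= 0" "ev emb H' xi ~= 0" using * nonvanishing q by blast+
 have nv: "~ vanishes_at (H * H') q" using * vanishes_at_mult by blast
 have "homogeneous (m + k) (G * H')" "homogeneous (m + k) (G' * H)"
  using homogeneous_mult[OF *(1,4)] homogeneous_mult[OF *(3,2)] by (auto simp: add.commute)
 then have v: "vanishes_at (G * H' - G' * H) q" using * vanishes_at_mult by (blast intro: vanishes_diff)
 show "x - y \<in> mOl q" unfolding *(7,8) fraction_diff(3)[OF *(1-4) nz]
  by (rule mO_intro[OF fraction_diff(1,2)[OF *(1-4) nz] nv v])
qed

lemma mO_1: "1 \<notin> mOl q"
proof
 assume "1 \<in> mOl q"
 then obtain G H m where *: "homogeneous m G" "homogeneous m H" "~ vanishes_at H q" "vanishes_at G q" "ev emb G xi / ev emb H xi = 1"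
  unfolding mOl_def by auto
 then have "ev emb (G - H) xi = 0" using nonvanishing[OF q *(2,3)] by (simp add: ev_simps)
 then have "vanishes_at (G - H) q" using q C_iff[OF homogeneous_diff[OF *(1,2)]] by blast
 then have "vanishes_at (G - (G - H)) q" using * vanishes_diff homogeneous_diff by blast
 then show False using * by simp
qed

lemma O_unit: "x \<in> Ol q ==> x \<notin> mOl q ==> x ~= 0 & inverse x \<in> Ol q"
proof -
 assume "x \<in> Ol q" "x \<notin> mOl q"
 then obtain G H m where *: "homogeneous m G" "homogeneous m H" "~ vanishes_at H q" "~ vanishes_at G q" "x = ev emb G xi / ev emb H xi"
  unfolding mOl_def Ol_def by blast
 then show ?thesis using O_intro[OF *(2,1,4)] nonvanishing[OF q *(1,4)] nonvanishing[OF q *(2,3)] by (auto simp: inverse_eq_divide)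
qed

lemma Rn_subring: "is_subring (Rn q)"
 using K_subring integral_subring[OF O_subring] unfolding Rn_def is_subring_def by auto

lemma O_Rn: "Ol q \<subseteq> Rn q" using O_K[OF q] integral_base[OF O_subring] by (auto simp: Rn_def)

lemma Rn_closed: "u \<in> K ==> integral (Rn q) u ==> u \<in> Rn q"
 using integral_trans[OF O_subring Rn_subring] by (auto simp: Rn_def)

end

end

section \<open>Transcendence degree one: K is algebraic over C(t) for every nonconstant t\<close>

definition ratfield :: "(complex => 'k::field) => 'k => 'k set" where
 "ratfield emb t = {poly (map_poly emb p) t / poly (map_poly emb q) t |p q. poly (map_poly emb q) t ~= 0}"

definition eval2 :: "(complex => 'k::field) => 'k => complex poly poly => 'k poly" where
 "eval2 emb t P = map_poly (%a. poly (map_poly emb a) t) P"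

lemma shift_out_0:
 fixes p :: "'a::idom poly"
 assumes "p ~= 0"
 shows "\<exists>k q. p = monom 1 k * q & coeff q 0 ~= 0"
 using assms
proof (induction "degree p" arbitrary: p rule: less_induct)
 case less
 show ?case
 proof (cases "coeff p 0 = 0")
  case False then show ?thesis by (intro exI[of _ 0] exI[of _ p]) simp
 next
  case True
  then have "poly p 0 = 0" by (simp add: poly_0_coeff_0)
  then have "[:-0, 1:] dvd p" unfolding poly_eq_0_iff_dvd by simp
  then obtain r where r: "p = [:0, 1:] * r" by (auto elim: dvdE)
  then have "r ~= 0" using less(2) by auto
  then have "degree r < degree p" using r by (simp add: degree_mult_eq del: mult_pCons_left)
  then obtain k q where "r = monom 1 k * q" "coeff q 0 ~= 0" using less(1)[OF _ \<open>r ~= 0\<close>] by blast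
  then show ?thesis using r by (intro exI[of _ "Suc k"] exI[of _ q]) (simp add: monom_Suc)
 qed
qed

lemma integral_field_root:
 fixes A :: "'k::field set"
 assumes A: "is_subring A" "!!x. x \<in> A ==> inverse x \<in> A"
  and p: "p ~= 0" "coeffs_in A p" "poly p u = 0"
 shows "integral A u"
 unfolding integral_iff[OF A(1)]
proof (intro allI impI)
 fix V assume V: "valuation_ring V & A \<subseteq> V"
 have "lead_coeff p * u \<in> V" using valuation_ring_root[of V p u] V p by (auto simp: coeffs_in_def)
 moreover have "inverse (lead_coeff p) \<in> V" using A(2) p(2) V by (auto simp: coeffs_in_def)
 ultimately have "inverse (lead_coeff p) * (lead_coeff p * u) \<in> V"
  using V subring_closed(6)[OF valuation_ring_subring] by blast
 moreover have "inverse (lead_coeff p) * (lead_coeff p * u) = u" using p(1) by (simp flip: mult.assoc)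
 ultimately show "u \<in> V" by simp
qed

text \<open>A power of the variable is split off from the equation of h. The reversed polynomial of
  what remains is a nonzero equation for 1/h.\<close>

lemma integral_field_inverse:
 fixes A :: "'k::field set"
 assumes A: "is_subring A" "!!x. x \<in> A ==> inverse x \<in> A" and h: "integral A h"
 shows "integral A (inverse h)"
proof (cases "h = 0")
 case False
 obtain p where p: "lead_coeff p = 1" "coeffs_in A p" "poly p h = 0" using h by (auto simp: integral_def)
 then have "p ~= 0" by auto
 then obtain k q where q: "p = monom 1 k * q" "coeff q 0 ~= 0" using shift_out_0 by blast
 have "coeff q i = coeff p (i + k)" for i using q(1) by (simp add: coeff_monom_mult)
 then have qA: "coeffs_in A q" using p(2) by (simp add: coeffs_in_def)
 have "poly q h = 0" using p(3) q(1) False by (simp add: poly_monom)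
 then have "poly (reflect_poly q) (inverse h) = 0" using False by (simp add: poly_reflect_poly_nz)
 moreover have "coeffs_in A (reflect_poly q)" using qA A(1)
  by (auto simp: coeffs_in_def coeff_reflect_poly subring_closed)
 moreover have "reflect_poly q ~= 0" using q(2) by auto
 ultimately show ?thesis using integral_field_root[OF A] by blast
qed (use integral_base[OF A(1)] subring_closed[OF A(1)] in auto)

context generic_point
begin

abbreviation "evp p t \<equiv> poly (map_poly emb p) t"

lemma evp_hom: "comm_hom (%p. evp p t)" by (rule comm_hom_eval)

lemma evp_simps: "evp (p + q) t = evp p t + evp q t" "evp (p * q) t = evp p t * evp q t" "evp (p - q) t = evp p t - evp q t"
 "evp 1 t = 1" "evp 0 t = 0" "evp [:c:] t = emb c" "evp [:0, 1:] t = t" "evp (pCons c p) t = emb c + t * evp p t"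
 using comm_hom.add[OF evp_hom] comm_hom.mult[OF evp_hom] comm_hom.diff[OF evp_hom]
 by (auto simp: map_poly_pCons one one_pCons)

text \<open>Over the algebraically closed constants p splits into linear factors, and t - c is
  nonzero for every constant c.\<close>

lemma transcendental:
 assumes t: "t \<notin> range emb" and p: "p ~= 0" shows "evp p t ~= 0"
 using p
proof (induction "degree p" arbitrary: p rule: less_induct)
 case less
 show ?case
 proof (cases "degree p = 0")
  case True then obtain c where "p = [:c:]" by (metis degree_eq_zeroE)
  then show ?thesis using less by (simp add: evp_simps emb_eq_0)
 next
  case False
  then obtain a where "poly p a = 0" using fundamental_theorem_of_algebra constant_degree by metis
  then obtain r where r: "p = [:- a, 1:] * r" unfolding poly_eq_0_iff_dvd by (auto elim: dvdE)
  then have "r ~= 0" using less by auto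
  then have "degree r < degree p" using r by (simp add: degree_mult_eq del: mult_pCons_left)
  then have "evp r t ~= 0" using less \<open>r ~= 0\<close> by blast
  moreover have "evp p t = (t - emb a) * evp r t"
   unfolding r evp_simps(2) by (simp add: map_poly_pCons uminus one)
  ultimately show ?thesis using t by auto
 qed
qed

lemma evp_subring: "is_subring A ==> range emb \<subseteq> A ==> t \<in> A ==> evp p t \<in> A"
 by (rule poly_in_subring) (auto simp: coeffs_in_def coeff_map_poly)

lemma ratfield_subring: "is_subring (ratfield emb t)"
 unfolding is_subring_def
proof (intro conjI ballI)
 show "1 \<in> ratfield emb t" unfolding ratfield_def mem_Collect_eq
  by (rule exI[of _ 1], rule exI[of _ 1]) (simp add: one)
 fix x y assume "x \<in> ratfield emb t" "y \<in> ratfield emb t"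
 then obtain p q r s where *: "x = evp p t / evp q t" "y = evp r t / evp s t" "evp q t ~= 0" "evp s t ~= 0"
  unfolding ratfield_def by blast
 show "x - y \<in> ratfield emb t" unfolding ratfield_def mem_Collect_eq
  unfolding *(1,2)
  by (rule exI[of _ "p * s - r * q"], rule exI[of _ "q * s"]) (use * in \<open>simp add: evp_simps(2,3) diff_frac_eq\<close>)
 show "x * y \<in> ratfield emb t" unfolding ratfield_def mem_Collect_eq
  unfolding *(1,2)
  by (rule exI[of _ "p * r"], rule exI[of _ "q * s"]) (use *(3,4) in \<open>simp add: evp_simps(2)\<close>)
qed

lemma ratfield_inverse: "x \<in> ratfield emb t ==> inverse x \<in> ratfield emb t"
proof -
 assume "x \<in> ratfield emb t"
 then obtain p q where *: "x = evp p t / evp q t" "evp q t ~= 0" unfolding ratfield_def by blast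
 show ?thesis
 proof (cases "evp p t = 0")
  case True then show ?thesis using * subring_closed[OF ratfield_subring] by simp
 next
  case False then show ?thesis using * unfolding ratfield_def mem_Collect_eq
   by - (rule exI[of _ q], rule exI[of _ p], simp)
 qed
qed

lemma ratfield_evp: "evp p t \<in> ratfield emb t"
 unfolding ratfield_def mem_Collect_eq by (rule exI[of _ p], rule exI[of _ 1]) (simp add: evp_simps)

lemma ratfield_gen: "t \<in> ratfield emb t" using ratfield_evp[of "[:0, 1:]" t] unfolding evp_simps(7) .

lemma ratfield_emb: "emb c \<in> ratfield emb t" using ratfield_evp[of "[:c:]" t] unfolding evp_simps(6) .

lemma ratfield_poly_clear:
 assumes t: "t \<notin> range emb" and p: "coeffs_in (ratfield emb t) p"
 shows "\<exists>P d. d ~= 0 & eval2 emb t P = smult (evp d t) p"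
 using p
proof (induction p)
 case 0 then show ?case by (intro exI[of _ 0] exI[of _ 1]) (simp add: eval2_def)
next
 case (pCons c p)
 have "coeff (pCons c p) 0 \<in> ratfield emb t" "!!i. coeff (pCons c p) (Suc i) \<in> ratfield emb t"
  using pCons(3) unfolding coeffs_in_def by blast+
 then have c: "c \<in> ratfield emb t" and "coeffs_in (ratfield emb t) p" by (auto simp: coeffs_in_def)
 then obtain P d where Pd: "d ~= 0" "eval2 emb t P = smult (evp d t) p" using pCons by blast
 obtain a b where ab: "c = evp a t / evp b t" "evp b t ~= 0" using c unfolding ratfield_def by blast
 have "b ~= 0" using ab(2) by auto
 interpret g: comm_hom "%p. evp p t" by (rule evp_hom)
 have "eval2 emb t (pCons (a * d) (smult b P)) = smult (evp (b * d) t) (pCons c p)"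
  using Pd ab by (simp add: eval2_def map_poly_pCons g.map_poly_smult' g.mult mult_ac)
 then show ?case using Pd(1) \<open>b ~= 0\<close> by (intro exI[of _ "pCons (a * d) (smult b P)"] exI[of _ "b * d"]) auto
qed

lemma coeff_eval2: "coeff (eval2 emb t P) i = evp (coeff P i) t"
 by (simp add: eval2_def coeff_map_poly)

lemma eval2_eq_0: "t \<notin> range emb ==> eval2 emb t P = 0 \<longleftrightarrow> P = 0"
proof -
 assume t: "t \<notin> range emb"
 have "evp p t = 0 \<longleftrightarrow> p = 0" for p using transcendental[OF t] evp_simps(5) by metis
 then show ?thesis unfolding poly_eq_iff[of "eval2 emb t P" 0] poly_eq_iff[of P 0] coeff_eval2 by simp
qed

lemma ratfield_relation:
 assumes t: "t \<notin> range emb" and u: "integral (ratfield emb t) u"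
 shows "\<exists>P. P ~= 0 & poly (eval2 emb t P) u = 0"
proof -
 obtain p where p: "lead_coeff p = 1" "coeffs_in (ratfield emb t) p" "poly p u = 0" using u by (auto simp: integral_def)
 obtain P d where Pd: "d ~= 0" "eval2 emb t P = smult (evp d t) p" using ratfield_poly_clear[OF t p(2)] by blast
 have "p ~= 0" using p by auto
 then have "P ~= 0" using Pd transcendental[OF t Pd(1)] eval2_eq_0[OF t] by (metis smult_eq_0_iff)
 then show ?thesis using Pd p(3) by (intro exI[of _ P]) simp
qed

text \<open>The parameter is x/y in a frame whose third base point is off the curve. There F is
  monic in z up to a constant, so z/y is algebraic over C(x/y), and every ratio of forms is a
  rational expression in x/y and z/y.\<close>

lemma base_parameter:
 "\<exists>t. t \<in> K & t \<notin> range emb & (\<forall>u\<in>K. integral (ratfield emb t) u)"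
proof -
 obtain v where v: "ev id F v ~= 0" using exists_ev_nonzero F_nz by blast
 then have "v ~= 0" using idc.ev_homogeneous_0[OF hom n_pos] by auto
 then obtain A A' :: "complex ^ 3 ^ 3" where A: "A ** A' = mat 1" "A' ** A = mat 1" "column 3 A = v"
  using exists_frame by blast
 let ?F = "frame A F"
 have hF: "homogeneous n ?F" by (rule homogeneous_frame[OF hom])
 have e0: "ev id ?F (vec3 0 0 1) ~= 0" using v by (simp add: idc.ev_frame mv_e3 A)
 then have deg: "degree ?F = n" and lc: "coeff ?F n = [:[:ev id ?F (vec3 0 0 1):]:]"
  using homogeneous_monic[OF hF refl] by auto
 define \<eta> where "\<eta> = mv emb A' xi"
 have xi: "xi = mv emb A \<eta>" unfolding \<eta>_def by (simp add: mv_mv[OF cpx_hom_axioms] A mv_1[OF cpx_hom_axioms])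
 have evf: "ev emb G xi = ev emb (frame A G) \<eta>" for G by (simp add: ev_frame xi)
 have gen': "ev emb H \<eta> = 0 \<longleftrightarrow> ?F dvd H" for H
 proof -
  have "H = frame A (frame A' H)" by (simp add: frame_frame A frame_mat_1)
  then show ?thesis using evf[of "frame A' H"] gen frame_dvd_iff[OF A(1,2)] by metis
 qed
 have nd: "~ ?F dvd [:H:]" if "H ~= 0" for H
  using dvd_imp_degree_le[of ?F "[:H:]"] deg n_pos that by auto
 have e2: "\<eta> $ 2 ~= 0" using gen'[of vy] nd[of "[:0, 1:]"] by (simp add: )
 define t where "t = \<eta> $ 1 / \<eta> $ 2"
 define w where "w = \<eta> $ 3 / \<eta> $ 2"
 have tK: "t \<in> K"
 proof -
  have "ev emb (frame A' vx) xi = \<eta> $ 1" "ev emb (frame A' vy) xi = \<eta> $ 2"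
   by (simp_all add: evf frame_frame A frame_mat_1)
  moreover have "homogeneous 1 (frame A' vx)" "homogeneous 1 (frame A' vy)" by (intro homogeneous_frame homogeneous_vx homogeneous_vy)+
  ultimately show ?thesis using K_intro e2 unfolding t_def by metis
 qed
 have tn: "t \<notin> range emb"
 proof
  assume "t \<in> range emb"
  then obtain c where "\<eta> $ 1 = emb c * \<eta> $ 2" using e2 by (auto simp: t_def field_simps)
  then have "ev emb (vx - cst c * vy) \<eta> = 0" by (simp only: ev_simps ev_cst ev_vx ev_vy) simp
  then have "?F dvd vx - cst c * vy" using gen' by blast
  moreover have "vx - cst c * vy = [:[:[:0, 1:]:] - [:[:c:]:] * [:0, 1:]:]" by simp
  moreover have "[:[:0, 1:]:] - [:[:c:]:] * [:0, 1:] ~= (0 :: complex poly poly)" by simp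
  ultimately show False using nd by metis
 qed
 have scale: "ev emb H \<eta> = (\<eta> $ 2) ^ m * ev emb H (vec3 t 1 w)" if "homogeneous m H" for H m
 proof -
  have "\<eta> = \<eta> $ 2 *s vec3 t 1 w" using e2 by (simp add: vec_eq_iff forall_3 t_def w_def)
  then show ?thesis using ev_scale[OF that] by metis
 qed
 let ?g = "%H. poly (map_poly (%q. evp q t) H) 1"
 have ev': "ev emb H (vec3 t 1 w) = poly (map_poly ?g H) w" for H by (simp add: ev_def subst3_def)
 have g_in: "?g H \<in> ratfield emb t" for H
  using subring_closed[OF ratfield_subring]
  by (intro poly_in_subring[OF ratfield_subring]) (auto simp: coeffs_in_def coeff_map_poly ratfield_evp)
 have sub: "is_subring {x. integral (ratfield emb t) x}" by (rule integral_subring[OF ratfield_subring])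
 have w: "integral (ratfield emb t) w"
 proof (rule integral_field_root[OF ratfield_subring ratfield_inverse])
  show "coeffs_in (ratfield emb t) (map_poly ?g ?F)" by (simp add: coeffs_in_def coeff_map_poly g_in)
  have "coeff (map_poly ?g ?F) n ~= 0" using lc e0 by (simp add: coeff_map_poly map_poly_pCons emb_eq_0)
  then show "map_poly ?g ?F ~= 0" by (metis coeff_0)
  have "ev emb ?F \<eta> = 0" using gen' by simp
  then show "poly (map_poly ?g ?F) w = 0" using scale[OF hF] e2 by (simp add: ev')
 qed
 have evI: "integral (ratfield emb t) (ev emb H (vec3 t 1 w))" for H
  unfolding ev' using poly_in_subring[OF sub, of "map_poly ?g H" w] w g_in integral_base[OF ratfield_subring]
  by (auto simp: coeffs_in_def coeff_map_poly)
 have "integral (ratfield emb t) u" if "u \<in> K" for u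
 proof -
  from that obtain G H m where *: "homogeneous m G" "homogeneous m H" "ev emb H xi ~= 0" "u = ev emb G xi / ev emb H xi"
   unfolding K_def by blast
  have "u = ev emb (frame A G) (vec3 t 1 w) * inverse (ev emb (frame A H) (vec3 t 1 w))"
   using * scale[OF homogeneous_frame[OF *(1)]] scale[OF homogeneous_frame[OF *(2)]] e2
   by (simp add: evf field_simps)
  then show ?thesis using evI integral_field_inverse[OF ratfield_subring ratfield_inverse evI]
    subring_mult[OF sub] by auto
 qed
 then show ?thesis using tK tn by blast
qed

text \<open>Exchange of parameters. K is algebraic over C(s) for one particular s. The relation
  between s and t, read as an equation of s, stays nonzero because t is transcendental, so s and
  with it all of K is algebraic over C(t).\<close>

lemma integral_ratfield:
 assumes t: "t \<in> K" "t \<notin> range emb" and u: "u \<in> K"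
 shows "integral (ratfield emb t) u"
proof -
 obtain s where s: "s \<in> K" "s \<notin> range emb" "!!u. u \<in> K ==> integral (ratfield emb s) u"
  using base_parameter by blast
 obtain P where P: "P ~= 0" "poly (eval2 emb s P) t = 0" using ratfield_relation[OF s(2) s(3)[OF t(1)]] by blast
 \<comment> \<open>The relation P(s,t) = 0, rearranged as a polynomial in s with coefficients in
   C[t].\<close>
 define q where "q = (\<Sum>k\<le>degree P. smult (t ^ k) (map_poly emb (coeff P k)))"
 have sI: "integral (ratfield emb t) s"
 proof (rule integral_field_root[OF ratfield_subring ratfield_inverse])
  have "degree (eval2 emb s P) \<le> degree P" by (intro degree_le) (auto simp: coeff_eval2 coeff_eq_0)
  then have "poly (eval2 emb s P) t = (\<Sum>k\<le>degree P. coeff (eval2 emb s P) k * t ^ k)"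
   unfolding poly_altdef[of "eval2 emb s P" t] by (intro sum.mono_neutral_left) (auto simp: coeff_eq_0)
  then have "poly (eval2 emb s P) t = (\<Sum>k\<le>degree P. evp (coeff P k) s * t ^ k)"
   unfolding coeff_eval2 .
  then show "poly q s = 0" using P(2) by (simp add: q_def poly_sum mult.commute)
  have cq: "coeff q i = evp (\<Sum>k\<le>degree P. monom (coeff (coeff P k) i) k) t" for i
   unfolding comm_hom.sum[OF evp_hom]
   by (simp add: q_def coeff_sum coeff_map_poly map_poly_monom poly_monom mult.commute)
  show "coeffs_in (ratfield emb t) q" unfolding coeffs_in_def cq by (simp add: ratfield_evp)
  obtain i where i: "coeff (coeff P (degree P)) i ~= 0" using P(1) by (metis leading_coeff_0_iff)
  have "coeff (\<Sum>k\<le>degree P. monom (coeff (coeff P k) i) k) (degree P) ~= 0"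
   using i by (simp add: coeff_sum coeff_monom if_distrib cong: if_cong)
  then have "coeff q i ~= 0" unfolding cq using transcendental[OF t(2)] by (metis coeff_0)
  then show "q ~= 0" by (metis coeff_0)
 qed
 have sub: "is_subring {x. integral (ratfield emb t) x}" by (rule integral_subring[OF ratfield_subring])
 have "integral (ratfield emb t) x" if "x \<in> ratfield emb s" for x
 proof -
  from that obtain p q where *: "x = evp p s / evp q s" unfolding ratfield_def by blast
  have "integral (ratfield emb t) (evp p s)" for p
   using evp_subring[OF sub, of s p] sI ratfield_emb integral_base[OF ratfield_subring] by blast
  then show ?thesis using subring_mult[OF sub, of "evp p s" "inverse (evp q s)"]
   integral_field_inverse[OF ratfield_subring ratfield_inverse] by (simp add: * field_class.field_divide_inverse)
 qed
 then show ?thesis using integral_trans[OF ratfield_subring ratfield_subring _ s(3)[OF u]] by blast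
qed

lemma algebraic_relation:
 assumes t: "t \<in> K" "t \<notin> range emb" and u: "u \<in> K"
 obtains P where "P ~= 0" "poly (eval2 emb t P) u = 0"
 using ratfield_relation[OF t(2) integral_ratfield[OF t u]] by blast

section \<open>Places and their centres on the curve\<close>

definition place :: "'k set => bool" where
 "place V \<longleftrightarrow> valuation_ring V & range emb \<subseteq> V & (\<exists>u\<in>K. u \<notin> V)"

lemma not_integral_emb: "u \<notin> range emb ==> ~ integral (range emb) u"
proof
 assume u: "u \<notin> range emb" and i: "integral (range emb) u"
 then obtain p where p: "lead_coeff p = 1" "coeffs_in (range emb) p" "poly p u = 0" by (auto simp: integral_def)
 have "\<forall>i. \<exists>c. coeff p i = emb c" using p(2) by (auto simp: coeffs_in_def)
 then obtain f where f: "!!i. coeff p i = emb (f i)" by metis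
 have f0: "f i = 0" if "i > degree p" for i
  using f[of i] that emb_eq_0 by (simp add: coeff_eq_0)
 define q where "q = (\<Sum>i\<le>degree p. monom (f i) i)"
 have "coeff q i = f i" for i using f0 by (auto simp: q_def coeff_sum coeff_monom if_distrib cong: if_cong)
 then have pq: "p = map_poly emb q" by (intro poly_eqI) (simp add: coeff_map_poly f)
 then have "q ~= 0" using p(1) by auto
 then show False using transcendental[OF u] p(3) pq by blast
qed

lemma emb_subring: "is_subring (range emb)"
 by (auto simp: is_subring_def simp flip: one diff mult)

lemma exists_place_excluding:
 assumes "u \<in> K" "u \<notin> range emb" shows "\<exists>V. place V & u \<notin> V"
 using not_integral_emb[OF assms(2)] integral_iff[OF emb_subring] assms unfolding place_def by blast

context
 fixes V :: "'k set" assumes V: "place V"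
begin

lemma place_valuation: "valuation_ring V" and place_emb: "emb c \<in> V"
 using V by (auto simp: place_def)

lemmas place_subring = valuation_ring_subring[OF place_valuation]

lemma emb_nonunit: "emb c \<in> nonunits V \<longleftrightarrow> c = 0"
 using place_emb[of "inverse c"] place_emb[of c] by (auto simp: nonunits_def emb_eq_0 emb_inverse)

text \<open>The residue field is C. If f - c were a unit of V for every constant c, then every
  nonzero polynomial in f would be a unit and V would contain C(f). As K is algebraic over C(f) and
  valuation rings are integrally closed, V would contain K.\<close>

lemma place_residue:
 assumes f: "f \<in> K" "f \<in> V" shows "\<exists>c. f - emb c \<in> nonunits V"
proof (rule ccontr)
 assume *: "\<nexists>c. f - emb c \<in> nonunits V"
 have fn: "f \<notin> range emb"
 proof
  assume "f \<in> range emb" then obtain c where "f - emb c = 0" by auto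
  then show False using * nonunits_0[OF place_valuation] by metis
 qed
 have inv: "inverse (evp p f) \<in> V" if "p ~= 0" for p
  using that
 proof (induction "degree p" arbitrary: p rule: less_induct)
  case less
  show ?case
  proof (cases "degree p = 0")
   case True then obtain c where "p = [:c:]" by (metis degree_eq_zeroE)
   then show ?thesis using place_emb[of "inverse c"] by (simp add: evp_simps emb_inverse)
  next
   case False
   then obtain a where "poly p a = 0" using fundamental_theorem_of_algebra constant_degree by metis
   then obtain r where r: "p = [:- a, 1:] * r" unfolding poly_eq_0_iff_dvd by (auto elim: dvdE)
   then have "r ~= 0" using less by auto
   then have "degree r < degree p" using r by (simp add: degree_mult_eq del: mult_pCons_left)
   then have "inverse (evp r f) \<in> V" using less \<open>r ~= 0\<close> by blast
   moreover have "inverse (f - emb a) \<in> V"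
    using * f(2) place_emb[of a] not_nonunit[OF place_valuation, of "f - emb a"] subring_closed[OF place_subring] by blast
   moreover have "evp p f = (f - emb a) * evp r f"
    unfolding r evp_simps(2) by (simp add: map_poly_pCons uminus one)
   ultimately show ?thesis using subring_mult[OF place_subring] by auto
  qed
 qed
 have "ratfield emb f \<subseteq> V"
 proof
  fix x assume "x \<in> ratfield emb f"
  then obtain p q where x: "x = evp p f / evp q f" "evp q f ~= 0" unfolding ratfield_def by blast
  then have "q ~= 0" by auto
  then have "inverse (evp q f) \<in> V" by (rule inv)
  moreover have "evp p f \<in> V" using evp_subring[OF place_subring] f(2) V by (auto simp: place_def)
  ultimately show "x \<in> V" using x subring_mult[OF place_subring] by (simp add: field_class.field_divide_inverse)
 qed
 moreover obtain u where "u \<in> K" "u \<notin> V" using V by (auto simp: place_def)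
 ultimately show False using integral_ratfield[OF f(1) fn] integral_iff[OF ratfield_subring] place_valuation by blast
qed

lemma ev_congruence:
 fixes w :: "'k ^ 3" and v :: "complex ^ 3"
 assumes "!!i. w $ i - emb (v $ i) \<in> nonunits V"
 shows "ev emb G w - emb (ev id G v) \<in> nonunits V"
proof -
 have *: "x \<in> V" if "x - emb c \<in> nonunits V" for x c
  using subring_add[OF place_subring nonunits_subset[OF place_valuation that] place_emb[of c]] by simp
 have ia: "emb (a + b) = emb a + emb b" and im: "emb (a * b) = emb a * emb b" for a b by (rule add, rule mult)
 show ?thesis
 proof (induction G rule: cpoly3_induct)
  case (cst c) then show ?case unfolding ev_cst idc.ev_cst by (simp add: nonunits_0[OF place_valuation])
 next
  case (add G H)
  have "ev emb (G + H) w - emb (ev id (G + H) v) = (ev emb G w - emb (ev id G v)) + (ev emb H w - emb (ev id H v))"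
   unfolding ev_add idc.ev_add ia by simp
  then show ?case using add nonunits_add[OF place_valuation] by metis
 next
  case (mult G H)
  have "ev emb (G * H) w - emb (ev id (G * H) v) = (ev emb G w - emb (ev id G v)) * ev emb H w + (ev emb H w - emb (ev id H v)) * emb (ev id G v)"
   unfolding ev_mult idc.ev_mult im by (simp add: algebra_simps)
  then show ?case using mult *[OF mult(2)] place_emb nonunits_add[OF place_valuation] nonunits_mult[OF place_valuation] by metis
 next
  case vx then show ?case unfolding ev_vx idc.ev_vx by (rule assms)
 next
  case vy then show ?case unfolding ev_vy idc.ev_vy by (rule assms)
 next
  case vz then show ?case unfolding ev_vz idc.ev_vz by (rule assms)
 qed
qed

lemma xi_nonzero: "\<exists>i. xi $ i ~= 0"
proof (rule ccontr)
 assume "\<nexists>i. xi $ i ~= 0"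
 then have "xi = 0" by (simp add: vec_eq_iff)
 obtain v where v: "ev id F v ~= 0" using exists_ev_nonzero F_nz by blast
 obtain q where "q \<in> C" using infinite_C by fastforce
 obtain v where v: "v ~= 0" "q = pt v" by (rule pt_cases)
 have "ev emb vx xi = 0" "ev emb vy xi = 0" "ev emb vz xi = 0" using \<open>xi = 0\<close> by simp_all
 then have "vanishes_at vx q" "vanishes_at vy q" "vanishes_at vz q"
  using C_iff[OF homogeneous_vx] C_iff[OF homogeneous_vy] C_iff[OF homogeneous_vz] \<open>q \<in> C\<close> by blast+
 then show False unfolding v(2) using vanishes_at_pt[OF homogeneous_vx v(1)] vanishes_at_pt[OF homogeneous_vy v(1)]
   vanishes_at_pt[OF homogeneous_vz v(1)] v(1) by (auto simp: vec_eq_iff forall_3)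
qed

lemma xi_quotient_K: "xi $ j ~= 0 ==> xi $ i / xi $ j \<in> K"
proof -
 have "\<exists>G. homogeneous 1 G & ev emb G xi = xi $ i" for i :: 3
  using exhaust_3[of i]
  by (elim disjE; intro exI[of _ "if i = 1 then vx else if i = 2 then vy else vz"])
   (simp_all del: One_nat_def)
 then obtain g where "!!i. homogeneous 1 (g i) & ev emb (g i) xi = xi $ i" by metis
 then show "xi $ j ~= 0 ==> xi $ i / xi $ j \<in> K" using K_intro[of 1 "g i" "g j"] by simp
qed

lemma max_coordinate: "\<exists>j. xi $ j ~= 0 & (\<forall>i. xi $ i / xi $ j \<in> V)"
proof -
 define le where "le a b \<longleftrightarrow> b ~= 0 & a / b \<in> V" for a b
 have ref: "le a a" if "a ~= 0" for a using that by (simp add: le_def subring_closed[OF place_subring])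
 have trans: "le a c" if "le a b" "le b c" for a b c
 proof -
  have "a / c = (a / b) * (b / c)" using that by (simp add: le_def)
  then show ?thesis using that subring_mult[OF place_subring] unfolding le_def by metis
 qed
 have z: "le 0 a" if "a ~= 0" for a using that by (simp add: le_def subring_closed[OF place_subring])
 have tot: "le a b \<or> le b a" if "a ~= 0 \<or> b ~= 0" for a b
  using that z valuation_ring_cases[OF place_valuation, of "a / b"] unfolding le_def by (cases "a = 0"; cases "b = 0") auto
 obtain k where k: "xi $ k ~= 0" using xi_nonzero by blast
 have "\<exists>j. xi $ j ~= 0 & (\<forall>i\<in>S. le (xi $ i) (xi $ j))" if "finite S" for S
  using that
 proof (induction S)
  case empty then show ?case using k by blast
 next
  case (insert x S)
  then obtain j where j: "xi $ j ~= 0" "\<forall>i\<in>S. le (xi $ i) (xi $ j)" by blast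
  consider "le (xi $ x) (xi $ j)" | "le (xi $ j) (xi $ x)" using tot j(1) by blast
  then show ?case
  proof cases
   case 1 then show ?thesis using j by blast
  next
   case 2 then have "xi $ x ~= 0" by (simp add: le_def)
   then show ?thesis using 2 j trans ref by (intro exI[of _ x]) blast
  qed
 qed
 from this[of UNIV] show ?thesis by (auto simp: le_def)
qed

text \<open>The valuative criterion of properness for the plane: dividing by a coordinate of least
  value puts all coordinates into V, and their residues form a point of the curve.\<close>

lemma place_center:
 obtains v j where "v ~= 0" "xi $ j ~= 0" "v $ j = 1" "pt v \<in> C"
  "!!i. xi $ i / xi $ j - emb (v $ i) \<in> nonunits V"
proof -
 obtain j where j: "xi $ j ~= 0" "!!i. xi $ i / xi $ j \<in> V" using max_coordinate by blast
 then have "\<exists>c. xi $ i / xi $ j - emb c \<in> nonunits V" for i using place_residue xi_quotient_K by blast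
 then obtain f where f: "!!i. xi $ i / xi $ j - emb (f i) \<in> nonunits V" by metis
 have "f j = 1"
 proof -
  have "emb (1 - f j) \<in> nonunits V" using f[of j] j(1) by (simp add: diff one)
  then show ?thesis using emb_nonunit by simp
 qed
 define v where "v = (\<chi> i. f i)"
 have vj1: "v $ j = 1" using \<open>f j = 1\<close> by (simp add: v_def)
 then have "v ~= 0" by (metis zero_index zero_neq_one)
 note vj = vj1 this
 have fv: "xi $ i / xi $ j - emb (v $ i) \<in> nonunits V" for i using f by (simp add: v_def)
 have "ev emb F (\<chi> i. xi $ i / xi $ j) - emb (ev id F v) \<in> nonunits V"
  by (rule ev_congruence) (simp add: fv)
 moreover have "xi = xi $ j *s (\<chi> i. xi $ i / xi $ j)" using j(1) by (simp add: vec_eq_iff)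
 then have "ev emb F (\<chi> i. xi $ i / xi $ j) = 0" using ev_scale[OF hom] gen j(1)
  by (metis dvd_refl mult_eq_0_iff power_not_zero)
 ultimately have "emb (0 - ev id F v) \<in> nonunits V" by (simp add: uminus)
 then have "ev id F v = 0" using emb_nonunit by simp
 then have "pt v \<in> C" unfolding C_def using vanishes_at_pt[OF hom vj(2)] by simp
 then show ?thesis using that vj j fv by blast
qed

lemma center_unique_aux:
 assumes v: "v ~= 0" "xi $ j ~= 0" and c: "!!i. xi $ i / xi $ j - emb (v $ i) \<in> nonunits V"
 shows "Ol (pt v) \<subseteq> V" "mOl (pt v) \<subseteq> nonunits V"
proof -
 let ?w = "\<chi> i. xi $ i / xi $ j"
 have w: "ev emb G ?w - emb (ev id G v) \<in> nonunits V" for G by (rule ev_congruence) (simp add: c)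
 have wV: "ev emb G ?w \<in> V" for G
  using subring_add[OF place_subring nonunits_subset[OF place_valuation w[of G]] place_emb[of "ev id G v"]] by simp
 have xi: "xi = xi $ j *s ?w" using v(2) by (simp add: vec_eq_iff)
 have quot: "ev emb G xi / ev emb H xi = ev emb G ?w * inverse (ev emb H ?w)" if "homogeneous m G" "homogeneous m H" for G H m
 proof -
  have "ev emb G xi = (xi $ j) ^ m * ev emb G ?w" "ev emb H xi = (xi $ j) ^ m * ev emb H ?w"
   using ev_scale[OF that(1), of "xi $ j" ?w] ev_scale[OF that(2), of "xi $ j" ?w] xi by simp_all
  then show ?thesis using v(2) by (simp add: field_simps)
 qed
 have inv: "inverse (ev emb H ?w) \<in> V" if "homogeneous m H" "~ vanishes_at H (pt v)" for H m
 proof -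
  have "ev id H v ~= 0" using that vanishes_at_pt[OF _ v(1)] by blast
  then have n: "emb (ev id H v) \<notin> nonunits V" using emb_nonunit by simp
  from unit_add_nonunit[OF place_valuation place_emb n w[of H]]
  have "ev emb H ?w \<notin> nonunits V" by simp
  then show ?thesis using wV not_nonunit[OF place_valuation] by blast
 qed
 show "Ol (pt v) \<subseteq> V"
 proof
  fix x assume "x \<in> Ol (pt v)"
  then obtain G H m where *: "homogeneous m G" "homogeneous m H" "~ vanishes_at H (pt v)" "x = ev emb G xi / ev emb H xi"
   unfolding Ol_def by blast
  then show "x \<in> V" using quot[OF *(1,2)] inv[OF *(2,3)] wV subring_mult[OF place_subring] by metis
 qed
 show "mOl (pt v) \<subseteq> nonunits V"
 proof
  fix x assume "x \<in> mOl (pt v)"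
  then obtain G H m where *: "homogeneous m G" "homogeneous m H" "~ vanishes_at H (pt v)" "vanishes_at G (pt v)" "x = ev emb G xi / ev emb H xi"
   unfolding mOl_def by blast
  have "ev id G v = 0" using vanishes_at_pt[OF *(1) v(1)] * by blast
  then have "ev emb G ?w \<in> nonunits V" using w[of G] by simp
  then show "x \<in> nonunits V" using * quot[OF *(1,2)] inv[OF *(2,3)] nonunits_mult[OF place_valuation] by metis
 qed
qed

lemma place_center_ex: "\<exists>q\<in>C. Ol q \<subseteq> V & mOl q \<subseteq> nonunits V"
 using place_center center_unique_aux by metis

end

end

lemma separating_line:
 fixes v w :: "complex ^ 3"
 assumes "v ~= 0" "w ~= 0" "pt v ~= pt w"
 shows "\<exists>a. ev id (lin a) v = 0 & ev id (lin a) w ~= 0"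
proof -
 have "v$1 * w$2 ~= v$2 * w$1 \<or> v$1 * w$3 ~= v$3 * w$1 \<or> v$2 * w$3 ~= v$3 * w$2"
 proof (rule ccontr)
  assume "~ ?thesis"
  then have eqs: "v$1 * w$2 = v$2 * w$1" "v$1 * w$3 = v$3 * w$1" "v$2 * w$3 = v$3 * w$2" by auto
  from assms(1) obtain i where i: "v $ i ~= 0" by (auto simp: vec_eq_iff)
  have "v $ i * w $ j = v $ j * w $ i" for j
   using exhaust_3[of i] exhaust_3[of j] eqs by auto
  then have w: "w = (w $ i / v $ i) *s v" using i by (simp add: vec_eq_iff field_simps)
  then have "w $ i / v $ i ~= 0" using assms(2) by auto
  then show False using w pt_eq_iff[OF assms(1,2)] assms(3) by blast
 qed
 then show ?thesis
 proof (elim disjE)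
  assume "v$1 * w$2 ~= v$2 * w$1"
  then show ?thesis by (intro exI[of _ "vec3 (- v$2) (v$1) 0"]) (simp add: idc.ev_lin)
 next
  assume "v$1 * w$3 ~= v$3 * w$1"
  then show ?thesis by (intro exI[of _ "vec3 (- v$3) 0 (v$1)"]) (simp add: idc.ev_lin)
 next
  assume "v$2 * w$3 ~= v$3 * w$2"
  then show ?thesis by (intro exI[of _ "vec3 0 (- v$3) (v$2)"]) (simp add: idc.ev_lin)
 qed
qed

lemma line_avoiding:
 fixes v :: "complex ^ 3" assumes "v ~= 0" shows "\<exists>a. ev id (lin a) v ~= 0"
proof -
 from assms obtain i where i: "v $ i ~= 0" by (auto simp: vec_eq_iff)
 have "ev id (lin (axis i 1)) v = v $ i" using exhaust_3[of i] by (auto simp: idc.ev_lin axis_def)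
 then show ?thesis using i by metis
qed

text \<open>For a relation P(s,u) = 0 this means: after a power of s is cancelled, the relation
  remains nontrivial modulo s.\<close>

lemma shift_out_0_coeffs:
 fixes P :: "'a::idom poly poly"
 assumes "P ~= 0"
 shows "\<exists>k Q i. P = smult (monom 1 k) Q & coeff (coeff Q i) 0 ~= 0"
 using assms
proof (induction "degree (lead_coeff P)" arbitrary: P rule: less_induct)
 case less
 show ?case
 proof (cases "\<exists>i. coeff (coeff P i) 0 ~= 0")
  case True then show ?thesis by (metis monom_0 one_pCons smult_1_left)
 next
  case False
  define Q where "Q = map_poly (poly_shift 1) P"
  have "coeff P i = [:0, 1:] * coeff Q i" for i
   using False by (intro poly_eqI) (auto simp: Q_def coeff_map_poly coeff_pCons coeff_poly_shift split: nat.splits)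
  then have PQ: "P = smult [:0, 1:] Q" by (intro poly_eqI) (simp only: coeff_smult)
  then have "Q ~= 0" using less(2) by auto
  then have lQ: "lead_coeff Q ~= 0" by simp
  have "degree (lead_coeff P) = Suc (degree (lead_coeff Q))"
   unfolding PQ using lQ by (simp add: degree_mult_eq lead_coeff_smult del: mult_pCons_left)
  then obtain k R i where R: "Q = smult (monom 1 k) R" "coeff (coeff R i) 0 ~= 0"
   using less(1)[OF _ \<open>Q ~= 0\<close>] by auto
  have "P = smult (monom 1 (Suc k)) R" unfolding PQ R(1) by (simp add: monom_Suc)
  then show ?thesis using R(2) by blast
 qed
qed

section \<open>Places over a given point and maximal ideals of the normalization\<close>

context generic_point
begin

lemma exists_mO_nonzero: assumes q: "q \<in> C" shows "\<exists>s\<in>mOl q. s ~= 0"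
proof -
 obtain y where y: "y \<in> C" "y ~= q" using exists_two_points[OF infinite_C] by blast
 obtain v where v: "v ~= 0" "q = pt v" by (rule pt_cases)
 obtain w where w: "w ~= 0" "y = pt w" by (rule pt_cases)
 have "pt v ~= pt w" using v w y by simp
 then obtain a where a: "ev id (lin a) v = 0" "ev id (lin a) w ~= 0" using separating_line[OF v(1) w(1)] by blast
 obtain b where b: "ev id (lin b) v ~= 0" using line_avoiding[OF v(1)] by blast
 have *: "vanishes_at (lin a) q" "~ vanishes_at (lin a) y" "~ vanishes_at (lin b) q"
  unfolding v(2) w(2) vanishes_at_pt[OF homogeneous_lin v(1)] vanishes_at_pt[OF homogeneous_lin w(1)] using a b by auto
 have "ev emb (lin a) xi / ev emb (lin b) xi \<in> mOl q" using mO_intro[OF homogeneous_lin homogeneous_lin *(3,1)] .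
 moreover have "ev emb (lin a) xi / ev emb (lin b) xi ~= 0"
  using nonvanishing[OF y(1) homogeneous_lin *(2)] nonvanishing[OF q homogeneous_lin *(3)] by simp
 ultimately show ?thesis by blast
qed

lemma mO_K: "q \<in> C ==> x \<in> mOl q ==> x \<in> K"
 using O_K mO_subset by blast

lemma mO_not_emb: assumes "q \<in> C" "s \<in> mOl q" "s ~= 0" shows "s \<notin> range emb"
proof
 assume "s \<in> range emb"
 then obtain c where c: "s = emb c" by blast
 then have "c ~= 0" using assms(3) by auto
 then have "s * emb (inverse c) = 1" using c emb_eq_0 by (simp add: emb_inverse)
 then show False using mO_mult[OF assms(1,2) O_emb[of "inverse c"]] mO_1[OF assms(1)] by simp
qed

lemma place_center_unique:
 assumes V: "place V" and q: "q \<in> C" "Ol q \<subseteq> V" and q': "q' \<in> C" "mOl q' \<subseteq> nonunits V"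
 shows "q = q'"
proof (rule ccontr)
 assume ne: "q ~= q'"
 obtain v where v: "v ~= 0" "q = pt v" by (rule pt_cases)
 obtain w where w: "w ~= 0" "q' = pt w" by (rule pt_cases)
 have "pt w ~= pt v" using v w ne by simp
 then obtain a where a: "ev id (lin a) w = 0" "ev id (lin a) v ~= 0" using separating_line[OF w(1) v(1)] by blast
 obtain b where b: "ev id (lin b) w ~= 0" using line_avoiding[OF w(1)] by blast
 have *: "vanishes_at (lin a) q'" "~ vanishes_at (lin a) q" "~ vanishes_at (lin b) q'"
  unfolding v(2) w(2) vanishes_at_pt[OF homogeneous_lin v(1)] vanishes_at_pt[OF homogeneous_lin w(1)] using a b by auto
 have 1: "ev emb (lin b) xi / ev emb (lin a) xi \<in> V" using O_intro[OF homogeneous_lin homogeneous_lin *(2)] q by blast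
 have 2: "ev emb (lin a) xi / ev emb (lin b) xi \<in> nonunits V" using mO_intro[OF homogeneous_lin homogeneous_lin *(3,1)] q' by blast
 have "(ev emb (lin a) xi / ev emb (lin b) xi) * (ev emb (lin b) xi / ev emb (lin a) xi) = 1"
  using nonvanishing[OF q(1) homogeneous_lin *(2)] nonvanishing[OF q'(1) homogeneous_lin *(3)] by simp
 then show False using nonunits_mult[OF place_valuation[OF V] 2 1] nonunits_1[OF place_valuation[OF V]] by simp
qed

lemma place_mO:
 assumes V: "place V" and q: "q \<in> C" "Ol q \<subseteq> V"
 shows "mOl q \<subseteq> nonunits V"
 using place_center_ex[OF V] place_center_unique[OF V q] by blast

lemma exists_place:
 assumes q: "q \<in> C" shows "\<exists>V. place V & Ol q \<subseteq> V"
proof -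
 have "x \<in> mOl q" if "x \<in> ideal_span (mOl q) (Ol q)" for x
  using that
 proof (induction rule: ideal_span.induct)
  case zero
  obtain s where "s \<in> mOl q" using exists_mO_nonzero q by blast
  then show ?case using mO_diff[OF q, of s s] by simp
 next
  case (step x b y)
  have xb: "x * b \<in> mOl q" using mO_mult[OF q] step by blast
  then have "0 \<in> mOl q" using mO_diff[OF q, of "x * b" "x * b"] by simp
  then have "0 - y \<in> mOl q" using mO_diff[OF q] step by blast
  then have "x * b - (0 - y) \<in> mOl q" using mO_diff[OF q xb] by blast
  then show ?case by simp
 qed
 then have "1 \<notin> ideal_span (mOl q) (Ol q)" using mO_1[OF q] by blast
 then obtain V where V: "valuation_ring V" "Ol q \<subseteq> V" "1 \<notin> ideal_span (mOl q) V"
  using chevalley[OF O_subring[OF q] mO_subset[OF q]] by blast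
 obtain s where s: "s \<in> mOl q" "s ~= 0" using exists_mO_nonzero q by blast
 have "inverse s \<notin> V"
 proof
  assume "inverse s \<in> V"
  then have "s * inverse s \<in> ideal_span (mOl q) V" using s by (intro ideal_span_base)
  then show False using s V by simp
 qed
 then have "place V" using V K_inverse mO_K[OF q s(1)] O_emb[of _ q] unfolding place_def by blast
 then show ?thesis using V by blast
qed

lemma place_Rn: "place V ==> q \<in> C ==> Ol q \<subseteq> V ==> Rn q \<subseteq> V"
proof (rule subsetI)
 fix x assume "place V" "q \<in> C" "Ol q \<subseteq> V" "x \<in> Rn q"
 then show "x \<in> V" using integral_iff[OF O_subring[of q], of x] place_valuation[of V] by (simp add: Rn_def)
qed

lemma place_max_ideal:
 assumes V: "place V" and q: "q \<in> C" "Ol q \<subseteq> V"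
 shows "max_ideal (nonunits V \<inter> Rn q) (Rn q)"
 unfolding max_ideal_def
proof (intro conjI ballI)
 note val = place_valuation[OF V]
 show "nonunits V \<inter> Rn q \<subseteq> Rn q" by blast
 show "0 \<in> nonunits V \<inter> Rn q" using nonunits_0[OF val] subring_0[OF Rn_subring[OF q(1)]] by blast
 show "1 \<notin> nonunits V \<inter> Rn q" using nonunits_1[OF val] by blast
 fix x assume x: "x \<in> nonunits V \<inter> Rn q"
 { fix y assume "y \<in> nonunits V \<inter> Rn q"
  then show "x - y \<in> nonunits V \<inter> Rn q" using x nonunits_diff[OF val] subring_diff[OF Rn_subring[OF q(1)]] by blast }
 fix s assume s: "s \<in> Rn q"
 then have "s \<in> V" using place_Rn[OF V q] by blast
 then show "x * s \<in> nonunits V \<inter> Rn q"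
  using x s nonunits_mult[OF val] subring_mult[OF Rn_subring[OF q(1)]] by blast
next
 note val = place_valuation[OF V]
 fix r assume r: "r \<in> Rn q - nonunits V \<inter> Rn q"
 then have rV: "r \<in> V" "r \<in> K" using place_Rn[OF V q] by (auto simp: Rn_def)
 then obtain c where c: "r - emb c \<in> nonunits V" using place_residue[OF V] by blast
 have "c ~= 0" using c r by auto
 have i: "emb (inverse c) \<in> Rn q" using O_emb O_Rn q by blast
 have "1 - r * emb (inverse c) = (emb c - r) * emb (inverse c)" using \<open>c ~= 0\<close> emb_eq_0
  by (simp add: algebra_simps emb_inverse)
 moreover have "- (r - emb c) \<in> nonunits V" using nonunits_uminus[OF val c] .
 ultimately have "1 - r * emb (inverse c) \<in> nonunits V" using nonunits_mult[OF val _ place_emb[OF V]] by simp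
 moreover have "1 - r * emb (inverse c) \<in> Rn q"
  using subring_diff[OF Rn_subring[OF q(1)] subring_1[OF Rn_subring[OF q(1)]] subring_mult[OF Rn_subring[OF q(1)] _ i]] r by blast
 ultimately show "\<exists>s\<in>Rn q. 1 - r * s \<in> nonunits V \<inter> Rn q" using i by blast
qed

text \<open>Lying over. Suppose g in \<open>mOl q\<close> had an inverse s modulo M. Multiplying an
  integral equation of s of degree m by g^m and replacing each g s by 1 gives an element e of M. All
  its terms but the leading 1 contain g, so e is congruent to 1 modulo \<open>mOl q\<close> and is a
  unit, which is absurd.\<close>

lemma max_ideal_contains_mO:
 assumes q: "q \<in> C" and M: "max_ideal M (Rn q)"
 shows "mOl q \<subseteq> M"
proof
 fix g assume g: "g \<in> mOl q"
 note sR = Rn_subring[OF q] and sO = O_subring[OF q]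
 have M2: "!!x y. x \<in> M ==> y \<in> M ==> x - y \<in> M" "!!x y. x \<in> M ==> y \<in> Rn q ==> x * y \<in> M" "0 \<in> M" "1 \<notin> M"
  using M by (auto simp: max_ideal_def)
 have M_add: "x + y \<in> M" if "x \<in> M" "y \<in> M" for x y using M2(1)[OF that(1) M2(1)[OF M2(3) that(2)]] by simp
 have M_sum: "(\<Sum>i\<in>I. f i) \<in> M" if "!!i. i \<in> I ==> f i \<in> M" for I and f :: "nat => 'k"
  using that by (induction I rule: infinite_finite_induct) (auto intro: M_add M2(3))
 have gO: "g \<in> Ol q" using g mO_subset[OF q] by blast
 show "g \<in> M"
 proof (rule ccontr)
  assume "g \<notin> M"
  then obtain s where s: "s \<in> Rn q" "1 - g * s \<in> M" using gO O_Rn[OF q] M unfolding max_ideal_def by blast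
  have gs: "g * s \<in> Rn q" using gO O_Rn[OF q] s subring_mult[OF sR] by blast
  obtain p where p: "lead_coeff p = 1" "coeffs_in (Ol q) p" "poly p s = 0" using s(1) by (auto simp: Rn_def integral_def)
  define m where "m = degree p"
  define e where "e = (\<Sum>i\<le>m. coeff p i * g ^ (m - i))"
  have pw: "1 - (g * s) ^ i \<in> M" for i
  proof (induction i)
   case (Suc i)
   have "1 - (g * s) ^ Suc i = (1 - (g * s) ^ i) + (1 - g * s) * (g * s) ^ i" by (simp add: algebra_simps)
   then show ?case using Suc M_add M2(2)[OF s(2) subring_power[OF sR gs]] by metis
  qed (simp add: M2)
  have "0 = g ^ m * poly p s" using p by simp
  also have "\<dots> = (\<Sum>i\<le>m. coeff p i * g ^ (m - i) * (g * s) ^ i)"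
  proof -
   have "g ^ m * (coeff p i * s ^ i) = coeff p i * g ^ (m - i) * (g * s) ^ i" if "i \<le> m" for i
   proof -
    have "g ^ m = g ^ (m - i) * g ^ i" using that by (simp flip: power_add)
    then show ?thesis by (simp add: power_mult_distrib)
   qed
   then show ?thesis unfolding poly_altdef m_def[symmetric] sum_distrib_left by (intro sum.cong refl) simp
  qed
  finally have "e = (\<Sum>i\<le>m. coeff p i * g ^ (m - i) * (1 - (g * s) ^ i))"
   by (simp add: e_def right_diff_distrib sum_subtractf)
  also have "\<dots> \<in> M"
  proof (rule M_sum)
   fix i
   have "coeff p i * g ^ (m - i) \<in> Rn q"
    using p(2) gO O_Rn[OF q] by (auto simp: coeffs_in_def intro!: subring_closed[OF sR])
   then show "coeff p i * g ^ (m - i) * (1 - (g * s) ^ i) \<in> M" using M2(2)[OF pw] by (metis mult.commute)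
  qed
  finally have eM: "e \<in> M" .
  have "e = 1 + (\<Sum>i<m. coeff p i * g ^ (m - i))" using p(1)
   unfolding e_def lessThan_Suc_atMost[symmetric] sum.lessThan_Suc by (simp add: m_def)
  moreover have "(\<Sum>i<m. coeff p i * g ^ (m - i)) = g * (\<Sum>i<m. coeff p i * g ^ (m - i - 1))"
   unfolding sum_distrib_left by (intro sum.cong refl) (auto simp: power_eq_if)
  moreover have "(\<Sum>i<m. coeff p i * g ^ (m - i - 1)) \<in> Ol q"
   using p(2) gO by (auto simp: coeffs_in_def intro!: subring_closed[OF sO])
  ultimately have e1: "e - 1 \<in> mOl q" using mO_mult[OF q g] by simp
  have eO: "e \<in> Ol q" using p(2) gO unfolding e_def by (auto simp: coeffs_in_def intro!: subring_closed[OF sO])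
  have "e \<notin> mOl q" using mO_diff[OF q _ e1, of e] mO_1[OF q] by auto
  then have "e ~= 0" "inverse e \<in> Rn q" using O_unit[OF q eO] O_Rn[OF q] by auto
  then show False using M2(2)[OF eM, of "inverse e"] M2(4) by simp
 qed
qed

text \<open>u is algebraic over C(s) for a nonzero s in the maximal ideal of the local ring. Once a
  power of s is cancelled, some coefficient of the relation is a nonzero constant modulo s, hence
  outside M, and \<open>localization_dichotomy\<close> applies.\<close>

lemma localization_valuation:
 assumes q: "q \<in> C" and M: "max_ideal M (Rn q)" and u: "u \<in> K"
 shows "u \<in> localization (Rn q) M \<or> inverse u \<in> localization (Rn q) M"
proof -
 note sR = Rn_subring[OF q]
 obtain s where s: "s \<in> mOl q" "s ~= 0" using exists_mO_nonzero q by blast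
 have sM: "s \<in> M" using max_ideal_contains_mO[OF q M] s by blast
 have sn: "s \<notin> range emb" using mO_not_emb[OF q s] .
 obtain P where P: "P ~= 0" "poly (eval2 emb s P) u = 0" using algebraic_relation[OF mO_K[OF q s(1)] sn u] .
 obtain k Q i where Q: "P = smult (monom 1 k) Q" "coeff (coeff Q i) 0 ~= 0" using shift_out_0_coeffs[OF P(1)] by blast
 interpret e: comm_hom "%p. evp p s" by (rule evp_hom)
 have "eval2 emb s P = smult (s ^ k) (eval2 emb s Q)"
  unfolding Q(1) by (intro poly_eqI) (simp add: coeff_eval2 e.mult map_poly_monom poly_monom one)
 then have Q0: "poly (eval2 emb s Q) u = 0" using P(2) s(2) by simp
 have sO: "s \<in> Ol q" using s mO_subset[OF q] by blast
 have evO: "evp a s \<in> Ol q" for a using evp_subring[OF O_subring[OF q], of s a] O_emb sO by blast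
 have cin: "coeffs_in (Rn q) (eval2 emb s Q)" unfolding coeffs_in_def coeff_eval2 using evO O_Rn[OF q] by blast
 have M2: "!!x y. x \<in> M ==> y \<in> M ==> x - y \<in> M" "!!x y. x \<in> M ==> y \<in> Rn q ==> x * y \<in> M" "0 \<in> M" "1 \<notin> M"
  using M by (auto simp: max_ideal_def)
 have "coeff (eval2 emb s Q) i \<notin> M"
 proof
  obtain a c where ac: "coeff Q i = pCons c a" by (metis pCons_cases)
  have "c ~= 0" using Q(2) ac by simp
  assume "coeff (eval2 emb s Q) i \<in> M"
  then have "emb c + s * evp a s \<in> M" unfolding coeff_eval2 ac evp_simps(8) .
  moreover have "s * evp a s \<in> M" using M2(2)[OF sM] evO O_Rn[OF q] by blast
  ultimately have "emb c + s * evp a s - s * evp a s \<in> M" using M2(1) by blast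
  then have "emb c * emb (inverse c) \<in> M" using M2(2) O_emb[of "inverse c" q] O_Rn[OF q] by auto
  then show False using \<open>c ~= 0\<close> emb_eq_0 M2(4) by (simp add: emb_inverse)
 qed
 moreover have RK: "Rn q \<subseteq> K" by (auto simp: Rn_def)
 ultimately obtain a b where ab: "a \<in> Rn q" "b \<in> Rn q - M" "u * b = a \<or> (u ~= 0 & inverse u * b = a)"
  using localization_dichotomy[OF sR Rn_closed[OF q] K_subring RK M2(3,1) u cin Q0] by blast
 have "b ~= 0" using ab M2(3) by auto
 then have "u = a / b \<or> inverse u = a / b" using ab(3) by (auto simp: field_simps)
 then show ?thesis using ab unfolding localization_def by blast
qed

text \<open>A nonconstant u is left out by some valuation ring over the constants, and u is then not
  integral at the centre of that place.\<close>

theorem globally_regular_constant: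
 assumes u: "u \<in> K" and reg: "!!q. q \<in> C ==> u \<in> Rn q"
 shows "u \<in> range emb"
proof (rule ccontr)
 assume "u \<notin> range emb"
 then obtain V where V: "place V" "u \<notin> V" using exists_place_excluding u by blast
 then obtain q where q: "q \<in> C" "Ol q \<subseteq> V" using place_center_ex by blast
 then show False using reg place_Rn V by blast
qed

definition unibranch :: "proj_plane => bool" where
 "unibranch q \<longleftrightarrow> (\<exists>!M. max_ideal M (Rn q))"

text \<open>Elements of \<open>Rn q\<close> outside its only maximal ideal M are units: if r were
  not, Chevalley's theorem would give a place W over q with r a nonunit, and the maximal ideal of W
  would differ from M. So localizing at M changes nothing, the ring is already a valuation ring of
  K, and V adds nothing inside K.\<close>

lemma unibranch_place:
 assumes q: "q \<in> C" "unibranch q" and V: "place V" "Ol q \<subseteq> V"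
 shows "V \<inter> K = Rn q"
proof
 show "Rn q \<subseteq> V \<inter> K" using place_Rn[OF V(1) q(1) V(2)] by (auto simp: Rn_def)
 define M where "M = nonunits V \<inter> Rn q"
 have M: "max_ideal M (Rn q)" unfolding M_def by (rule place_max_ideal[OF V(1) q(1) V(2)])
 note sR = Rn_subring[OF q(1)]
 have unit: "inverse r \<in> Rn q" if r: "r \<in> Rn q - M" for r
 proof (rule ccontr)
  assume ni: "inverse r \<notin> Rn q"
  have r0: "r ~= 0" using r M by (auto simp: max_ideal_def)
  have "\<exists>b\<in>Rn q. x = r * b" if "x \<in> ideal_span {r} (Rn q)" for x
   using that
  proof (induction rule: ideal_span.induct)
   case zero then show ?case using subring_0[OF sR] by (auto intro!: bexI[of _ 0])
  next
   case (step x b y)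
   then obtain c where "c \<in> Rn q" "y = r * c" by blast
   with step show ?case using subring_add[OF sR] by (auto intro!: bexI[of _ "b + c"] simp: distrib_left)
  qed
  then have "1 \<notin> ideal_span {r} (Rn q)" using ni r0 by (metis inverse_unique)
  then obtain W where W: "valuation_ring W" "Rn q \<subseteq> W" "1 \<notin> ideal_span {r} W"
   using chevalley[OF sR, of "{r}"] r by blast
  have nW: "inverse r \<notin> W" using ideal_span_base[of r "{r}" "inverse r" W] W(3) r0 by auto
  have OW: "Ol q \<subseteq> W" using W(2) O_Rn[OF q(1)] by blast
  have pW: "place W" unfolding place_def using W(1) OW O_emb nW K_inverse[of r] r by (auto simp: Rn_def)
  have "nonunits W \<inter> Rn q = M" using place_max_ideal[OF pW q(1) OW] M q(2) by (auto simp: unibranch_def)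
  moreover have "r \<in> nonunits W" using r W(2) nW by (auto simp: nonunits_def)
  ultimately show False using r by blast
 qed
 have loc: "localization (Rn q) M \<subseteq> Rn q"
  unfolding localization_def using unit subring_mult[OF sR] by (auto simp: field_class.field_divide_inverse)
 show "V \<inter> K \<subseteq> Rn q"
 proof
  fix f assume f: "f \<in> V \<inter> K"
  show "f \<in> Rn q"
  proof (rule ccontr)
   assume nf: "f \<notin> Rn q"
   then have i: "inverse f \<in> Rn q" using localization_valuation[OF q(1) M, of f] f loc by blast
   have "f ~= 0" using nf subring_0[OF sR] by auto
   have "inverse f \<in> M" using unit[of "inverse f"] i nf by auto
   then have "inverse f \<in> nonunits V" by (simp add: M_def)
   then show False using f \<open>f ~= 0\<close> by (auto simp: nonunits_def)
  qed
 qed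
qed

end

section \<open>Rational orders of functions at a place\<close>

lemma powi_pow: "(t powi a) ^ k = t powi (a * int k)" for t :: "'a::field"
 by (simp only: power_int_mult power_int_of_nat)

definition vunits :: "'a::field set => 'a set" where
 "vunits V = {f. f ~= 0 & f \<in> V & inverse f \<in> V}"

context
 fixes V :: "'a::field set"
 assumes V: "valuation_ring V"
begin

lemmas sVr = valuation_ring_subring[OF V]

lemma vunits_mult: "f \<in> vunits V ==> g \<in> vunits V ==> f * g \<in> vunits V"
 using subring_mult[OF sVr] by (auto simp: vunits_def)

lemma vunits_inverse: "f \<in> vunits V ==> inverse f \<in> vunits V"
 by (auto simp: vunits_def)

lemma vunits_1: "1 \<in> vunits V"
 using subring_1[OF sVr] by (auto simp: vunits_def)

lemma vunits_power: "f \<in> vunits V ==> f ^ n \<in> vunits V"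
 by (induction n) (auto intro: vunits_1 vunits_mult)

lemma vunits_nonunits: "f \<in> vunits V ==> f \<notin> nonunits V"
 by (auto simp: vunits_def nonunits_def)

lemma V_power_root: "u ^ n \<in> V ==> n > 0 ==> u \<in> V"
proof (rule ccontr)
 assume *: "u ^ n \<in> V" "n > 0" "u \<notin> V"
 then have i: "inverse u \<in> V" "u ~= 0" using valuation_ring_cases[OF V] subring_0[OF sVr] by auto
 have "u = u ^ n * inverse u ^ (n - 1)" using *(2) i(2) by (cases n) (auto simp: field_simps)
 then show False using * i subring_mult[OF sVr] subring_power[OF sVr] by metis
qed

lemma vunits_power_root: "u ^ n \<in> vunits V ==> n > 0 ==> u \<in> vunits V"
 using V_power_root[of u n] V_power_root[of "inverse u" n] by (auto simp: vunits_def power_inverse zero_power)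

lemma nonunit_power: "t \<in> nonunits V ==> n > 0 ==> t ^ n \<notin> vunits V"
 using vunits_power_root[of t n] vunits_nonunits by blast

lemma power_int_vunits:
 assumes t: "t \<in> nonunits V" "t ~= 0" shows "t powi m \<in> vunits V \<longleftrightarrow> m = 0"
proof
 assume u: "t powi m \<in> vunits V"
 show "m = 0"
 proof (rule ccontr)
  assume "m ~= 0"
  then consider "m > 0" | "m < 0" by linarith
  then show False
  proof cases
   case 1 then show False using u nonunit_power[OF t(1), of "nat m"] by (auto simp: power_int_def)
  next
   case 2
   then have "inverse (t ^ nat (- m)) \<in> vunits V" using u by (auto simp: power_int_def power_inverse)
   then have "t ^ nat (- m) \<in> vunits V" using vunits_inverse by fastforce
   then show False using 2 nonunit_power[OF t(1), of "nat (-m)"] by auto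
  qed
 qed
qed (simp add: vunits_1)

text \<open>A term that divides no other term properly has the least value. If all other terms were
  smaller in V by a nonunit, they could not cancel it.\<close>

lemma sum_zero_two_terms:
 assumes S: "finite S" "(\<Sum>i\<in>S. x i) = 0" "S ~= {}" "!!i. i \<in> S ==> x i ~= 0"
 shows "\<exists>i\<in>S. \<exists>j\<in>S. i ~= j & x i / x j \<in> vunits V"
proof -
 have "\<exists>j\<in>S'. \<forall>i\<in>S'. x i / x j \<in> V" if "finite S'" "S' ~= {}" "S' \<subseteq> S" for S'
  using that
 proof (induction S' rule: finite_ne_induct)
  case (singleton k) then show ?case using S(4) subring_1[OF sVr] by auto
 next
  case (insert k S')
  then obtain j where j: "j \<in> S'" "\<forall>i\<in>S'. x i / x j \<in> V" by auto
  have nz: "x k ~= 0" "x j ~= 0" using insert j S(4) by auto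
  show ?case
  proof (cases "x k / x j \<in> V")
   case True then show ?thesis using j by blast
  next
   case False
   then have kj: "x j / x k \<in> V" using valuation_ring_cases[OF V, of "x k / x j"] by (simp add: field_simps)
   have "x i / x k \<in> V" if "i \<in> S'" for i
   proof -
    have "x i / x k = (x i / x j) * (x j / x k)" using nz by simp
    then show ?thesis using j(2) that kj subring_mult[OF sVr] by metis
   qed
   moreover have "x k / x k \<in> V" using nz subring_1[OF sVr] by simp
   ultimately show ?thesis by auto
  qed
 qed
 then obtain j where j: "j \<in> S" "\<forall>i\<in>S. x i / x j \<in> V" using S by blast
 have "\<exists>i\<in>S - {j}. x i / x j \<in> vunits V"
 proof (rule ccontr)
  assume "~ ?thesis"
  then have "x i / x j \<in> nonunits V" if "i \<in> S - {j}" for i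
   using that j S(4) not_nonunit[OF V, of "x i / x j"] unfolding vunits_def by blast
  then have "(\<Sum>i\<in>S - {j}. x i / x j) \<in> nonunits V" by (rule nonunits_sum[OF V])
  moreover have "(\<Sum>i\<in>S. x i / x j) = 0" using S(2) by (simp flip: sum_divide_distrib)
  then have "x j / x j + (\<Sum>i\<in>S - {j}. x i / x j) = 0" using S(1) j(1) sum.remove by metis
  then have "(\<Sum>i\<in>S - {j}. x i / x j) = - 1" using S(4)[OF j(1)] by (simp add: add_eq_0_iff)
  ultimately show False using nonunits_uminus[OF V] nonunits_1[OF V] by force
 qed
 then show ?thesis using j by blast
qed

end

context generic_point
begin

definition val_rel :: "'k set => 'k => 'k => real => bool" where
 "val_rel V t u r \<longleftrightarrow> (\<exists>n::nat. \<exists>m::int. n > 0 & r = real_of_int m / real n & u ^ n * t powi (- m) \<in> vunits V)"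

text \<open>Despite its name not a uniformizer: some nonzero nonunit of V in K, which is given the
  value 1.\<close>

definition unif :: "'k set => 'k" where
 "unif V = (SOME t. t \<in> K & t \<in> nonunits V & t ~= 0)"

definition val :: "'k set => 'k => real" where
 "val V u = (THE r. val_rel V (unif V) u r)"

context
 fixes V :: "'k set" assumes V: "place V"
begin

private lemmas vr = place_valuation[OF V]
private lemmas sub = valuation_ring_subring[OF vr]

lemma unif: "unif V \<in> K" "unif V \<in> nonunits V" "unif V ~= 0"
proof -
 obtain u where u: "u \<in> K" "u \<notin> V" using V by (auto simp: place_def)
 then have "u ~= 0" using subring_0[OF sub] by auto
 then have "inverse u \<in> K & inverse u \<in> nonunits V & inverse u ~= 0"
  using u K_inverse valuation_ring_cases[OF vr, of u] by (auto simp: nonunits_def)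
 then have "unif V \<in> K & unif V \<in> nonunits V & unif V ~= 0"
  unfolding unif_def by (rule someI)
 then show "unif V \<in> K" "unif V \<in> nonunits V" "unif V ~= 0" by auto
qed

lemma unif_not_emb: "unif V \<notin> range emb"
 using unif emb_nonunit[OF V] by fastforce

lemma val_rel_unique:
 assumes "val_rel V (unif V) u r" "val_rel V (unif V) u s" shows "r = s"
proof -
 let ?t = "unif V"
 obtain n m where nm: "n > 0" "r = real_of_int m / real n" "u ^ n * ?t powi (- m) \<in> vunits V"
  using assms(1) by (auto simp: val_rel_def)
 obtain n' m' where nm': "n' > 0" "s = real_of_int m' / real n'" "u ^ n' * ?t powi (- m') \<in> vunits V"
  using assms(2) by (auto simp: val_rel_def)
 have t0: "?t ~= 0" by (rule unif)
 have u0: "u ~= 0" using nm(1,3) by (auto simp: vunits_def zero_power)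
 have "(u ^ n * ?t powi (- m)) ^ n' * inverse ((u ^ n' * ?t powi (- m')) ^ n) \<in> vunits V"
  by (intro vunits_mult[OF vr] vunits_inverse[OF vr] vunits_power[OF vr] nm(3) nm'(3))
 also have "(u ^ n * ?t powi (- m)) ^ n' * inverse ((u ^ n' * ?t powi (- m')) ^ n) = ?t powi (m' * int n - m * int n')"
 proof -
  have "(u ^ n * ?t powi (- m)) ^ n' = u ^ (n * n') * ?t powi (- m * int n')"
   by (simp only: power_mult_distrib power_mult[symmetric] powi_pow)
  moreover have "(u ^ n' * ?t powi (- m')) ^ n = u ^ (n * n') * ?t powi (- m' * int n)"
   by (simp only: power_mult_distrib power_mult[symmetric] powi_pow mult.commute[of n' n])
  moreover have "w * ?t powi a * inverse (w * ?t powi b) = ?t powi (a - b)" if "w ~= 0" for w a b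
   using that t0 by (simp add: power_int_diff field_simps)
  moreover have "u ^ (n * n') ~= 0" using u0 by simp
  moreover have "- m * int n' - - m' * int n = m' * int n - m * int n'" by simp
  ultimately show ?thesis by presburger
 qed
 finally have "m' * int n - m * int n' = 0" using power_int_vunits[OF vr unif(2,3)] by blast
 then have "real_of_int (m' * int n) = real_of_int (m * int n')" by simp
 then show ?thesis unfolding nm(2) nm'(2) using nm(1) nm'(1) by (simp add: frac_eq_eq)
qed

lemma evp_order:
 assumes "p ~= 0" shows "\<exists>e. evp p (unif V) * unif V powi (- int e) \<in> vunits V"
proof -
 let ?t = "unif V"
 obtain e q where q: "p = monom 1 e * q" "coeff q 0 ~= 0" using shift_out_0[OF assms] by blast
 obtain a c where ac: "q = pCons c a" by (metis pCons_cases)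
 have c: "c ~= 0" using q ac by simp
 have "evp a ?t \<in> V" using evp_subring[OF sub, of ?t a] unif(2) place_emb[OF V] by (auto simp: nonunits_def)
 then have "?t * evp a ?t \<in> nonunits V" using nonunits_mult[OF vr] unif(2) by blast
 then have "emb c + ?t * evp a ?t \<in> V & emb c + ?t * evp a ?t \<notin> nonunits V"
  using unit_add_nonunit[OF vr place_emb[OF V, of c]] emb_nonunit[OF V] c by blast
 then have "evp q ?t \<in> vunits V" unfolding ac evp_simps(8) using not_nonunit[OF vr] by (auto simp: vunits_def)
 moreover have "evp p ?t = ?t ^ e * evp q ?t" unfolding q(1) evp_simps(2) by (simp add: map_poly_monom poly_monom one)
 moreover have "?t ^ e * w * ?t powi (- int e) = w" for w using unif(3) by (simp add: power_int_minus)
 ultimately have "evp p ?t * ?t powi (- int e) \<in> vunits V" by (simp only:)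
 then show ?thesis by blast
qed

text \<open>u satisfies an equation over C[t] with t = \<open>unif V\<close>. Two of its terms have
  equal value, and each coefficient is a power of t times a unit, so a positive power of u is a
  power of t up to a unit.\<close>

lemma val_rel_exists:
 assumes u: "u \<in> K" "u ~= 0" shows "\<exists>r. val_rel V (unif V) u r"
proof -
 let ?t = "unif V"
 have t0: "?t ~= 0" by (rule unif)
 obtain P where P: "P ~= 0" "poly (eval2 emb ?t P) u = 0" using algebraic_relation[OF unif(1) unif_not_emb u(1)] .
 let ?p = "eval2 emb ?t P"
 define S where "S = {i. i \<le> degree ?p & coeff ?p i ~= 0}"
 have p0: "?p ~= 0" using P(1) eval2_eq_0[OF unif_not_emb] by blast
 have fin: "finite S" by (simp add: S_def)
 have "(\<Sum>i\<in>S. coeff ?p i * u ^ i) = (\<Sum>i\<le>degree ?p. coeff ?p i * u ^ i)"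
  by (rule sum.mono_neutral_left) (auto simp: S_def)
 then have "(\<Sum>i\<in>S. coeff ?p i * u ^ i) = 0" using P(2) by (simp add: poly_altdef)
 moreover have "degree ?p \<in> S" using p0 by (simp add: S_def)
 moreover have "coeff ?p i * u ^ i ~= 0" if "i \<in> S" for i using that u(2) by (simp add: S_def)
 ultimately have "\<exists>i\<in>S. \<exists>j\<in>S. i ~= j & (coeff ?p i * u ^ i) / (coeff ?p j * u ^ j) \<in> vunits V"
  using sum_zero_two_terms[OF vr fin, of "%i. coeff ?p i * u ^ i"] by blast
 then obtain i j where ij: "i \<in> S" "j \<in> S" "i ~= j" "(coeff ?p i * u ^ i) / (coeff ?p j * u ^ j) \<in> vunits V"
  by blast
 have "\<exists>e::nat. coeff ?p k * ?t powi (- int e) \<in> vunits V" if "k \<in> S" for k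
 proof -
  have "coeff P k ~= 0" using that coeff_eval2[of ?t P k] unfolding S_def by auto
  then show ?thesis using evp_order unfolding coeff_eval2 by blast
 qed
 then obtain e where e: "!!k. k \<in> S ==> coeff ?p k * ?t powi (- int (e k)) \<in> vunits V" by metis
 have main: "\<exists>r. val_rel V ?t u r" if kl: "k \<in> S" "l \<in> S" "l < k" "(coeff ?p k * u ^ k) / (coeff ?p l * u ^ l) \<in> vunits V" for k l
 proof -
  let ?a = "coeff ?p k * ?t powi (- int (e k))" and ?b = "coeff ?p l * ?t powi (- int (e l))"
  have cz: "coeff ?p k ~= 0" "coeff ?p l ~= 0" using kl by (auto simp: S_def)
  have "(coeff ?p k * u ^ k) / (coeff ?p l * u ^ l) * (inverse ?a * ?b) \<in> vunits V"
   by (intro vunits_mult[OF vr] vunits_inverse[OF vr] kl e)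
  also have "(coeff ?p k * u ^ k) / (coeff ?p l * u ^ l) * (inverse ?a * ?b) = u ^ (k - l) * ?t powi (- (int (e l) - int (e k)))"
  proof -
   have "u ^ k = u ^ l * u ^ (k - l)" using kl(3) by (simp flip: power_add)
   moreover have "a * (b * c) / (d * b) * (inverse (a * ?t powi - e1) * (d * ?t powi - e2)) = c * ?t powi (- (e2 - e1))"
    if "a ~= 0" "b ~= 0" "d ~= 0" for a b c d e1 e2 using that t0
    by (simp add: power_int_diff power_int_minus field_simps)
   moreover have "u ^ l ~= 0" using u(2) by simp
   ultimately show ?thesis using cz by (simp only:)
  qed
  finally have "val_rel V ?t u (real_of_int (int (e l) - int (e k)) / real (k - l))"
   unfolding val_rel_def using kl(3) by (intro exI[of _ "k - l"] exI[of _ "int (e l) - int (e k)"]) auto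
  then show ?thesis by blast
 qed
 show ?thesis
 proof (cases "j < i")
  case True then show ?thesis using main ij by blast
 next
  case False
  have "(coeff ?p j * u ^ j) / (coeff ?p i * u ^ i) \<in> vunits V" using vunits_inverse[OF vr ij(4)] by simp
  then show ?thesis using main[of j i] ij False by auto
 qed
qed

lemma val_eq: "val_rel V (unif V) u r ==> val V u = r"
 unfolding val_def using val_rel_unique by (intro the_equality) auto

lemma val_rel_val: "u \<in> K ==> u ~= 0 ==> val_rel V (unif V) u (val V u)"
 using val_rel_exists val_eq by metis

lemma val_mult:
 assumes "u \<in> K" "u ~= 0" "w \<in> K" "w ~= 0" shows "val V (u * w) = val V u + val V w"
proof (rule val_eq)
 let ?t = "unif V"
 obtain n m where nm: "n > 0" "val V u = real_of_int m / real n" "u ^ n * ?t powi (- m) \<in> vunits V"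
  using val_rel_val[OF assms(1,2)] by (auto simp: val_rel_def)
 obtain n' m' where nm': "n' > 0" "val V w = real_of_int m' / real n'" "w ^ n' * ?t powi (- m') \<in> vunits V"
  using val_rel_val[OF assms(3,4)] by (auto simp: val_rel_def)
 have t0: "?t ~= 0" by (rule unif)
 have "(u ^ n * ?t powi (- m)) ^ n' * (w ^ n' * ?t powi (- m')) ^ n \<in> vunits V"
  by (intro vunits_mult[OF vr] vunits_power[OF vr] nm(3) nm'(3))
 also have "(u ^ n * ?t powi (- m)) ^ n' * (w ^ n' * ?t powi (- m')) ^ n = (u * w) ^ (n * n') * ?t powi (- (m * int n' + m' * int n))"
 proof -
  have "(u ^ n * ?t powi (- m)) ^ n' = u ^ (n * n') * ?t powi (- (m * int n'))"
   by (simp only: power_mult_distrib power_mult[symmetric] powi_pow mult_minus_left)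
  moreover have "(w ^ n' * ?t powi (- m')) ^ n = w ^ (n * n') * ?t powi (- (m' * int n))"
   by (simp only: power_mult_distrib power_mult[symmetric] powi_pow mult.commute[of n' n] mult_minus_left)
  moreover have "?t powi (- (m * int n' + m' * int n)) = ?t powi (- (m * int n')) * ?t powi (- (m' * int n))"
   using t0 by (simp flip: power_int_add)
  ultimately show ?thesis by (simp only: power_mult_distrib mult_ac)
 qed
 finally have f: "(u * w) ^ (n * n') * ?t powi (- (m * int n' + m' * int n)) \<in> vunits V" .
 have "val V u + val V w = real_of_int (m * int n' + m' * int n) / real (n * n')"
  unfolding nm(2) nm'(2) using nm(1) nm'(1) by (simp add: add_frac_eq)
 moreover have "n * n' > 0" using nm(1) nm'(1) by simp
 ultimately show "val_rel V ?t (u * w) (val V u + val V w)" unfolding val_rel_def using f by blast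
qed

lemma val_vunit: "u \<in> vunits V ==> val V u = 0"
proof (rule val_eq)
 assume "u \<in> vunits V"
 then show "val_rel V (unif V) u 0" unfolding val_rel_def by (intro exI[of _ "1::nat"] exI[of _ "0::int"]) simp
qed

lemma val_1: "val V 1 = 0" by (rule val_vunit) (rule vunits_1[OF vr])

lemma val_inverse: assumes "u \<in> K" "u ~= 0" shows "val V (inverse u) = - val V u"
 using val_mult[OF assms K_inverse[OF assms(1)]] assms val_1 by auto

lemma val_divide: assumes "u \<in> K" "u ~= 0" "w \<in> K" "w ~= 0" shows "val V (u / w) = val V u - val V w"
 using val_mult[OF assms(1,2) K_inverse[OF assms(3)]] val_inverse[OF assms(3,4)] assms
 by (simp add: field_class.field_divide_inverse)

lemma val_power: assumes "u \<in> K" "u ~= 0" shows "val V (u ^ k) = real k * val V u"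
 by (induction k) (use assms val_1 val_mult[OF assms subring_power[OF K_subring assms(1)]] in \<open>auto simp: algebra_simps\<close>)

lemma val_nonneg: assumes "u \<in> K" "u ~= 0" shows "val V u \<ge> 0 \<longleftrightarrow> u \<in> V"
proof -
 let ?t = "unif V"
 have t0: "?t ~= 0" by (rule unif)
 obtain n m where nm: "n > 0" "val V u = real_of_int m / real n" "u ^ n * ?t powi (- m) \<in> vunits V"
  using val_rel_val[OF assms(1,2)] by (auto simp: val_rel_def)
 define w where "w = u ^ n * ?t powi (- m)"
 have uw: "u ^ n = w * ?t powi m" using t0 by (simp add: w_def power_int_minus)
 have wV: "w \<in> V" "inverse w \<in> V" "w ~= 0" using nm by (auto simp: w_def vunits_def)
 have tV: "?t \<in> V" using unif(2) by (auto simp: nonunits_def)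
 show ?thesis
 proof (cases "m \<ge> 0")
  case True
  then have "u ^ n \<in> V" using uw wV tV subring_mult[OF sub] subring_power[OF sub] by (simp add: power_int_def)
  then show ?thesis using V_power_root[OF vr _ nm(1)] nm True by simp
 next
  case False
  have "?t ^ nat (- m) = ?t * ?t ^ (nat (- m) - 1)" using False by (cases "nat (- m)") auto
  then have tn: "?t ^ nat (- m) \<in> nonunits V" using nonunits_mult[OF vr unif(2)] subring_power[OF sub tV] by metis
  have "inverse (u ^ n) = ?t ^ nat (- m) * inverse w" using uw False by (simp add: power_int_def field_simps)
  then have i: "inverse (u ^ n) \<in> nonunits V" using nonunits_mult[OF vr tn wV(2)] by simp
  have "u \<notin> V"
  proof
   assume "u \<in> V"
   then have "inverse (u ^ n) * u ^ n \<in> nonunits V" using nonunits_mult[OF vr i] subring_power[OF sub] by blast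
   then show False using assms(2) nonunits_1[OF vr] by simp
  qed
  moreover have "val V u < 0" using nm False by (simp add: divide_neg_pos)
  ultimately show ?thesis by simp
 qed
qed

lemma val_pos: assumes "u \<in> K" "u ~= 0" shows "val V u > 0 \<longleftrightarrow> u \<in> nonunits V"
 using val_nonneg[OF assms] val_nonneg[OF K_inverse[OF assms(1)]] val_inverse[OF assms] assms(2)
 by (auto simp: nonunits_def)

lemma val_emb: "c ~= 0 ==> val V (emb c) = 0"
 using place_emb[OF V, of c] place_emb[OF V, of "inverse c"] emb_eq_0 by (intro val_vunit) (auto simp: vunits_def emb_inverse)

end

text \<open>The clause \<open>u = 0\<close> replaces the value \<open>\<infinity>\<close> of a valuation at 0.\<close>

definition val_ge :: "'k set => 'k => real => bool" where
 "val_ge V u r \<longleftrightarrow> u \<in> K & (u = 0 \<or> val V u \<ge> r)"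

lemma val_ge_add:
 assumes V: "place V" and u: "val_ge V u r" and w: "val_ge V w r" shows "val_ge V (u + w) r"
proof -
 have K: "u + w \<in> K" using u w subring_add[OF K_subring] by (auto simp: val_ge_def)
 have aux: "val V (u + w) \<ge> r" if "val_ge V u r" "val_ge V w r" "u ~= 0" "w ~= 0" "u + w ~= 0" "val V u \<le> val V w" for u w
 proof -
  have k: "u \<in> K" "w \<in> K" "u + w \<in> K" "w / u \<in> K" "1 + w / u \<in> K" using that(1,2) K_divide subring_add[OF K_subring] subring_1[OF K_subring]
   by (auto simp: val_ge_def)
  have nz: "1 + w / u ~= 0" using that(3,5) by (simp add: field_simps)
  have "val V (w / u) \<ge> 0" using val_divide[OF V k(2) that(4) k(1) that(3)] that(6) by simp
  then have "w / u \<in> V" using val_nonneg[OF V k(4)] that by simp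
  then have "1 + w / u \<in> V" using valuation_ring_subring[OF place_valuation[OF V]] by (intro subring_add subring_1) auto
  then have "val V (1 + w / u) \<ge> 0" using val_nonneg[OF V k(5) nz] by simp
  moreover have "u * (1 + w / u) = u + w" using that(3) by (simp add: field_simps)
  ultimately show ?thesis using val_mult[OF V k(1) that(3) k(5) nz] that(1,3) by (simp add: val_ge_def)
 qed
 show ?thesis
 proof (cases "u = 0 \<or> w = 0 \<or> u + w = 0")
  case True then show ?thesis using u w K by (auto simp: val_ge_def)
 next
  case False
  then show ?thesis using aux[OF u w] aux[OF w u] K by (cases "val V u \<le> val V w") (auto simp: val_ge_def add.commute)
 qed
qed

lemma val_ge_mult:
 assumes V: "place V" and u: "val_ge V u r" and w: "val_ge V w s" shows "val_ge V (u * w) (r + s)"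
 using assms val_mult[OF V, of u w] subring_mult[OF K_subring] unfolding val_ge_def by fastforce

lemma val_ge_uminus: "place V ==> val_ge V u r ==> val_ge V (- u) r"
proof -
 assume V: "place V" and u: "val_ge V u r"
 have "emb (- 1) = - 1" by (simp add: uminus one)
 then have "val_ge V (- 1) 0" using K_emb[of "-1"] val_emb[OF V, of "-1"] by (auto simp: val_ge_def)
 from val_ge_mult[OF V this u] show ?thesis by simp
qed

lemma val_ge_diff: "place V ==> val_ge V u r ==> val_ge V w r ==> val_ge V (u - w) r"
 using val_ge_add[of V u r "- w"] val_ge_uminus by simp

lemma val_ge_mono: "val_ge V u r ==> s \<le> r ==> val_ge V u s"
 by (auto simp: val_ge_def)

lemma val_ge_V: "place V ==> val_ge V u 0 \<longleftrightarrow> u \<in> K & u \<in> V"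
 using val_nonneg subring_0[OF place_subring] by (auto simp: val_ge_def)

lemma val_ge_emb: "place V ==> val_ge V (emb c) 0"
 using val_ge_V K_emb place_emb by blast

lemma val_ge_0: "val_ge V 0 r"
 using subring_0[OF K_subring] by (auto simp: val_ge_def)

lemma val_ge_sum:
 assumes V: "place V" and "!!i. i \<in> I ==> val_ge V (f i) r" shows "val_ge V (\<Sum>i\<in>I. f i) r"
 using assms(2) by (induction I rule: infinite_finite_induct) (auto intro: val_ge_add[OF V] val_ge_0)

lemma val_ge_power:
 assumes V: "place V" and u: "val_ge V u r" shows "val_ge V (u ^ k) (real k * r)"
proof (induction k)
 case 0 show ?case using val_ge_emb[OF V, of 1] by (simp add: one)
next
 case (Suc k) from val_ge_mult[OF V u Suc] show ?case by (simp add: algebra_simps)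
qed

end

section \<open>Existence of generic points\<close>

text \<open>Places C[x,y] inside an algebraic closure of C(x,y), in which the generic points take
  their coordinates.\<close>

definition tower :: "complex poly poly => complex poly poly fract alg_closure" where
 "tower H = to_ac (to_fract H)"

lemma tower_hom: "comm_hom tower"
 by unfold_locales (auto simp: tower_def)

lemma tower_eq_0: "tower H = 0 \<longleftrightarrow> H = 0"
 by (simp add: tower_def)

definition tower_emb :: "complex => complex poly poly fract alg_closure" where
 "tower_emb c = tower [:[:c:]:]"

lemma tower_emb_hom: "cpx_hom tower_emb"
proof -
 interpret t: comm_hom tower by (rule tower_hom)
 show ?thesis
  by unfold_locales (auto simp: tower_emb_def simp flip: t.add t.mult t.one one_pCons)
qed

lemma tower_eval: "poly (map_poly (%H. poly (map_poly tower_emb H) (tower [:[:0, 1:]:])) G) (tower [:0, 1:]) = tower G"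
proof -
 interpret t: comm_hom tower by (rule tower_hom)
 interpret i: cpx_hom tower_emb by (rule tower_emb_hom)
 have 1: "poly (map_poly tower_emb H) (tower [:[:0, 1:]:]) = tower [:H:]" for H
 proof (induction H)
  case (pCons c H)
  have "[:pCons c H:] = [:[:c:]:] + [:[:0, 1:]:] * [:H:]" by simp
  then have "tower [:pCons c H:] = tower_emb c + tower [:[:0, 1:]:] * tower [:H:]"
   by (metis t.add t.mult tower_emb_def)
  then show ?case using pCons by (simp add: map_poly_pCons)
 qed simp
 show ?thesis unfolding 1
 proof (induction G)
  case (pCons H G)
  have "pCons H G = [:H:] + [:0, 1:] * G" by simp
  then have "tower (pCons H G) = tower [:H:] + tower [:0, 1:] * tower G" by (metis t.add t.mult)
  then show ?case using pCons by (simp add: map_poly_pCons)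
 qed simp
qed

text \<open>In a frame where F is monic in z up to a constant, x and y remain independent variables
  and z is a root of F. If F does not divide H, elimination puts a nonzero r(x,y) into the ideal (F,
  H); as r does not vanish at the point, neither does H.\<close>

theorem generic_point_exists:
 assumes F: "irred F" "homogeneous n F"
 shows "\<exists>xi. generic_point tower_emb xi F n"
proof -
 interpret t: comm_hom tower by (rule tower_hom)
 interpret i: cpx_hom tower_emb by (rule tower_emb_hom)
 have n: "n > 0" using F irreducible_degree_pos by blast
 have "F ~= 0" using F by auto
 then obtain v where v: "ev id F v ~= 0" using exists_ev_nonzero by blast
 then have "v ~= 0" using idc.ev_homogeneous_0[OF F(2) n] by auto
 then obtain A A' :: "complex ^ 3 ^ 3" where A: "A ** A' = mat 1" "A' ** A = mat 1" "column 3 A = v"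
  using exists_frame by blast
 let ?F = "frame A F"
 have hF: "homogeneous n ?F" "irred ?F" using homogeneous_frame frame_irreducible A F by blast+
 have "ev id ?F (vec3 0 0 1) ~= 0" using v by (simp add: idc.ev_frame mv_e3 A)
 then have deg: "degree ?F = n" and lc: "coeff ?F n = [:[:ev id ?F (vec3 0 0 1):]:]" "ev id ?F (vec3 0 0 1) ~= 0"
  using homogeneous_monic[OF hF(1) refl] by auto
 have "coeff (map_poly tower ?F) n ~= 0" using lc by (simp add: coeff_map_poly tower_eq_0)
 then have "degree (map_poly tower ?F) > 0" using n le_degree by fastforce
 then obtain z where z: "poly (map_poly tower ?F) z = 0" using alg_closed_imp_poly_has_root by blast
 define \<eta> where "\<eta> = vec3 (tower [:[:0, 1:]:]) (tower [:0, 1:]) z"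
 have ev: "ev tower_emb H \<eta> = poly (map_poly tower H) z" for H
  by (simp add: ev_def subst3_def \<eta>_def tower_eval)
 have dvd: "ev tower_emb H \<eta> = 0 \<longleftrightarrow> ?F dvd H" for H
 proof
  assume H: "ev tower_emb H \<eta> = 0"
  show "?F dvd H"
  proof (rule ccontr)
   assume "~ ?F dvd H"
   then obtain U W r where r: "r ~= 0" "U * ?F + W * H = [:r:]"
    using prime_elimination[of ?F H] hF deg n by (auto simp: irreducible_imp_prime_elem)
   have "ev tower_emb [:r:] \<eta> = 0" unfolding r(2)[symmetric] i.ev_add i.ev_mult H using ev[of ?F] z by simp
   then show False using r(1) by (simp add: ev map_poly_pCons tower_eq_0)
  qed
 qed (use i.ev_dvd ev[of ?F] z in auto)
 have "generic_point tower_emb (mv tower_emb A \<eta>) F n"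
 proof (intro generic_point.intro tower_emb_hom generic_point_axioms.intro F)
  fix G
  show "ev tower_emb G (mv tower_emb A \<eta>) = 0 \<longleftrightarrow> F dvd G"
   unfolding i.ev_frame[symmetric] dvd by (rule frame_dvd_iff[OF A(1,2)])
 qed
 then show ?thesis by blast
qed

section \<open>Comparison with the function field and the normalization\<close>

text \<open>Turns a subring of a type-class ring into a ring record with the same operations, so
  that it can be compared with \<open>function_field\<close>.\<close>

definition rng :: "'a::comm_ring_1 set => 'a ring" where
 "rng S = \<lparr>carrier = S, monoid.mult = (*), one = 1, zero = 0, add = (+)\<rparr>"

lemma rng_simps [simp]: "carrier (rng S) = S" "x \<otimes>\<^bsub>rng S\<^esub> y = x * y" "\<one>\<^bsub>rng S\<^esub> = 1" "\<zero>\<^bsub>rng S\<^esub> = 0" "x \<oplus>\<^bsub>rng S\<^esub> y = x + y"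
 by (simp_all add: rng_def)

lemma rng_carrier_update [simp]: "(rng S)\<lparr>carrier := T\<rparr> = rng T"
 by (simp add: rng_def)

lemma rng_cring:
 assumes S: "is_subring S" shows "cring (rng S)"
proof (rule cringI)
 show "abelian_group (rng S)"
 proof (rule abelian_groupI)
  fix x assume "x \<in> carrier (rng S)"
  then show "\<exists>y\<in>carrier (rng S). y \<oplus>\<^bsub>rng S\<^esub> x = \<zero>\<^bsub>rng S\<^esub>"
   using subring_uminus[OF S] by (intro bexI[of _ "- x"]) auto
 qed (use subring_closed[OF S] in \<open>auto simp: add_ac\<close>)
 show "comm_monoid (rng S)"
  by (rule comm_monoidI) (use subring_closed[OF S] in \<open>auto simp: mult_ac\<close>)
qed (simp add: algebra_simps)

lemma rng_minus: "is_subring S ==> x \<in> S ==> y \<in> S ==> x \<ominus>\<^bsub>rng S\<^esub> y = x - y"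
proof -
 assume S: "is_subring S" and x: "x \<in> S" and y: "y \<in> S"
 interpret cring "rng S" by (rule rng_cring[OF S])
 have "\<ominus>\<^bsub>rng S\<^esub> y = - y" using subring_uminus[OF S y] y by (intro minus_equality) auto
 then show ?thesis by (simp add: a_minus_def)
qed

lemma rng_finsum:
 assumes S: "is_subring S" and f: "!!i. i \<in> A ==> f i \<in> S" "finite A"
 shows "finsum (rng S) f A = sum f A"
proof -
 interpret cring "rng S" by (rule rng_cring[OF S])
 show ?thesis using f(2,1) by (induction A rule: finite_induct) (auto simp: finsum_insert)
qed

text \<open>Maximality tested on elements: whatever lies outside M is invertible modulo M. In this
  shape it passes through an isomorphism clause by clause.\<close>

lemma (in cring) maximalideal_iff:
 "maximalideal M R \<longleftrightarrow> M \<subseteq> carrier R & \<zero> \<in> M & (\<forall>x\<in>M. \<forall>y\<in>M. x \<ominus> y \<in> M) & (\<forall>x\<in>M. \<forall>s\<in>carrier R. x \<otimes> s \<in> M) & \<one> \<notin> M &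
   (\<forall>r\<in>carrier R - M. \<exists>s\<in>carrier R. \<one> \<ominus> r \<otimes> s \<in> M)"
proof
 assume "maximalideal M R"
 then interpret M: maximalideal M R .
 have one: "\<one> \<notin> M" using M.I_notcarr M.one_imp_carrier by blast
 have "\<exists>s\<in>carrier R. \<one> \<ominus> r \<otimes> s \<in> M" if r: "r \<in> carrier R - M" for r
 proof -
  have i: "ideal (M <+>\<^bsub>R\<^esub> PIdl r) R" using r by (intro add_ideals cgenideal_ideal M.is_ideal) auto
  have sub: "M \<subseteq> M <+>\<^bsub>R\<^esub> PIdl r"
  proof
   fix m assume m: "m \<in> M"
   have "\<zero> \<in> PIdl r" using r additive_subgroup.zero_closed[OF ideal.axioms(1)[OF cgenideal_ideal]] by blast
   then have "m \<oplus> \<zero> \<in> M <+>\<^bsub>R\<^esub> PIdl r" using m unfolding set_add_def' by blast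
   then show "m \<in> M <+>\<^bsub>R\<^esub> PIdl r" using M.Icarr[OF m] by simp
  qed
  have "\<zero> \<oplus> r \<in> M <+>\<^bsub>R\<^esub> PIdl r"
   using r cgenideal_self[of r] M.zero_closed unfolding set_add_def' by blast
  then have "r \<in> M <+>\<^bsub>R\<^esub> PIdl r" using r by simp
  then have "M <+>\<^bsub>R\<^esub> PIdl r = carrier R"
   using M.I_maximal[OF i sub] ideal.Icarr[OF i] r by blast
  then have "\<one> \<in> M <+>\<^bsub>R\<^esub> PIdl r" by simp
  then obtain m s where ms: "m \<in> M" "s \<in> carrier R" "\<one> = m \<oplus> s \<otimes> r" by (auto simp: set_add_def' cgenideal_def)
  then have "\<one> \<ominus> r \<otimes> s = m" using r M.Icarr by (simp add: m_comm[of s r] a_minus_def a_assoc r_neg)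
  then show ?thesis using ms by blast
 qed
 then show "M \<subseteq> carrier R & \<zero> \<in> M & (\<forall>x\<in>M. \<forall>y\<in>M. x \<ominus> y \<in> M) & (\<forall>x\<in>M. \<forall>s\<in>carrier R. x \<otimes> s \<in> M) & \<one> \<notin> M &
   (\<forall>r\<in>carrier R - M. \<exists>s\<in>carrier R. \<one> \<ominus> r \<otimes> s \<in> M)"
  using one M.I_r_closed M.Icarr by (auto simp: a_minus_def)
next
 assume *: "M \<subseteq> carrier R & \<zero> \<in> M & (\<forall>x\<in>M. \<forall>y\<in>M. x \<ominus> y \<in> M) & (\<forall>x\<in>M. \<forall>s\<in>carrier R. x \<otimes> s \<in> M) & \<one> \<notin> M &
   (\<forall>r\<in>carrier R - M. \<exists>s\<in>carrier R. \<one> \<ominus> r \<otimes> s \<in> M)"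
 then have sub: "M \<subseteq> carrier R" and z: "\<zero> \<in> M" and d: "!!x y. x \<in> M ==> y \<in> M ==> x \<ominus> y \<in> M"
  and m: "!!x s. x \<in> M ==> s \<in> carrier R ==> x \<otimes> s \<in> M" and o: "\<one> \<notin> M"
  and r: "!!r. r \<in> carrier R - M ==> \<exists>s\<in>carrier R. \<one> \<ominus> r \<otimes> s \<in> M" by blast+
 have neg: "\<ominus> y \<in> M" if "y \<in> M" for y
 proof -
  have "y \<in> carrier R" using that sub by blast
  then have "\<zero> \<ominus> y = \<ominus> y" by (simp add: a_minus_def)
  then show ?thesis using d[OF z that] by simp
 qed
 have ad: "x \<oplus> y \<in> M" if "x \<in> M" "y \<in> M" for x y
 proof -
  have "x \<in> carrier R" "y \<in> carrier R" using that sub by blast+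
  then have "x \<ominus> (\<ominus> y) = x \<oplus> y" by (simp add: a_minus_def)
  then show ?thesis using d[OF that(1) neg[OF that(2)]] by simp
 qed
 have i: "ideal M R"
 proof (rule idealI[OF ring_axioms])
  show "subgroup M (add_monoid R)"
   by (rule add.subgroupI) (use sub z neg ad in \<open>auto simp: a_inv_def\<close>)
  fix a x assume ax: "a \<in> M" "x \<in> carrier R"
  then show "a \<otimes> x \<in> M" by (rule m)
  then show "x \<otimes> a \<in> M" using ax sub m_comm[of a x] by auto
 qed
 show "maximalideal M R"
 proof (rule maximalidealI[OF i])
  show "carrier R ~= M" using o one_closed by blast
  fix J assume J: "ideal J R" "M \<subseteq> J" "J \<subseteq> carrier R"
  show "J = M \<or> J = carrier R"
  proof (cases "J = M")
   case False
   then obtain x where x: "x \<in> J" "x \<notin> M" using J by blast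
   then obtain s where s: "s \<in> carrier R" "\<one> \<ominus> x \<otimes> s \<in> M" using r J by blast
   interpret J: ideal J R by (rule J(1))
   have "x \<otimes> s \<in> J" using x s J.I_r_closed by blast
   moreover have "(\<one> \<ominus> x \<otimes> s) \<oplus> x \<otimes> s = \<one>" using x s J by (auto simp: a_minus_def a_assoc l_neg)
   ultimately have "\<one> \<in> J" using s(2) J(2) J.a_closed by (metis subsetD)
   then show ?thesis using J.one_imp_carrier by blast
  qed simp
 qed
qed

lemma maximalideal_rng:
 assumes R: "cring R" and S: "is_subring S" and h: "h \<in> ring_iso R (rng S)" and M: "M \<subseteq> carrier R"
 shows "maximalideal M R \<longleftrightarrow> max_ideal (h ` M) S"
proof -
 interpret R: cring R by (rule R)
 interpret S: cring "rng S" by (rule rng_cring[OF S])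
 have hh: "h \<in> ring_hom R (rng S)" and bij: "bij_betw h (carrier R) S" using h by (auto simp: ring_iso_def)
 then interpret h: ring_hom_cring R "rng S" h by (unfold_locales) auto
 have inj: "inj_on h (carrier R)" and im: "h ` carrier R = S" using bij by (auto simp: bij_betw_def)
 have mem: "h x \<in> h ` M \<longleftrightarrow> x \<in> M" if "x \<in> carrier R" for x using inj M that by (auto dest: inj_onD)
 have hm: "h (x \<ominus>\<^bsub>R\<^esub> y) = h x - h y" if "x \<in> carrier R" "y \<in> carrier R" for x y
 proof -
  have "h (x \<ominus>\<^bsub>R\<^esub> y) = h x \<ominus>\<^bsub>rng S\<^esub> h y" using that by (simp add: a_minus_def)
  then show ?thesis using that im by (subst (asm) rng_minus[OF S]) auto
 qed
 have ht: "h (x \<otimes>\<^bsub>R\<^esub> y) = h x * h y" if "x \<in> carrier R" "y \<in> carrier R" for x y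
  using that h.hom_mult by simp
 have Mc: "x \<in> carrier R" if "x \<in> M" for x using that M by blast
 have e1: "\<zero>\<^bsub>R\<^esub> \<in> M \<longleftrightarrow> 0 \<in> h ` M" using mem[of "\<zero>\<^bsub>R\<^esub>"] h.hom_zero by simp
 have e2: "\<one>\<^bsub>R\<^esub> \<in> M \<longleftrightarrow> 1 \<in> h ` M" using mem[of "\<one>\<^bsub>R\<^esub>"] h.hom_one by simp
 have e3: "(\<forall>x\<in>M. \<forall>y\<in>M. x \<ominus>\<^bsub>R\<^esub> y \<in> M) \<longleftrightarrow> (\<forall>x\<in>h ` M. \<forall>y\<in>h ` M. x - y \<in> h ` M)"
 proof -
  have "x \<ominus>\<^bsub>R\<^esub> y \<in> M \<longleftrightarrow> h x - h y \<in> h ` M" if "x \<in> M" "y \<in> M" for x y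
   using mem[of "x \<ominus>\<^bsub>R\<^esub> y"] hm[OF Mc[OF that(1)] Mc[OF that(2)]] Mc[OF that(1)] Mc[OF that(2)] R.minus_closed by metis
  then show ?thesis by blast
 qed
 have e4: "(\<forall>x\<in>M. \<forall>s\<in>carrier R. x \<otimes>\<^bsub>R\<^esub> s \<in> M) \<longleftrightarrow> (\<forall>x\<in>h ` M. \<forall>s\<in>S. x * s \<in> h ` M)"
 proof -
  have "x \<otimes>\<^bsub>R\<^esub> s \<in> M \<longleftrightarrow> h x * h s \<in> h ` M" if "x \<in> M" "s \<in> carrier R" for x s
   using mem[of "x \<otimes>\<^bsub>R\<^esub> s"] ht[OF Mc[OF that(1)] that(2)] Mc[OF that(1)] that(2) R.m_closed by metis
  then show ?thesis unfolding im[symmetric] by blast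
 qed
 have inner: "(\<exists>s\<in>carrier R. \<one>\<^bsub>R\<^esub> \<ominus>\<^bsub>R\<^esub> r \<otimes>\<^bsub>R\<^esub> s \<in> M) \<longleftrightarrow> (\<exists>s\<in>S. 1 - h r * s \<in> h ` M)" if r: "r \<in> carrier R" for r
 proof -
  have "\<one>\<^bsub>R\<^esub> \<ominus>\<^bsub>R\<^esub> r \<otimes>\<^bsub>R\<^esub> s \<in> M \<longleftrightarrow> 1 - h r * h s \<in> h ` M" if "s \<in> carrier R" for s
   using mem[of "\<one>\<^bsub>R\<^esub> \<ominus>\<^bsub>R\<^esub> r \<otimes>\<^bsub>R\<^esub> s"] hm[of "\<one>\<^bsub>R\<^esub>" "r \<otimes>\<^bsub>R\<^esub> s"] ht[OF r that] r that h.hom_one by simp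
  then show ?thesis unfolding im[symmetric] by auto
 qed
 have set: "S - h ` M = h ` (carrier R - M)" unfolding im[symmetric] using inj M by (auto dest: inj_onD)
 have e5: "(\<forall>r\<in>carrier R - M. \<exists>s\<in>carrier R. \<one>\<^bsub>R\<^esub> \<ominus>\<^bsub>R\<^esub> r \<otimes>\<^bsub>R\<^esub> s \<in> M) \<longleftrightarrow> (\<forall>r\<in>S - h ` M. \<exists>s\<in>S. 1 - r * s \<in> h ` M)"
  unfolding set using inner by auto
 have "h ` M \<subseteq> S" using M im by blast
 then show ?thesis unfolding R.maximalideal_iff max_ideal_def e1 e2 e3 e4 e5 using M by simp
qed

lemma card_Collect_eq_1: "card {x. P x} = 1 \<longleftrightarrow> (\<exists>!x. P x)"
proof
 assume "\<exists>!x. P x" then show "card {x. P x} = 1" unfolding One_nat_def card_1_singleton_iff by auto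
next
 assume "card {x. P x} = 1"
 then obtain a where "{x. P x} = {a}" unfolding One_nat_def card_1_singleton_iff by blast
 then have "P x \<longleftrightarrow> x = a" for x by blast
 then show "\<exists>!x. P x" by simp
qed

lemma integral_iff_sum:
 fixes x :: "'a::comm_ring_1"
 assumes A: "is_subring A"
 shows "integral A x \<longleftrightarrow> (\<exists>(n::nat) a. (\<forall>i<n. a i \<in> A) & x ^ n + (\<Sum>i<n. a i * x ^ i) = 0)"
proof
 assume "integral A x"
 then obtain p where p: "lead_coeff p = 1" "coeffs_in A p" "poly p x = 0" by (auto simp: integral_def)
 have "poly p x = x ^ degree p + (\<Sum>i<degree p. coeff p i * x ^ i)"
  using p(1) by (simp add: poly_altdef lessThan_Suc_atMost[symmetric])
 then show "\<exists>(n::nat) a. (\<forall>i<n. a i \<in> A) & x ^ n + (\<Sum>i<n. a i * x ^ i) = 0"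
  using p by (intro exI[of _ "degree p"] exI[of _ "coeff p"]) (auto simp: coeffs_in_def)
next
 assume "\<exists>(n::nat) a. (\<forall>i<n. a i \<in> A) & x ^ n + (\<Sum>i<n. a i * x ^ i) = 0"
 then obtain n a where na: "!!i. i < (n::nat) ==> a i \<in> A" "x ^ n + (\<Sum>i<n. a i * x ^ i) = 0" by blast
 define p where "p = monom 1 n + (\<Sum>i<n. monom (a i) i)"
 have c: "coeff p k = (if k = n then 1 else if k < n then a k else 0)" for k
  by (simp add: p_def coeff_sum coeff_monom)
 have "degree p = n"
 proof (rule antisym)
  show "degree p \<le> n" by (rule degree_le) (auto simp: c)
  show "n \<le> degree p" by (rule le_degree) (simp add: c)
 qed
 then have "lead_coeff p = 1" by (simp add: c)
 moreover have "coeffs_in A p" using na(1) subring_0[OF A] subring_1[OF A] by (auto simp: coeffs_in_def c)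
 moreover have "poly p x = 0" using na(2) by (simp add: p_def poly_monom poly_sum)
 ultimately show "integral A x" unfolding integral_def by blast
qed

section \<open>The isomorphism of the function field with \<open>K\<close>\<close>

context generic_point
begin

definition gens :: "cpoly3 => cpoly3 => bool" where
 "gens G H \<longleftrightarrow> (\<exists>m. homogeneous m G & homogeneous m H) & ev emb H xi ~= 0"

text \<open>The value of a fraction at \<open>xi\<close>. An admissible representation has to be
  selected, because in another representation of the same fraction the denominator may vanish at
  \<open>xi\<close>.\<close>

definition psi :: "cpoly3 fract => 'k" where
 "psi f = (case (SOME (G, H). gens G H & f = Fract G H) of (G, H) => ev emb G xi / ev emb H xi)"

lemma gens_nz: "gens G H ==> H ~= 0"
 by (auto simp: gens_def)

lemma psi_Fract: "gens G H ==> psi (Fract G H) = ev emb G xi / ev emb H xi"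
proof -
 assume GH: "gens G H"
 obtain G' H' where e: "(SOME (G', H'). gens G' H' & Fract G H = Fract G' H') = (G', H')" by fastforce
 have "\<exists>p. (case p of (G', H') => gens G' H' & Fract G H = Fract G' H')" using GH by blast
 from someI_ex[OF this] have g: "gens G' H'" "Fract G H = Fract G' H'" unfolding e by auto
 then have "G * H' = G' * H" using gens_nz GH by (simp add: eq_fract)
 then have "ev emb G xi * ev emb H' xi = ev emb G' xi * ev emb H xi" by (metis ev_mult)
 then show ?thesis unfolding psi_def e using g GH by (simp add: gens_def frac_eq_eq)
qed

definition Gc :: "cpoly3 fract set" where "Gc = {Fract G H |G H. gens G H}"

lemma generic_ring_eq: "generic_ring C = rng Gc"
 unfolding generic_ring_def rng_def Gc_def gens_def using C_iff by (intro ring.equality) (auto, metis+)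

lemma Gc_ops:
 assumes "gens G H" "gens G' H'"
 shows "Fract G H - Fract G' H' = Fract (G * H' - G' * H) (H * H')" "gens (G * H' - G' * H) (H * H')"
  "Fract G H * Fract G' H' = Fract (G * G') (H * H')" "gens (G * G') (H * H')"
proof -
 obtain m k where *: "homogeneous m G" "homogeneous m H" "homogeneous k G'" "homogeneous k H'" "ev emb H xi ~= 0" "ev emb H' xi ~= 0"
  using assms by (auto simp: gens_def)
 show "gens (G * H' - G' * H) (H * H')" using fraction_diff(1,2)[OF *] *(5,6) by (auto simp: gens_def ev_mult)
 show "gens (G * G') (H * H')" using homogeneous_mult[OF *(1,3)] homogeneous_mult[OF *(2,4)] *(5,6) by (auto simp: gens_def ev_mult)
qed (use assms gens_nz in \<open>simp_all add: mult.commute\<close>)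

lemma psi_ops:
 assumes "f \<in> Gc" "g \<in> Gc"
 shows "psi (f - g) = psi f - psi g" "psi (f * g) = psi f * psi g" "f - g \<in> Gc" "f * g \<in> Gc"
proof -
 obtain G H G' H' where *: "f = Fract G H" "g = Fract G' H'" "gens G H" "gens G' H'" using assms unfolding Gc_def by blast
 note o = Gc_ops[OF *(3,4)]
 have nz: "ev emb H xi ~= 0" "ev emb H' xi ~= 0" using * by (auto simp: gens_def)
 show "psi (f - g) = psi f - psi g" unfolding *(1,2) o(1) psi_Fract[OF o(2)] psi_Fract[OF *(3)] psi_Fract[OF *(4)]
  using nz by (simp add: ev_simps field_simps)
 show "psi (f * g) = psi f * psi g" unfolding *(1,2) o(3) psi_Fract[OF o(4)] psi_Fract[OF *(3)] psi_Fract[OF *(4)]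
  using nz by (simp add: ev_simps field_simps)
 show "f - g \<in> Gc" "f * g \<in> Gc" unfolding *(1,2) o(1) o(3) Gc_def using o(2,4) by blast+
qed

lemma gens_1: "gens 1 1" by (auto simp: gens_def intro: exI[of _ 0])

lemma psi_1: "psi 1 = 1" "1 \<in> Gc"
 using psi_Fract[OF gens_1] gens_1 by (auto simp: One_fract_def Gc_def)

lemma Gc_subring: "is_subring Gc"
 using psi_ops(3,4) psi_1(2) by (auto simp: is_subring_def)

lemma psi_image: "psi ` Gc = K"
proof -
 have "psi ` Gc = {ev emb G xi / ev emb H xi |G H. gens G H}"
  unfolding Gc_def using psi_Fract by (force simp: image_def)
 also have "\<dots> = K" unfolding K_def gens_def by blast
 finally show ?thesis .
qed

lemma psi_hom: "ring_hom_ring (generic_ring C) (rng K) psi"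
proof (rule ring_hom_ringI)
 show "ring (generic_ring C)" unfolding generic_ring_eq using rng_cring[OF Gc_subring] cring.axioms(1) by blast
 show "ring (rng K)" using rng_cring[OF K_subring] cring.axioms(1) by blast
 show "psi \<one>\<^bsub>generic_ring C\<^esub> = \<one>\<^bsub>rng K\<^esub>" by (simp add: generic_ring_eq psi_1)
 fix x y assume "x \<in> carrier (generic_ring C)" "y \<in> carrier (generic_ring C)"
 then have xy: "x \<in> Gc" "y \<in> Gc" by (auto simp: generic_ring_eq)
 show "psi (x \<otimes>\<^bsub>generic_ring C\<^esub> y) = psi x \<otimes>\<^bsub>rng K\<^esub> psi y" using psi_ops[OF xy] by (simp add: generic_ring_eq)
 have "x + y = x - (0 - y)" by simp
 moreover have "0 - y \<in> Gc" "psi (0 - y) = psi 0 - psi y" "psi 0 = psi 1 - psi 1"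
  using psi_ops(1,3)[OF subring_0[OF Gc_subring] xy(2)] psi_ops(1)[OF psi_1(2) psi_1(2)] by auto
 ultimately show "psi (x \<oplus>\<^bsub>generic_ring C\<^esub> y) = psi x \<oplus>\<^bsub>rng K\<^esub> psi y" using psi_ops(1)[OF xy(1), of "0 - y"] by (simp add: generic_ring_eq)
qed (use psi_image in \<open>auto simp: generic_ring_eq\<close>)

lemma generic_ideal_eq: "generic_ideal C = a_kernel (generic_ring C) (rng K) psi"
proof -
 have "a_kernel (generic_ring C) (rng K) psi = {f \<in> Gc. psi f = 0}" by (auto simp: a_kernel_def' generic_ring_eq)
 also have "\<dots> = {Fract G H |G H. gens G H & ev emb G xi = 0}"
  unfolding Gc_def using psi_Fract by (force simp: gens_def)
 also have "\<dots> = generic_ideal C"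
 proof -
  have "gens G H & ev emb G xi = 0 \<longleftrightarrow> (\<exists>n. homogeneous n G & homogeneous n H) &
    ~ (\<forall>q\<in>C. vanishes_at H q) & (\<forall>q\<in>C. vanishes_at G q)" for G H
   unfolding gens_def using C_iff by blast
  then show ?thesis unfolding generic_ideal_def by (simp only:)
 qed
 finally show ?thesis ..
qed

abbreviation "FF \<equiv> function_field C"

text \<open>The isomorphism induced by \<open>psi\<close> on the quotient: \<open>psi\<close> is
  constant on each coset of its kernel, so the image of a coset is a singleton.\<close>

definition hh :: "cpoly3 fract set => 'k" where "hh = (%Y. the_elem (psi ` Y))"

lemma hh_iso: "hh \<in> ring_iso FF (rng K)"
proof -
 interpret psi: ring_hom_ring "generic_ring C" "rng K" psi by (rule psi_hom)
 have "psi ` carrier (generic_ring C) = carrier (rng K)" by (simp add: generic_ring_eq psi_image)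
 then show ?thesis unfolding hh_def function_field_def generic_ideal_eq by (rule psi.FactRing_iso_set)
qed

lemma FF_cring: "cring FF"
proof -
 interpret psi: ring_hom_ring "generic_ring C" "rng K" psi by (rule psi_hom)
 have "cring (generic_ring C)" unfolding generic_ring_eq by (rule rng_cring[OF Gc_subring])
 then show ?thesis unfolding function_field_def generic_ideal_eq
  using ideal.quotient_is_cring[OF psi.kernel_is_ideal] by blast
qed

lemma hh_bij: "bij_betw hh (carrier FF) K"
 using hh_iso by (auto simp: ring_iso_def)

lemma hh_hom: "ring_hom_cring FF (rng K) hh"
 using hh_iso FF_cring rng_cring[OF K_subring]
 by (auto simp: ring_iso_def ring_hom_cring_def ring_hom_cring_axioms_def)

lemma hh_restrict: "f \<in> Gc ==> restrict_to_curve C f \<in> carrier FF & hh (restrict_to_curve C f) = psi f"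
proof -
 assume f: "f \<in> Gc"
 interpret psi: ring_hom_ring "generic_ring C" "rng K" psi by (rule psi_hom)
 interpret I: ideal "generic_ideal C" "generic_ring C" unfolding generic_ideal_eq by (rule psi.kernel_is_ideal)
 have fc: "f \<in> carrier (generic_ring C)" using f by (simp add: generic_ring_eq)
 have "restrict_to_curve C f \<in> carrier FF" unfolding function_field_def restrict_to_curve_def FactRing_def
  using psi.R.a_rcosetsI[OF I.a_subset fc] by simp
 moreover have "psi ` restrict_to_curve C f = {psi f}"
 proof -
  have "psi (i \<oplus>\<^bsub>generic_ring C\<^esub> f) = psi f" if "i \<in> generic_ideal C" for i
   using that fc unfolding generic_ideal_eq a_kernel_def' by (simp add: psi.hom_add)
  moreover have "f \<in> restrict_to_curve C f" unfolding restrict_to_curve_def using I.a_rcos_self[OF fc] .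
  ultimately show ?thesis unfolding restrict_to_curve_def a_r_coset_def' by blast
 qed
 ultimately show ?thesis by (simp add: hh_def)
qed

lemma hh_inv: assumes b: "b \<in> carrier FF" "hh b ~= 0"
 shows "inv\<^bsub>FF\<^esub> b \<in> carrier FF & hh (inv\<^bsub>FF\<^esub> b) = inverse (hh b)"
proof -
 interpret h: ring_hom_cring FF "rng K" hh by (rule hh_hom)
 have inj: "inj_on hh (carrier FF)" using hh_bij by (simp add: bij_betw_def)
 have "inverse (hh b) \<in> hh ` carrier FF" using hh_bij b K_inverse h.hom_closed by (auto simp: bij_betw_def)
 then obtain c where c: "c \<in> carrier FF" "hh c = inverse (hh b)" by auto
 have "hh (b \<otimes>\<^bsub>FF\<^esub> c) = hh \<one>\<^bsub>FF\<^esub>" using b c h.hom_mult h.hom_one by simp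
 then have "b \<otimes>\<^bsub>FF\<^esub> c = \<one>\<^bsub>FF\<^esub>" using inj_on_eq_iff[OF inj h.R.m_closed[OF b(1) c(1)] h.R.one_closed] by simp
 then have "inv\<^bsub>FF\<^esub> b = c" using b c by (intro h.R.comm_inv_char) auto
 then show ?thesis using c by simp
qed

lemma hh_pow: "x \<in> carrier FF ==> hh (x [^]\<^bsub>FF\<^esub> (i::nat)) = hh x ^ i"
proof -
 interpret h: ring_hom_cring FF "rng K" hh by (rule hh_hom)
 assume "x \<in> carrier FF"
 then show ?thesis by (induction i) (use h.hom_one h.hom_mult in \<open>simp_all add: mult.commute\<close>)
qed

context
 fixes q assumes q: "q \<in> C"
begin

lemma hh_local_ring: "hh ` local_ring C q = Ol q" "local_ring C q \<subseteq> carrier FF"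
proof -
 have g: "gens G H" if "\<exists>m. homogeneous m G & homogeneous m H" "~ vanishes_at H q" for G H
  using that nonvanishing[OF q] by (auto simp: gens_def)
 have e: "hh (restrict_to_curve C (Fract G H)) = ev emb G xi / ev emb H xi" "restrict_to_curve C (Fract G H) \<in> carrier FF"
  if "gens G H" for G H using hh_restrict[of "Fract G H"] psi_Fract[OF that] that by (auto simp: Gc_def)
 show "local_ring C q \<subseteq> carrier FF" unfolding local_ring_def using g e(2) by blast
 show "hh ` local_ring C q = Ol q"
 proof (intro subset_antisym subsetI)
  fix y assume "y \<in> hh ` local_ring C q"
  then obtain G H where "\<exists>m. homogeneous m G & homogeneous m H" "~ vanishes_at H q" "y = hh (restrict_to_curve C (Fract G H))"
   unfolding local_ring_def by blast
  then show "y \<in> Ol q" using e(1)[OF g] unfolding Ol_def by blast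
 next
  fix y assume "y \<in> Ol q"
  then obtain G H m where *: "homogeneous m G" "homogeneous m H" "~ vanishes_at H q" "y = ev emb G xi / ev emb H xi" unfolding Ol_def by blast
  then have "y = hh (restrict_to_curve C (Fract G H))" using e(1)[OF g] by metis
  then show "y \<in> hh ` local_ring C q" unfolding local_ring_def using * by blast
 qed
qed

lemma normal_ring_iff: "x \<in> normal_ring C q \<longleftrightarrow> x \<in> carrier FF & hh x \<in> Rn q"
proof -
 interpret h: ring_hom_cring FF "rng K" hh by (rule hh_hom)
 have "(\<exists>(n::nat) a. (\<forall>i<n. a i \<in> local_ring C q) &
    (x [^]\<^bsub>FF\<^esub> n) \<oplus>\<^bsub>FF\<^esub> (\<Oplus>\<^bsub>FF\<^esub>i\<in>{..<n}. a i \<otimes>\<^bsub>FF\<^esub> (x [^]\<^bsub>FF\<^esub> i)) = \<zero>\<^bsub>FF\<^esub>) \<longleftrightarrow> integral (Ol q) (hh x)" (is "?L \<longleftrightarrow> _")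
  if x: "x \<in> carrier FF"
 proof -
  have key: "(x [^]\<^bsub>FF\<^esub> n) \<oplus>\<^bsub>FF\<^esub> (\<Oplus>\<^bsub>FF\<^esub>i\<in>{..<n}. a i \<otimes>\<^bsub>FF\<^esub> (x [^]\<^bsub>FF\<^esub> i)) = \<zero>\<^bsub>FF\<^esub> \<longleftrightarrow>
    hh x ^ n + (\<Sum>i<n. hh (a i) * hh x ^ i) = 0" if a: "!!i. i < n ==> a i \<in> local_ring C q" for n :: nat and a
  proof -
   let ?t = "%i. a i \<otimes>\<^bsub>FF\<^esub> (x [^]\<^bsub>FF\<^esub> i)"
   have ac: "a i \<in> carrier FF" if "i < n" for i using a that hh_local_ring(2) by blast
   then have tc: "?t \<in> {..<n} \<rightarrow> carrier FF" using x by auto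
   have hp: "hh (x [^]\<^bsub>FF\<^esub> i) = hh x ^ i" for i :: nat
    by (induction i) (use x h.hom_one h.hom_mult in \<open>simp_all add: mult.commute\<close>)
   have "hh (finsum FF ?t {..<n}) = finsum (rng K) (hh \<circ> ?t) {..<n}" using tc by (rule h.hom_finsum)
   also have "\<dots> = sum (hh \<circ> ?t) {..<n}" using tc h.hom_closed by (intro rng_finsum[OF K_subring]) auto
   also have "\<dots> = (\<Sum>i<n. hh (a i) * hh x ^ i)" using ac x by (intro sum.cong) (auto simp: h.hom_mult hp)
   finally have v: "hh ((x [^]\<^bsub>FF\<^esub> n) \<oplus>\<^bsub>FF\<^esub> finsum FF ?t {..<n}) = hh x ^ n + (\<Sum>i<n. hh (a i) * hh x ^ i)"
    using x tc h.hom_add by (simp add: hp)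
   have c: "(x [^]\<^bsub>FF\<^esub> n) \<oplus>\<^bsub>FF\<^esub> finsum FF ?t {..<n} \<in> carrier FF" using x tc by simp
   have "inj_on hh (carrier FF)" using hh_bij by (simp add: bij_betw_def)
   from inj_on_eq_iff[OF this c h.R.zero_closed] show ?thesis using h.hom_zero by (simp add: v)
  qed
  show ?thesis unfolding integral_iff_sum[OF O_subring[OF q]]
  proof
   assume ?L
   then obtain n a where na: "!!i. i < (n::nat) ==> a i \<in> local_ring C q"
    "(x [^]\<^bsub>FF\<^esub> n) \<oplus>\<^bsub>FF\<^esub> (\<Oplus>\<^bsub>FF\<^esub>i\<in>{..<n}. a i \<otimes>\<^bsub>FF\<^esub> (x [^]\<^bsub>FF\<^esub> i)) = \<zero>\<^bsub>FF\<^esub>" by blast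
   then show "\<exists>(n::nat) b. (\<forall>i<n. b i \<in> Ol q) & hh x ^ n + (\<Sum>i<n. b i * hh x ^ i) = 0"
    using key[of n a] hh_local_ring(1) by (intro exI[of _ n] exI[of _ "%i. hh (a i)"]) auto
  next
   assume "\<exists>(n::nat) b. (\<forall>i<n. b i \<in> Ol q) & hh x ^ n + (\<Sum>i<n. b i * hh x ^ i) = 0"
   then obtain n b where nb: "!!i. i < (n::nat) ==> b i \<in> Ol q" "hh x ^ n + (\<Sum>i<n. b i * hh x ^ i) = 0" by blast
   have "\<exists>c. i < n \<longrightarrow> c \<in> local_ring C q & hh c = b i" for i
   proof (cases "i < n")
    case True
    then have "b i \<in> hh ` local_ring C q" using nb(1) hh_local_ring(1) by simp
    then show ?thesis by auto
   qed simp
   then obtain a where a: "!!i. i < n ==> a i \<in> local_ring C q & hh (a i) = b i" by metis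
   have "(\<Sum>i<n. hh (a i) * hh x ^ i) = (\<Sum>i<n. b i * hh x ^ i)" using a by (intro sum.cong) auto
   then show ?L using key[of n a] a nb(2) by (intro exI[of _ n] exI[of _ a]) auto
  qed
 qed
 then show ?thesis unfolding normal_ring_def integral_closure_def Rn_def
  using h.hom_closed by auto
qed

lemma hh_normal_ring: "hh ` normal_ring C q = Rn q" "normal_ring C q \<subseteq> carrier FF"
proof -
 show "normal_ring C q \<subseteq> carrier FF" using normal_ring_iff by blast
 have "Rn q \<subseteq> hh ` carrier FF" using hh_bij by (auto simp: bij_betw_def Rn_def)
 then show "hh ` normal_ring C q = Rn q" using normal_ring_iff by blast
qed

lemma normal_ring_iso:
 "cring (FF\<lparr>carrier := normal_ring C q\<rparr>)" "hh \<in> ring_iso (FF\<lparr>carrier := normal_ring C q\<rparr>) (rng (Rn q))"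
proof -
 interpret h: ring_hom_cring FF "rng K" hh by (rule hh_hom)
 note sR = Rn_subring[OF q]
 have inj: "inj_on hh (carrier FF)" using hh_bij by (simp add: bij_betw_def)
 have hminus: "hh (\<ominus>\<^bsub>FF\<^esub> x) = - hh x" if "x \<in> carrier FF" for x
 proof -
  have "hh (\<ominus>\<^bsub>FF\<^esub> x) = \<ominus>\<^bsub>rng K\<^esub> hh x" using that by simp
  moreover have "\<ominus>\<^bsub>rng K\<^esub> hh x = - hh x" using that h.hom_closed subring_uminus[OF K_subring]
   by (intro h.S.minus_equality) auto
  ultimately show ?thesis by simp
 qed
 have "subring (normal_ring C q) FF"
 proof (rule h.R.subringI)
  show "normal_ring C q \<subseteq> carrier FF" by (rule hh_normal_ring)
  show "\<one>\<^bsub>FF\<^esub> \<in> normal_ring C q" using h.hom_one subring_1[OF sR] by (simp add: normal_ring_iff)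
  fix x y assume x: "x \<in> normal_ring C q"
  show "\<ominus>\<^bsub>FF\<^esub> x \<in> normal_ring C q" using x hminus subring_uminus[OF sR] by (simp add: normal_ring_iff)
  assume y: "y \<in> normal_ring C q"
  show "x \<otimes>\<^bsub>FF\<^esub> y \<in> normal_ring C q" "x \<oplus>\<^bsub>FF\<^esub> y \<in> normal_ring C q"
   using x y subring_mult[OF sR] subring_add[OF sR] by (auto simp: normal_ring_iff h.hom_mult h.hom_add)
 qed
 then show "cring (FF\<lparr>carrier := normal_ring C q\<rparr>)"
  using h.R.subcring_iff[OF hh_normal_ring(2)] h.R.subcringI' by blast
 have "bij_betw hh (normal_ring C q) (Rn q)" using inj hh_normal_ring by (auto simp: bij_betw_def intro: inj_on_subset)
 then show "hh \<in> ring_iso (FF\<lparr>carrier := normal_ring C q\<rparr>) (rng (Rn q))"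
  using hh_normal_ring(2) h.hom_one h.hom_mult h.hom_add normal_ring_iff
  by (auto simp: ring_iso_def ring_hom_def subset_iff)
qed

lemma maximalideal_normal_ring:
 "M \<subseteq> normal_ring C q ==> maximalideal M (FF\<lparr>carrier := normal_ring C q\<rparr>) \<longleftrightarrow> max_ideal (hh ` M) (Rn q)"
 using maximalideal_rng[OF normal_ring_iso(1) Rn_subring[OF q] normal_ring_iso(2)] by simp

lemma hh_point_ring:
 assumes M: "maximalideal M (FF\<lparr>carrier := normal_ring C q\<rparr>)"
 shows "hh ` point_ring C (q, M) = localization (Rn q) (hh ` M)" "point_ring C (q, M) \<subseteq> carrier FF"
proof -
 interpret h: ring_hom_cring FF "rng K" hh by (rule hh_hom)
 have inj: "inj_on hh (carrier FF)" using hh_bij by (simp add: bij_betw_def)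
 have sub: "M \<subseteq> normal_ring C q" using additive_subgroup.a_subset[OF ideal.axioms(1)[OF maximalideal.axioms(1)[OF M]]] by simp
 have mx: "max_ideal (hh ` M) (Rn q)" using maximalideal_normal_ring[OF sub] M by simp
 have mem: "hh x \<in> hh ` M \<longleftrightarrow> x \<in> M" if "x \<in> normal_ring C q" for x
  using inj sub that hh_normal_ring(2) by (auto dest: inj_onD)
 have nzb: "hh b ~= 0" if "b \<in> normal_ring C q - M" for b
 proof
  assume "hh b = 0"
  then have "hh b \<in> hh ` M" using mx by (simp add: max_ideal_def)
  then show False using mem that by blast
 qed
 have e: "a \<otimes>\<^bsub>FF\<^esub> inv\<^bsub>FF\<^esub> b \<in> carrier FF & hh (a \<otimes>\<^bsub>FF\<^esub> inv\<^bsub>FF\<^esub> b) = hh a / hh b"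
  if "a \<in> normal_ring C q" "b \<in> normal_ring C q - M" for a b
  using that hh_inv[of b] nzb[OF that(2)] hh_normal_ring(2) h.hom_mult
  by (auto simp: field_class.field_divide_inverse subset_iff)
 show "point_ring C (q, M) \<subseteq> carrier FF" unfolding point_ring_def using e by auto
 have "hh ` point_ring C (q, M) = {hh a / hh b |a b. a \<in> normal_ring C q & b \<in> normal_ring C q - M}"
  unfolding point_ring_def fst_conv snd_conv using e by (auto simp: image_def) (metis e)+
 also have "\<dots> = localization (Rn q) (hh ` M)"
  unfolding localization_def hh_normal_ring(1)[symmetric] using mem by (auto simp: image_iff)
 finally show "hh ` point_ring C (q, M) = localization (Rn q) (hh ` M)" .
qed

end

definition npoints :: "(proj_plane \<times> 'k set) set" where
 "npoints = {(q, M). q \<in> C & max_ideal M (Rn q)}"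

definition npt :: "npoint => proj_plane \<times> 'k set" where
 "npt P = (fst P, hh ` snd P)"

lemma normalization_npoints: "bij_betw npt (normalization C) npoints"
 unfolding bij_betw_def
proof
 have inj: "inj_on hh (carrier FF)" using hh_bij by (simp add: bij_betw_def)
 have sub: "M \<subseteq> normal_ring C q & M \<subseteq> carrier FF" if "(q, M) \<in> normalization C" for q M
 proof -
  have q: "q \<in> C" and M: "maximalideal M (FF\<lparr>carrier := normal_ring C q\<rparr>)" using that by (auto simp: normalization_def)
  show ?thesis using additive_subgroup.a_subset[OF ideal.axioms(1)[OF maximalideal.axioms(1)[OF M]]] hh_normal_ring(2)[OF q] by auto
 qed
 show "inj_on npt (normalization C)"
 proof (rule inj_onI; clarsimp simp: npt_def)
  fix q M M' assume "(q, M) \<in> normalization C" "(q, M') \<in> normalization C" "hh ` M = hh ` M'"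
  then show "M = M'" using inj sub by (meson inj_on_image_eq_iff)
 qed
 show "npt ` normalization C = npoints"
 proof (intro subset_antisym subsetI)
  fix y assume "y \<in> npt ` normalization C"
  then obtain q M where *: "(q, M) \<in> normalization C" "y = (q, hh ` M)" by (auto simp: npt_def)
  then show "y \<in> npoints" using sub[OF *(1)] maximalideal_normal_ring[of q M] by (auto simp: normalization_def npoints_def)
 next
  fix y assume "y \<in> npoints"
  then obtain q M where *: "y = (q, M)" "q \<in> C" "max_ideal M (Rn q)" by (auto simp: npoints_def)
  define N where "N = {x \<in> normal_ring C q. hh x \<in> M}"
  have "M \<subseteq> hh ` normal_ring C q" using *(3) hh_normal_ring(1)[OF *(2)] by (auto simp: max_ideal_def)
  then have "hh ` N = M" unfolding N_def by blast
  moreover have "(q, N) \<in> normalization C" using maximalideal_normal_ring[OF *(2), of N] * \<open>hh ` N = M\<close>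
   by (auto simp: normalization_def N_def)
  ultimately show "y \<in> npt ` normalization C" using * by (force simp: npt_def)
 qed
qed

lemma preimage_npoints: "bij_betw npt (normalization_preimage C S) {P \<in> npoints. fst P \<in> S}"
proof -
 have "normalization_preimage C S = {P \<in> normalization C. fst (npt P) \<in> S}"
  by (simp add: normalization_preimage_def npt_def)
 moreover have n: "npt ` normalization C = npoints" "inj_on npt (normalization C)"
  using normalization_npoints by (auto simp: bij_betw_def)
 ultimately show ?thesis unfolding n(1)[symmetric] bij_betw_def using inj_on_subset[OF n(2)] by blast
qed

lemma npoints_nonempty: "q \<in> C ==> \<exists>M. (q, M) \<in> npoints"
proof -
 assume q: "q \<in> C"
 obtain V where V: "place V" "Ol q \<subseteq> V" using exists_place[OF q] by blast
 show ?thesis using place_max_ideal[OF V(1) q V(2)] q unfolding npoints_def by blast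
qed

lemma unibranch_iff: "q \<in> C ==> card (normalization_preimage C {q}) = 1 \<longleftrightarrow> unibranch q"
proof -
 assume q: "q \<in> C"
 have "card (normalization_preimage C {q}) = card {P \<in> npoints. fst P \<in> {q}}"
  using preimage_npoints by (rule bij_betw_same_card)
 also have "{P \<in> npoints. fst P \<in> {q}} = Pair q ` {M. max_ideal M (Rn q)}" using q by (auto simp: npoints_def)
 also have "card \<dots> = card {M. max_ideal M (Rn q)}" by (rule card_image) (auto intro: inj_onI)
 finally show ?thesis unfolding unibranch_def by (simp only: card_Collect_eq_1)
qed

end

section \<open>Curves with function field of one generator\<close>

text \<open>The order of a polynomial at a point of the projective line, with \<open>None\<close>
  for the point at infinity.\<close>

definition ordp :: "complex option => complex poly => int" where
 "ordp i p = (case i of None => - int (degree p) | Some a => int (order a p))"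

lemma ordp_mult: "p ~= 0 ==> q ~= 0 ==> ordp i (p * q) = ordp i p + ordp i q"
 by (cases i) (auto simp: ordp_def degree_mult_eq order_mult)

lemma ordp_diff:
 assumes "p - q ~= 0" "p = 0 \<or> ordp i p \<ge> k" "q = 0 \<or> ordp i q \<ge> k"
 shows "ordp i (p - q) \<ge> k"
proof (cases i)
 case None
 have "degree (p - q) \<le> max (degree p) (degree q)" by (rule degree_diff_le_max)
 then show ?thesis using assms None by (cases "p = 0"; cases "q = 0") (auto simp: ordp_def max_def split: if_splits)
next
 case (Some a)
 have "[:-a, 1:] ^ nat k dvd p"
  using assms(2) Some by (cases "p = 0") (auto simp: ordp_def intro!: dvd_trans[OF le_imp_power_dvd order_1])
 moreover have "[:-a, 1:] ^ nat k dvd q"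
  using assms(3) Some by (cases "q = 0") (auto simp: ordp_def intro!: dvd_trans[OF le_imp_power_dvd order_1])
 ultimately have "[:-a, 1:] ^ nat k dvd p - q" by (rule dvd_diff)
 then have "nat k \<le> order a (p - q)" using assms(1) by (metis order_divides)
 then show ?thesis using Some by (simp add: ordp_def)
qed

text \<open>Says that K = C(w). The parameter w identifies the normalization with the projective
  line, whose points are encoded as \<open>complex option\<close>.\<close>

locale one_generator = generic_point emb xi F n
 for emb :: "complex => 'k::field" and xi F n +
 fixes w :: 'k
 assumes w: "w \<in> K" and gen_w: "K \<subseteq> ratfield emb w"
begin

lemma w_not_emb: "w \<notin> range emb"
proof
 assume "w \<in> range emb"
 then obtain c where c: "w = emb c" by blast
 obtain t where t: "t \<in> K" "t \<notin> range emb" using base_parameter by blast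
 have "evp p w \<in> range emb" for p using evp_subring[OF emb_subring, of w p] c by blast
 moreover have "x / y \<in> range emb" if "x \<in> range emb" "y \<in> range emb" for x y
 proof -
  from that(1) obtain a where "x = emb a" by (rule rangeE)
  moreover from that(2) obtain b where "y = emb b" by (rule rangeE)
  ultimately have "x / y = emb (a * inverse b)" by (simp add: mult emb_inverse field_class.field_divide_inverse)
  then show ?thesis by blast
 qed
 ultimately have "ratfield emb w \<subseteq> range emb" unfolding ratfield_def by blast
 then show False using t gen_w by blast
qed

lemma evp_0_iff: "evp p w = 0 \<longleftrightarrow> p = 0"
 using transcendental[OF w_not_emb, of p] evp_simps(5)[of w] by (cases "p = 0") auto

lemma evp_inj: "evp p w = evp q w \<longleftrightarrow> p = q"
 using evp_0_iff[of "p - q"] evp_simps(3)[of p q w] by simp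

lemma evp_K: "evp p w \<in> K"
 using evp_subring[OF K_subring _ w] K_emb by blast

lemma K_rep:
 assumes "f \<in> K" obtains p q where "q ~= 0" "f = evp p w / evp q w"
 using assms gen_w evp_0_iff unfolding ratfield_def by blast

lemma K_rep_nz:
 assumes "f \<in> K" "f ~= 0" obtains p q where "p ~= 0" "q ~= 0" "f = evp p w / evp q w"
 using K_rep[OF assms(1)] assms(2) evp_0_iff by (metis div_0)

definition ordw :: "complex option => 'k => int" where
 "ordw i f = (THE n. \<exists>p q. p ~= 0 & q ~= 0 & f = evp p w / evp q w & n = ordp i p - ordp i q)"

lemma ordw_eq:
 assumes "p ~= 0" "q ~= 0" shows "ordw i (evp p w / evp q w) = ordp i p - ordp i q"
 unfolding ordw_def
proof (rule the_equality)
 show "\<exists>p' q'. p' ~= 0 & q' ~= 0 & evp p w / evp q w = evp p' w / evp q' w & ordp i p - ordp i q = ordp i p' - ordp i q'"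
  using assms by blast
 fix n assume "\<exists>p' q'. p' ~= 0 & q' ~= 0 & evp p w / evp q w = evp p' w / evp q' w & n = ordp i p' - ordp i q'"
 then obtain p' q' where *: "p' ~= 0" "q' ~= 0" "evp p w / evp q w = evp p' w / evp q' w" "n = ordp i p' - ordp i q'" by blast
 have "evp (p * q') w = evp (p' * q) w" using *(1-3) assms evp_0_iff unfolding evp_simps(2) by (simp add: frac_eq_eq)
 then have "ordp i (p * q') = ordp i (p' * q)" using evp_inj by metis
 then show "n = ordp i p - ordp i q" using * assms by (simp add: ordp_mult)
qed

lemma ordw_mult: assumes "f \<in> K" "f ~= 0" "g \<in> K" "g ~= 0" shows "ordw i (f * g) = ordw i f + ordw i g"
proof -
 obtain p q where f: "p ~= 0" "q ~= 0" "f = evp p w / evp q w" using K_rep_nz assms(1,2) by metis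
 obtain r s where g: "r ~= 0" "s ~= 0" "g = evp r w / evp s w" using K_rep_nz assms(3,4) by metis
 have "f * g = evp (p * r) w / evp (q * s) w" unfolding f g evp_simps(2) by simp
 then show ?thesis using f g ordw_eq[of "p * r" "q * s" i] by (simp add: ordw_eq ordp_mult)
qed

lemma ordw_1: "ordw i 1 = 0"
 using ordw_eq[of 1 1 i] by (simp add: evp_simps(4))

lemma ordw_inverse: assumes "f \<in> K" "f ~= 0" shows "ordw i (inverse f) = - ordw i f"
 using ordw_mult[OF assms K_inverse[OF assms(1)], of i] assms(2) ordw_1[of i] by simp

lemma ordw_power: assumes "f \<in> K" "f ~= 0" shows "ordw i (f ^ k) = int k * ordw i f"
 by (induction k) (use assms ordw_1 ordw_mult[OF assms subring_power[OF K_subring assms(1)]] in \<open>auto simp: algebra_simps\<close>)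

lemma K_powi: "f \<in> K ==> f powi m \<in> K"
 using K_inverse subring_power[OF K_subring] by (auto simp: power_int_def)

lemma ordw_powi: assumes "f \<in> K" "f ~= 0" shows "ordw i (f powi m) = m * ordw i f"
 using ordw_power[OF assms, of i "nat m"] ordw_power[OF K_inverse[OF assms(1)], of i "nat (- m)"] assms ordw_inverse[OF assms, of i]
 by (cases "m \<ge> 0") (auto simp: power_int_def)

definition Vw :: "complex option => 'k set" where
 "Vw i = {f \<in> K. f = 0 \<or> ordw i f \<ge> 0}"

text \<open>The standard local parameter at the point i of the projective line.\<close>

definition tw :: "complex option => 'k" where
 "tw i = (case i of None => inverse w | Some a => w - emb a)"

lemma tw: "tw i \<in> K" "tw i ~= 0" "ordw i (tw i) = 1"
proof -
 have w0: "w ~= 0" using w_not_emb zero by (metis rangeI)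
 have a: "w - emb a = evp [:- a, 1:] w" for a by (simp add: map_poly_pCons uminus one)
 have wv: "w = evp [:0, 1:] w" by (simp add: evp_simps one)
 show "tw i \<in> K" using w K_inverse K_emb subring_diff[OF K_subring] by (cases i) (auto simp: tw_def)
 show "tw i ~= 0" using w0 w_not_emb by (cases i) (auto simp: tw_def)
 show "ordw i (tw i) = 1"
 proof (cases i)
  case None
  have "inverse w = evp 1 w / evp [:0, 1:] w" using wv by (simp add: evp_simps(4) inverse_eq_divide)
  then have "ordw i (inverse w) = ordp i 1 - ordp i [:0, 1:]" using ordw_eq[of 1 "[:0, 1:]" i] by simp
  then show ?thesis using None by (simp add: tw_def ordp_def)
 next
  case (Some b)
  have "order b [:- b, 1:] = 1" using order_power_n_n[of b 1] by simp
  moreover have "ordw i (w - emb b) = ordp i [:- b, 1:] - ordp i 1"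
   using ordw_eq[of "[:- b, 1:]" 1 i] a[of b] evp_simps(4)[of w] by simp
  ultimately show ?thesis using Some by (simp add: tw_def ordp_def)
 qed
qed

lemma Vw_subring: "is_subring (Vw i)"
 unfolding is_subring_def
proof (intro conjI ballI)
 show "1 \<in> Vw i" using ordw_1 subring_1[OF K_subring] by (simp add: Vw_def)
 fix f g assume fg: "f \<in> Vw i" "g \<in> Vw i"
 then have k: "f \<in> K" "g \<in> K" by (auto simp: Vw_def)
 have "f * g \<in> K" using k subring_mult[OF K_subring] by blast
 then show "f * g \<in> Vw i" using fg ordw_mult[of f g i] by (cases "f = 0 \<or> g = 0") (auto simp: Vw_def)
 show "f - g \<in> Vw i"
 proof (cases "f - g = 0")
  case True then show ?thesis using subring_0[OF K_subring] by (simp add: Vw_def)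
 next
  case False
  obtain p q where f: "q ~= 0" "f = evp p w / evp q w" using K_rep[OF k(1)] .
  obtain r s where g: "s ~= 0" "g = evp r w / evp s w" using K_rep[OF k(2)] .
  have nz: "evp q w ~= 0" "evp s w ~= 0" using f g evp_0_iff by auto
  have e: "f - g = evp (p * s - r * q) w / evp (q * s) w" unfolding f(2) g(2) evp_simps(2,3) using nz by (simp add: diff_frac_eq)
  then have "p * s - r * q ~= 0" using False evp_0_iff by auto
  moreover have "p * s = 0 \<or> ordp i (p * s) \<ge> ordp i (q * s)"
  proof (cases "p = 0")
   case False
   then have "f ~= 0" using f nz evp_0_iff by simp
   then have "ordw i f \<ge> 0" using fg by (auto simp: Vw_def)
   then show ?thesis using ordw_eq[OF False f(1), of i] f g False by (simp add: ordp_mult)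
  qed simp
  moreover have "r * q = 0 \<or> ordp i (r * q) \<ge> ordp i (q * s)"
  proof (cases "r = 0")
   case False
   then have "g ~= 0" using g nz evp_0_iff by simp
   then have "ordw i g \<ge> 0" using fg by (auto simp: Vw_def)
   then show ?thesis using ordw_eq[OF False g(1), of i] f g False by (simp add: ordp_mult)
  qed simp
  ultimately have "ordp i (p * s - r * q) \<ge> ordp i (q * s)" and n: "p * s - r * q ~= 0" using ordp_diff by blast+
  moreover have "ordw i (f - g) = ordp i (p * s - r * q) - ordp i (q * s)"
   unfolding e using ordw_eq[OF n, of "q * s" i] f g by simp
  ultimately show ?thesis using k subring_diff[OF K_subring] by (simp add: Vw_def)
 qed
qed

lemma Vw_emb: "emb c \<in> Vw i"
proof (cases "c = 0")
 case True then show ?thesis using subring_0[OF Vw_subring] by simp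
next
 case False
 have "ordw i (emb c) = ordp i [:c:] - ordp i 1" using ordw_eq[of "[:c:]" 1 i] False by (simp add: evp_simps(4,6))
 moreover have "order a [:c:] = 0" for a using False by (intro order_0I) simp
 ultimately show ?thesis using K_emb by (cases i) (auto simp: Vw_def ordp_def)
qed

lemma Vw_factor:
 assumes "f \<in> K" "f \<notin> Vw i" shows "f ~= 0" "\<exists>g\<in>Vw i. inverse f = tw i * g"
proof -
 show f0: "f ~= 0" using assms by (auto simp: Vw_def)
 have o: "ordw i (inverse f) \<ge> 1" using assms f0 ordw_inverse[OF assms(1) f0, of i] by (simp add: Vw_def)
 have k: "inverse f * inverse (tw i) \<in> K" using K_inverse assms(1) tw(1) subring_mult[OF K_subring] by blast
 have "ordw i (inverse f * inverse (tw i)) \<ge> 0"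
  using o ordw_mult[OF K_inverse[OF assms(1)] _ K_inverse[OF tw(1)], of i i] ordw_inverse[OF tw(1,2), of i i] f0 tw(2,3) by simp
 then have "inverse f * inverse (tw i) \<in> Vw i" using k by (simp add: Vw_def)
 moreover have "inverse f = tw i * (inverse f * inverse (tw i))" using tw(2)[of i] by simp
 ultimately show "\<exists>g\<in>Vw i. inverse f = tw i * g" by blast
qed

lemma place_eq_Vw:
 assumes V: "place V" and sub: "Vw i \<subseteq> V" and t: "tw i \<in> nonunits V" shows "V \<inter> K = Vw i"
proof (intro subset_antisym subsetI)
 fix f assume f: "f \<in> V \<inter> K"
 show "f \<in> Vw i"
 proof (rule ccontr)
  assume "f \<notin> Vw i"
  then obtain g where g: "g \<in> Vw i" "inverse f = tw i * g" "f ~= 0" using Vw_factor f by blast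
  then have "inverse f \<in> nonunits V" using nonunits_mult[OF place_valuation[OF V] t] sub by auto
  then show False using f g(3) by (auto simp: nonunits_def)
 qed
qed (use sub in \<open>auto simp: Vw_def\<close>)

lemma exists_place_Vw: "\<exists>V. place V & V \<inter> K = Vw i"
proof -
 have ti: "inverse (tw i) \<notin> Vw i" using tw[of i] ordw_inverse[OF tw(1,2), of i i] by (simp add: Vw_def)
 have tV: "tw i \<in> Vw i" using tw[of i] by (simp add: Vw_def)
 have "\<exists>b\<in>Vw i. x = tw i * b" if "x \<in> ideal_span {tw i} (Vw i)" for x
  using that
 proof (induction rule: ideal_span.induct)
  case zero then show ?case using subring_0[OF Vw_subring] by (auto intro!: bexI[of _ 0])
 next
  case (step x b y)
  then obtain c where "c \<in> Vw i" "y = tw i * c" by blast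
  with step show ?case using subring_add[OF Vw_subring] by (auto intro!: bexI[of _ "b + c"] simp: distrib_left)
 qed
 then have "1 \<notin> ideal_span {tw i} (Vw i)" using ti by (metis inverse_unique)
 then obtain V where V: "valuation_ring V" "Vw i \<subseteq> V" "1 \<notin> ideal_span {tw i} V"
  using chevalley[OF Vw_subring, of "{tw i}"] tV by blast
 have nV: "inverse (tw i) \<notin> V" using ideal_span_base[of "tw i" "{tw i}" "inverse (tw i)" V] V(3) tw(2) by auto
 have pV: "place V" unfolding place_def using V Vw_emb nV K_inverse[OF tw(1)] by blast
 have "tw i \<in> nonunits V" using nV tV V(2) by (auto simp: nonunits_def)
 then show ?thesis using place_eq_Vw[OF pV V(2)] pV by blast
qed

text \<open>If w is in V with residue a, then polynomials not vanishing at a are units, so V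
  contains the local ring at a. Otherwise 1/w is a nonunit, and the same argument for polynomials in
  1/w gives the ring at infinity. A discrete valuation ring cannot be enlarged without inverting its
  parameter, which is \<open>place_eq_Vw\<close>.\<close>

lemma place_Vw:
 assumes V: "place V" shows "\<exists>i. V \<inter> K = Vw i"
proof (cases "w \<in> V")
 case True
 note vr = place_valuation[OF V]
 obtain a where a: "w - emb a \<in> nonunits V" using place_residue[OF V w True] by blast
 have unit: "inverse (evp q w) \<in> V" if "poly q a ~= 0" for q
 proof -
  have "[:- a, 1:] dvd q - [:poly q a:]" by (simp flip: poly_eq_0_iff_dvd)
  then obtain r where r: "q - [:poly q a:] = [:- a, 1:] * r" by (rule dvdE)
  then have "q = [:poly q a:] + [:- a, 1:] * r" by (simp add: algebra_simps)
  then have "evp q w = evp [:poly q a:] w + evp [:- a, 1:] w * evp r w" by (metis evp_simps(1,2))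
  then have e: "evp q w = emb (poly q a) + (w - emb a) * evp r w" by (simp add: map_poly_pCons uminus one evp_simps(6))
  have "evp r w \<in> V" using evp_subring[OF place_subring[OF V] _ True] place_emb[OF V] by blast
  then have n: "(w - emb a) * evp r w \<in> nonunits V" using nonunits_mult[OF vr a] by blast
  have "emb (poly q a) \<notin> nonunits V" using emb_nonunit[OF V] that by simp
  from unit_add_nonunit[OF vr place_emb[OF V] this n] show ?thesis using not_nonunit[OF vr] e by metis
 qed
 have "Vw (Some a) \<subseteq> V"
 proof
  fix f assume f: "f \<in> Vw (Some a)"
  show "f \<in> V"
  proof (cases "f = 0")
   case True then show ?thesis using subring_0[OF place_subring[OF V]] by simp
  next
   case False
   then obtain p q where pq: "p ~= 0" "q ~= 0" "f = evp p w / evp q w" using K_rep_nz f by (auto simp: Vw_def)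
   have o: "order a q \<le> order a p" using f False ordw_eq[OF pq(1,2), of "Some a"] pq(3) by (simp add: Vw_def ordp_def)
   obtain q' where q': "q = [:-a, 1:] ^ order a q * q'" "~ [:-a, 1:] dvd q'" using order_decomp[OF pq(2)] by blast
   have "[:-a, 1:] ^ order a q dvd p" using o dvd_trans[OF le_imp_power_dvd order_1] by blast
   then obtain p' where p': "p = [:-a, 1:] ^ order a q * p'" by (rule dvdE)
   have "evp ([:-a, 1:] ^ order a q) w ~= 0" using evp_0_iff by simp
   then have "f = evp p' w / evp q' w" using pq(3) p' q'(1) by (metis evp_simps(2) mult_divide_mult_cancel_left)
   moreover have "poly q' a ~= 0" using q'(2) by (simp add: poly_eq_0_iff_dvd)
   moreover have "evp p' w \<in> V" using evp_subring[OF place_subring[OF V] _ True] \<open>w \<in> V\<close> place_emb[OF V]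
    using evp_subring[OF place_subring[OF V], of w p'] by blast
   ultimately show ?thesis using unit subring_mult[OF place_subring[OF V]] by (simp add: field_class.field_divide_inverse)
  qed
 qed
 then show ?thesis using place_eq_Vw[OF V, of "Some a"] a by (auto simp: tw_def)
next
 case False
 note vr = place_valuation[OF V] and sV = place_subring[OF V]
 have w0: "w ~= 0" using False subring_0[OF sV] by auto
 have n: "inverse w \<in> nonunits V" using False valuation_ring_cases[OF vr, of w] by (auto simp: nonunits_def)
 have iV: "inverse w \<in> V" using n nonunits_subset[OF vr] by blast
 have rev: "evp p w * inverse w ^ m = (\<Sum>i\<le>m. emb (coeff p i) * inverse w ^ (m - i))" if "degree p \<le> m" for p m
 proof -
  have "evp p w = (\<Sum>i\<le>m. emb (coeff p i) * w ^ i)"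
  proof -
   have "degree (map_poly emb p) \<le> m" using that by (intro degree_le) (auto simp: coeff_map_poly coeff_eq_0)
   then have "evp p w = (\<Sum>i\<le>m. coeff (map_poly emb p) i * w ^ i)"
    unfolding poly_altdef by (intro sum.mono_neutral_left) (auto simp: coeff_eq_0)
   then show ?thesis by (simp add: coeff_map_poly)
  qed
  moreover have "w ^ i * inverse w ^ m = inverse w ^ (m - i)" if "i \<le> m" for i
  proof -
   have "inverse w ^ m = inverse w ^ i * inverse w ^ (m - i)" using that by (simp flip: power_add)
   then show ?thesis using w0 by (simp add: power_inverse)
  qed
  ultimately show ?thesis unfolding sum_distrib_right by (intro trans[OF sum_distrib_right] | simp add: sum_distrib_right mult.assoc)+
 qed
 have "Vw None \<subseteq> V"
 proof
  fix f assume f: "f \<in> Vw None"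
  show "f \<in> V"
  proof (cases "f = 0")
   case True then show ?thesis using subring_0[OF sV] by simp
  next
   case False
   then obtain p q where pq: "p ~= 0" "q ~= 0" "f = evp p w / evp q w" using K_rep_nz f by (auto simp: Vw_def)
   define m where "m = degree q"
   have o: "degree p \<le> m" using f False ordw_eq[OF pq(1,2), of None] pq(3) by (simp add: Vw_def ordp_def m_def)
   have pV: "evp p w * inverse w ^ m \<in> V" unfolding rev[OF o]
    using iV place_emb[OF V] by (intro subring_sum[OF sV] subring_mult[OF sV] subring_power[OF sV])
   have "evp q w * inverse w ^ m = emb (lead_coeff q) + (\<Sum>i<m. emb (coeff q i) * inverse w ^ (m - i))"
    using rev[of q m] unfolding lessThan_Suc_atMost[symmetric] sum.lessThan_Suc by (simp add: m_def)
   moreover have "(\<Sum>i<m. emb (coeff q i) * inverse w ^ (m - i)) \<in> nonunits V"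
   proof (rule nonunits_sum[OF vr])
    fix i assume "i \<in> {..<m}"
    then have "inverse w ^ (m - i) = inverse w * inverse w ^ (m - i - 1)" by (cases "m - i") auto
    then have "emb (coeff q i) * inverse w ^ (m - i) = inverse w * (emb (coeff q i) * inverse w ^ (m - i - 1))" by simp
    then show "emb (coeff q i) * inverse w ^ (m - i) \<in> nonunits V"
     using nonunits_mult[OF vr n] subring_mult[OF sV place_emb[OF V] subring_power[OF sV iV]] by metis
   qed
   moreover have "emb (lead_coeff q) \<notin> nonunits V" using emb_nonunit[OF V] pq(2) by simp
   ultimately have "inverse (evp q w * inverse w ^ m) \<in> V"
    using unit_add_nonunit[OF vr place_emb[OF V]] not_nonunit[OF vr] by metis
   then have "evp p w * inverse w ^ m * inverse (evp q w * inverse w ^ m) \<in> V" using subring_mult[OF sV pV] by blast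
   moreover have "evp p w * inverse w ^ m * inverse (evp q w * inverse w ^ m) = f" using w0 pq(3)
    by (simp add: field_simps)
   ultimately show ?thesis by simp
  qed
 qed
 then show ?thesis using place_eq_Vw[OF V, of None] n by (auto simp: tw_def)
qed

lemma Vw_inj: "Vw i = Vw j ==> i = j"
proof (rule ccontr)
 assume e: "Vw i = Vw j" and ne: "i ~= j"
 have main: False if "Vw (Some a) = Vw k" "Some a ~= k" for a k
 proof -
  have a: "w - emb a = evp [:- a, 1:] w / evp 1 w" by (simp add: map_poly_pCons uminus one evp_simps(4))
  have o: "ordw l (w - emb a) = ordp l [:- a, 1:] - ordp l 1" for l unfolding a by (rule ordw_eq) auto
  have "ordw k (w - emb a) \<le> 0"
  proof (cases k)
   case None then show ?thesis by (simp add: o ordp_def)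
  next
   case (Some b)
   then have "poly [:- a, 1:] b ~= 0" using that by simp
   then have "order b [:- a, 1:] = 0" by (rule order_0I)
   then show ?thesis using Some by (simp add: o ordp_def)
  qed
  moreover have "w - emb a \<in> K" "w - emb a ~= 0" using tw(1,2)[of "Some a"] by (auto simp: tw_def)
  ultimately have "inverse (w - emb a) \<in> Vw k" using ordw_inverse[of "w - emb a" k] K_inverse by (simp add: Vw_def)
  moreover have "inverse (tw (Some a)) \<notin> Vw (Some a)"
   using tw[of "Some a"] ordw_inverse[OF tw(1,2), of "Some a" "Some a"] by (simp add: Vw_def)
  ultimately show False using that by (simp add: tw_def)
 qed
 show False
 proof (cases i)
  case (Some a) then show False using main[of a j] e ne by simp
 next
  case None
  then obtain b where "j = Some b" using ne by (cases j) auto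
  then show False using main[of b i] e ne by auto
 qed
qed

lemma localization_place:
 assumes V: "place V" and q: "q \<in> C" "Ol q \<subseteq> V" and M: "max_ideal M (Rn q)" "M = nonunits V \<inter> Rn q"
 shows "localization (Rn q) M = V \<inter> K"
proof (intro subset_antisym subsetI)
 note vr = place_valuation[OF V] and RV = place_Rn[OF V q]
 fix f assume "f \<in> localization (Rn q) M"
 then obtain a b where ab: "a \<in> Rn q" "b \<in> Rn q - M" "f = a / b" unfolding localization_def by blast
 then have "inverse b \<in> V" using M(2) RV not_nonunit[OF vr] by blast
 then have "f \<in> V" using ab RV subring_mult[OF place_subring[OF V]] by (auto simp: field_class.field_divide_inverse)
 moreover have "f \<in> K" using ab K_divide by (auto simp: Rn_def)
 ultimately show "f \<in> V \<inter> K" by blast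
next
 note vr = place_valuation[OF V] and RV = place_Rn[OF V q]
 fix f assume f: "f \<in> V \<inter> K"
 show "f \<in> localization (Rn q) M"
 proof (rule ccontr)
  assume nf: "f \<notin> localization (Rn q) M"
  then have "inverse f \<in> localization (Rn q) M" using localization_valuation[OF q(1) M(1), of f] f by blast
  then obtain a b where ab: "a \<in> Rn q" "b \<in> Rn q - M" "inverse f = a / b" unfolding localization_def by blast
  have f0: "f ~= 0"
  proof
   assume "f = 0"
   moreover have "0 / 1 \<in> localization (Rn q) M" unfolding localization_def
    using subring_0[OF Rn_subring[OF q(1)]] subring_1[OF Rn_subring[OF q(1)]] M(1) unfolding max_ideal_def by blast
   ultimately show False using nf by simp
  qed
  have aM: "a \<in> M"
  proof (rule ccontr)
   assume "a \<notin> M"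
   moreover have "f = b / a" using ab(3) f0 by (metis inverse_divide inverse_inverse_eq)
   ultimately show False using nf ab unfolding localization_def by blast
  qed
  have "inverse b \<in> V" using ab M(2) RV not_nonunit[OF vr] by blast
  then have "inverse f \<in> nonunits V" using aM M(2) nonunits_mult[OF vr] ab(3) by (auto simp: field_class.field_divide_inverse)
  then show False using f f0 by (auto simp: nonunits_def)
 qed
qed

text \<open>The converse of \<open>place_max_ideal\<close>: Chevalley's theorem applied to M gives a
  place whose nonunits contain M, and maximality of M yields equality.\<close>

lemma max_ideal_place:
 assumes q: "q \<in> C" and M: "max_ideal M (Rn q)"
 shows "\<exists>V. place V & Ol q \<subseteq> V & M = nonunits V \<inter> Rn q"
proof -
 note sR = Rn_subring[OF q]
 have M2: "M \<subseteq> Rn q" "!!x y. x \<in> M ==> y \<in> M ==> x - y \<in> M" "!!x y. x \<in> M ==> y \<in> Rn q ==> x * y \<in> M" "0 \<in> M" "1 \<notin> M"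
  and max: "!!r. r \<in> Rn q - M ==> \<exists>s\<in>Rn q. 1 - r * s \<in> M"
  using M by (auto simp: max_ideal_def)
 have "x \<in> M" if "x \<in> ideal_span M (Rn q)" for x
  using that
 proof (induction rule: ideal_span.induct)
  case (step x b y)
  have "0 - y \<in> M" using M2(2)[OF M2(4) step(4)] .
  then have "x * b - (0 - y) \<in> M" using M2(2)[OF M2(3)[OF step(1,2)]] by blast
  then show ?case by simp
 qed (rule M2(4))
 then have "1 \<notin> ideal_span M (Rn q)" using M2(5) by blast
 then obtain V where V: "valuation_ring V" "Rn q \<subseteq> V" "1 \<notin> ideal_span M V" using chevalley[OF sR M2(1)] by blast
 have ni: "inverse x \<notin> V" if "x \<in> M" "x ~= 0" for x
  using ideal_span_base[of x M "inverse x" V] that V(3) by auto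
 have MV: "M \<subseteq> nonunits V" using ni M2(1) V(2) by (auto simp: nonunits_def)
 have OV: "Ol q \<subseteq> V" using O_Rn[OF q] V(2) by blast
 obtain s where s: "s \<in> mOl q" "s ~= 0" using exists_mO_nonzero[OF q] by blast
 then have "inverse s \<notin> V" using ni max_ideal_contains_mO[OF q M] by blast
 then have pV: "place V" unfolding place_def using V(1) OV O_emb K_inverse[OF mO_K[OF q s(1)]] by blast
 have "nonunits V \<inter> Rn q \<subseteq> M"
 proof
  fix x assume x: "x \<in> nonunits V \<inter> Rn q"
  show "x \<in> M"
  proof (rule ccontr)
   assume "x \<notin> M"
   then obtain s where s: "s \<in> Rn q" "1 - x * s \<in> M" using max x by blast
   have "x * s \<in> nonunits V" using x s(1) V(2) nonunits_mult[OF V(1)] by blast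
   then have "(1 - x * s) + x * s \<in> nonunits V" using s(2) MV nonunits_add[OF V(1)] by blast
   then show False using nonunits_1[OF V(1)] by simp
  qed
 qed
 then show ?thesis using pV OV MV M2(1) by blast
qed

text \<open>Points of the normalization, traces of places on K and points of the projective line
  correspond. A place determines its centre, and in the ring over the centre it determines the
  maximal ideal.\<close>

lemma npoints_Vw: "bij_betw (%(q, M). localization (Rn q) M) npoints (range Vw)"
 unfolding bij_betw_def
proof
 show "inj_on (%(q, M). localization (Rn q) M) npoints"
 proof (rule inj_onI; clarsimp simp: npoints_def)
  fix q M q' M'
  assume q: "q \<in> C" and M: "max_ideal M (Rn q)" and q': "q' \<in> C" and M': "max_ideal M' (Rn q')"
   and e: "localization (Rn q) M = localization (Rn q') M'"
  obtain V where V: "place V" "Ol q \<subseteq> V" "M = nonunits V \<inter> Rn q" using max_ideal_place[OF q M] by blast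
  obtain V' where V': "place V'" "Ol q' \<subseteq> V'" "M' = nonunits V' \<inter> Rn q'" using max_ideal_place[OF q' M'] by blast
  have eq: "V \<inter> K = V' \<inter> K" using e localization_place[OF V(1) q V(2) M V(3)] localization_place[OF V'(1) q' V'(2) M' V'(3)] by simp
  have "Ol q' \<subseteq> V" using V'(2) O_K[OF q'] eq by blast
  then have qq: "q' = q" using place_center_unique[OF V(1) q' _ q place_mO[OF V(1) q V(2)]] by blast
  have "x \<in> nonunits V \<longleftrightarrow> x \<in> nonunits V'" if "x \<in> Rn q" for x
  proof -
   have "x \<in> K" "inverse x \<in> K" using that K_inverse by (auto simp: Rn_def)
   then show ?thesis using eq by (auto simp: nonunits_def)
  qed
  then show "q = q' & M = M'" using qq V(3) V'(3) by blast
 qed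
 show "(%(q, M). localization (Rn q) M) ` npoints = range Vw"
 proof (intro subset_antisym subsetI)
  fix W assume "W \<in> (%(q, M). localization (Rn q) M) ` npoints"
  then obtain q M where q: "q \<in> C" and M: "max_ideal M (Rn q)" and W: "W = localization (Rn q) M" by (auto simp: npoints_def)
  obtain V where V: "place V" "Ol q \<subseteq> V" "M = nonunits V \<inter> Rn q" using max_ideal_place[OF q M] by blast
  then show "W \<in> range Vw" using W localization_place[OF V(1) q V(2) M V(3)] place_Vw[OF V(1)] by auto
 next
  fix W assume "W \<in> range Vw"
  then obtain i where i: "W = Vw i" by blast
  obtain V where V: "place V" "V \<inter> K = Vw i" using exists_place_Vw by blast
  obtain q where q: "q \<in> C" "Ol q \<subseteq> V" using place_center_ex[OF V(1)] by blast
  define M where "M = nonunits V \<inter> Rn q"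
  have M: "max_ideal M (Rn q)" unfolding M_def by (rule place_max_ideal[OF V(1) q])
  have "localization (Rn q) M = W" using localization_place[OF V(1) q M M_def] V(2) i by simp
  moreover have "(q, M) \<in> npoints" using q M by (simp add: npoints_def)
  ultimately show "W \<in> (%(q, M). localization (Rn q) M) ` npoints" by force
 qed
qed

end

section \<open>Genus zero\<close>

context one_generator
begin

lemma K_field: "field (rng K)"
proof -
 interpret cring "rng K" by (rule rng_cring[OF K_subring])
 have "Units (rng K) = carrier (rng K) - {\<zero>\<^bsub>rng K\<^esub>}"
 proof (intro subset_antisym subsetI)
  fix x assume "x \<in> carrier (rng K) - {\<zero>\<^bsub>rng K\<^esub>}"
  then have "x \<in> K" "inverse x \<in> K" "inverse x * x = 1" "x * inverse x = 1" using K_inverse by auto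
  then show "x \<in> Units (rng K)" unfolding Units_def by auto
 next
  fix x assume "x \<in> Units (rng K)"
  then show "x \<in> carrier (rng K) - {\<zero>\<^bsub>rng K\<^esub>}" unfolding Units_def by auto
 qed
 then show ?thesis by (rule cring_fieldI)
qed

lemma emb_subfield: "subfield (range emb) (rng K)"
proof -
 interpret field "rng K" by (rule K_field)
 have um: "\<ominus>\<^bsub>rng K\<^esub> x = - x" if "x \<in> K" for x
  using that subring_uminus[OF K_subring] by (intro minus_equality) auto
 have sub: "subring (range emb) (rng K)"
 proof (rule subringI)
  show "range emb \<subseteq> carrier (rng K)" using K_emb by auto
  show "\<one>\<^bsub>rng K\<^esub> \<in> range emb" using one by (auto intro: range_eqI[of _ _ 1])
  fix x y assume x: "x \<in> range emb"
  then show "\<ominus>\<^bsub>rng K\<^esub> x \<in> range emb" using um K_emb subring_uminus[OF emb_subring] by auto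
  assume y: "y \<in> range emb"
  show "x \<otimes>\<^bsub>rng K\<^esub> y \<in> range emb" "x \<oplus>\<^bsub>rng K\<^esub> y \<in> range emb"
   using x y subring_mult[OF emb_subring] subring_add[OF emb_subring] by auto
 qed
 show ?thesis
 proof (rule subfieldI'[OF sub])
  fix x assume "x \<in> range emb - {\<zero>\<^bsub>rng K\<^esub>}"
  then obtain c where c: "x = emb c" "x ~= 0" by auto
  then have cz: "c ~= 0" by auto
  have "inv\<^bsub>rng K\<^esub> x = emb (inverse c)"
   using c cz K_emb emb_eq_0 by (intro comm_inv_char) (auto simp: emb_inverse K_inverse)
  then show "inv\<^bsub>rng K\<^esub> x \<in> range emb" by simp
 qed
qed

definition Th :: "'k => cpoly3 fract set" where "Th = inv_into (carrier FF) hh"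

lemma Th_iso: "Th \<in> ring_iso (rng K) FF"
 unfolding Th_def using ring_iso_set_sym[OF cring.axioms(1)[OF FF_cring] hh_iso] .

lemma Th_hh: "x \<in> carrier FF ==> Th (hh x) = x" "y \<in> K ==> hh (Th y) = y" "y \<in> K ==> Th y \<in> carrier FF"
 unfolding Th_def using hh_bij by (auto simp: bij_betw_def f_inv_into_f inv_into_into)

lemma Th_hom: "ring_hom_ring (rng K) FF Th"
proof -
 have "Th \<in> ring_hom (rng K) FF" using Th_iso by (simp add: ring_iso_def)
 then show ?thesis using ring_hom_ringI2[OF cring.axioms(1)[OF rng_cring[OF K_subring]] cring.axioms(1)[OF FF_cring]] by blast
qed

lemma FF_one_zero: "\<one>\<^bsub>FF\<^esub> ~= \<zero>\<^bsub>FF\<^esub>"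
proof -
 interpret h: ring_hom_cring FF "rng K" hh by (rule hh_hom)
 show ?thesis
 proof
  assume "\<one>\<^bsub>FF\<^esub> = \<zero>\<^bsub>FF\<^esub>"
  then have "hh \<one>\<^bsub>FF\<^esub> = hh \<zero>\<^bsub>FF\<^esub>" by simp
  then show False using h.hom_one h.hom_zero by simp
 qed
qed

lemma constants_eq: "constants C = Th ` range emb"
proof -
 have g: "gens (cst c) 1" for c by (auto simp: gens_def intro: exI[of _ 0])
 have "restrict_to_curve C (Fract (cst c) 1) = Th (emb c)" for c
 proof -
  have m: "Fract (cst c) 1 \<in> Gc" using g by (auto simp: Gc_def)
  have "hh (restrict_to_curve C (Fract (cst c) 1)) = emb c" using hh_restrict[OF m] psi_Fract[OF g] by simp
  then show ?thesis using Th_hh(1) hh_restrict[OF m] by metis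
 qed
 then show ?thesis unfolding constants_def by auto
qed

lemma constants_subfield: "subfield (constants C) FF"
proof -
 interpret Th: ring_hom_ring "rng K" FF Th by (rule Th_hom)
 show ?thesis unfolding constants_eq by (rule Th.img_is_subfield(2)[OF emb_subfield FF_one_zero])
qed

text \<open>Each step adjoins the line spanned by \<open>th\<close> w^m, which is outside the span
  of the lower powers because w is transcendental.\<close>

lemma dimension_poly_space:
 assumes th: "th \<in> K" "th ~= 0"
 shows "ring.dimension (rng K) m (range emb) {th * evp g w |g. g = 0 \<or> degree g < m}"
proof (induction m)
 interpret R: field "rng K" by (rule K_field)
 case 0
 have "{th * evp g w |g. g = 0 \<or> degree g < 0} = {\<zero>\<^bsub>rng K\<^esub>}" by (auto simp: evp_simps)
 then show ?case using R.zero_dim by simp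
next
 interpret R: field "rng K" by (rule K_field)
 case (Suc m)
 define E where "E = {th * evp g w |g. g = 0 \<or> degree g < m}"
 define v where "v = th * evp (monom 1 m) w"
 have vK: "v \<in> K" using th evp_K subring_mult[OF K_subring] by (simp add: v_def)
 have vE: "v \<notin> E"
 proof
  assume "v \<in> E"
  then obtain g where g: "g = 0 \<or> degree g < m" "th * evp (monom 1 m) w = th * evp g w" by (auto simp: E_def v_def)
  then have "monom 1 m = g" using th evp_inj by simp
  then show False using g(1) by (auto simp: degree_monom_eq)
 qed
 have "R.line_extension (range emb) v E = {emb c * v + e |c e. e \<in> E}"
  unfolding R.line_extension_def set_add_def' r_coset_def by (auto simp: rng_def)
 also have "\<dots> = {th * evp g w |g. g = 0 \<or> degree g < Suc m}"
 proof (intro subset_antisym subsetI)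
  fix x assume "x \<in> {emb c * v + e |c e. e \<in> E}"
  then obtain c g where x: "x = emb c * v + th * evp g w" "g = 0 \<or> degree g < m" by (auto simp: E_def)
  have "x = th * evp ([:c:] * monom 1 m + g) w" unfolding x(1) evp_simps(1,2) v_def by (simp add: evp_simps(6) algebra_simps)
  moreover have "degree ([:c:] * monom 1 m + g) < Suc m"
  proof -
   have "degree ([:c:] * monom 1 m) \<le> m" by (simp add: degree_monom_le smult_monom)
   moreover have "degree g \<le> m" using x(2) by auto
   ultimately show ?thesis by (simp add: degree_add_le le_imp_less_Suc)
  qed
  ultimately show "x \<in> {th * evp g w |g. g = 0 \<or> degree g < Suc m}" by blast
 next
  fix x assume "x \<in> {th * evp g w |g. g = 0 \<or> degree g < Suc m}"
  then obtain g where x': "x = th * evp g w" "g = 0 \<or> degree g < Suc m" by blast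
  then have x: "x = th * evp g w" "degree g \<le> m" by auto
  define g' where "g' = g - [:coeff g m:] * monom 1 m"
  have "coeff g' k = 0" if "k \<ge> m" for k
   using x(2) that by (cases "k = m") (auto simp: g'_def smult_monom coeff_monom coeff_eq_0)
  then have "g' = 0 \<or> degree g' < m" by (metis leading_coeff_0_iff not_less)
  moreover have "g = [:coeff g m:] * monom 1 m + g'" by (simp add: g'_def)
  then have "x = emb (coeff g m) * v + th * evp g' w" unfolding x(1) v_def
   by (metis (no_types, opaque_lifting) evp_simps(1,2,6) distrib_left mult.left_commute)
  ultimately show "x \<in> {emb c * v + e |c e. e \<in> E}" unfolding E_def by blast
 qed
 finally show ?case using R.Suc_dim[OF _ vE, of m "range emb"] Suc vK unfolding E_def by simp
qed

text \<open>The point of the normalization at which the parameter w takes the value i, with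
  \<open>None\<close> for a pole of w.\<close>

definition plc :: "complex option => npoint" where
 "plc i = (THE P. P \<in> normalization C & hh ` point_ring C P = Vw i)"

lemma plc_bij: "bij_betw plc UNIV (normalization C)" and plc_ring: "hh ` point_ring C (plc i) = Vw i"
 and plc_normalization: "plc i \<in> normalization C"
proof -
 define L where "L = (%(q, M). localization (Rn q) M)"
 have pr: "hh ` point_ring C P = L (npt P)" if "P \<in> normalization C" for P
  using that hh_point_ring(1)[of "fst P" "snd P"] by (cases P) (auto simp: normalization_def L_def npt_def)
 have b: "bij_betw (L \<circ> npt) (normalization C) (range Vw)"
  using bij_betw_trans[OF normalization_npoints npoints_Vw] unfolding L_def .
 have ex: "\<exists>!P. P \<in> normalization C & hh ` point_ring C P = Vw i" for i
 proof -
  have "Vw i \<in> (L \<circ> npt) ` normalization C" using b by (simp add: bij_betw_def)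
  then obtain P where P: "P \<in> normalization C" "L (npt P) = Vw i" by auto
  show ?thesis
  proof (rule ex1I[of _ P])
   show "P \<in> normalization C & hh ` point_ring C P = Vw i" using P pr by simp
   fix Q assume Q: "Q \<in> normalization C & hh ` point_ring C Q = Vw i"
   then have e: "(L \<circ> npt) Q = (L \<circ> npt) P" using P pr[of Q] by simp
   have "inj_on (L \<circ> npt) (normalization C)" using b by (simp add: bij_betw_def)
   from inj_onD[OF this e] show "Q = P" using P(1) Q by blast
  qed
 qed
 have pl: "plc i \<in> normalization C & hh ` point_ring C (plc i) = Vw i" for i
  unfolding plc_def by (rule theI'[OF ex])
 show "hh ` point_ring C (plc i) = Vw i" "plc i \<in> normalization C" using pl by auto
 show "bij_betw plc UNIV (normalization C)"
  unfolding bij_betw_def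
 proof
  show "inj plc" using pl Vw_inj by (metis injI)
  show "range plc = normalization C"
  proof (intro subset_antisym subsetI)
   fix P assume P: "P \<in> normalization C"
   then have "(L \<circ> npt) P \<in> range Vw" using b by (auto simp: bij_betw_def)
   then obtain i where "hh ` point_ring C P = Vw i" using pr P by auto
   then have "P = plc i" using ex[of i] pl[of i] P by blast
   then show "P \<in> range plc" by blast
  qed (use pl in auto)
 qed
qed

lemma Vw_units:
 assumes "u \<in> K" shows "u \<in> Vw i & (\<exists>x\<in>Vw i. x * u = 1) \<longleftrightarrow> u ~= 0 & ordw i u = 0"
proof
 assume "u \<in> Vw i & (\<exists>x\<in>Vw i. x * u = 1)"
 then obtain x where x: "u \<in> Vw i" "x \<in> Vw i" "x * u = 1" by blast
 then have nz: "u ~= 0" "x ~= 0" by auto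
 have "ordw i x + ordw i u = 0" using ordw_mult[of x u i] x nz ordw_1[of i] by (simp add: Vw_def)
 then show "u ~= 0 & ordw i u = 0" using x nz by (auto simp: Vw_def)
next
 assume u: "u ~= 0 & ordw i u = 0"
 then have "inverse u \<in> Vw i" "inverse u * u = 1" using assms K_inverse ordw_inverse[of u i] by (auto simp: Vw_def)
 then show "u \<in> Vw i & (\<exists>x\<in>Vw i. x * u = 1)" using u assms by (auto simp: Vw_def)
qed

text \<open>Units of the local ring have order 0 and nonunits order at least 1, so the generators of
  the maximal ideal are exactly the elements of order 1. Whichever generator t is taken, f = u t^n
  forces n to be the order.\<close>

lemma order_at_plc:
 assumes f: "f \<in> carrier FF" "hh f ~= 0"
 shows "order_at C (plc i) f = ordw i (hh f)"
proof -
 interpret h: ring_hom_cring FF "rng K" hh by (rule hh_hom)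
 have inj: "inj_on hh (carrier FF)" using hh_bij by (simp add: bij_betw_def)
 define R where "R = FF\<lparr>carrier := point_ring C (plc i)\<rparr>"
 have Rsub: "point_ring C (plc i) \<subseteq> carrier FF"
  using plc_normalization[of i] hh_point_ring(2)[of "fst (plc i)" "snd (plc i)"] by (auto simp: normalization_def)
 have mem: "x \<in> point_ring C (plc i) \<longleftrightarrow> hh x \<in> Vw i" if "x \<in> carrier FF" for x
  using inj_on_image_mem_iff[OF inj that Rsub] plc_ring[of i] by simp
 have cR: "carrier R = {x \<in> carrier FF. hh x \<in> Vw i}" using Rsub mem by (auto simp: R_def)
 have im: "hh ` carrier R = Vw i" by (simp add: R_def plc_ring)
 have mR: "x \<otimes>\<^bsub>R\<^esub> y = x \<otimes>\<^bsub>FF\<^esub> y" "\<one>\<^bsub>R\<^esub> = \<one>\<^bsub>FF\<^esub>" for x y by (simp_all add: R_def)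
 have hm: "hh (x \<otimes>\<^bsub>FF\<^esub> y) = hh x * hh y" if "x \<in> carrier FF" "y \<in> carrier FF" for x y using that h.hom_mult by simp
 have h1: "hh \<one>\<^bsub>FF\<^esub> = 1" using h.hom_one by simp
 have eq: "x = y \<longleftrightarrow> hh x = hh y" if "x \<in> carrier FF" "y \<in> carrier FF" for x y using inj_on_eq_iff[OF inj that] by blast
 have KK: "hh x \<in> K" if "x \<in> carrier FF" for x using that h.hom_closed by simp
 have units: "u \<in> Units R \<longleftrightarrow> u \<in> carrier FF & hh u ~= 0 & ordw i (hh u) = 0" for u
 proof -
  have "u \<in> Units R \<longleftrightarrow> u \<in> carrier R & (\<exists>x\<in>carrier R. hh x * hh u = 1)"
  proof -
   have "x \<otimes>\<^bsub>FF\<^esub> u = \<one>\<^bsub>FF\<^esub> & u \<otimes>\<^bsub>FF\<^esub> x = \<one>\<^bsub>FF\<^esub> \<longleftrightarrow> hh x * hh u = 1" if "x \<in> carrier R" "u \<in> carrier R" for x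
    using that eq[of "x \<otimes>\<^bsub>FF\<^esub> u" "\<one>\<^bsub>FF\<^esub>"] eq[of "u \<otimes>\<^bsub>FF\<^esub> x" "\<one>\<^bsub>FF\<^esub>"] hm[of x u] hm[of u x] h1
    by (auto simp: cR mult.commute)
   then show ?thesis unfolding Units_def mR by blast
  qed
  also have "\<dots> \<longleftrightarrow> u \<in> carrier FF & hh u \<in> Vw i & (\<exists>x\<in>Vw i. x * hh u = 1)" unfolding im[symmetric] using mem by (auto simp: cR)
  also have "\<dots> \<longleftrightarrow> u \<in> carrier FF & hh u ~= 0 & ordw i (hh u) = 0" using Vw_units[OF KK] by blast
  finally show ?thesis .
 qed
 have nonu: "x \<in> carrier R - Units R \<longleftrightarrow> x \<in> carrier FF & (hh x = 0 \<or> ordw i (hh x) \<ge> 1)" for x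
  using KK by (auto simp: cR units Vw_def)
 have gen: "PIdl\<^bsub>R\<^esub> t = carrier R - Units R \<longleftrightarrow> hh t ~= 0 & ordw i (hh t) = 1" if t: "t \<in> carrier R" for t
 proof
  assume p: "PIdl\<^bsub>R\<^esub> t = carrier R - Units R"
  define z where "z = Th (tw i)"
  have z: "z \<in> carrier FF" "hh z = tw i" using Th_hh tw(1) by (auto simp: z_def)
  then have "z \<in> PIdl\<^bsub>R\<^esub> t" using p nonu[of z] tw(3) by simp
  then obtain x where x: "x \<in> carrier R" "z = x \<otimes>\<^bsub>FF\<^esub> t" by (auto simp: cgenideal_def mR)
  have e: "tw i = hh x * hh t" using x t z hm by (simp add: cR)
  then have nz: "hh x ~= 0" "hh t ~= 0" using tw(2)[of i] by auto
  then have "1 = ordw i (hh x) + ordw i (hh t)" using ordw_mult[of "hh x" "hh t" i] e x t tw(3)[of i] by (simp add: cR Vw_def)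
  moreover have "ordw i (hh x) \<ge> 0" using x nz by (simp add: cR Vw_def)
  moreover have "t \<in> carrier R - Units R"
  proof -
   have "\<one>\<^bsub>FF\<^esub> \<otimes>\<^bsub>FF\<^esub> t \<in> PIdl\<^bsub>R\<^esub> t" unfolding cgenideal_def mR
    using h1 subring_1[OF Vw_subring[of i]] by (auto simp: cR)
   then show ?thesis using p t by (simp add: cR)
  qed
  then have "ordw i (hh t) \<ge> 1" using nonu[of t] nz by simp
  ultimately show "hh t ~= 0 & ordw i (hh t) = 1" using nz by linarith
 next
  assume ht: "hh t ~= 0 & ordw i (hh t) = 1"
  have tF: "t \<in> carrier FF" using t by (simp add: cR)
  show "PIdl\<^bsub>R\<^esub> t = carrier R - Units R"
  proof (intro subset_antisym subsetI)
   fix y assume "y \<in> PIdl\<^bsub>R\<^esub> t"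
   then obtain x where x: "x \<in> carrier FF" "hh x \<in> Vw i" "y = x \<otimes>\<^bsub>FF\<^esub> t" by (auto simp: cgenideal_def mR cR)
   have "hh y = 0 \<or> ordw i (hh y) \<ge> 1"
    using x tF ht hm[of x t] ordw_mult[of "hh x" "hh t" i] KK by (cases "hh x = 0") (auto simp: Vw_def)
   then show "y \<in> carrier R - Units R" using nonu x tF by simp
  next
   fix y assume "y \<in> carrier R - Units R"
   then have y: "y \<in> carrier FF" "hh y = 0 \<or> ordw i (hh y) \<ge> 1" using nonu by auto
   define x where "x = Th (hh y / hh t)"
   have k: "hh y / hh t \<in> K" using KK y tF K_divide by blast
   then have x: "x \<in> carrier FF" "hh x = hh y / hh t" using Th_hh by (auto simp: x_def)
   have "hh x \<in> Vw i"
   proof (cases "hh y = 0")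
    case False
    have "ordw i (hh y / hh t) = ordw i (hh y) - ordw i (hh t)"
     using ordw_mult[of "hh y" "inverse (hh t)" i] ordw_inverse[of "hh t" i] ht False KK[OF y(1)] KK[OF tF] K_inverse
     by (simp add: field_class.field_divide_inverse)
    then show ?thesis using False y ht k by (simp add: Vw_def x)
   qed (use k in \<open>simp add: Vw_def x\<close>)
   moreover have "y = x \<otimes>\<^bsub>FF\<^esub> t" using eq[of y "x \<otimes>\<^bsub>FF\<^esub> t"] x y tF ht hm by simp
   ultimately show "y \<in> PIdl\<^bsub>R\<^esub> t" unfolding cgenideal_def mR using x by (auto simp: cR)
  qed
 qed
 have ipow: "t [^]\<^bsub>FF\<^esub> (m::int) \<in> carrier FF & hh (t [^]\<^bsub>FF\<^esub> m) = hh t powi m" if t: "t \<in> carrier FF" "hh t ~= 0" for t m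
 proof (cases "m < 0")
  case True
  have "t [^]\<^bsub>FF\<^esub> nat (- m) \<in> carrier FF" "hh (t [^]\<^bsub>FF\<^esub> nat (- m)) = hh t ^ nat (- m)" using t hh_pow by auto
  moreover have "t [^]\<^bsub>FF\<^esub> m = inv\<^bsub>FF\<^esub> (t [^]\<^bsub>FF\<^esub> nat (- m))" unfolding int_pow_def2[of FF t m] using True by simp
  moreover have "hh t powi m = inverse (hh t ^ nat (- m))" using True by (simp add: power_int_def power_inverse)
  ultimately show ?thesis using hh_inv[of "t [^]\<^bsub>FF\<^esub> nat (- m)"] t(2) by simp
 next
  case False
  have "t [^]\<^bsub>FF\<^esub> m = t [^]\<^bsub>FF\<^esub> nat m" unfolding int_pow_def2[of FF t m] using False by simp
  moreover have "hh t powi m = hh t ^ nat m" using False by (simp add: power_int_def)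
  ultimately show ?thesis using t hh_pow[OF t(1), of "nat m"] by simp
 qed
 have unfold: "order_at C (plc i) f = (THE n. \<exists>t u. t \<in> carrier R & PIdl\<^bsub>R\<^esub> t = carrier R - Units R & u \<in> Units R &
        f = u \<otimes>\<^bsub>FF\<^esub> (t [^]\<^bsub>FF\<^esub> n))"
  unfolding order_at_def Let_def R_def ..
 show ?thesis unfolding unfold
 proof (rule the_equality)
  define m where "m = ordw i (hh f)"
  define t where "t = Th (tw i)"
  define u where "u = Th (hh f * inverse (tw i powi m))"
  have t: "t \<in> carrier FF" "hh t = tw i" using Th_hh tw(1) by (auto simp: t_def)
  have k: "tw i powi m \<in> K" "tw i powi m ~= 0" using K_powi tw(1,2) by auto
  have uk: "hh f * inverse (tw i powi m) \<in> K" using k KK[OF f(1)] K_inverse subring_mult[OF K_subring] by blast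
  then have u: "u \<in> carrier FF" "hh u = hh f * inverse (tw i powi m)" using Th_hh by (auto simp: u_def)
  have "ordw i (hh u) = 0" unfolding u(2)
   using ordw_mult[OF KK[OF f(1)] f(2) K_inverse[OF k(1)], of i] ordw_inverse[OF k, of i] ordw_powi[OF tw(1,2), of i i m] k tw(3)[of i]
   by (simp add: m_def)
  then have uU: "u \<in> Units R" using units u f k by simp
  have tR: "t \<in> carrier R" using t tw[of i] by (simp add: cR Vw_def)
  have tt: "hh t ~= 0" "ordw i (hh t) = 1" using t tw by auto
  have "f = u \<otimes>\<^bsub>FF\<^esub> (t [^]\<^bsub>FF\<^esub> m)"
   using eq[OF f(1), of "u \<otimes>\<^bsub>FF\<^esub> (t [^]\<^bsub>FF\<^esub> m)"] ipow[OF t(1) tt(1), of m] hm[OF u(1), of "t [^]\<^bsub>FF\<^esub> m"] u t k by simp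
  then show "\<exists>t u. t \<in> carrier R & PIdl\<^bsub>R\<^esub> t = carrier R - Units R & u \<in> Units R & f = u \<otimes>\<^bsub>FF\<^esub> (t [^]\<^bsub>FF\<^esub> ordw i (hh f))"
   using tR gen[OF tR] tt uU unfolding m_def by blast
 next
  fix m :: int assume "\<exists>t u. t \<in> carrier R & PIdl\<^bsub>R\<^esub> t = carrier R - Units R & u \<in> Units R & f = u \<otimes>\<^bsub>FF\<^esub> (t [^]\<^bsub>FF\<^esub> m)"
  then obtain t u where *: "t \<in> carrier R" "PIdl\<^bsub>R\<^esub> t = carrier R - Units R" "u \<in> Units R" "f = u \<otimes>\<^bsub>FF\<^esub> (t [^]\<^bsub>FF\<^esub> m)" by blast
  have tt: "hh t ~= 0" "ordw i (hh t) = 1" "t \<in> carrier FF" using gen[OF *(1)] *(1,2) by (auto simp: cR)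
  have uu: "u \<in> carrier FF" "hh u ~= 0" "ordw i (hh u) = 0" using *(3) units by auto
  have "hh f = hh u * hh t powi m" using *(4) ipow[OF tt(3,1), of m] hm[OF uu(1)] by simp
  then show "m = ordw i (hh f)"
   using ordw_mult[OF KK[OF uu(1)] uu(2) K_powi[OF KK[OF tt(3)]], of m i] ordw_powi[OF KK[OF tt(3)] tt(1), of i m] tt uu by simp
 qed
qed

text \<open>A root of the denominator in a representation with denominator of least degree would be
  a pole, since a common linear factor could be cancelled.\<close>

lemma poly_of_regular:
 assumes f: "f \<in> K" and reg: "!!a. f = 0 \<or> ordw (Some a) f \<ge> 0"
 shows "\<exists>g. f = evp g w"
proof (cases "f = 0")
 case True then show ?thesis by (intro exI[of _ 0]) (simp add: evp_simps)
next
 case False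
 define Q where "Q pq \<longleftrightarrow> fst pq ~= 0 & snd pq ~= 0 & f = evp (fst pq) w / evp (snd pq) w" for pq
 obtain p0 q0 where "p0 ~= 0" "q0 ~= 0" "f = evp p0 w / evp q0 w" using K_rep_nz[OF f False] .
 then have "Q (p0, q0)" by (simp add: Q_def)
 then obtain pq where pq: "Q pq" and min: "!!y. Q y ==> degree (snd pq) \<le> degree (snd y)"
  using ex_has_least_nat[of Q _ "%y. degree (snd y)"] by blast
 obtain p q where [simp]: "pq = (p, q)" by (cases pq)
 have nz: "p ~= 0" "q ~= 0" "f = evp p w / evp q w" using pq by (auto simp: Q_def)
 have "degree q = 0"
 proof (rule ccontr)
  assume "degree q ~= 0"
  then obtain a where a: "poly q a = 0" using fundamental_theorem_of_algebra constant_degree by metis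
  then have oq: "order a q > 0" using nz(2) by (simp add: order_root)
  have "ordw (Some a) f \<ge> 0" using reg False by blast
  then have "order a p > 0" using oq ordw_eq[OF nz(1,2), of "Some a"] nz(3) by (simp add: ordp_def)
  then have "poly p a = 0" using order_root by fastforce
  then obtain p' where p': "p = [:-a, 1:] * p'" unfolding poly_eq_0_iff_dvd by (rule dvdE)
  obtain q' where q': "q = [:-a, 1:] * q'" using a unfolding poly_eq_0_iff_dvd by (rule dvdE)
  have "evp [:-a, 1:] w ~= 0" using evp_0_iff by simp
  then have "f = evp p' w / evp q' w" using nz(3) unfolding p' q' evp_simps(2) by simp
  moreover have nz': "p' ~= 0" "q' ~= 0" using nz p' q' by auto
  ultimately have "Q (p', q')" by (simp add: Q_def)
  then have "degree q \<le> degree q'" using min by fastforce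
  then show False using nz'(2) by (simp add: q' degree_mult_eq del: mult_pCons_left)
 qed
 then obtain c where c: "q = [:c:]" by (metis degree_eq_zeroE)
 have "f = evp (smult (inverse c) p) w"
 proof -
  have "smult (inverse c) p = [:inverse c:] * p" by simp
  then show ?thesis using nz(3) by (simp only: c evp_simps(2,6) emb_inverse field_class.field_divide_inverse mult.commute)
 qed
 then show ?thesis by blast
qed

text \<open>Riemann-Roch on the projective line. Multiplication by \<open>th\<close> moves the
  finite part of D to infinity, so L(D) consists of the products of \<open>th\<close> with the
  polynomials of degree at most deg D, and has dimension deg D + 1.\<close>

theorem ell_ge:
 assumes D: "divisor C D" shows "int (ell C D) \<ge> divisor_degree C D + 1"
proof (cases "divisor_degree C D \<ge> 0")
 \<comment> \<open>For negative degree the bound is at most 0, while \<open>ell\<close> is a natural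
   number whatever its value.\<close>
 case False then show ?thesis by simp
next
 case True
 interpret Th: ring_hom_ring "rng K" FF Th by (rule Th_hom)
 interpret h: ring_hom_cring FF "rng K" hh by (rule hh_hom)
 define d where "d i = D (plc i)" for i
 define A where "A = {a. d (Some a) ~= 0}"
 define N where "N = nat (divisor_degree C D)"
 have inj: "inj plc" and sur: "range plc = normalization C" using plc_bij by (auto simp: bij_betw_def)
 have fin: "finite {i. d i ~= 0}"
 proof -
  have "plc ` {i. d i ~= 0} = {P \<in> normalization C. D P ~= 0}" unfolding sur[symmetric] by (auto simp: d_def)
  then show ?thesis using D inj finite_imageD unfolding divisor_def by (metis inj_on_subset subset_UNIV)
 qed
 have finA: "finite A"
 proof -
  have "Some ` A \<subseteq> {i. d i ~= 0}" by (auto simp: A_def)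
  then have "finite (Some ` A)" using fin finite_subset by blast
  then show ?thesis by (rule finite_imageD) simp
 qed
 have deg: "divisor_degree C D = (\<Sum>a\<in>A. d (Some a)) + d None"
 proof -
  have "divisor_degree C D = (\<Sum>P\<in>plc ` {i. d i ~= 0}. D P)"
   unfolding divisor_degree_def by (rule sum.cong) (auto simp: d_def sur[symmetric])
  also have "\<dots> = (\<Sum>i | d i ~= 0. d i)"
   by (subst sum.reindex) (auto simp: d_def intro: inj_on_subset[OF inj])
  also have "\<dots> = (\<Sum>i\<in>insert None (Some ` A). d i)"
  proof (rule sum.mono_neutral_left)
   show "{i. d i ~= 0} \<subseteq> insert None (Some ` A)"
   proof
    fix i assume "i \<in> {i. d i ~= 0}" then show "i \<in> insert None (Some ` A)" by (cases i) (auto simp: A_def)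
   qed
  qed (use finA in auto)
  also have "\<dots> = d None + (\<Sum>a\<in>A. d (Some a))"
   using finA by (subst sum.insert) (auto simp: sum.reindex)
  finally show ?thesis by simp
 qed
 \<comment> \<open>At each finite point a this has order - d a; its order at infinity is therefore
   the sum of these d a.\<close>
 define th where "th = (\<Prod>a\<in>A. (w - emb a) powi (- d (Some a)))"
 have wa: "w - emb a \<in> K" "w - emb a ~= 0" for a using tw(1,2)[of "Some a"] by (auto simp: tw_def)
 have thp: "(\<Prod>a\<in>B. (w - emb a) powi (- d (Some a))) \<in> K & (\<Prod>a\<in>B. (w - emb a) powi (- d (Some a))) ~= 0 &
   ordw i (\<Prod>a\<in>B. (w - emb a) powi (- d (Some a))) = (\<Sum>a\<in>B. - d (Some a) * ordw i (w - emb a))" if "finite B" for B i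
  using that
 proof (induction B)
  case empty then show ?case using subring_1[OF K_subring] ordw_1 by simp
 next
  case (insert b B)
  have 1: "(w - emb b) powi (- d (Some b)) \<in> K" "(w - emb b) powi (- d (Some b)) ~= 0" using K_powi[OF wa(1)] wa(2) by auto
  show ?case using insert 1 ordw_mult[OF 1, of "\<Prod>a\<in>B. (w - emb a) powi (- d (Some a))" i] ordw_powi[OF wa, of i b "- d (Some b)"]
   subring_mult[OF K_subring 1(1)] by auto
 qed
 have thK: "th \<in> K" "th ~= 0" using thp[OF finA] by (auto simp: th_def)
 have oa: "ordw (Some b) (w - emb a) = (if a = b then 1 else 0)" for a b
 proof -
  have "w - emb a = evp [:- a, 1:] w / evp 1 w" by (simp add: map_poly_pCons uminus one evp_simps(4))
  then have o: "ordw (Some b) (w - emb a) = ordp (Some b) [:- a, 1:] - ordp (Some b) 1" using ordw_eq[of "[:- a, 1:]" 1 "Some b"] by simp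
  show ?thesis
  proof (cases "a = b")
   case True then show ?thesis using tw(3)[of "Some b"] by (simp add: tw_def)
  next
   case False
   then have "order b [:- a, 1:] = 0" by (intro order_0I) simp
   then show ?thesis using o False by (simp add: ordp_def)
  qed
 qed
 have oN: "ordw None (w - emb a) = -1" for a
 proof -
  have "w - emb a = evp [:- a, 1:] w / evp 1 w" by (simp add: map_poly_pCons uminus one evp_simps(4))
  then show ?thesis using ordw_eq[of "[:- a, 1:]" 1 None] by (simp add: ordp_def)
 qed
 have th_fin: "ordw (Some b) th = - d (Some b)" for b
 proof -
  have "ordw (Some b) th = (\<Sum>a\<in>A. if a = b then - d (Some a) else 0)"
   using thp[OF finA, of "Some b"] unfolding th_def oa by (simp add: if_distrib cong: if_cong)
  also have "\<dots> = (if b \<in> A then - d (Some b) else 0)" using finA by simp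
  finally show ?thesis by (auto simp: A_def)
 qed
 have th_inf: "ordw None th = (\<Sum>a\<in>A. d (Some a))" using thp[OF finA, of None] unfolding th_def oN by simp
 define E where "E = {th * evp g w |g. g = 0 \<or> degree g < Suc N}"
 have Npos: "int N = (\<Sum>a\<in>A. d (Some a)) + d None" using True deg by (simp add: N_def)
 have E: "f \<in> E \<longleftrightarrow> f \<in> K & (f = 0 \<or> (\<forall>i. ordw i f \<ge> - d i))" for f
 proof
  assume "f \<in> E"
  then obtain g where g: "f = th * evp g w" "g = 0 \<or> degree g < Suc N" by (auto simp: E_def)
  have fK: "f \<in> K" using g thK evp_K subring_mult[OF K_subring] by blast
  show "f \<in> K & (f = 0 \<or> (\<forall>i. ordw i f \<ge> - d i))"
  proof (cases "g = 0")
   case True then show ?thesis using g subring_0[OF K_subring] by (simp add: evp_simps)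
  next
   case False
   have og: "ordw i (evp g w) = ordp i g - ordp i 1" for i using ordw_eq[OF False, of 1 i] by (simp add: evp_simps(4))
   have of: "ordw i f = ordw i th + ordw i (evp g w)" for i
    unfolding g(1) using thK evp_K evp_0_iff False by (intro ordw_mult) auto
   have "ordw i f \<ge> - d i" for i
   proof (cases i)
    case None then show ?thesis using of og th_inf g False Npos by (simp add: ordp_def)
   next
    case (Some b) then show ?thesis using of og th_fin by (simp add: ordp_def)
   qed
   then show ?thesis using fK by blast
  qed
 next
  assume f: "f \<in> K & (f = 0 \<or> (\<forall>i. ordw i f \<ge> - d i))"
  show "f \<in> E"
  proof (cases "f = 0")
   case True then show ?thesis unfolding E_def mem_Collect_eq by (intro exI[of _ 0]) (simp add: evp_simps)
  next
   case False
   define h where "h = f * inverse th"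
   have hK: "h \<in> K" "h ~= 0" using f thK K_inverse subring_mult[OF K_subring] False by (auto simp: h_def)
   have oh: "ordw i h = ordw i f - ordw i th" for i
    unfolding h_def using ordw_mult[of f "inverse th" i] ordw_inverse[OF thK, of i] f False thK K_inverse by simp
   have oh': "ordw (Some a) h \<ge> 0" for a using oh[of "Some a"] th_fin[of a] f False by (metis add.commute diff_ge_0_iff_ge)
   obtain g where g: "h = evp g w" using poly_of_regular[OF hK(1)] oh' by blast
   then have g0: "g ~= 0" using hK(2) by (auto simp: evp_simps)
   have "ordw None h = - int (degree g)" using ordw_eq[OF g0, of 1 None] g by (simp add: evp_simps(4) ordp_def)
   moreover have "ordw None f \<ge> - d None" using f False by blast
   ultimately have "degree g \<le> N" using oh[of None] th_inf Npos by linarith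
   moreover have "f = th * evp g w" using g thK by (simp add: h_def field_simps)
   ultimately show ?thesis unfolding E_def by auto
  qed
 qed
 have L: "riemann_roch_space C D = Th ` E"
 proof -
  have z: "f = \<zero>\<^bsub>FF\<^esub> \<longleftrightarrow> hh f = 0" if "f \<in> carrier FF" for f
  proof -
   have "inj_on hh (carrier FF)" using hh_bij by (simp add: bij_betw_def)
   from inj_on_eq_iff[OF this that Th.S.zero_closed] show ?thesis using h.hom_zero by simp
  qed
  have m: "f \<in> riemann_roch_space C D \<longleftrightarrow> f \<in> carrier FF & hh f \<in> E" for f
  proof (cases "f \<in> carrier FF")
   case True
   then have "hh f \<in> K" using h.hom_closed by simp
   moreover have "(\<forall>P\<in>normalization C. order_at C P f \<ge> - D P) \<longleftrightarrow> (\<forall>i. ordw i (hh f) \<ge> - d i)" if "hh f ~= 0"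
    unfolding sur[symmetric] d_def using order_at_plc[OF True that] by simp
   ultimately show ?thesis unfolding riemann_roch_space_def E using True z by auto
  qed (simp add: riemann_roch_space_def)
  show ?thesis
  proof (intro subset_antisym subsetI)
   fix f assume "f \<in> riemann_roch_space C D"
   then show "f \<in> Th ` E" using m Th_hh(1) by (metis imageI)
  next
   fix f assume "f \<in> Th ` E"
   then obtain e where e: "e \<in> E" "f = Th e" by blast
   then have "e \<in> K" using E by blast
   then show "f \<in> riemann_roch_space C D" using e m Th_hh(2,3) by simp
  qed
 qed
 have "ring.dimension (rng K) (Suc N) (range emb) E" unfolding E_def by (rule dimension_poly_space[OF thK])
 moreover have "inj_on Th E" using E Th_hh(2) by (metis inj_onI)
 ultimately have dim: "ring.dimension FF (Suc N) (constants C) (riemann_roch_space C D)"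
  unfolding L constants_eq by (intro Th.inj_hom_dimension[OF emb_subfield FF_one_zero])
 have "ell C D = Suc N" unfolding ell_def
  by (rule the_equality[of _ "Suc N"], rule dim) (rule Th.S.dimension_is_inj[OF constants_subfield _ dim])
 then show ?thesis using True by (simp add: N_def)
qed

theorem rational: "rational_curve C"
proof -
 have "integral_curve C" unfolding integral_curve_def C_def using irr hom by blast
 moreover have "genus C = 0" unfolding genus_def using ell_ge by (intro Least_eq_0) simp
 ultimately show ?thesis by (simp add: rational_curve_def)
qed

end

section \<open>Linear terms, nodes and multiplicities\<close>

lemma cpx_hom_pconst: "cpx_hom (%c. [:c:])"
 by unfold_locales (auto simp: one_pCons)

interpretation pc: cpx_hom "%c. [:c:]" by (rule cpx_hom_pconst)

text \<open>The k-th component is the linear coefficient of F(v + T e_k) in T, so that no partial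
  derivatives of nested polynomials are needed.\<close>

definition grad :: "cpoly3 => complex ^ 3 => complex ^ 3" where
 "grad F v = (\<chi> k. coeff (ev (%c. [:c:]) F (\<chi> i. [:v $ i, if i = k then 1 else 0:])) 1)"

lemma coeff_0_ev: "coeff (ev (%c. [:c:]) F (\<chi> i. [:v $ i, u i:])) 0 = ev id F v"
proof -
 interpret c: comm_hom "%p::complex poly. coeff p 0" by unfold_locales (auto simp: coeff_mult)
 have "ev (%x. coeff [:x:] 0) F (\<chi> i. coeff ((\<chi> i. [:v $ i, u i:]) $ i) 0) = coeff (ev (%c. [:c:]) F (\<chi> i. [:v $ i, u i:])) 0"
  by (rule ev_comp[OF cpx_hom_pconst c.comm_hom_axioms])
 moreover have "(%x::complex. coeff [:x:] 0) = id" by auto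
 moreover have "(\<chi> i. coeff ((\<chi> i. [:v $ i, u i:]) $ i) 0) = v" by (simp add: vec_eq_iff)
 ultimately show ?thesis by simp
qed

lemma coeff_1_mult: "coeff (p * q) 1 = coeff p 0 * coeff q 1 + coeff p 1 * coeff q (0::nat)"
 by (simp add: coeff_mult atMost_Suc add.commute)

lemma grad_add: "grad (F + G) v = grad F v + grad G v"
 by (simp add: grad_def vec_eq_iff pc.ev_add)

lemma grad_mult: "grad (F * G) v $ k = ev id F v * grad G v $ k + ev id G v * grad F v $ k"
 unfolding grad_def vec_lambda_beta pc.ev_mult coeff_1_mult coeff_0_ev by (simp add: mult.commute)

lemma grad_cst: "grad (cst c) v $ k = 0"
 unfolding grad_def vec_lambda_beta pc.ev_cst by simp

lemma grad_var: "grad vx v $ k = (if k = 1 then 1 else 0)" "grad vy v $ k = (if k = 2 then 1 else 0)"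
 "grad vz v $ k = (if k = 3 then 1 else 0)"
 unfolding grad_def vec_lambda_beta pc.ev_vx pc.ev_vy pc.ev_vz by auto

lemma grad_lin: "grad (lin a) v = a"
proof -
 have "grad (lin a) v $ k = a $ k" for k
  unfolding lin_def grad_add vector_add_component grad_mult grad_cst grad_var idc.ev_cst
  using exhaust_3[of k] by auto
 then show ?thesis by (simp add: vec_eq_iff)
qed

lemma taylor_product:
 fixes a b :: "'a::comm_ring_1"
 shows "(a + l + q) * (b + m + r) - a * b - (a * m + b * l) = l * m + a * r + b * q + l * r + m * q + q * r"
 by (simp add: algebra_simps)

text \<open>One statement for several filtrations: W1 holds the quantities of first order and W2
  those of second order. It is used for polynomials in one and in two variables vanishing at the
  origin, and for elements of value at least \<open>mu\<close> and 2 \<open>mu\<close> in the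
  function field.\<close>

lemma taylor:
 fixes h :: "complex => 'a::comm_ring_1" and W1 W2 :: "'a set" and \<delta> :: "'a ^ 3"
 assumes h: "cpx_hom h"
  and W1: "0 \<in> W1" "!!x y. x \<in> W1 ==> y \<in> W1 ==> x + y \<in> W1" "!!c x. x \<in> W1 ==> h c * x \<in> W1"
  and W2: "0 \<in> W2" "!!x y. x \<in> W2 ==> y \<in> W2 ==> x + y \<in> W2" "!!c x. x \<in> W2 ==> h c * x \<in> W2"
  and W: "!!x y. x \<in> W1 ==> y \<in> W1 ==> x * y \<in> W2" "!!x y. x \<in> W1 ==> y \<in> W2 ==> x * y \<in> W2"
    "!!x y. x \<in> W2 ==> y \<in> W2 ==> x * y \<in> W2"
  and \<delta>: "!!i. \<delta> $ i \<in> W1"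
 shows "ev h F (\<chi> i. h (v $ i) + \<delta> $ i) - h (ev id F v) - (\<Sum>k\<in>UNIV. h (grad F v $ k) * \<delta> $ k) \<in> W2"
proof -
 interpret h: cpx_hom h by fact
 define L where "L F = (\<Sum>k\<in>UNIV. h (grad F v $ k) * \<delta> $ k)" for F
 have LW: "L F \<in> W1" for F
  unfolding L_def sum_3 by (intro W1 \<delta>)
 define Q where "Q F = ev h F (\<chi> i. h (v $ i) + \<delta> $ i) - h (ev id F v) - L F" for F
 have evQ: "ev h F (\<chi> i. h (v $ i) + \<delta> $ i) = h (ev id F v) + L F + Q F" for F by (simp add: Q_def)
 have "Q F \<in> W2"
 proof (induction F rule: cpoly3_induct)
  case (cst c)
  have "Q (cst c) = 0" unfolding Q_def L_def h.ev_cst idc.ev_cst grad_cst by simp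
  then show ?case using W2 by simp
 next
  case vx
  have "Q vx = 0" unfolding Q_def L_def h.ev_vx idc.ev_vx grad_var by (simp add: sum_3 h.one)
  then show ?case using W2 by simp
 next
  case vy
  have "Q vy = 0" unfolding Q_def L_def h.ev_vy idc.ev_vy grad_var by (simp add: sum_3 h.one)
  then show ?case using W2 by simp
 next
  case vz
  have "Q vz = 0" unfolding Q_def L_def h.ev_vz idc.ev_vz grad_var by (simp add: sum_3 h.one)
  then show ?case using W2 by simp
 next
  case (add F G)
  have "L (F + G) = L F + L G" unfolding L_def by (simp add: grad_add h.add distrib_right sum.distrib)
  then have "Q (F + G) = Q F + Q G" unfolding Q_def h.ev_add idc.ev_add h.add by (simp add: algebra_simps)
  then show ?case using add W2 by simp
 next
  case (mult F G)
  have lin: "L (F * G) = h (ev id F v) * L G + h (ev id G v) * L F"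
   unfolding L_def grad_mult sum_3 h.add h.mult by (simp only: algebra_simps)
  have "Q (F * G) = ev h F (\<chi> i. h (v $ i) + \<delta> $ i) * ev h G (\<chi> i. h (v $ i) + \<delta> $ i)
    - h (ev id F v) * h (ev id G v) - L (F * G)"
   unfolding Q_def[of "F * G"] h.ev_mult idc.ev_mult h.mult by (rule refl)
  then have "Q (F * G) = L F * L G + h (ev id F v) * Q G + h (ev id G v) * Q F + L F * Q G + L G * Q F + Q F * Q G"
   unfolding evQ[of F] evQ[of G] lin taylor_product .
  moreover have "L F * L G \<in> W2" "L F * Q G \<in> W2" "L G * Q F \<in> W2" "Q F * Q G \<in> W2"
   using W LW mult by auto
  ultimately show ?case using W2(2) W2(3) mult by presburger
 qed
 then show ?thesis by (simp add: Q_def L_def)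
qed

lemma directional:
 "coeff (ev (%c. [:c:]) F (\<chi> i. [:v $ i, u $ i:])) 1 = (\<Sum>k\<in>UNIV. grad F v $ k * u $ k)"
proof -
 let ?W1 = "{p :: complex poly. coeff p 0 = 0}" and ?W2 = "{p :: complex poly. coeff p 0 = 0 & coeff p 1 = 0}"
 have e: "(\<chi> i. [:v $ i:] + (\<chi> i. [:0, u $ i:]) $ i) = (\<chi> i. [:v $ i, u $ i:])" by (simp add: vec_eq_iff)
 have "ev (%c. [:c:]) F (\<chi> i. [:v $ i:] + (\<chi> i. [:0, u $ i:]) $ i) - [:ev id F v:] - (\<Sum>k\<in>UNIV. [:grad F v $ k:] * (\<chi> i. [:0, u $ i:]) $ k) \<in> ?W2"
  by (rule taylor[OF cpx_hom_pconst, where ?W1.0 = ?W1]) (auto simp: coeff_mult)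
 then show ?thesis unfolding e by (simp add: sum_3)
qed

lemma grad_scale:
 assumes F: "homogeneous n F" and c: "c ~= 0"
 shows "(\<Sum>k\<in>UNIV. grad F (c *s v) $ k * u $ k) = c ^ (n - 1) * (\<Sum>k\<in>UNIV. grad F v $ k * u $ k)"
proof -
 have e: "(\<chi> i. [:(c *s v) $ i, (c *s u) $ i:]) = [:c:] *s (\<chi> i. [:v $ i, u $ i:])" by (simp add: vec_eq_iff)
 have cp: "[:c:] ^ n = [:c ^ n:]" by (induction n) (auto simp: one_pCons)
 have "c * (\<Sum>k\<in>UNIV. grad F (c *s v) $ k * u $ k) = c ^ n * (\<Sum>k\<in>UNIV. grad F v $ k * u $ k)"
  using directional[of F "c *s v" "c *s u"] directional[of F v u] unfolding e pc.ev_scale[OF F] cp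
  by (simp add: sum_distrib_left mult_ac)
 \<comment> \<open>For n = 0 the truncated exponent n - 1 is 0 and the formula holds because both
   sums vanish.\<close>
 moreover have "n > 0 \<or> (\<Sum>k\<in>UNIV. grad F v $ k * u $ k) = 0 & (\<Sum>k\<in>UNIV. grad F (c *s v) $ k * u $ k) = 0"
 proof (cases "n > 0")
  case False
  then have h0: "homogeneous 0 F" using F by simp
  have "ev (%c. [:c:]) F w = ev (%c. [:c:]) F 0" for w using pc.ev_scale[OF h0, of 0 w] pc.ev_scale[OF h0, of 0 0] by simp
  moreover have "ev (%c. [:c:]) F 0 = [:ev id F 0:]"
   using ev_comp[OF cpx_hom_id pc.comm_hom_axioms, of F 0] by (simp add: zero_vec_def)
  ultimately have "coeff (ev (%c. [:c:]) F w) 1 = 0" for w by simp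
  then show ?thesis using directional[of F v u] directional[of F "c *s v" u] by simp
 qed simp
 ultimately show ?thesis using c by (cases n) auto
qed

text \<open>Compare the linear coefficients in T of F((1 + T) v) = (1 + T)^n F(v).\<close>

lemma euler:
 assumes F: "homogeneous n F" shows "(\<Sum>k\<in>UNIV. grad F v $ k * v $ k) = of_nat n * ev id F v"
proof -
 have e: "(\<chi> i. [:v $ i, v $ i:]) = [:1, 1:] *s (\<chi> i. [:v $ i:])" by (simp add: vec_eq_iff)
 have "ev (%c. [:c:]) F (\<chi> i. [:v $ i:]) = [:ev id F v:]"
  using ev_comp[OF cpx_hom_id pc.comm_hom_axioms, of F v] by simp
 then have "coeff (ev (%c. [:c:]) F (\<chi> i. [:v $ i, v $ i:])) 1 = coeff ([:1, 1:] ^ n) 1 * ev id F v"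
  unfolding e pc.ev_scale[OF F] by simp
 moreover have "coeff ([:1, 1:] ^ n :: complex poly) 1 = of_nat n & coeff ([:1, 1:] ^ n :: complex poly) 0 = 1"
  by (induction n) (auto simp: one_pCons coeff_pCons)
 ultimately show ?thesis using directional[of F v v] by simp
qed

lemma homogeneous_1_lin:
 assumes F: "homogeneous 1 F" shows "\<exists>a. F = lin a"
proof -
 define a where "a = vec3 (coeff (coeff (coeff F 0) 0) 1) (coeff (coeff (coeff F 0) 1) 0) (coeff (coeff (coeff F 1) 0) 0)"
 have "coeff (coeff (coeff F k) j) i = coeff (coeff (coeff (lin a) k) j) i" for i j k
 proof (cases "i + j + k = 1")
  case False
  then show ?thesis using F homogeneous_lin[of a] unfolding homogeneous_def by metis
 next
  case True
  then consider "i = 1" "j = 0" "k = 0" | "i = 0" "j = 1" "k = 0" | "i = 0" "j = 0" "k = 1" by linarith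
  then show ?thesis by cases (auto simp: lin_def a_def)
 qed
 then have "F = lin a" by (intro poly_eqI) blast
 then show ?thesis by blast
qed

lemma irreducible_dvd_zero_sets:
 assumes F: "irred F" "homogeneous n F" and G: "irred G" "homogeneous m G" and d: "F dvd G"
 shows "{q. vanishes_at F q} = {q. vanishes_at G q}"
proof -
 obtain H where H: "G = F * H" using d by (rule dvdE)
 have "~ is_unit F" using F Factorial_Ring.irreducible_not_unit by blast
 then have "is_unit H" using G(1) H Factorial_Ring.irreducibleD by blast
 then obtain c where "c ~= 0" "H = cst c" using is_unit_cpoly3 by blast
 then have "ev id G v = c * ev id F v" for v unfolding H idc.ev_mult by (simp only: idc.ev_cst) simp
 then have "ev id G v = 0 \<longleftrightarrow> ev id F v = 0" for v using \<open>c ~= 0\<close> by simp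
 then have "vanishes_at F q \<longleftrightarrow> vanishes_at G q" for q
  using pt_cases[of q] vanishes_at_pt F(2) G(2) by metis
 then show ?thesis by blast
qed

lemma union_reduced_equation:
 assumes F: "irred (F i)" "homogeneous (n i) (F i)" "irred (F j)" "homogeneous (n j) (F j)" "irred (F k)" "homogeneous (n k) (F k)"
  and ne: "{q. vanishes_at (F i) q} ~= {q. vanishes_at (F j) q}" "{q. vanishes_at (F i) q} ~= {q. vanishes_at (F k) q}"
   "{q. vanishes_at (F j) q} ~= {q. vanishes_at (F k) q}"
 shows "reduced_equation (F i * (F j * F k)) ({q. vanishes_at (F i) q} \<union> {q. vanishes_at (F j) q} \<union> {q. vanishes_at (F k) q})"
  "homogeneous (n i + (n j + n k)) (F i * (F j * F k))"
proof -
 show h: "homogeneous (n i + (n j + n k)) (F i * (F j * F k))" by (intro homogeneous_mult F)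
 have np: "n i + (n j + n k) > 0" using irreducible_degree_pos F by blast
 have nd: "~ F i dvd F j" "~ F i dvd F k" "~ F j dvd F k"
  using irreducible_dvd_zero_sets F ne by blast+
 have prime: "prime_elem (F i)" "prime_elem (F j)" "prime_elem (F k)"
  using F irreducible_imp_prime_elem by blast+
 have "~ F i dvd F j * F k" using prime(1) nd prime_elem_dvd_mult_iff by blast
 then have "squarefree (F i * (F j * F k))"
  using prime nd(3) by (intro squarefree_mult_coprime squarefree_prime_elem prime_elem_imp_coprime)
 moreover have "{q. vanishes_at (F i) q} \<union> {q. vanishes_at (F j) q} \<union> {q. vanishes_at (F k) q} = {q. vanishes_at (F i * (F j * F k)) q}"
  using vanishes_at_mult[OF F(2) homogeneous_mult[OF F(4,6)]] vanishes_at_mult[OF F(4,6)] by blast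
 ultimately show "reduced_equation (F i * (F j * F k)) ({q. vanishes_at (F i) q} \<union> {q. vanishes_at (F j) q} \<union> {q. vanishes_at (F k) q})"
  unfolding reduced_equation_def using h np by metis
qed

lemma poly_1_frame:
 "subst3 (%c. [:[:c:]:]) F [:[:A $ 1 $ 3, A $ 1 $ 1:], [:A $ 1 $ 2:]:] [:[:A $ 2 $ 3, A $ 2 $ 1:], [:A $ 2 $ 2:]:]
   [:[:A $ 3 $ 3, A $ 3 $ 1:], [:A $ 3 $ 2:]:] = poly (frame A F) 1"
proof -
 interpret g: comm_hom "%p::cpoly3. poly p 1" by unfold_locales auto
 have "ev (%x. poly (cst x) 1) F (\<chi> i. poly ((\<chi> i. lin (A $ i)) $ i) 1) = poly (ev cst F (\<chi> i. lin (A $ i))) 1"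
  by (rule ev_comp[OF cpx_hom_cst g.comm_hom_axioms])
 then show ?thesis by (simp add: frame_def lin_def ev_def)
qed

text \<open>Makes visible what the choices inside \<open>local_equation\<close> leave open: the
  equation is known up to a factor c, and of the matrix only that it is invertible with its last
  column over q.\<close>

lemma local_equation_frame:
 assumes F: "reduced_equation F D"
 obtains A A' :: "complex ^ 3 ^ 3" and c where "A ** A' = mat 1" "A' ** A = mat 1" "column 3 A ~= 0" "pt (column 3 A) = q" "c ~= 0"
  "local_equation D q = poly (frame A (cst c * F)) 1"
proof -
 define G where "G = (SOME F. reduced_equation F D)"
 define A where "A = (SOME A :: complex^3^3. invertible A & column 3 A \<in> Rep_proj_plane q)"
 have G: "reduced_equation G D" unfolding G_def using F by (rule someI)
 obtain c where c: "c ~= 0" "G = cst c * F" using reduced_equation_unique[OF F G] by blast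
 obtain v where v: "v ~= 0" "q = pt v" by (rule pt_cases)
 have vr: "v \<in> Rep_proj_plane q" using v Rep_pt[OF v(1)] by (auto intro!: range_eqI[of _ _ 1])
 have "\<exists>A :: complex^3^3. invertible A & column 3 A \<in> Rep_proj_plane q"
  using exists_frame[OF v(1)] vr by (metis invertible_def)
 then have A: "invertible A" "column 3 A \<in> Rep_proj_plane q" unfolding A_def by (metis (mono_tags, lifting) someI_ex)+
 obtain A' where A': "A ** A' = mat 1" "A' ** A = mat 1" using A(1) by (auto simp: invertible_def)
 have nz: "column 3 A ~= 0"
 proof
  assume "column 3 A = 0"
  then have "!!i. A $ i $ 3 = 0" by (simp add: column_def vec_eq_iff)
  then have "(A' ** A) $ 3 $ 3 = 0" by (simp add: matrix_matrix_mult_def)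
  then show False using A'(2) by (simp add: mat_def)
 qed
 obtain e where e: "column 3 A = e *s v" using A(2) Rep_pt[OF v(1)] v(2) by auto
 then have "e ~= 0" using nz by (auto simp: vsmult_eq_0)
 then have "pt (column 3 A) = q" using pt_eq_iff[OF v(1) nz] e v(2) by metis
 moreover have "local_equation D q = poly (frame A G) 1"
  unfolding local_equation_def Let_def G_def[symmetric] A_def[symmetric] by (rule poly_1_frame)
 ultimately show ?thesis using that A' nz c by blast
qed

definition vord :: "nat => complex poly poly set" where
 "vord m = {f. \<forall>i j. i + j < m \<longrightarrow> coeff (coeff f j) i = 0}"

lemma vord_add: "f \<in> vord m ==> g \<in> vord m ==> f + g \<in> vord m"
 by (auto simp: vord_def)

lemma vord_0: "0 \<in> vord m" by (simp add: vord_def)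

lemma vord_mult: assumes "f \<in> vord m" "g \<in> vord k" shows "f * g \<in> vord (m + k)"
 unfolding vord_def
proof (intro CollectI allI impI)
 fix i j assume ij: "i + j < m + k"
 have "coeff (coeff f j') i' * coeff (coeff g (j - j')) (i - i') = 0" if "i' \<le> i" "j' \<le> j" for i' j'
 proof (cases "i' + j' < m")
  case True then show ?thesis using assms(1) by (simp add: vord_def)
 next
  case False
  then have "(i - i') + (j - j') < k" using ij that by linarith
  then show ?thesis using assms(2) by (simp add: vord_def)
 qed
 then show "coeff (coeff (f * g) j) i = 0" unfolding coeff_mult coeff_sum by (intro sum.neutral ballI) simp
qed

lemma vord_mono: "f \<in> vord m ==> k \<le> m ==> f \<in> vord k"
 by (auto simp: vord_def)

lemma cpx_hom_cc: "cpx_hom (%c. [:[:c:]:])"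
 by unfold_locales (auto simp: one_pCons)

lemma vord_cst: "f \<in> vord m ==> [:[:c:]:] * f \<in> vord m"
 by (auto simp: vord_def)

lemma local_taylor:
 assumes "column 3 A = v"
 shows "\<exists>Q\<in>vord 2. poly (frame A F) 1 = [:[:ev id F v:]:] +
   [:[:0, \<Sum>k\<in>UNIV. grad F v $ k * A $ k $ 1:], [:\<Sum>k\<in>UNIV. grad F v $ k * A $ k $ 2:]:] + Q"
proof -
 let ?d = "(\<chi> i. [:[:0, A $ i $ 1:], [:A $ i $ 2:]:]) :: complex poly poly ^ 3"
 have vi: "v $ i = A $ i $ 3" for i using assms by (auto simp: column_def)
 have m1: "ev (%c. [:[:c:]:]) F (\<chi> i. [:[:v $ i:]:] + ?d $ i) - [:[:ev id F v:]:] - (\<Sum>k\<in>UNIV. [:[:grad F v $ k:]:] * ?d $ k) \<in> vord 2"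
 proof (rule taylor[OF cpx_hom_cc, where ?W1.0 = "vord 1"])
  show "x * y \<in> vord 2" if "x \<in> vord 1" "y \<in> vord 1" for x y using vord_mult[OF that] by (simp add: numeral_2_eq_2)
  show "x * y \<in> vord 2" if "x \<in> vord 1" "y \<in> vord 2" for x y using vord_mono[OF vord_mult[OF that]] by simp
  show "x * y \<in> vord 2" if "x \<in> vord 2" "y \<in> vord 2" for x y using vord_mono[OF vord_mult[OF that]] by simp
  show "?d $ i \<in> vord 1" for i by (auto simp: vord_def)
 qed (auto intro: vord_0 vord_add vord_cst simp del: mult_pCons_left)
 have m2: "ev (%c. [:[:c:]:]) F (\<chi> i. [:[:v $ i:]:] + ?d $ i) = poly (frame A F) 1"
  unfolding poly_1_frame[symmetric] by (simp add: ev_def vi)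
 have m3: "(\<Sum>k\<in>UNIV. [:[:grad F v $ k:]:] * ?d $ k) = [:[:0, \<Sum>k\<in>UNIV. grad F v $ k * A $ k $ 1:], [:\<Sum>k\<in>UNIV. grad F v $ k * A $ k $ 2:]:]"
  by (simp add: sum_3)
 have ex: "\<exists>Q\<in>vord 2. a = b + l + Q" if "a - b - l \<in> vord 2" for a b l :: "complex poly poly"
  using that by (intro bexI[of _ "a - b - l"]) (simp_all add: algebra_simps)
 show ?thesis using ex[OF m1] unfolding m2 m3 .
qed

text \<open>Up to terms of order 3 the local equation at q is a constant multiple of
  \<open>Fk\<close>(v) times the product of the linear parts of \<open>Fi\<close> and
  \<open>Fj\<close>. At a node this quadratic part has nonzero discriminant. So \<open>Fk\<close>(v)
  is nonzero and the two linear parts are independent; by Euler's relation both gradients kill v,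
  hence nothing else.\<close>

lemma node_transversal:
 assumes eq: "reduced_equation (Fi * (Fj * Fk)) D"
  and F: "homogeneous ni Fi" "homogeneous nj Fj" "homogeneous nk Fk" and node: "is_node D q" and on: "vanishes_at Fi q" "vanishes_at Fj q"
 obtains v where "v ~= 0" "pt v = q" "ev id Fk v ~= 0"
  "!!u. (\<Sum>k\<in>UNIV. grad Fi v $ k * u $ k) = 0 ==> (\<Sum>k\<in>UNIV. grad Fj v $ k * u $ k) = 0 ==> \<exists>c. u = c *s v"
proof -
 obtain A A' :: "complex ^ 3 ^ 3" and c where A: "A ** A' = mat 1" "A' ** A = mat 1" "column 3 A ~= 0" "pt (column 3 A) = q" and c: "c ~= 0"
  and le: "local_equation D q = poly (frame A (cst c * (Fi * (Fj * Fk)))) 1"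
  using local_equation_frame[OF eq] by blast
 define v where "v = column 3 A"
 have v: "v ~= 0" "pt v = q" using A by (auto simp: v_def)
 have z: "ev id Fi v = 0" "ev id Fj v = 0" using on vanishes_at_pt[OF F(1) v(1)] vanishes_at_pt[OF F(2) v(1)] v by auto
 define al be where "al G = (\<Sum>k\<in>UNIV. grad G v $ k * A $ k $ 1)" and "be G = (\<Sum>k\<in>UNIV. grad G v $ k * A $ k $ 2)" for G
 have T: "\<exists>Q\<in>vord 2. poly (frame A G) 1 = [:[:ev id G v:]:] + [:[:0, al G:], [:be G:]:] + Q" for G
  using local_taylor[OF v_def[symmetric], of G] unfolding al_def be_def .
 obtain Qi where Qi: "Qi \<in> vord 2" "poly (frame A Fi) 1 = [:[:0, al Fi:], [:be Fi:]:] + Qi" using T[of Fi] z by auto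
 obtain Qj where Qj: "Qj \<in> vord 2" "poly (frame A Fj) 1 = [:[:0, al Fj:], [:be Fj:]:] + Qj" using T[of Fj] z by auto
 define a where "a = c * ev id Fk v"
 obtain Qk where Qk: "Qk \<in> vord 2" "poly (frame A Fk) 1 = [:[:ev id Fk v:]:] + [:[:0, al Fk:], [:be Fk:]:] + Qk" using T[of Fk] by auto
 define li lj lk :: "complex poly poly" where "li = [:[:0, al Fi:], [:be Fi:]:]" and "lj = [:[:0, al Fj:], [:be Fj:]:]" and "lk = [:[:0, al Fk:], [:be Fk:]:]"
 have l1: "li \<in> vord 1" "lj \<in> vord 1" "lk \<in> vord 1" by (auto simp: vord_def li_def lj_def lk_def)
 have cc: "frame A (cst c) = cst c" by (simp add: frame_def)
 have f: "local_equation D q = [:[:a:]:] * (li * lj) + [:[:c:]:] * ((li * Qj + Qi * lj + Qi * Qj) * [:[:ev id Fk v:]:] + (li + Qi) * (lj + Qj) * (lk + Qk))"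
 proof -
  have "local_equation D q = [:[:c:]:] * ((li + Qi) * ((lj + Qj) * ([:[:ev id Fk v:]:] + lk + Qk)))"
   unfolding le frame_mult cc poly_mult Qi(2) Qj(2) Qk(2) li_def lj_def lk_def by simp
  moreover have "[:[:a:]:] = [:[:c:]:] * [:[:ev id Fk v:]:]" by (simp add: a_def)
  ultimately show ?thesis by (simp only: algebra_simps)
 qed
 have s1: "li + Qi \<in> vord 1" "lj + Qj \<in> vord 1" "lk + Qk \<in> vord 1"
  using l1 Qi(1) Qj(1) Qk(1) vord_mono[of _ 2 1] by (auto intro: vord_add)
 have p3: "(li + Qi) * (lj + Qj) * (lk + Qk) \<in> vord 3"
  using vord_mult[OF vord_mult[OF s1(1,2)] s1(3)] by (simp add: numeral_3_eq_3)
 have q3: "li * Qj + Qi * lj + Qi * Qj \<in> vord 3"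
  using vord_mult[OF l1(1) Qj(1)] vord_mult[OF Qi(1) l1(2)] vord_mono[OF vord_mult[OF Qi(1) Qj(1)], of 3]
  by (auto intro!: vord_add simp: numeral_3_eq_3)
 have r3: "[:[:c:]:] * ((li * Qj + Qi * lj + Qi * Qj) * [:[:ev id Fk v:]:] + (li + Qi) * (lj + Qj) * (lk + Qk)) \<in> vord 3"
  by (intro vord_cst vord_add p3) (metis vord_cst q3 mult.commute)
 have co: "coeff (coeff (local_equation D q) j) i = a * coeff (coeff (li * lj) j) i" if "i + j = 2" for i j
  using r3 that unfolding f vord_def by simp
 have q: "coeff (coeff (local_equation D q) 0) 2 = a * (al Fi * al Fj)"
  "coeff (coeff (local_equation D q) 1) 1 = a * (al Fi * be Fj + be Fi * al Fj)"
  "coeff (coeff (local_equation D q) 2) 0 = a * (be Fi * be Fj)"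
  by (simp_all add: co li_def lj_def numeral_2_eq_2)
 obtain w x y z where n: "w * z - x * y ~= 0" "a * (al Fi * al Fj) = w * y" "a * (al Fi * be Fj + be Fi * al Fj) = w * z + x * y"
   "a * (be Fi * be Fj) = x * z"
  using node q unfolding is_node_def Let_def by auto
 \<comment> \<open>The discriminant of the quadratic part, computed from its two
   factorizations.\<close>
 have "(w * z - x * y)\<^sup>2 = (w * z + x * y)\<^sup>2 - 4 * (w * y) * (x * z)" by (simp add: power2_eq_square algebra_simps)
 also have "\<dots> = (a * (al Fi * be Fj - be Fi * al Fj))\<^sup>2" unfolding n(2-4)[symmetric] by (simp add: power2_eq_square algebra_simps)
 finally have nz: "a * (al Fi * be Fj - be Fi * al Fj) ~= 0" using n(1) by (metis power_eq_0_iff zero_power2)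
 then have "ev id Fk v ~= 0" by (auto simp: a_def)
 moreover have "\<exists>e. u = e *s v" if u: "(\<Sum>k\<in>UNIV. grad Fi v $ k * u $ k) = 0" "(\<Sum>k\<in>UNIV. grad Fj v $ k * u $ k) = 0" for u
 proof -
  define x where "x = A' *v u"
  have ux: "u = A *v x" by (simp add: x_def matrix_vector_mul_assoc A)
  have uc: "u $ k = A $ k $ 1 * x $ 1 + A $ k $ 2 * x $ 2 + v $ k * x $ 3" for k
   unfolding ux by (simp add: matrix_vector_mult_def sum_3 v_def column_def)
  have expand: "(\<Sum>k\<in>UNIV. grad G v $ k * u $ k) = al G * x $ 1 + be G * x $ 2 + (\<Sum>k\<in>UNIV. grad G v $ k * v $ k) * x $ 3" for G
   unfolding al_def be_def sum_3 uc by (simp add: algebra_simps)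
  have 1: "al Fi * x $ 1 + be Fi * x $ 2 = 0" using u(1) expand[of Fi] euler[OF F(1), of v] z by simp
  have 2: "al Fj * x $ 1 + be Fj * x $ 2 = 0" using u(2) expand[of Fj] euler[OF F(2), of v] z by simp
  have d: "al Fi * be Fj - be Fi * al Fj ~= 0" using nz by auto
  have "(al Fi * be Fj - be Fi * al Fj) * x $ 1 = be Fj * (al Fi * x $ 1 + be Fi * x $ 2) - be Fi * (al Fj * x $ 1 + be Fj * x $ 2)"
   by (simp add: algebra_simps)
  then have x1: "x $ 1 = 0" using 1 2 d by simp
  have "(al Fi * be Fj - be Fi * al Fj) * x $ 2 = al Fi * (al Fj * x $ 1 + be Fj * x $ 2) - al Fj * (al Fi * x $ 1 + be Fi * x $ 2)"
   by (simp add: algebra_simps)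
  then have x2: "x $ 2 = 0" using 1 2 d by simp
  have "u = x $ 3 *s v" using uc x1 x2 by (simp add: vec_eq_iff)
  then show ?thesis by blast
 qed
 ultimately show ?thesis using that v by blast
qed

lemma coeff_poly_1:
 assumes F: "homogeneous n F" and ij: "i + j + k = n"
 shows "coeff (coeff (poly F 1) j) i = coeff (coeff (coeff F k) j) i"
proof -
 have "coeff (coeff (poly F 1) j) i = (\<Sum>l\<le>degree F. coeff (coeff (coeff F l) j) i)"
  by (simp add: poly_altdef coeff_sum)
 also have "\<dots> = (\<Sum>l\<in>{k} \<inter> {..degree F}. coeff (coeff (coeff F l) j) i)"
 proof (rule sum.mono_neutral_right)
  show "\<forall>l\<in>{..degree F} - {k} \<inter> {..degree F}. coeff (coeff (coeff F l) j) i = 0"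
  proof
   fix l assume "l \<in> {..degree F} - {k} \<inter> {..degree F}"
   then have "i + j + l ~= n" using ij by auto
   then show "coeff (coeff (coeff F l) j) i = 0" using F unfolding homogeneous_def by blast
  qed
 qed auto
 also have "\<dots> = coeff (coeff (coeff F k) j) i" by (cases "k \<le> degree F") (auto simp: coeff_eq_0)
 finally show ?thesis .
qed

lemma coeff_poly_1_0:
 assumes F: "homogeneous n F" and ij: "i + j > n"
 shows "coeff (coeff (poly F 1) j) i = 0"
proof -
 have "coeff (coeff (coeff F l) j) i = 0" for l
 proof -
  have "i + j + l ~= n" using ij by auto
  then show ?thesis using F unfolding homogeneous_def by blast
 qed
 then show ?thesis by (simp add: poly_altdef coeff_sum)
qed

text \<open>The coefficient of z^(n - m) in the frame is, up to a constant, the part of degree m of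
  the local equation. Hence the multiplicity is n minus the degree in z, and multiplicity n - 1
  means that the equation is linear in z.\<close>

lemma mult_at_frame:
 assumes F: "irred F" "homogeneous n F" and n: "n \<ge> 2" and D: "D = {q. vanishes_at F q}" and q: "q \<in> D"
 obtains A A' :: "complex ^ 3 ^ 3" where "A ** A' = mat 1" "A' ** A = mat 1" "column 3 A ~= 0" "pt (column 3 A) = q"
   "mult_at q D = n - 1 \<longleftrightarrow> degree (frame A F) = 1"
proof -
 have re: "reduced_equation F D" unfolding D by (rule reduced_equation_irreducible[OF F])
 obtain A A' :: "complex ^ 3 ^ 3" and c where A: "A ** A' = mat 1" "A' ** A = mat 1" "column 3 A ~= 0" "pt (column 3 A) = q" and c: "c ~= 0"
  and le: "local_equation D q = poly (frame A (cst c * F)) 1"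
  using local_equation_frame[OF re] by blast
 have cc: "frame A (cst c) = cst c" by (simp add: frame_def)
 have le': "coeff (coeff (local_equation D q) j) i = c * coeff (coeff (poly (frame A F) 1) j) i" for i j
  unfolding le frame_mult cc poly_mult by simp
 define G where "G = frame A F"
 have G: "homogeneous n G" "irred G" using homogeneous_frame[OF F(2)] frame_irreducible[OF A(1,2) F(1)] by (auto simp: G_def)
 have G0: "G ~= 0" using G by auto
 have P: "(\<exists>i j. i + j = m & coeff (coeff (local_equation D q) j) i ~= 0) \<longleftrightarrow> m \<le> n & coeff G (n - m) ~= 0" for m
 proof (cases "m \<le> n")
  case False
  then have "coeff (coeff (local_equation D q) j) i = 0" if "i + j = m" for i j
   using that coeff_poly_1_0[OF G(1), of i j] by (simp add: le' G_def)
  then show ?thesis using False by blast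
 next
  case True
  have "coeff (coeff (local_equation D q) j) i ~= 0 \<longleftrightarrow> coeff (coeff (coeff G (n - m)) j) i ~= 0" if "i + j = m" for i j
   using that coeff_poly_1[OF G(1), of i j "n - m"] True c by (simp add: le' G_def)
  moreover have "coeff G (n - m) ~= 0 \<longleftrightarrow> (\<exists>i j. coeff (coeff (coeff G (n - m)) j) i ~= 0)"
   by (metis coeff_0 leading_coeff_0_iff)
  moreover have "i + j = m" if "coeff (coeff (coeff G (n - m)) j) i ~= 0" for i j
  proof -
   have "i + j + (n - m) = n" using G(1) that unfolding homogeneous_def by blast
   then show ?thesis using True by simp
  qed
  ultimately show ?thesis using True by blast
 qed
 have dn: "degree G \<le> n"
 proof -
  have "coeff (coeff (coeff G (degree G)) j) i ~= 0 \<longrightarrow> i + j + degree G = n" for i j using G(1) unfolding homogeneous_def by blast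
  moreover obtain i j where "coeff (coeff (coeff G (degree G)) j) i ~= 0" using G0 by (metis coeff_0 leading_coeff_0_iff)
  ultimately show ?thesis by force
 qed
 have "mult_at q D = n - degree G"
  unfolding mult_at_def P
 proof (rule Least_equality)
  show "n - degree G \<le> n & coeff G (n - (n - degree G)) ~= 0" using dn G0 by simp
  fix m assume "m \<le> n & coeff G (n - m) ~= 0"
  then have "n - m \<le> degree G" using le_degree by blast
  then show "n - degree G \<le> m" by linarith
 qed
 then have "mult_at q D = n - 1 \<longleftrightarrow> degree (frame A F) = 1" using n dn by (auto simp: G_def)
 then show ?thesis using that A by blast
qed

lemma independent_frame:
 fixes u v w :: "complex ^ 3"
 assumes "!!a b c. a *s u + b *s v + c *s w = 0 ==> a = 0 & b = 0 & c = 0"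
 obtains A' where "cols u v w ** A' = mat 1" "A' ** cols u v w = mat 1"
proof -
 have "\<exists>B. B ** cols u v w = mat 1"
  unfolding matrix_left_invertible_ker
 proof (intro allI impI)
  fix x assume "cols u v w *v x = 0"
  then have "x $ 1 *s u + x $ 2 *s v + x $ 3 *s w = 0"
   by (simp add: vec_eq_iff matrix_vector_mult_def sum_3 algebra_simps)
  then show "x = 0" using assms[of "x $ 1" "x $ 2" "x $ 3"] by (simp add: vec_eq_iff forall_3)
 qed
 then show ?thesis using that matrix_left_right_inverse by blast
qed

lemma line_span:
 fixes a u v w :: "complex ^ 3"
 assumes a: "a ~= 0" "ev id (lin a) u = 0" "ev id (lin a) v = 0" "ev id (lin a) w = 0"
  and vw: "v ~= 0" "w ~= 0" "pt v ~= pt w"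
 shows "\<exists>b c. u = b *s v + c *s w"
proof (rule ccontr)
 assume no: "~ ?thesis"
 have ind: "x = 0 & y = 0 & z = 0" if e: "x *s u + y *s v + z *s w = 0" for x y z
 proof -
  have x: "x = 0"
  proof (rule ccontr)
   assume "x ~= 0"
   have "u $ i = (- y / x) * v $ i + (- z / x) * w $ i" for i
   proof -
    have "x * u $ i + y * v $ i + z * w $ i = 0" using arg_cong[OF e, of "%t. t $ i"] by simp
    then have "x * u $ i - (- y * v $ i - z * w $ i) = 0" by (simp add: algebra_simps)
    then show ?thesis using \<open>x ~= 0\<close> by (simp add: field_simps) (simp add: eq_neg_iff_add_eq_0 ac_simps)
   qed
   then have "u = (- y / x) *s v + (- z / x) *s w" by (simp add: vec_eq_iff)
   then show False using no by blast
  qed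
  have e': "y * v $ i + z * w $ i = 0" for i using arg_cong[OF e, of "%t. t $ i"] x by simp
  have z: "z = 0"
  proof (rule ccontr)
   assume z: "z ~= 0"
   have w: "w = (- y / z) *s v" using e' z by (simp add: vec_eq_iff field_simps add_eq_0_iff)
   then have "- y / z ~= 0" using vw(2) by auto
   then show False using w pt_eq_iff[OF vw(1,2)] vw(3) by blast
  qed
  then show ?thesis using x e' vw(1) by (auto simp: vec_eq_iff)
 qed
 obtain A' where A': "cols u v w ** A' = mat 1" using independent_frame[OF ind] by blast
 have "a v* cols u v w = 0"
  using a(2-4) by (simp add: vec_eq_iff forall_3 vector_matrix_mult_def sum_3 idc.ev_lin algebra_simps)
 then have "a v* (cols u v w ** A') = 0" by (simp add: vector_matrix_mul_assoc[symmetric])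
 then show False using A' a(1) by simp
qed

lemma ev_lin_id: "ev id (lin a) v = (\<Sum>k\<in>UNIV. a $ k * v $ k)"
 by (simp add: idc.ev_lin sum_3)

lemma ev_lin_comb: "ev id (lin a) (b *s v + c *s w) = b * ev id (lin a) v + c * ev id (lin a) w"
 by (simp add: idc.ev_lin algebra_simps)

text \<open>On the points w + s v of the line the form is affine in s, and its constant term F(w) is
  0. A third zero would make F vanish on the whole line, so the line would divide the irreducible F,
  against n at least 2.\<close>

lemma two_point_line:
 fixes v w :: "complex ^ 3"
 assumes F: "irred F" "homogeneous n F" "n \<ge> 2" and L: "irred (lin a)"
  and vw: "v ~= 0" "w ~= 0" "pt v ~= pt w"
  and on: "ev id (lin a) v = 0" "ev id (lin a) w = 0" "ev id F v = 0" "ev id F w = 0"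
  and aff: "!!s. ev id F (w + s *s v) = c0 + c1 * s"
 shows "{q. vanishes_at F q} \<inter> {q. vanishes_at (lin a) q} = {pt v, pt w}"
proof (intro subset_antisym subsetI)
 fix x assume x: "x \<in> {q. vanishes_at F q} \<inter> {q. vanishes_at (lin a) q}"
 obtain u where u: "u ~= 0" "x = pt u" by (rule pt_cases)
 have a0: "a ~= 0"
 proof
  assume "a = 0" then have "lin a = 0" by (simp add: lin_def) then show False using L by simp
 qed
 have uz: "ev id F u = 0" "ev id (lin a) u = 0" using x u vanishes_at_pt[OF F(2) u(1)] vanishes_at_pt[OF homogeneous_lin u(1)] by auto
 obtain b c where bc: "u = b *s v + c *s w" using line_span[OF a0 uz(2) on(1,2) vw] by blast
 have c0: "c0 = 0" using aff[of 0] on by simp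
 show "x \<in> {pt v, pt w}"
 proof (rule ccontr)
  assume nx: "x \<notin> {pt v, pt w}"
  have "c ~= 0"
  proof
   assume "c = 0"
   then have "u = b *s v" using bc by simp
   moreover from this u(1) have "b ~= 0" by auto
   ultimately show False using nx u pt_eq_iff[OF vw(1) u(1)] by (metis insertI1)
  qed
  have "b ~= 0"
  proof
   assume "b = 0"
   then have "u = c *s w" using bc by simp
   then show False using nx u pt_eq_iff[OF vw(2) u(1)] \<open>c ~= 0\<close> by (metis insertI1 insertI2)
  qed
  have uw: "u = c *s (w + (b / c) *s v)" using bc \<open>c ~= 0\<close> by (simp add: vec_eq_iff algebra_simps)
  have "ev id F (w + (b / c) *s v) = 0" using uz(1) \<open>c ~= 0\<close> idc.ev_scale[OF F(2), of c "w + (b / c) *s v"] uw by simp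
  then have c1: "c1 = 0" using aff[of "b / c"] c0 \<open>b ~= 0\<close> \<open>c ~= 0\<close> by simp
  have "lin a dvd F"
  proof (rule nullstellensatz[OF L homogeneous_lin])
   fix t :: "complex ^ 3" assume t: "t ~= 0" "ev id (lin a) t = 0"
   obtain e f where ef: "t = e *s v + f *s w" using line_span[OF a0 t(2) on(1,2) vw] by blast
   show "ev id F t = 0"
   proof (cases "f = 0")
    case True then show ?thesis using ef idc.ev_scale[OF F(2), of e v] on by simp
   next
    case False
    then have "t = f *s (w + (e / f) *s v)" using ef by (simp add: vec_eq_iff algebra_simps)
    then show ?thesis using idc.ev_scale[OF F(2), of f "w + (e / f) *s v"] aff c0 c1 by simp
   qed
  qed
  then obtain H where H: "F = lin a * H" by (rule dvdE)
  have "~ is_unit (lin a)" using L Factorial_Ring.irreducible_not_unit by blast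
  then have "is_unit H" using F(1) H Factorial_Ring.irreducibleD by blast
  then obtain k where "H = cst k" using is_unit_cpoly3 by blast
  then have "homogeneous 1 F" unfolding H by (metis homogeneous_cst_mult homogeneous_lin mult.commute)
  then have "n = 1" using homogeneous_unique F by fastforce
  then show False using F(3) by simp
 qed
next
 fix x assume "x \<in> {pt v, pt w}"
 then show "x \<in> {q. vanishes_at F q} \<inter> {q. vanishes_at (lin a) q}"
  using vanishes_at_pt[OF F(2) vw(1)] vanishes_at_pt[OF F(2) vw(2)] vanishes_at_pt[OF homogeneous_lin vw(1)] vanishes_at_pt[OF homogeneous_lin vw(2)] on by auto
qed

section \<open>Orders of forms along a branch\<close>

lemma line_through:
 fixes v w :: "complex ^ 3"
 shows "\<exists>a. a ~= 0 & ev id (lin a) v = 0 & ev id (lin a) w = 0"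
proof (rule ccontr)
 assume no: "~ ?thesis"
 define M :: "complex ^ 3 ^ 3" where "M = (\<chi> r. if r = 1 then v else if r = 2 then w else 0)"
 have "\<exists>B. B ** M = mat 1"
  unfolding matrix_left_invertible_ker
 proof (intro allI impI)
  fix a assume a: "M *v a = 0"
  have "(M *v a) $ 1 = 0" "(M *v a) $ 2 = 0" unfolding a by simp_all
  then have "ev id (lin a) v = 0" "ev id (lin a) w = 0"
   by (simp_all add: M_def matrix_vector_mult_def sum_3 idc.ev_lin mult.commute)
  then show "a = 0" using no by blast
 qed
 then obtain B where "B ** M = mat 1" by blast
 then have "M ** B = mat 1" using matrix_left_right_inverse by blast
 then have "(M ** B) $ 3 $ 3 = 1" by (simp add: mat_def)
 then show False by (simp add: M_def matrix_matrix_mult_def)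
qed

lemma lin_eq_0: "lin a = 0 \<longleftrightarrow> a = 0"
proof
 assume "lin a = 0"
 then have "lin a = cst 0" by simp
 then have "a $ k = 0" for k using grad_lin[of a 0] grad_cst[of 0 0 k] by simp
 then show "a = 0" by (simp add: vec_eq_iff)
qed (simp add: lin_def)

context generic_point
begin

lemma ev_in_subring:
 assumes S: "is_subring S" "range emb \<subseteq> S" and w: "!!i. w $ i \<in> S" shows "ev emb G w \<in> S"
proof (induction G rule: cpoly3_induct)
 case (cst c) then show ?case unfolding ev_cst using S by blast
next
 case vx then show ?case unfolding ev_vx by (rule w)
next
 case vy then show ?case unfolding ev_vy by (rule w)
next
 case vz then show ?case unfolding ev_vz by (rule w)
next
 case (add F G) then show ?case unfolding ev_add using subring_add[OF S(1)] by blast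
next
 case (mult F G) then show ?case unfolding ev_mult using subring_mult[OF S(1)] by blast
qed

text \<open>Ratios of forms of equal degree do not see the scaling l, so K lies in C(w) as soon as
  the scaled coordinates do.\<close>

lemma rational_parametrization:
 assumes w: "w \<in> K" and l: "l ~= 0" and y: "!!i. l * xi $ i \<in> ratfield emb w"
 shows "rational_curve C"
proof -
 have ev: "ev emb P (l *s xi) \<in> ratfield emb w" for P
  by (rule ev_in_subring[OF ratfield_subring]) (use y ratfield_emb in auto)
 have "K \<subseteq> ratfield emb w"
 proof
  fix u assume "u \<in> K"
  then obtain G H m where gh: "u = ev emb G xi / ev emb H xi" "homogeneous m G" "homogeneous m H" by (auto simp: K_def)
  have "u = ev emb G (l *s xi) / ev emb H (l *s xi)" unfolding gh(1) ev_scale[OF gh(2)] ev_scale[OF gh(3)] using l by simp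
  then have "u = ev emb G (l *s xi) * inverse (ev emb H (l *s xi))" by (simp add: field_class.field_divide_inverse)
  then show "u \<in> ratfield emb w" using subring_mult[OF ratfield_subring] ratfield_inverse ev by metis
 qed
 then interpret one_generator emb xi F n w by unfold_locales (use w in auto)
 show ?thesis by (rule rational)
qed

text \<open>Lines are outside the main argument, which starts at degree 2, but they belong to
  Hyp(B,2) and are needed for E(B) = Hyp(B,2).\<close>

lemma line_rational:
 assumes "n = 1" shows "rational_curve C"
proof -
 obtain a where a: "F = lin a" using homogeneous_1_lin hom assms by blast
 then have a0: "a ~= 0" using F_nz lin_eq_0 by blast
 have e: "emb (a $ 1) * xi $ 1 + emb (a $ 2) * xi $ 2 + emb (a $ 3) * xi $ 3 = 0" using gen[of F] a ev_lin by simp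
 obtain q V where V: "q \<in> C" "place V" using infinite_C exists_place by (metis finite.emptyI ex_in_conv)
 have main: "rational_curve C" if d: "emb (a $ i) * xi $ i + emb (a $ j) * xi $ j + emb (a $ k) * xi $ k = 0" "a $ i ~= 0" "xi $ j ~= 0"
  and all: "!!l. l = i \<or> l = j \<or> l = k" for i j k
 proof (rule rational_parametrization[of "xi $ k / xi $ j" "inverse (xi $ j)"])
  let ?w = "xi $ k / xi $ j"
  show "?w \<in> K" by (rule xi_quotient_K[OF V(2) d(3)])
  show "inverse (xi $ j) ~= 0" using d by simp
  have "emb (a $ i) ~= 0" using d emb_eq_0 by blast
  have "emb (a $ i) * xi $ i = - (emb (a $ j) * xi $ j + emb (a $ k) * xi $ k)"
   using d(1) by (simp only: eq_neg_iff_add_eq_0 add.assoc)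
  then have "emb (a $ i) * (inverse (xi $ j) * xi $ i) = - (emb (a $ j) + emb (a $ k) * ?w)"
   using d(3) by (simp add: field_simps)
  then have i: "inverse (xi $ j) * xi $ i = - (emb (inverse (a $ i)) * (emb (a $ j) + emb (a $ k) * ?w))"
   using \<open>emb (a $ i) ~= 0\<close> unfolding emb_inverse by (simp add: field_simps)
  show "inverse (xi $ j) * xi $ l \<in> ratfield emb ?w" for l
  proof -
   note r = subring_uminus[OF ratfield_subring] subring_mult[OF ratfield_subring] subring_add[OF ratfield_subring]
    ratfield_emb ratfield_gen
   have "inverse (xi $ j) * xi $ i \<in> ratfield emb ?w" unfolding i by (intro r)
   moreover have "inverse (xi $ j) * xi $ j = 1" "inverse (xi $ j) * xi $ k = ?w" using d(3) by (simp_all add: field_simps)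
   ultimately show ?thesis using all[of l] subring_1[OF ratfield_subring] ratfield_gen by auto
  qed
 qed
 have two: "rational_curve C" if d: "emb (a $ i) * xi $ i + emb (a $ j) * xi $ j + emb (a $ k) * xi $ k = 0" "a $ i ~= 0"
  and all: "!!l. l = i \<or> l = j \<or> l = k" for i j k
 proof -
  consider "xi $ j ~= 0" | "xi $ k ~= 0" | "xi $ j = 0" "xi $ k = 0" by blast
  then show ?thesis
  proof cases
   case 1 then show ?thesis using main[of i j k] d all by blast
  next
   case 2
   have "emb (a $ i) * xi $ i + emb (a $ k) * xi $ k + emb (a $ j) * xi $ j = 0" using d(1) by (simp only: ac_simps)
   then show ?thesis using main[of i k j] d(2) all 2 by blast
  next
   case 3
   then have "xi $ i = 0" using d emb_eq_0 by simp
   then have "xi $ l = 0" for l using all[of l] 3 by auto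
   then show ?thesis using xi_nonzero[OF V(2)] by blast
  qed
 qed
 have "a $ 1 ~= 0 \<or> a $ 2 ~= 0 \<or> a $ 3 ~= 0" using a0 by (simp add: vec_eq_iff forall_3)
 then show ?thesis
  using two[of 1 2 3] two[of 2 1 3] two[of 3 1 2] e exhaust_3 by (auto simp: ac_simps)
qed

lemma dvd_degree: "F dvd G ==> homogeneous m G ==> G ~= 0 ==> n \<le> m"
proof -
 assume G: "F dvd G" "homogeneous m G" "G ~= 0"
 obtain H where H: "G = F * H" using G(1) by (rule dvdE)
 then obtain k where "homogeneous k H" using homogeneous_factor[of m H F] G by (auto simp: mult.commute)
 then have "homogeneous (n + k) G" unfolding H using homogeneous_mult[OF hom] by blast
 then show "n \<le> m" using homogeneous_unique[OF G(2) _ G(3)] by fastforce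
qed

lemma prime_F: "prime_elem F"
 using irr irreducible_imp_prime_elem by blast

text \<open>Poles can only lie over zeros of H. At a unibranch point, membership in a single place
  already means integrality by \<open>unibranch_place\<close>, so the ratio is regular on the
  normalization and hence constant.\<close>

lemma constant_ratio:
 assumes G: "homogeneous m G" and H: "homogeneous m H" and nd: "~ F dvd H"
  and reg: "!!r. r \<in> C ==> vanishes_at H r ==> unibranch r & (\<exists>V. place V & Ol r \<subseteq> V & ev emb G xi / ev emb H xi \<in> V)"
 obtains c where "ev emb G xi / ev emb H xi = emb c" "F dvd G - cst c * H"
proof -
 have Hn: "ev emb H xi ~= 0" using gen nd by blast
 have uK: "ev emb G xi / ev emb H xi \<in> K" by (rule K_intro[OF G H Hn])
 have "ev emb G xi / ev emb H xi \<in> Rn r" if r: "r \<in> C" for r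
 proof (cases "vanishes_at H r")
  case True
  then show ?thesis using reg[OF r True] unibranch_place[OF r] uK by blast
 next
  case False
  then show ?thesis using O_intro[OF G H False] O_Rn[OF r] by blast
 qed
 then obtain c where c: "ev emb G xi / ev emb H xi = emb c" using globally_regular_constant[OF uK] by blast
 then have "ev emb (G - cst c * H) xi = 0" unfolding ev_diff ev_mult ev_cst using Hn by (simp add: field_simps)
 then show ?thesis using that c gen by blast
qed

lemma vanishing_ratio:
 assumes G: "homogeneous m G" and H: "homogeneous m H" and nd: "~ F dvd H"
  and reg: "!!r. r \<in> C ==> vanishes_at H r ==> unibranch r & (\<exists>V. place V & Ol r \<subseteq> V & ev emb G xi / ev emb H xi \<in> V)"
  and t: "t \<in> C" "vanishes_at G t" "~ vanishes_at H t"
 shows "F dvd G"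
proof -
 obtain c where c: "F dvd G - cst c * H" using constant_ratio[OF G H nd reg] by blast
 obtain w where w: "w ~= 0" "t = pt w" by (rule pt_cases)
 have "ev id F w = 0" "ev id G w = 0" "ev id H w ~= 0"
  using t vanishes_at_pt[OF hom w(1)] vanishes_at_pt[OF G w(1)] vanishes_at_pt[OF H w(1)] w(2) by (auto simp: C_def)
 moreover have "ev id (G - cst c * H) w = 0" using idc.ev_dvd[OF c] calculation by blast
 then have "ev id G w - c * ev id H w = 0" unfolding idc.ev_diff idc.ev_mult idc.ev_cst by simp
 ultimately have "c = 0" by simp
 then show ?thesis using c by simp
qed

text \<open>The common pattern of several contradictions: the ratio would be a constant that is 0 at
  t, so F would divide a power of a line, hence a line.\<close>

lemma line_power_ratio:
 assumes n: "n \<ge> 2" and a: "a ~= 0" and H: "homogeneous m H" and nd: "~ F dvd H"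
  and reg: "!!r. r \<in> C ==> vanishes_at H r ==> unibranch r & (\<exists>V. place V & Ol r \<subseteq> V & ev emb (lin a ^ m) xi / ev emb H xi \<in> V)"
  and m: "m > 0" and t: "t \<in> C" "vanishes_at (lin a) t" "~ vanishes_at H t"
 shows False
proof -
 have G: "homogeneous m (lin a ^ m)" using homogeneous_power[OF homogeneous_lin[of a], of m] by simp
 obtain w where w: "w ~= 0" "t = pt w" by (rule pt_cases)
 have "ev id (lin a) w = 0" using t(2) vanishes_at_pt[OF homogeneous_lin w(1)] w(2) by blast
 then have "ev id (lin a ^ m) w = 0" unfolding idc.ev_power using m by (simp add: zero_power)
 then have "vanishes_at (lin a ^ m) t" using vanishes_at_pt[OF G w(1)] w(2) by blast
 then have "F dvd lin a ^ m" using vanishing_ratio[OF G H nd reg t(1) _ t(3)] by blast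
 then have "F dvd lin a" using prime_F prime_elem_dvd_power by blast
 then have "n \<le> 1" using dvd_degree[OF _ homogeneous_lin] a lin_eq_0 by blast
 then show False using n by simp
qed

text \<open>Every point of the curve has at least one place above it. With at most two places in
  all, each of p and q has exactly one, and no further point remains.\<close>

lemma two_points:
 assumes S: "S \<subseteq> C" "finite (normalization_preimage C S)" "card (normalization_preimage C S) \<le> 2"
  and pq: "p \<in> S" "q \<in> S" "p ~= q"
 shows "S = {p, q} & unibranch p & unibranch q"
proof -
 define N where "N = {P \<in> npoints. fst P \<in> S}"
 have bij: "bij_betw npt (normalization_preimage C S) N" unfolding N_def by (rule preimage_npoints)
 have N: "finite N" "card N \<le> 2" using S(2,3) bij_betw_finite[OF bij] bij_betw_same_card[OF bij] by auto
 have "p \<in> C" "q \<in> C" using pq S(1) by auto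
 then obtain A B where AB: "(p, A) \<in> npoints" "(q, B) \<in> npoints" using npoints_nonempty by blast
 then have sub: "{(p, A), (q, B)} \<subseteq> N" using pq by (auto simp: N_def)
 have "card {(p, A), (q, B)} = 2" using pq by simp
 then have Neq: "{(p, A), (q, B)} = N" using N sub by (intro card_seteq) auto
 have "r \<in> {p, q}" if "r \<in> S" for r
 proof -
  have "r \<in> C" using that S(1) by blast
  then obtain M where "(r, M) \<in> npoints" using npoints_nonempty by blast
  then have "(r, M) \<in> N" using that by (simp add: N_def)
  then show ?thesis unfolding Neq[symmetric] by auto
 qed
 moreover have "unibranch p" unfolding unibranch_def
 proof (rule ex1I[of _ A])
  show "max_ideal A (Rn p)" using AB by (auto simp: npoints_def)
  show "M = A" if "max_ideal M (Rn p)" for M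
  proof -
   have "(p, M) \<in> N" using that pq S(1) by (auto simp: npoints_def N_def)
   then show ?thesis unfolding Neq[symmetric] using pq by auto
  qed
 qed
 moreover have "unibranch q" unfolding unibranch_def
 proof (rule ex1I[of _ B])
  show "max_ideal B (Rn q)" using AB by (auto simp: npoints_def)
  show "M = B" if "max_ideal M (Rn q)" for M
  proof -
   have "(q, M) \<in> N" using that pq S(1) by (auto simp: npoints_def N_def)
   then show ?thesis unfolding Neq[symmetric] using pq by auto
  qed
 qed
 ultimately show ?thesis using pq by blast
qed

lemma two_unibranch_points:
 assumes "p \<in> C" "q \<in> C" "unibranch p" "unibranch q"
 shows "finite (normalization_preimage C {p, q})" "card (normalization_preimage C {p, q}) \<le> 2"
proof -
 define N where "N = {P \<in> npoints. fst P \<in> {p, q}}"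
 have bij: "bij_betw npt (normalization_preimage C {p, q}) N" unfolding N_def by (rule preimage_npoints)
 obtain A B where AB: "!!M. max_ideal M (Rn p) ==> M = A" "!!M. max_ideal M (Rn q) ==> M = B"
  using assms unfolding unibranch_def by metis
 then have sub: "N \<subseteq> {(p, A), (q, B)}" by (auto simp: N_def npoints_def)
 have "finite N" "card N \<le> 2" using finite_subset[OF sub] card_mono[OF _ sub] card_insert_le_m1[of 2 "{(q, B)}" "(p, A)"] by auto
 then show "finite (normalization_preimage C {p, q})" "card (normalization_preimage C {p, q}) \<le> 2"
  using bij_betw_finite[OF bij] bij_betw_same_card[OF bij] by auto
qed

end

text \<open>Projectively: the tangent lines of G and H at v have only v in common. In particular
  neither gradient is zero.\<close>

definition transv :: "cpoly3 => cpoly3 => complex ^ 3 => bool" where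
 "transv G H v \<longleftrightarrow> (\<forall>u. (\<Sum>k\<in>UNIV. grad G v $ k * u $ k) = 0 \<longrightarrow> (\<Sum>k\<in>UNIV. grad H v $ k * u $ k) = 0 \<longrightarrow> (\<exists>c. u = c *s v))"

lemma transv_scale:
 assumes "homogeneous m G" "homogeneous k H" "c ~= 0" and t: "transv G H v"
 shows "transv G H (c *s v)"
 unfolding transv_def
proof (intro allI impI)
 fix u assume u: "(\<Sum>k\<in>UNIV. grad G (c *s v) $ k * u $ k) = 0" "(\<Sum>k\<in>UNIV. grad H (c *s v) $ k * u $ k) = 0"
 then have "(\<Sum>k\<in>UNIV. grad G v $ k * u $ k) = 0" "(\<Sum>k\<in>UNIV. grad H v $ k * u $ k) = 0"
  using assms(3) unfolding grad_scale[OF assms(1,3)] grad_scale[OF assms(2,3)] by simp_all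
 then obtain e where "u = e *s v" using t unfolding transv_def by blast
 then have "u = (e / c) *s (c *s v)" using assms(3) by (simp add: vec_eq_iff)
 then show "\<exists>e. u = e *s (c *s v)" by blast
qed

text \<open>A place with its centre v, seen in the affine chart where coordinate j is 1:
  \<open>near\<close> says that the affine coordinates of \<open>xi\<close> reduce to those of
  v.\<close>

locale branch = generic_point emb xi F n
 for emb :: "complex => 'k::field" and xi F n +
 fixes V :: "'k set" and v :: "complex ^ 3" and j :: 3
 assumes V: "place V" and vj: "v $ j = 1" and xj: "xi $ j ~= 0"
  and near: "!!i. xi $ i / xi $ j - emb (v $ i) \<in> nonunits V"
begin

definition eta :: "'k ^ 3" where "eta = (\<chi> i. xi $ i / xi $ j)"

definition del :: "'k ^ 3" where "del = (\<chi> i. xi $ i / xi $ j - emb (v $ i))"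

lemma v_nz: "v ~= 0" using vj by auto

lemma eta_K: "ev emb G eta \<in> K"
 by (rule ev_in_subring[OF K_subring]) (use K_emb xi_quotient_K[OF V xj] in \<open>auto simp: eta_def\<close>)

lemma ev_eta: assumes "homogeneous m G" shows "ev emb G xi = xi $ j ^ m * ev emb G eta"
proof -
 have "xi = xi $ j *s eta" using xj by (simp add: vec_eq_iff eta_def)
 then show ?thesis using ev_scale[OF assms, of "xi $ j" eta] by simp
qed

lemma eta_eq_0: "homogeneous m G ==> ev emb G eta = 0 \<longleftrightarrow> F dvd G"
 using ev_eta[of m G] gen[of G] xj by simp

lemma eta_near: "ev emb G eta - emb (ev id G v) \<in> nonunits V"
 by (rule ev_congruence[OF V]) (use near in \<open>simp add: eta_def\<close>)

lemma eta_nonunit: "ev emb G eta \<in> nonunits V \<longleftrightarrow> ev id G v = 0"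
proof -
 note vr = place_valuation[OF V]
 have "ev emb G eta \<in> nonunits V \<longleftrightarrow> emb (ev id G v) \<in> nonunits V"
  using nonunits_diff[OF vr, of "ev emb G eta" "ev emb G eta - emb (ev id G v)"] nonunits_add[OF vr eta_near[of G], of "emb (ev id G v)"] eta_near[of G]
  by (auto simp: algebra_simps)
 then show ?thesis using emb_nonunit[OF V] by blast
qed

lemma center_C: "pt v \<in> C"
proof -
 have "ev emb F eta = 0" using eta_eq_0[OF hom] by simp
 then have "ev id F v = 0" using eta_nonunit[of F] nonunits_0[OF place_valuation[OF V]] by simp
 then show ?thesis unfolding C_def using vanishes_at_pt[OF hom v_nz] by simp
qed

lemma center_O: "Ol (pt v) \<subseteq> V" "mOl (pt v) \<subseteq> nonunits V"
 using center_unique_aux[OF V v_nz xj near] by blast+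

lemma ratio_V:
 assumes G: "homogeneous m G" and H: "homogeneous m H" and nd: "~ F dvd H"
  and s: "val_ge V (ev emb G eta) s" "val V (ev emb H eta) \<le> s"
 shows "ev emb G xi / ev emb H xi \<in> V"
proof -
 have e: "ev emb G xi / ev emb H xi = ev emb G eta / ev emb H eta" unfolding ev_eta[OF G] ev_eta[OF H] using xj by simp
 have H0: "ev emb H eta ~= 0" using eta_eq_0[OF H] nd by blast
 show ?thesis
 proof (cases "ev emb G eta = 0")
  case True then show ?thesis unfolding e using subring_0[OF place_subring[OF V]] by simp
 next
  case False
  then have "val V (ev emb G eta / ev emb H eta) \<ge> 0" using val_divide[OF V eta_K _ eta_K H0, of G] s by (simp add: val_ge_def)
  then show ?thesis unfolding e using val_nonneg[OF V K_divide[OF eta_K eta_K], of G H] False H0 by simp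
 qed
qed

lemma ratio_nonunit:
 assumes G: "homogeneous m G" and H: "homogeneous m H" and nd: "~ F dvd H"
  and s: "val_ge V (ev emb G eta) s" "val V (ev emb H eta) < s"
 shows "ev emb G xi / ev emb H xi \<in> nonunits V"
proof -
 have e: "ev emb G xi / ev emb H xi = ev emb G eta / ev emb H eta" unfolding ev_eta[OF G] ev_eta[OF H] using xj by simp
 have H0: "ev emb H eta ~= 0" using eta_eq_0[OF H] nd by blast
 show ?thesis
 proof (cases "ev emb G eta = 0")
  case True then show ?thesis unfolding e using nonunits_0[OF place_valuation[OF V]] by simp
 next
  case False
  then have "val V (ev emb G eta / ev emb H eta) > 0" using val_divide[OF V eta_K _ eta_K H0, of G] s by (simp add: val_ge_def)
  then show ?thesis unfolding e using val_pos[OF V K_divide[OF eta_K eta_K], of G H] False H0 by simp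
 qed
qed

lemma eta_val: "val_ge V (ev emb G eta) 0"
proof -
 have "ev emb G eta - emb (ev id G v) \<in> V" using eta_near nonunits_subset[OF place_valuation[OF V]] by blast
 then have "ev emb G eta - emb (ev id G v) + emb (ev id G v) \<in> V" by (intro subring_add[OF place_subring[OF V]] place_emb[OF V])
 then show ?thesis using val_ge_V[OF V] eta_K by simp
qed

lemma eta_val_0: assumes "ev id G v ~= 0" shows "val V (ev emb G eta) = 0" "ev emb G eta ~= 0"
proof -
 have nn: "ev emb G eta \<notin> nonunits V" using assms eta_nonunit by blast
 then show nz: "ev emb G eta ~= 0" using nonunits_0[OF place_valuation[OF V]] by metis
 show "val V (ev emb G eta) = 0" using val_pos[OF V eta_K nz] nn eta_val[of G] nz by (simp add: val_ge_def)
qed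

lemma del_K: "del $ i \<in> K"
proof -
 have "xi $ i / xi $ j - emb (v $ i) \<in> K" by (rule subring_diff[OF K_subring xi_quotient_K[OF V xj] K_emb])
 then show ?thesis by (simp add: del_def)
qed

lemma eta_del: "eta = (\<chi> i. emb (v $ i) + del $ i)"
 by (simp add: eta_def del_def)

lemma del_j: "del $ j = 0"
 using xj vj one by (simp add: del_def)

lemma del_nonzero: "\<exists>i. del $ i ~= 0"
proof (rule ccontr)
 assume "~ ?thesis"
 then have eta: "eta = (\<chi> i. emb (v $ i))" unfolding eta_del by simp
 obtain r where r: "r \<in> C" "r ~= pt v" using exists_two_points[OF infinite_C] by blast
 obtain w where w: "w ~= 0" "r = pt w" by (rule pt_cases)
 obtain a where a: "ev id (lin a) v = 0" "ev id (lin a) w ~= 0" using separating_line[OF v_nz w(1)] r w by metis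
 have "ev emb (lin a) eta = emb (ev id (lin a) v)"
  unfolding eta using ev_comp[OF cpx_hom_id comm_hom_axioms, of "lin a" v] by simp
 then have "F dvd lin a" using a eta_eq_0[OF homogeneous_lin] by simp
 moreover have "ev id F w = 0" using r w vanishes_at_pt[OF hom w(1)] by (simp add: C_def)
 ultimately show False using idc.ev_dvd a(2) by blast
qed

text \<open>The least order of the local coordinates along the branch. In the normalization of
  \<open>val\<close>, this is the multiplicity of the branch at its centre.\<close>

definition mu :: real where "mu = Min ((%i. val V (del $ i)) ` {i. del $ i ~= 0})"

lemma mu_ge: "val_ge V (del $ i) mu"
 unfolding val_ge_def mu_def using del_K by (auto intro!: Min_le)

lemma mu_attained: "\<exists>i. del $ i ~= 0 & val V (del $ i) = mu"
proof -
 have "mu \<in> (%i. val V (del $ i)) ` {i. del $ i ~= 0}"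
  unfolding mu_def using del_nonzero by (intro Min_in) auto
 then show ?thesis by auto
qed

lemma mu_pos: "mu > 0"
proof -
 obtain i where i: "del $ i ~= 0" "val V (del $ i) = mu" using mu_attained by blast
 have "del $ i \<in> nonunits V" using near[of i] by (simp add: del_def)
 then show ?thesis using val_pos[OF V del_K i(1)] i(2) by simp
qed

lemma val_ge_emb_mult: "val_ge V x r ==> val_ge V (emb c * x) r"
 using val_ge_mult[OF V val_ge_emb[OF V]] by fastforce

lemma taylor_val: "val_ge V (ev emb G eta - emb (ev id G v) - (\<Sum>k\<in>UNIV. emb (grad G v $ k) * del $ k)) (2 * mu)"
proof -
 have "ev emb G (\<chi> i. emb (v $ i) + del $ i) - emb (ev id G v) - (\<Sum>k\<in>UNIV. emb (grad G v $ k) * del $ k) \<in> {u. val_ge V u (2 * mu)}"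
 proof (rule taylor[OF cpx_hom_axioms, where ?W1.0 = "{u. val_ge V u mu}"])
  show "x * y \<in> {u. val_ge V u (2 * mu)}" if "x \<in> {u. val_ge V u mu}" "y \<in> {u. val_ge V u mu}" for x y
   using val_ge_mult[OF V, of x mu y mu] that by simp
  show "x * y \<in> {u. val_ge V u (2 * mu)}" if "x \<in> {u. val_ge V u mu}" "y \<in> {u. val_ge V u (2 * mu)}" for x y
   using val_ge_mult[OF V, of x mu y "2 * mu"] that mu_pos by (auto intro: val_ge_mono)
  show "x * y \<in> {u. val_ge V u (2 * mu)}" if "x \<in> {u. val_ge V u (2 * mu)}" "y \<in> {u. val_ge V u (2 * mu)}" for x y
   using val_ge_mult[OF V, of x "2 * mu" y "2 * mu"] that mu_pos by (auto intro: val_ge_mono)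
 qed (auto intro: val_ge_0 val_ge_add[OF V] val_ge_emb_mult mu_ge)
 then show ?thesis unfolding eta_del by simp
qed

lemma grad_val:
 assumes "ev id G v = 0" "val_ge V (ev emb G eta) r" "r \<le> 2 * mu"
 shows "val_ge V (\<Sum>k\<in>UNIV. emb (grad G v $ k) * del $ k) r"
proof -
 have t: "val_ge V (ev emb G eta - (\<Sum>k\<in>UNIV. emb (grad G v $ k) * del $ k)) r"
  using val_ge_mono[OF taylor_val[of G] assms(3)] assms(1) by simp
 show ?thesis using val_ge_diff[OF V assms(2) t] by simp
qed

lemma first_order:
 assumes "ev id G v = 0" shows "val_ge V (ev emb G eta) mu"
proof -
 have "val_ge V (ev emb G eta - (\<Sum>k\<in>UNIV. emb (grad G v $ k) * del $ k)) mu"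
  using val_ge_mono[OF taylor_val[of G], of mu] mu_pos assms by simp
 moreover have "val_ge V (\<Sum>k\<in>UNIV. emb (grad G v $ k) * del $ k) mu"
  by (intro val_ge_sum[OF V] val_ge_emb_mult mu_ge)
 ultimately show ?thesis using val_ge_add[OF V] by fastforce
qed

text \<open>By Euler's relation the linear form of the gradient vanishes at v, so on the branch it
  equals the linear Taylor term of G, and the remaining terms have value at least 2
  \<open>mu\<close>.\<close>

lemma tangent_val:
 assumes G: "homogeneous m G" "ev id G v = 0" "val_ge V (ev emb G eta) (2 * mu)"
 shows "val_ge V (ev emb (lin (grad G v)) eta) (2 * mu)"
proof -
 have "(\<Sum>k\<in>UNIV. grad G v $ k * v $ k) = 0" using euler[OF G(1), of v] G(2) by simp
 then have z: "emb (\<Sum>k\<in>UNIV. grad G v $ k * v $ k) = 0" by simp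
 have "ev emb (lin (grad G v)) eta = emb (\<Sum>k\<in>UNIV. grad G v $ k * v $ k) + (\<Sum>k\<in>UNIV. emb (grad G v $ k) * del $ k)"
  unfolding ev_lin eta_del sum_3 add mult by (simp add: distrib_left)
 then show ?thesis using grad_val[OF G(2,3)] z by simp
qed

text \<open>If both contacts exceeded \<open>mu\<close>, so would the values of the two linear
  parts. Together with coordinate j, which \<open>del\<close> lacks, these linear parts can be
  solved for all local coordinates, and then no coordinate could have value
  \<open>mu\<close>.\<close>

lemma transversal:
 assumes t: "transv G H v" and z: "ev id G v = 0" "ev id H v = 0"
  and r: "r > mu" "val_ge V (ev emb G eta) r" "val_ge V (ev emb H eta) r"
 shows False
proof -
 \<comment> \<open>The value of G bounds that of its linear part only up to the quadratic remainder,
   of value at least 2 \<open>mu\<close>.\<close>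
 define s where "s = min r (2 * mu)"
 have s: "s > mu" "s \<le> r" "s \<le> 2 * mu" using r mu_pos by (auto simp: s_def)
 \<comment> \<open>The third row fixes coordinate j; as v has j-th coordinate 1, it removes the
   direction v left over by the two gradients.\<close>
 define A :: "complex ^ 3 ^ 3" where "A = (\<chi> l. if l = 1 then grad G v else if l = 2 then grad H v else axis j 1)"
 have A: "A $ 1 = grad G v" "A $ 2 = grad H v" "A $ 3 = axis j 1" by (simp_all add: A_def)
 have ax: "(\<Sum>k\<in>UNIV. h ((axis j 1 :: complex ^ 3) $ k) * u $ k) = u $ j" if "cpx_hom h" for h :: "complex => 'b::comm_ring_1" and u
 proof -
  interpret h: cpx_hom h by fact
  have "(\<Sum>k\<in>UNIV. h ((axis j 1 :: complex ^ 3) $ k) * u $ k) = (\<Sum>k\<in>UNIV. if k = j then u $ k else 0)"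
   by (intro sum.cong) (auto simp: axis_def h.one)
  then show ?thesis by simp
 qed
 have "\<exists>B. B ** A = mat 1"
  unfolding matrix_left_invertible_ker
 proof (intro allI impI)
  fix u assume u: "A *v u = 0"
  have "(A *v u) $ 1 = 0" "(A *v u) $ 2 = 0" "(A *v u) $ 3 = 0" unfolding u by simp_all
  then have "(\<Sum>k\<in>UNIV. grad G v $ k * u $ k) = 0" "(\<Sum>k\<in>UNIV. grad H v $ k * u $ k) = 0" and uj: "u $ j = 0"
   using ax[OF cpx_hom_id, of u] by (auto simp: matrix_vector_mult_def A)
  then obtain c where "u = c *s v" using t unfolding transv_def by blast
  then show "u = 0" using uj vj by simp
 qed
 then obtain B where B: "B ** A = mat 1" by blast
 define L where "L = mv emb A del"
 have L1: "val_ge V (L $ 1) s"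
  using grad_val[OF z(1) val_ge_mono[OF r(2) s(2)] s(3)] by (simp add: L_def mv_def A sum_3)
 have L2: "val_ge V (L $ 2) s"
  using grad_val[OF z(2) val_ge_mono[OF r(3) s(2)] s(3)] by (simp add: L_def mv_def A sum_3)
 have L3: "val_ge V (L $ 3) s"
  using ax[OF cpx_hom_axioms, of del] del_j val_ge_0 by (simp add: L_def mv_def A sum_3)
 have "mv emb B L = del" unfolding L_def mv_mv[OF cpx_hom_axioms] B by (rule mv_1[OF cpx_hom_axioms])
 then have "val_ge V (del $ i) s" for i
  using val_ge_add[OF V val_ge_add[OF V val_ge_emb_mult[OF L1, of "B $ i $ 1"] val_ge_emb_mult[OF L2, of "B $ i $ 2"]] val_ge_emb_mult[OF L3, of "B $ i $ 3"]]
  by (auto simp: mv_def vec_eq_iff)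
 then show False using mu_attained s(1) by (force simp: val_ge_def)
qed

lemma transversal_eq:
 assumes t: "transv G H v" and z: "ev id G v = 0" "ev id H v = 0" and G: "ev emb G eta ~= 0"
  and r: "r > mu" "val_ge V (ev emb H eta) r"
 shows "val V (ev emb G eta) = mu"
proof (rule ccontr)
 assume ne: "val V (ev emb G eta) ~= mu"
 have "val V (ev emb G eta) \<ge> mu" using first_order[OF z(1)] G by (simp add: val_ge_def)
 then have g: "val V (ev emb G eta) > mu" using ne by simp
 define s where "s = min r (val V (ev emb G eta))"
 have "val_ge V (ev emb G eta) s" unfolding val_ge_def s_def using eta_K by simp
 moreover have "val_ge V (ev emb H eta) s" by (rule val_ge_mono[OF r(2)]) (simp add: s_def)
 moreover have "s > mu" using g r(1) by (simp add: s_def)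
 ultimately show False using transversal[OF t z] by blast
qed

end

lemma (in generic_point) branch_exists:
 assumes q: "q \<in> C" shows "\<exists>V v j. branch emb xi F n V v j & pt v = q"
proof -
 obtain V where V: "place V" "Ol q \<subseteq> V" using exists_place[OF q] by blast
 obtain v j where v: "v ~= 0" "xi $ j ~= 0" "v $ j = 1" "pt v \<in> C" "!!i. xi $ i / xi $ j - emb (v $ i) \<in> nonunits V"
  using place_center[OF V(1)] by blast
 interpret b: branch emb xi F n V v j by unfold_locales (use V v in auto)
 have "pt v = q" using place_center_unique[OF V(1) q V(2) v(4)] b.center_O by simp
 then show ?thesis using b.branch_axioms by blast
qed

section \<open>Curves meeting three components in two places\<close>

text \<open>F is the curve and \<open>f\<close> 1, \<open>f\<close> 2, \<open>f\<close> 3 are the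
  components. The condition \<open>node\<close> condenses the geometry of the nodes: no triple
  points, and components crossing transversally.\<close>

locale tri = generic_point emb xi F n
 for emb :: "complex => 'k::field" and xi F n +
 fixes f :: "nat => cpoly3" and b :: "nat => nat"
 assumes n2: "n \<ge> 2"
  and f: "!!l. l \<in> {1, 2, 3} ==> homogeneous (b l) (f l)"
  and b: "!!l. l \<in> {1, 2, 3} ==> b l > 0"
  and nd: "!!l. l \<in> {1, 2, 3} ==> ~ F dvd f l"
  and node: "!!i j k q. {i, j, k} = {1, 2, 3} ==> vanishes_at (f i) q ==> vanishes_at (f j) q ==>
   ~ vanishes_at (f k) q & (\<exists>v. v ~= 0 & pt v = q & transv (f i) (f j) v)"
  and fin: "finite (normalization_preimage C (C \<inter> {q. \<exists>l\<in>{1, 2, 3}. vanishes_at (f l) q}))"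
   "card (normalization_preimage C (C \<inter> {q. \<exists>l\<in>{1, 2, 3}. vanishes_at (f l) q})) \<le> 2"
begin

abbreviation "Z l \<equiv> {q. vanishes_at (f l) q}"

lemma node_at:
 assumes p: "{i, j, k} = {1, 2, 3}" and v: "v ~= 0" "ev id (f i) v = 0" "ev id (f j) v = 0"
 shows "ev id (f k) v ~= 0 & transv (f i) (f j) v"
proof -
 have ijk: "i \<in> {1, 2, 3}" "j \<in> {1, 2, 3}" "k \<in> {1, 2, 3}" using p by auto
 have "vanishes_at (f i) (pt v)" "vanishes_at (f j) (pt v)"
  using vanishes_at_pt[OF f[OF ijk(1)] v(1)] vanishes_at_pt[OF f[OF ijk(2)] v(1)] v by auto
 note nn = node[OF p this]
 obtain w where w: "w ~= 0" "pt w = pt v" "transv (f i) (f j) w" using nn by blast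
 obtain c where "c ~= 0" "v = c *s w" using pt_eq_iff[OF w(1) v(1)] w(2) by blast
 then have "transv (f i) (f j) v" using transv_scale[OF f[OF ijk(1)] f[OF ijk(2)] _ w(3)] by blast
 then show ?thesis using nn vanishes_at_pt[OF f[OF ijk(3)] v(1)] by blast
qed

text \<open>If the curve missed the component, the ratio of a line through a point of the curve,
  raised to the power \<open>b l\<close>, to \<open>f l\<close> would have no poles at all.\<close>

lemma meets: assumes l: "l \<in> {1, 2, 3}" shows "\<exists>q\<in>C. vanishes_at (f l) q"
proof (rule ccontr)
 assume no: "~ ?thesis"
 obtain t where t: "t \<in> C" using infinite_C by (metis finite.emptyI ex_in_conv)
 obtain w where w: "w ~= 0" "t = pt w" by (rule pt_cases)
 obtain a where a: "a ~= 0" "ev id (lin a) w = 0" using line_through[of w w] by blast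
 have "vanishes_at (lin a) t" using vanishes_at_pt[OF homogeneous_lin w(1)] a(2) w(2) by blast
 then show False using line_power_ratio[OF n2 a(1) f[OF l] nd[OF l] _ b[OF l] t] no t by blast
qed

end

locale tri_branch = tri emb xi F n f b + branch emb xi F n V v j0
 for emb :: "complex => 'k::field" and xi F n f b V v j0
begin

text \<open>Take the line through v and a further point t of the curve. Its power with exponent
  \<open>b l\<close> has contact at least \<open>b l\<close> times \<open>mu\<close> at v. If
  \<open>f l\<close> had no more, the ratio of the two would be regular everywhere and vanish at
  t.\<close>

lemma tang:
 assumes u: "unibranch (pt v)" and l: "l \<in> {1, 2, 3}" and Z: "C \<inter> Z l = {pt v}"
 shows "val V (ev emb (f l) eta) > b l * mu"
proof (rule ccontr)
 assume no: "~ ?thesis"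
 obtain t where t: "t \<in> C" "t ~= pt v" using exists_two_points[OF infinite_C] by blast
 obtain w where w: "w ~= 0" "t = pt w" by (rule pt_cases)
 obtain a where a: "a ~= 0" "ev id (lin a) v = 0" "ev id (lin a) w = 0" using line_through by blast
 have "val_ge V (ev emb (lin a ^ b l) eta) (b l * mu)"
  unfolding ev_power by (rule val_ge_power[OF V first_order[OF a(2)]])
 moreover have hl: "homogeneous (b l) (lin a ^ b l)" using homogeneous_power[OF homogeneous_lin[of a], of "b l"] by simp
 ultimately have rV: "ev emb (lin a ^ b l) xi / ev emb (f l) xi \<in> V"
  using ratio_V[OF hl f[OF l] nd[OF l]] no by simp
 have "vanishes_at (lin a) t" using vanishes_at_pt[OF homogeneous_lin w(1)] a(3) w(2) by blast
 moreover have "~ vanishes_at (f l) t" using Z t by blast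
 moreover have "unibranch r & (\<exists>V. place V & Ol r \<subseteq> V & ev emb (lin a ^ b l) xi / ev emb (f l) xi \<in> V)" if "r \<in> C" "vanishes_at (f l) r" for r
 proof -
  have "r = pt v" using Z that by blast
  then show ?thesis using u V center_O(1) rV by blast
 qed
 ultimately show False using line_power_ratio[OF n2 a(1) f[OF l] nd[OF l] _ b[OF l] t(1)] by blast
qed

lemma tang_mu:
 assumes u: "unibranch (pt v)" and l: "l \<in> {1, 2, 3}" and Z: "C \<inter> Z l = {pt v}"
 shows "val V (ev emb (f l) eta) > mu"
proof -
 have "1 * mu \<le> b l * mu" using b[OF l] mu_pos by (intro mult_right_mono) auto
 then show ?thesis using tang[OF assms] by simp
qed

lemma f_eta: "l \<in> {1, 2, 3} ==> ev emb (f l) eta ~= 0"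
 using eta_eq_0 f nd by blast

lemma f_zero: assumes l: "l \<in> {1, 2, 3}" and v: "pt v \<in> Z l" shows "ev id (f l) v = 0"
 using vanishes_at_pt[OF f[OF l] v_nz] v by simp

text \<open>Component j has contact greater than \<open>mu\<close> by \<open>tang\<close>, so by
  transversality the component i through the same point has contact exactly
  \<open>mu\<close>.\<close>

lemma simple:
 assumes u: "unibranch (pt v)" and p: "{i, j, k} = {1, 2, 3}" and Z: "C \<inter> Z j = {pt v}" "pt v \<in> Z i"
 shows "val V (ev emb (f i) eta) = mu"
proof -
 have ij: "i \<in> {1, 2, 3}" "j \<in> {1, 2, 3}" using p by auto
 have "pt v \<in> Z j" using Z(1) by blast
 then have z: "ev id (f i) v = 0" "ev id (f j) v = 0" using f_zero[OF ij(1) Z(2)] f_zero[OF ij(2)] by auto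
 have "val_ge V (ev emb (f j) eta) (val V (ev emb (f j) eta))" using eta_K by (simp add: val_ge_def)
 then show ?thesis
  using transversal_eq[OF _ z f_eta[OF ij(1)] tang_mu[OF u ij(2) Z(1)]] node_at[OF p v_nz z] by blast
qed

lemma no_double:
 assumes u: "unibranch (pt v)" and p: "{i, j, k} = {1, 2, 3}" and Z: "C \<inter> Z i = {pt v}" "C \<inter> Z j = {pt v}"
 shows False
proof -
 have "i \<in> {1, 2, 3}" using p by auto
 moreover have "pt v \<in> Z i" using Z by blast
 ultimately show False using simple[OF u p Z(2)] tang_mu[OF u _ Z(1)] by simp
qed

end

context tri
begin

lemma no_double_point:
 assumes q: "q \<in> C" and u: "unibranch q" and p: "{i, j, k} = {1, 2, 3}" and Z: "C \<inter> Z i = {q}" "C \<inter> Z j = {q}"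
 shows False
proof -
 obtain V v j0 where b: "branch emb xi F n V v j0" "pt v = q" using branch_exists[OF q] by blast
 interpret B: branch emb xi F n V v j0 by (rule b(1))
 interpret B: tri_branch emb xi F n f b V v j0 by unfold_locales
 show False using B.no_double[of i j k] u p Z b(2) by blast
qed

text \<open>Record which components pass through p and which through q. Each passes through at least
  one of them, no point lies on all three, and no two meet the curve in the same single point. Up to
  relabelling, propositional logic leaves only this pattern.\<close>

lemma configuration:
 obtains i j k p q where "{i, j, k} = {1, 2, 3}" "p \<in> C" "q \<in> C" "p ~= q" "unibranch p" "unibranch q"
  "C \<inter> Z i = {p, q}" "C \<inter> Z j = {p}" "C \<inter> Z k = {q}"
proof -
 note result = that
 define S where "S = C \<inter> {q. \<exists>l\<in>{1, 2, 3}. vanishes_at (f l) q}"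
 have SC: "S \<subseteq> C" by (auto simp: S_def)
 have three: "~ (vanishes_at (f 1) q & vanishes_at (f 2) q & vanishes_at (f 3) q)" for q
  using node[of 1 2 3 q] by blast
 obtain r1 r2 r3 where r: "r1 \<in> C" "vanishes_at (f 1) r1" "r2 \<in> C" "vanishes_at (f 2) r2" "r3 \<in> C" "vanishes_at (f 3) r3"
  using meets[of 1] meets[of 2] meets[of 3] by auto
 have rS: "r1 \<in> S" "r2 \<in> S" "r3 \<in> S" using r by (auto simp: S_def)
 have "r1 ~= r2 \<or> r2 ~= r3" using three r by metis
 then obtain p q where pq: "p \<in> S" "q \<in> S" "p ~= q" using rS by blast
 have Spq: "S = {p, q}" and u: "unibranch p" "unibranch q" using two_points[OF SC _ _ pq] fin unfolding S_def by blast+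
 have C: "p \<in> C" "q \<in> C" using pq SC by auto
 define P Q where "P l \<longleftrightarrow> vanishes_at (f l) p" and "Q l \<longleftrightarrow> vanishes_at (f l) q" for l
 have Z: "C \<inter> Z l = {r. r = p & P l \<or> r = q & Q l}" if "l \<in> {1, 2, 3}" for l
 proof -
  have "C \<inter> Z l \<subseteq> {p, q}" using Spq that unfolding S_def by blast
  then show ?thesis using C unfolding P_def Q_def by blast
 qed
 have PQ: "P l \<or> Q l" if "l \<in> {1, 2, 3}" for l
  using meets[OF that] Z[OF that] by blast
 have dP: "Q i \<or> Q j" if "{i, j, k} = {1, 2, 3}" for i j k
 proof (rule ccontr)
  assume nq: "~ (Q i \<or> Q j)"
  have ij: "i \<in> {1, 2, 3}" "j \<in> {1, 2, 3}" using that by auto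
  have "C \<inter> Z i = {p}" "C \<inter> Z j = {p}" using Z[OF ij(1)] Z[OF ij(2)] PQ[OF ij(1)] PQ[OF ij(2)] nq by auto
  then show False using no_double_point[OF C(1) u(1) that] by blast
 qed
 have dQ: "P i \<or> P j" if "{i, j, k} = {1, 2, 3}" for i j k
 proof (rule ccontr)
  assume nq: "~ (P i \<or> P j)"
  have ij: "i \<in> {1, 2, 3}" "j \<in> {1, 2, 3}" using that by auto
  have "C \<inter> Z i = {q}" "C \<inter> Z j = {q}" using Z[OF ij(1)] Z[OF ij(2)] PQ[OF ij(1)] PQ[OF ij(2)] nq by auto
  then show False using no_double_point[OF C(2) u(2) that] by blast
 qed
 have perms: "{1, 3, 2} = {1, 2, 3 :: nat}" "{2, 1, 3} = {1, 2, 3 :: nat}" "{2, 3, 1} = {1, 2, 3 :: nat}" "{3, 1, 2} = {1, 2, 3 :: nat}" "{3, 2, 1} = {1, 2, 3 :: nat}" by auto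
 have nt: "~ (P 1 & P 2 & P 3)" "~ (Q 1 & Q 2 & Q 3)" using three unfolding P_def Q_def by blast+
 have d: "Q 1 \<or> Q 2" "Q 1 \<or> Q 3" "Q 2 \<or> Q 3" "P 1 \<or> P 2" "P 1 \<or> P 3" "P 2 \<or> P 3"
  using dP[of 1 2 3] dP[of 1 3 2] dP[of 2 3 1] dQ[of 1 2 3] dQ[of 1 3 2] dQ[of 2 3 1] perms by blast+
 have fin: thesis if "{i, j, k} = {1, 2, 3}" "P i" "Q i" "P j" "~ Q j" "~ P k" "Q k" for i j k
 proof -
  have "i \<in> {1, 2, 3}" "j \<in> {1, 2, 3}" "k \<in> {1, 2, 3}" using that(1) by auto
  then have "C \<inter> Z i = {p, q}" "C \<inter> Z j = {p}" "C \<inter> Z k = {q}" using Z that(2-) by auto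
  then show thesis using result[OF that(1) C pq(3) u] by blast
 qed
 have "(P 1 & Q 1 & P 2 & ~ Q 2 & ~ P 3 & Q 3)
  \<or> (P 1 & Q 1 & P 3 & ~ Q 3 & ~ P 2 & Q 2)
  \<or> (P 2 & Q 2 & P 1 & ~ Q 1 & ~ P 3 & Q 3)
  \<or> (P 2 & Q 2 & P 3 & ~ Q 3 & ~ P 1 & Q 1)
  \<or> (P 3 & Q 3 & P 1 & ~ Q 1 & ~ P 2 & Q 2)
  \<or> (P 3 & Q 3 & P 2 & ~ Q 2 & ~ P 1 & Q 1)"
  using d nt PQ[of 1] PQ[of 2] PQ[of 3] by simp argo
 then consider "P 1 & Q 1 & P 2 & ~ Q 2 & ~ P 3 & Q 3"
  | "P 1 & Q 1 & P 3 & ~ Q 3 & ~ P 2 & Q 2"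
  | "P 2 & Q 2 & P 1 & ~ Q 1 & ~ P 3 & Q 3"
  | "P 2 & Q 2 & P 3 & ~ Q 3 & ~ P 1 & Q 1"
  | "P 3 & Q 3 & P 1 & ~ Q 1 & ~ P 2 & Q 2"
  | "P 3 & Q 3 & P 2 & ~ Q 2 & ~ P 1 & Q 1" by argo
 then show thesis
 proof cases
  case 1 then show thesis using fin[OF refl] by simp
 next
  case 2 then show thesis using fin[OF perms(1)] by simp
 next
  case 3 then show thesis using fin[OF perms(2)] by simp
 next
  case 4 then show thesis using fin[OF perms(3)] by simp
 next
  case 5 then show thesis using fin[OF perms(4)] by simp
 next
  case 6 then show thesis using fin[OF perms(5)] by simp
 qed
qed

end

text \<open>Component i passes through both points, j meets the curve only at P and k only at Q.
  Exchanging the two ends is the lemma \<open>swap\<close>.\<close>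

locale config = tri emb xi F n f b + P: tri_branch emb xi F n f b VP vp jp + Q: tri_branch emb xi F n f b VQ vq jq
 for emb :: "complex => 'k::field" and xi F n f b VP vp jp VQ vq jq +
 fixes i j k :: nat
 assumes perm: "{i, j, k} = {1, 2, 3}"
  and uni: "unibranch (pt vp)" "unibranch (pt vq)"
  and ne: "pt vp ~= pt vq"
  and Zi: "C \<inter> {q. vanishes_at (f i) q} = {pt vp, pt vq}"
  and Zj: "C \<inter> {q. vanishes_at (f j) q} = {pt vp}"
  and Zk: "C \<inter> {q. vanishes_at (f k) q} = {pt vq}"
begin

lemma swap: "config emb xi F n f b VQ vq jq VP vp jp i k j"
 by unfold_locales (use perm uni ne Zi Zj Zk in auto)

lemma idx: "i \<in> {1, 2, 3}" "j \<in> {1, 2, 3}" "k \<in> {1, 2, 3}"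
 using perm by auto

lemma perm': "{i, k, j} = {1, 2, 3}"
 using perm by auto

lemma on: "pt vp \<in> Z i" "pt vq \<in> Z i" "pt vp \<in> Z j" "pt vq \<in> Z k"
 using Zi Zj Zk by blast+

lemma f_i: "val VP (ev emb (f i) P.eta) = P.mu" "val VQ (ev emb (f i) Q.eta) = Q.mu"
 using P.simple[OF uni(1) perm Zj] Q.simple[OF uni(2) perm' Zk] on by auto

lemma zeros: "ev id (f i) vp = 0" "ev id (f i) vq = 0" "ev id (f j) vp = 0" "ev id (f k) vq = 0"
 using P.f_zero Q.f_zero idx on by blast+

lemma regular:
 assumes G: "homogeneous m G" and H: "homogeneous m H" "~ F dvd H"
  and r: "r \<in> {pt vp, pt vq}"
  and P: "val_ge VP (ev emb G P.eta) x" "val VP (ev emb H P.eta) \<le> x"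
  and Q: "val_ge VQ (ev emb G Q.eta) y" "val VQ (ev emb H Q.eta) \<le> y"
 shows "unibranch r & (\<exists>V. place V & Ol r \<subseteq> V & ev emb G xi / ev emb H xi \<in> V)"
 using r P.ratio_V[OF G H P] Q.ratio_V[OF G H Q] uni P.center_O(1) Q.center_O(1) P.V Q.V by blast

text \<open>\<open>f i\<close> has the least possible contact \<open>mu\<close> at P and at Q, while
  the line PQ to the power \<open>b i\<close> has at least \<open>b i\<close> times that. For
  \<open>b i\<close> at least 2 the ratio would be regular everywhere and vanish at P, so F would
  divide a line.\<close>

lemma degree_i: "b i = 1"
proof (rule ccontr)
 assume "b i ~= 1"
 then have b2: "b i \<ge> 2" using b[OF idx(1)] by simp
 obtain a where a: "a ~= 0" "ev id (lin a) vp = 0" "ev id (lin a) vq = 0" using line_through by blast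
 have G: "homogeneous (b i) (lin a ^ b i)" using homogeneous_power[OF homogeneous_lin[of a], of "b i"] by simp
 have P: "val_ge VP (ev emb (lin a ^ b i) P.eta) (b i * P.mu)"
  unfolding ev_power by (rule val_ge_power[OF P.V P.first_order[OF a(2)]])
 have Q: "val_ge VQ (ev emb (lin a ^ b i) Q.eta) (b i * Q.mu)"
  unfolding ev_power by (rule val_ge_power[OF Q.V Q.first_order[OF a(3)]])
 have "2 * P.mu \<le> b i * P.mu" "2 * Q.mu \<le> b i * Q.mu" using b2 P.mu_pos Q.mu_pos by (auto intro!: mult_right_mono)
 then have lt: "val VP (ev emb (f i) P.eta) < b i * P.mu" "val VQ (ev emb (f i) Q.eta) < b i * Q.mu" using f_i P.mu_pos Q.mu_pos by auto
 have reg: "unibranch r & (\<exists>V. place V & Ol r \<subseteq> V & ev emb (lin a ^ b i) xi / ev emb (f i) xi \<in> V)"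
  if r: "r \<in> C" "vanishes_at (f i) r" for r
 proof -
  have "r \<in> {pt vp, pt vq}" using r Zi by blast
  then show ?thesis using regular[OF G f[OF idx(1)] nd[OF idx(1)] _ P _ Q] lt by simp
 qed
 obtain c where c: "ev emb (lin a ^ b i) xi / ev emb (f i) xi = emb c" "F dvd lin a ^ b i - cst c * f i"
  using constant_ratio[OF G f[OF idx(1)] nd[OF idx(1)] reg] by blast
 have "emb c \<in> nonunits VP" using P.ratio_nonunit[OF G f[OF idx(1)] nd[OF idx(1)] P lt(1)] c(1) by simp
 then have "c = 0" using emb_nonunit[OF P.V] by blast
 then have "F dvd lin a ^ b i" using c(2) by simp
 then have "F dvd lin a" using prime_F prime_elem_dvd_power by blast
 then have "n \<le> 1" using dvd_degree[OF _ homogeneous_lin] a(1) lin_eq_0 by blast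
 then show False using n2 by simp
qed

text \<open>The tangent of component j at P does not pass through Q, since otherwise it would share
  this second point with the line \<open>f i\<close>, against transversality.\<close>

lemma tangent_nonzero: "(\<Sum>l\<in>UNIV. grad (f j) vp $ l * vq $ l) ~= 0"
proof
 assume 0: "(\<Sum>l\<in>UNIV. grad (f j) vp $ l * vq $ l) = 0"
 obtain a where a: "f i = lin a" using homogeneous_1_lin f[OF idx(1)] degree_i by metis
 have "(\<Sum>l\<in>UNIV. grad (f i) vp $ l * vq $ l) = 0" using zeros(2) unfolding a grad_lin ev_lin_id .
 moreover have "transv (f i) (f j) vp" using node_at[OF perm P.v_nz zeros(1,3)] by blast
 ultimately obtain c where c: "vq = c *s vp" using 0 unfolding transv_def by blast
 then have "c ~= 0" using Q.v_nz by auto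
 then show False using c ne pt_eq_iff[OF P.v_nz Q.v_nz] by blast
qed

lemma tangent_contact:
 assumes "b j \<ge> 2"
 shows "val_ge VP (ev emb (lin (grad (f j) vp)) P.eta) (2 * P.mu)"
proof -
 have "2 * P.mu \<le> b j * P.mu" using assms P.mu_pos by (intro mult_right_mono) auto
 then have "val_ge VP (ev emb (f j) P.eta) (2 * P.mu)"
  using P.tang[OF uni(1) idx(2) Zj] P.eta_K by (simp add: val_ge_def)
 then show ?thesis using P.tangent_val[OF f[OF idx(2)] zeros(3)] by blast
qed

theorem conic:
 assumes bj: "b j \<ge> 2" and bk: "b k \<ge> 2"
 shows "n = 2 & rational_curve C"
proof -
 interpret S: config emb xi F n f b VQ vq jq VP vp jp i k j by (rule swap)
 define x y where "x = grad (f j) vp" and "y = grad (f k) vq"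
 obtain z where z: "f i = lin z" using homogeneous_1_lin f[OF idx(1)] degree_i by metis
 have xq: "ev id (lin x) vq ~= 0" unfolding x_def ev_lin_id by (rule tangent_nonzero)
 have yp: "ev id (lin y) vp ~= 0" unfolding y_def ev_lin_id by (rule S.tangent_nonzero)
 have xp: "ev id (lin x) vp = 0" unfolding x_def ev_lin_id euler[OF f[OF idx(2)]] zeros by simp
 have yq: "ev id (lin y) vq = 0" unfolding y_def ev_lin_id euler[OF f[OF idx(3)]] zeros by simp
 have zp: "ev id (lin z) vp = 0" "ev id (lin z) vq = 0" using zeros(1,2) z by auto
 have nz: "~ F dvd lin z" using nd[OF idx(1)] z by simp
 have hG: "homogeneous 2 (lin x * lin y)" and hH: "homogeneous 2 (lin z * lin z)"
  using homogeneous_mult[OF homogeneous_lin homogeneous_lin] by (simp_all add: numeral_2_eq_2)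
 have nH: "~ F dvd lin z * lin z" using nz prime_F prime_elem_dvd_mult_iff by blast
 have P: "val_ge VP (ev emb (lin x * lin y) P.eta) (2 * P.mu)"
  using val_ge_mult[OF P.V tangent_contact[OF bj] P.eta_val[of "lin y"]] unfolding ev_mult x_def by simp
 have Q: "val_ge VQ (ev emb (lin x * lin y) Q.eta) (2 * Q.mu)"
  using val_ge_mult[OF Q.V Q.eta_val[of "lin x"] S.tangent_contact[OF bk]] unfolding ev_mult y_def by simp
 have HP: "val VP (ev emb (lin z * lin z) P.eta) = 2 * P.mu"
  unfolding ev_mult using val_mult[OF P.V P.eta_K P.f_eta[OF idx(1)] P.eta_K P.f_eta[OF idx(1)]] f_i(1) unfolding z by simp
 have HQ: "val VQ (ev emb (lin z * lin z) Q.eta) = 2 * Q.mu"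
  unfolding ev_mult using val_mult[OF Q.V Q.eta_K Q.f_eta[OF idx(1)] Q.eta_K Q.f_eta[OF idx(1)]] f_i(2) unfolding z by simp
 have reg: "unibranch r & (\<exists>V. place V & Ol r \<subseteq> V & ev emb (lin x * lin y) xi / ev emb (lin z * lin z) xi \<in> V)"
  if r: "r \<in> C" "vanishes_at (lin z * lin z) r" for r
 proof -
  have "vanishes_at (f i) r" using r(2) vanishes_at_mult[OF homogeneous_lin homogeneous_lin] z by metis
  then have "r \<in> {pt vp, pt vq}" using r Zi by blast
  then show ?thesis using regular[OF hG hH nH _ P _ Q] HP HQ by simp
 qed
 obtain c where c: "F dvd lin x * lin y - cst c * (lin z * lin z)"
  using constant_ratio[OF hG hH nH reg] by blast
 define E where "E = lin x * lin y - cst c * (lin z * lin z)"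
 have hE: "homogeneous 2 E" unfolding E_def by (intro homogeneous_diff hG homogeneous_cst_mult hH)
 \<comment> \<open>A point where E is visibly nonzero: z and the remaining mixed products vanish
   there.\<close>
 have "ev id E (1 *s vp + 1 *s vq) = ev id (lin x) vq * ev id (lin y) vp"
  unfolding E_def idc.ev_diff idc.ev_mult idc.ev_cst ev_lin_comb xp yq zp by simp
 then have E0: "E ~= 0" using xq yp by auto
 have n: "n = 2" using dvd_degree[OF c hE[unfolded E_def] E0[unfolded E_def]] n2 by simp
 have x0: "ev emb (lin x) xi ~= 0"
 proof
  assume "ev emb (lin x) xi = 0"
  then have "F dvd lin x" using gen by blast
  moreover have "lin x ~= 0" using xq by auto
  ultimately show False using dvd_degree[OF _ homogeneous_lin] n by fastforce
 qed
 have z0: "ev emb (lin z) xi ~= 0" using nz gen by blast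
 define t where "t = ev emb (lin x) xi / ev emb (lin z) xi"
 have tK: "t \<in> K" unfolding t_def by (rule K_intro[OF homogeneous_lin homogeneous_lin z0])
 have "ev emb E xi = 0" using c gen E_def by blast
 then have "ev emb (lin x) xi * ev emb (lin y) xi = emb c * (ev emb (lin z) xi * ev emb (lin z) xi)"
  unfolding E_def ev_diff ev_mult ev_cst by simp
 \<comment> \<open>With t = x/z the equation x y = c z^2 gives y/z = c/t, so t parametrizes the
   conic.\<close>
 then have yz: "inverse (ev emb (lin z) xi) * ev emb (lin y) xi = emb c * inverse t"
  unfolding t_def using x0 z0 by (simp add: field_simps)
 \<comment> \<open>The forms x, y, z are independent: x and z have only P in common, and y does not
   vanish there. So the coordinates of \<open>xi\<close> can be recovered from their values.\<close>
 define A :: "complex ^ 3 ^ 3" where "A = (\<chi> l. if l = 1 then x else if l = 2 then y else z)"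
 have A: "A $ 1 = x" "A $ 2 = y" "A $ 3 = z" by (simp_all add: A_def)
 have "\<exists>B. B ** A = mat 1"
  unfolding matrix_left_invertible_ker
 proof (intro allI impI)
  fix u assume u: "A *v u = 0"
  have "(A *v u) $ 1 = 0" "(A *v u) $ 2 = 0" "(A *v u) $ 3 = 0" unfolding u by simp_all
  then have s: "(\<Sum>l\<in>UNIV. x $ l * u $ l) = 0" "(\<Sum>l\<in>UNIV. y $ l * u $ l) = 0" "(\<Sum>l\<in>UNIV. z $ l * u $ l) = 0"
   by (auto simp: matrix_vector_mult_def A)
  have "transv (f i) (f j) vp" using node_at[OF perm P.v_nz zeros(1,3)] by blast
  then obtain e where e: "u = e *s vp" using s(1,3) unfolding transv_def z grad_lin x_def by blast
  have "e * ev id (lin y) vp = 0" using s(2) unfolding e ev_lin_id by (simp add: sum_3 algebra_simps)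
  then show "u = 0" using e yp by simp
 qed
 then obtain B where B: "B ** A = mat 1" by blast
 have rep: "mv emb B (mv emb A xi) = xi" unfolding mv_mv[OF cpx_hom_axioms] B by (rule mv_1[OF cpx_hom_axioms])
 have rat: "inverse (ev emb (lin z) xi) * xi $ l \<in> ratfield emb t" for l
 proof -
  have "xi $ l = emb (B $ l $ 1) * ev emb (lin x) xi + emb (B $ l $ 2) * ev emb (lin y) xi + emb (B $ l $ 3) * ev emb (lin z) xi"
   using arg_cong[OF rep, of "%u. u $ l"] by (simp add: mv_def A ev_lin)
  then have "inverse (ev emb (lin z) xi) * xi $ l = emb (B $ l $ 1) * t
    + emb (B $ l $ 2) * (inverse (ev emb (lin z) xi) * ev emb (lin y) xi) + emb (B $ l $ 3)"
   using z0 by (simp add: t_def field_simps)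
  moreover note r = subring_mult[OF ratfield_subring] subring_add[OF ratfield_subring] ratfield_emb ratfield_gen ratfield_inverse
  ultimately show ?thesis unfolding yz by (auto intro!: r)
 qed
 have "rational_curve C" by (rule rational_parametrization[OF tK _ rat]) (use z0 in simp)
 then show ?thesis using n by blast
qed

end

section \<open>Curves with a point of multiplicity one less than the degree\<close>

definition lpoly :: "cpoly3 => complex ^ 3 => complex ^ 3 => complex poly" where
 "lpoly F w v = ev (%c. [:c:]) F (\<chi> i. [:w $ i, v $ i:])"

text \<open>For a form of degree n vanishing at v, this says without reference to a frame that the
  multiplicity at v is at least n - 1.\<close>

definition affine_along :: "cpoly3 => complex ^ 3 => bool" where
 "affine_along F v \<longleftrightarrow> (\<forall>w. degree (lpoly F w v) \<le> 1)"

lemma poly_lpoly: "poly (lpoly F w v) s = ev id F (w + s *s v)"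
proof -
 interpret g: comm_hom "%p::complex poly. poly p s" by unfold_locales auto
 have "ev (%x. poly [:x:] s) F (\<chi> i. poly ((\<chi> i. [:w $ i, v $ i:]) $ i) s) = poly (lpoly F w v) s"
  unfolding lpoly_def by (rule ev_comp[OF cpx_hom_pconst g.comm_hom_axioms])
 moreover have "(%x::complex. poly [:x:] s) = id" by auto
 moreover have "(\<chi> i. poly ((\<chi> i. [:w $ i, v $ i:]) $ i) s) = w + s *s v" by (simp add: vec_eq_iff)
 ultimately show ?thesis by simp
qed

lemma affine_eval: assumes "affine_along F v" shows "\<exists>c0 c1. \<forall>s. ev id F (w + s *s v) = c0 + c1 * s"
proof -
 define p where "p = lpoly F w v"
 have d: "degree p \<le> 1" using assms by (simp add: affine_along_def p_def)
 have "p = [:coeff p 0, coeff p 1:]" using d by (intro poly_eqI) (auto simp: coeff_pCons coeff_eq_0 split: nat.splits)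
 then have "poly p s = coeff p 0 + coeff p 1 * s" for s by (metis mult.commute poly_pCons poly_0 add_0_right mult_zero_right)
 then show ?thesis using poly_lpoly[of F w v] unfolding p_def by metis
qed

lemma affine_scale: assumes "affine_along F v" shows "affine_along F (c *s v)"
 unfolding affine_along_def
proof
 fix w
 interpret g: comm_hom "%p::complex poly. pcompose p [:0, c:]"
  by unfold_locales (auto simp: pcompose_add pcompose_mult pcompose_1)
 have "ev (%x. pcompose [:x:] [:0, c:]) F (\<chi> i. pcompose ((\<chi> i. [:w $ i, v $ i:]) $ i) [:0, c:]) = pcompose (lpoly F w v) [:0, c:]"
  unfolding lpoly_def by (rule ev_comp[OF cpx_hom_pconst g.comm_hom_axioms])
 moreover have "(\<chi> i. pcompose ((\<chi> i. [:w $ i, v $ i:]) $ i) [:0, c:]) = (\<chi> i. [:w $ i, (c *s v) $ i:])"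
  by (simp add: vec_eq_iff pcompose_pCons mult.commute)
 ultimately have "lpoly F w (c *s v) = pcompose (lpoly F w v) [:0, c:]" by (simp add: lpoly_def pcompose_const)
 then have "degree (lpoly F w (c *s v)) = degree (lpoly F w v) * degree [:0, c:]" by (simp only: degree_pcompose)
 moreover have "degree (lpoly F w v) \<le> 1" using assms by (simp add: affine_along_def)
 moreover have "degree [:0, c:] \<le> 1" by simp
 ultimately show "degree (lpoly F w (c *s v)) \<le> 1" using mult_le_mono[of "degree (lpoly F w v)" 1 "degree [:0, c:]" 1] by simp
qed

lemma poly_map_poly_sum:
 fixes f :: "'a::zero => 'b::comm_ring_1"
 assumes "f 0 = 0" shows "poly (map_poly f G) c = (\<Sum>k\<le>degree G. f (coeff G k) * c ^ k)"
proof -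
 have "poly (map_poly f G) c = (\<Sum>k\<le>degree (map_poly f G). f (coeff G k) * c ^ k)"
  unfolding poly_altdef using assms by (simp add: coeff_map_poly)
 also have "\<dots> = (\<Sum>k\<le>degree G. f (coeff G k) * c ^ k)"
 proof (rule sum.mono_neutral_left)
  show "\<forall>k\<in>{..degree G} - {..degree (map_poly f G)}. f (coeff G k) * c ^ k = 0"
  proof
   fix k assume "k \<in> {..degree G} - {..degree (map_poly f G)}"
   then have "coeff (map_poly f G) k = 0" by (intro coeff_eq_0) auto
   then show "f (coeff G k) * c ^ k = 0" using assms by (simp add: coeff_map_poly)
  qed
  have "degree (map_poly f G) \<le> degree G" using assms by (intro degree_le) (simp add: coeff_map_poly coeff_eq_0)
  then show "{..degree (map_poly f G)} \<subseteq> {..degree G}" by simp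
 qed simp
 finally show ?thesis .
qed

definition fiber_value :: "complex ^ 3 => complex poly poly => complex" where
 "fiber_value x g = poly (map_poly (%h. poly h (x $ 1)) g) (x $ 2)"

text \<open>In a frame whose third base point is the direction of movement, only the third
  coordinate changes, so the form is expanded by powers of z.\<close>

lemma lpoly_frame:
 "lpoly F (A *v x) (column 3 A) = (\<Sum>k\<le>degree (frame A F). [:fiber_value x (coeff (frame A F) k):] * [:x $ 3, 1:] ^ k)"
proof -
 have 1: "poly (map_poly (%c. [:c:]) H) [:a:] = [:poly H a:]" for H and a :: complex
  by (induction H) (auto simp: map_poly_pCons)
 have 2: "poly (map_poly (%H. [:poly H a:]) g) [:b:] = [:poly (map_poly (%H. poly H a) g) b:]" for a b :: complex and g
  by (induction g) (auto simp: map_poly_pCons)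
 let ?u = "\<chi> i. [:x $ i, if i = 3 then 1 else 0:]"
 have "mv (%c. [:c:]) A ?u = (\<chi> i. [:(A *v x) $ i, column 3 A $ i:])"
  by (simp add: mv_def vec_eq_iff matrix_vector_mult_def sum_3 column_def)
 then have "lpoly F (A *v x) (column 3 A) = ev (%c. [:c:]) (frame A F) ?u"
  unfolding lpoly_def pc.ev_frame by simp
 also have "\<dots> = poly (map_poly (%g. [:fiber_value x g:]) (frame A F)) [:x $ 3, 1:]"
  unfolding ev_def subst3_def by (simp add: 1 2 fiber_value_def)
 finally show ?thesis by (subst (asm) poly_map_poly_sum) (simp_all add: fiber_value_def)
qed

lemma affine_frame:
 assumes A: "A ** A' = mat 1" and v: "column 3 A = v"
 shows "affine_along F v \<longleftrightarrow> degree (frame A F) \<le> 1"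
proof
 assume a: "affine_along F v"
 define G where "G = frame A F"
 show "degree (frame A F) \<le> 1"
 proof (cases "G = 0")
  case False
  then obtain a b where ab: "poly (map_poly (%q. poly q a) (lead_coeff G)) b ~= 0"
   using exists_poly2_nonzero[of "lead_coeff G"] by auto
  have "lpoly F (A *v vec3 a b 0) v = (\<Sum>k\<le>degree G. monom (fiber_value (vec3 a b 0) (coeff G k)) k)"
   unfolding v[symmetric] lpoly_frame G_def[symmetric] by (intro sum.cong) (auto simp: monom_altdef)
  then have "coeff (lpoly F (A *v vec3 a b 0) v) (degree G) = fiber_value (vec3 a b 0) (lead_coeff G)"
   by (simp add: coeff_sum)
  then have "coeff (lpoly F (A *v vec3 a b 0) v) (degree G) ~= 0" using ab by (simp add: fiber_value_def)
  then have "degree G \<le> degree (lpoly F (A *v vec3 a b 0) v)" by (rule le_degree)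
  then show ?thesis using a unfolding affine_along_def G_def by (meson le_trans)
 qed (simp add: G_def)
next
 assume d: "degree (frame A F) \<le> 1"
 show "affine_along F v" unfolding affine_along_def
 proof
  fix w
  have w: "w = A *v (A' *v w)" by (simp add: matrix_vector_mul_assoc A)
  have "degree (lpoly F (A *v (A' *v w)) (column 3 A)) \<le> degree (frame A F)"
   unfolding lpoly_frame
  proof (rule degree_sum_le)
   fix k assume "k \<in> {..degree (frame A F)}"
   then show "degree ([:fiber_value (A' *v w) (coeff (frame A F) k):] * [:(A' *v w) $ 3, 1:] ^ k) \<le> degree (frame A F)"
    using degree_mult_le[of "[:fiber_value (A' *v w) (coeff (frame A F) k):]" "[:(A' *v w) $ 3, 1:] ^ k"]
    by (simp add: degree_power_eq)
  qed simp
  then show "degree (lpoly F w v) \<le> 1" using d w v by simp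
 qed
qed

lemma conic_affine:
 assumes F: "homogeneous 2 F" and v: "v ~= 0" "ev id F v = 0" shows "affine_along F v"
proof -
 obtain A A' :: "complex ^ 3 ^ 3" where A: "A ** A' = mat 1" "column 3 A = v" using exists_frame[OF v(1)] by blast
 \<comment> \<open>The form itself vanishes at (0,0,1). Adding z^2 makes
   \<open>homogeneous_monic\<close> applicable, and the coefficient 1 of z^2 found there belongs to
   the added term.\<close>
 define G where "G = frame A F + vz ^ 2"
 have z2: "homogeneous 2 (vz ^ 2)" using homogeneous_power[OF homogeneous_vz, of 2] by simp
 have hG: "homogeneous 2 G" unfolding G_def by (intro homogeneous_add homogeneous_frame F z2)
 have "ev id G (vec3 0 0 1) = 1"
  unfolding G_def idc.ev_add idc.ev_power idc.ev_vz idc.ev_frame mv_e3 A(2) by (simp add: v)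
 then have G: "degree G = 2" "coeff G 2 = [:[:1:]:]" using homogeneous_monic[OF hG] by auto
 have vz: "vz ^ 2 = monom 1 2" by (simp add: monom_altdef)
 have "coeff (frame A F) k = 0" if "k > 1" for k
 proof -
  have "coeff (frame A F) k = coeff G k - coeff (vz ^ 2) k" by (simp add: G_def)
  also have "\<dots> = 0" using that G unfolding vz by (cases "k = 2") (auto simp: coeff_eq_0 one_pCons)
  finally show ?thesis .
 qed
 then have "degree (frame A F) \<le> 1" by (intro degree_le) auto
 then show ?thesis using affine_frame[OF A] by blast
qed

text \<open>Affinity along v bounds the degree in z by 1. Degree 0 would mean that F is constant
  along v, which the second hypothesis excludes.\<close>

lemma mult_at_affine:
 assumes F: "irred F" "homogeneous n F" "n \<ge> 2" and D: "D = {q. vanishes_at F q}" and v: "v ~= 0" "pt v \<in> D"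
 shows "mult_at (pt v) D = n - 1 ==> affine_along F v"
  and "affine_along F v ==> ev id F (w + s *s v) ~= ev id F w ==> mult_at (pt v) D = n - 1"
proof -
 obtain A A' :: "complex ^ 3 ^ 3" where A: "A ** A' = mat 1" "column 3 A ~= 0" "pt (column 3 A) = pt v"
   and m: "mult_at (pt v) D = n - 1 \<longleftrightarrow> degree (frame A F) = 1" using mult_at_frame[OF F D v(2)] by blast
 obtain c where c: "c ~= 0" "column 3 A = c *s v" using pt_eq_iff[OF v(1) A(2)] A(3) by auto
 have v': "v = (1 / c) *s column 3 A" using c by (simp add: vec_eq_iff)
 show "affine_along F v" if "mult_at (pt v) D = n - 1"
  using that m affine_frame[OF A(1) refl, of F] affine_scale[of F "column 3 A" "1 / c"] v' by simp
 assume a: "affine_along F v" and ne: "ev id F (w + s *s v) ~= ev id F w"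
 have "degree (frame A F) \<le> 1" using affine_frame[OF A(1) refl, of F] affine_scale[OF a, of c] c by simp
 moreover have "degree (frame A F) ~= 0"
 proof
  assume d: "degree (frame A F) = 0"
  have w: "w = A *v (A' *v w)" by (simp add: matrix_vector_mul_assoc A)
  have "poly (lpoly F w (column 3 A)) t = poly (lpoly F w (column 3 A)) 0" for t
   by (subst (1 2) w) (simp add: lpoly_frame d)
  then have "ev id F (w + t *s column 3 A) = ev id F w" for t unfolding poly_lpoly by simp
  from this[of "s / c"] have "ev id F (w + s *s v) = ev id F w" using c(1) unfolding c(2) by simp
  then show False using ne by simp
 qed
 ultimately show "mult_at (pt v) D = n - 1" using m by simp
qed

section \<open>Hensel approximation of a smooth branch\<close>

text \<open>Newton's estimate with u as an exact factor, where \<open>taylor\<close> would only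
  bound the remainder. I is the ideal of small quantities: polynomials without constant term in
  \<open>hensel\<close>, nonunits of a place in \<open>hyperline\<close>.\<close>

lemma difference_quotient:
 fixes h :: "complex => 'a::comm_ring_1"
 assumes h: "cpx_hom h" and S: "range h \<subseteq> S" "!!a b. a \<in> S ==> b \<in> S ==> a + b \<in> S"
  and I: "0 \<in> I" "I \<subseteq> S" "!!a b. a \<in> I ==> b \<in> I ==> a + b \<in> I" "!!a b. a \<in> I ==> b \<in> S ==> a * b \<in> I"
  and x: "!!i. x $ i - h (q $ i) \<in> I" "!!i. x' $ i - h (q $ i) \<in> I" "!!i. x $ i - x' $ i = u * h (p $ i)"
 shows "\<exists>e\<in>I. ev h F x - ev h F x' = u * (h (\<Sum>k\<in>UNIV. grad F q $ k * p $ k) + e)"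
proof -
 interpret h: cpx_hom h by fact
 define W where "W F = ev id F q" for F
 have W: "W (cst c) = c" "W vx = q $ 1" "W vy = q $ 2" "W vz = q $ 3" "W (F + G) = W F + W G" "W (F * G) = W F * W G" for c F G
  unfolding W_def idc.ev_cst idc.ev_vx idc.ev_vy idc.ev_vz idc.ev_add idc.ev_mult by simp_all
 define D where "D F = h (\<Sum>k\<in>UNIV. grad F q $ k * p $ k)" for F
 have hS: "h c \<in> S" for c using S(1) by blast
 have near: "ev h F y - h (W F) \<in> I" if y: "!!i. y $ i - h (q $ i) \<in> I" for y F
 proof (induction F rule: cpoly3_induct)
  case (cst c) then show ?case unfolding h.ev_cst W using I(1) by simp
 next
  case vx then show ?case unfolding h.ev_vx W by (rule y)
 next
  case vy then show ?case unfolding h.ev_vy W by (rule y)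
 next
  case vz then show ?case unfolding h.ev_vz W by (rule y)
 next
  case (add F G)
  from I(3)[OF this] show ?case unfolding h.ev_add W h.add by (simp add: algebra_simps)
 next
  case (mult F G)
  have "ev h G y - h (W G) + h (W G) \<in> S" using mult I(2) by (intro S(2) hS) auto
  then have "(ev h F y - h (W F)) * ev h G y + (ev h G y - h (W G)) * h (W F) \<in> I"
   using mult by (intro I(3) I(4) hS) simp_all
  then show ?case unfolding h.ev_mult W h.mult by (simp add: algebra_simps)
 qed
 have evS: "ev h F y \<in> S" if y: "!!i. y $ i - h (q $ i) \<in> I" for y F
 proof -
  have "ev h F y - h (W F) + h (W F) \<in> S" using near[OF y, of F] I(2) by (intro S(2) hS) auto
  then show ?thesis by simp
 qed
 have "\<exists>e\<in>I. ev h F x - ev h F x' = u * (D F + e)"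
 proof (induction F rule: cpoly3_induct)
  case (cst c) then show ?case unfolding h.ev_cst D_def grad_cst using I(1) by (intro bexI[of _ 0]) simp_all
 next
  case vx then show ?case unfolding h.ev_vx D_def grad_var using I(1) x(3) by (intro bexI[of _ 0]) (simp_all add: sum_3)
 next
  case vy then show ?case unfolding h.ev_vy D_def grad_var using I(1) x(3) by (intro bexI[of _ 0]) (simp_all add: sum_3)
 next
  case vz then show ?case unfolding h.ev_vz D_def grad_var using I(1) x(3) by (intro bexI[of _ 0]) (simp_all add: sum_3)
 next
  case (add F G)
  obtain e1 e2 where e: "e1 \<in> I" "ev h F x - ev h F x' = u * (D F + e1)" "e2 \<in> I" "ev h G x - ev h G x' = u * (D G + e2)"
   using add by blast
  have "D (F + G) = D F + D G" by (simp add: D_def grad_add distrib_right sum.distrib h.add)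
  moreover have "ev h (F + G) x - ev h (F + G) x' = (ev h F x - ev h F x') + (ev h G x - ev h G x')" unfolding h.ev_add by simp
  ultimately have "ev h (F + G) x - ev h (F + G) x' = u * (D (F + G) + (e1 + e2))" unfolding e by (simp add: algebra_simps)
  then show ?case using I(3) e by blast
 next
  case (mult F G)
  obtain e1 e2 where e: "e1 \<in> I" "ev h F x - ev h F x' = u * (D F + e1)" "e2 \<in> I" "ev h G x - ev h G x' = u * (D G + e2)"
   using mult by blast
  define a b where "a = ev h G x - h (W G)" and "b = ev h F x' - h (W F)"
  have ab: "a \<in> I" "b \<in> I" unfolding a_def b_def by (intro near x)+
  have DS: "D H \<in> S" for H unfolding D_def by (rule hS)
  have D: "D (F * G) = h (W F) * D G + h (W G) * D F"
   unfolding D_def grad_mult sum_3 W_def by (simp only: h.add h.mult algebra_simps)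
  have "ev h (F * G) x - ev h (F * G) x' = (ev h F x - ev h F x') * ev h G x + ev h F x' * (ev h G x - ev h G x')"
   unfolding h.ev_mult by (simp add: algebra_simps)
  also have "\<dots> = u * (D F * ev h G x + e1 * ev h G x + ev h F x' * D G + e2 * ev h F x')"
   unfolding e by (simp add: algebra_simps)
  also have "D F * ev h G x = D F * h (W G) + a * D F" by (simp add: a_def algebra_simps)
  also have "ev h F x' * D G = h (W F) * D G + b * D G" by (simp add: b_def algebra_simps)
  finally have "ev h (F * G) x - ev h (F * G) x' = u * (D (F * G) + (a * D F + e1 * ev h G x + b * D G + e2 * ev h F x'))"
   unfolding D by (simp add: algebra_simps)
  moreover have "a * D F + e1 * ev h G x + b * D G + e2 * ev h F x' \<in> I"
   by (intro I(3) I(4) ab e DS evS x)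
  ultimately show ?case by blast
 qed
 then show ?thesis by (simp add: D_def)
qed

lemma dvd_iff_coeff_0: "[:0, 1:] dvd p \<longleftrightarrow> coeff p 0 = (0 :: complex)"
 using poly_eq_0_iff_dvd[of p 0] by (simp add: poly_0_coeff_0)

text \<open>Newton iteration. Since the derivative of F in the direction p is nonzero at q, the
  branch is a graph over the parameter in the direction r, and its Taylor coefficients are found one
  at a time.\<close>

lemma hensel:
 assumes z: "ev id F q = 0" and d: "(\<Sum>k\<in>UNIV. grad F q $ k * p $ k) ~= 0"
 shows "\<exists>\<phi>. coeff \<phi> 0 = 0 & degree \<phi> \<le> N &
  [:0, 1:] ^ Suc N dvd ev (%c. [:c:]) F (\<chi> i. [:q $ i:] + \<phi> * [:p $ i:] + [:0, r $ i:])"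
proof (induction N)
 case 0
 have "(\<chi> i. [:q $ i:] + 0 * [:p $ i:] + [:0, r $ i:]) = (\<chi> i. [:q $ i, r $ i:])" by (simp add: vec_eq_iff)
 then have "coeff (ev (%c. [:c:]) F (\<chi> i. [:q $ i:] + 0 * [:p $ i:] + [:0, r $ i:])) 0 = 0"
  using coeff_0_ev[of F q "%i. r $ i"] z by simp
 then have "[:0, 1:] ^ Suc 0 dvd ev (%c. [:c:]) F (\<chi> i. [:q $ i:] + 0 * [:p $ i:] + [:0, r $ i:])"
  by (simp only: dvd_iff_coeff_0 power_Suc power_0 mult_1_right)
 then show ?case by (intro exI[of _ 0]) simp
next
 case (Suc N)
 define P where "P \<phi> = ev (%c. [:c:]) F (\<chi> i. [:q $ i:] + \<phi> * [:p $ i:] + [:0, r $ i:])" for \<phi>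
 define D where "D = (\<Sum>k\<in>UNIV. grad F q $ k * p $ k)"
 obtain \<phi> where \<phi>: "coeff \<phi> 0 = 0" "degree \<phi> \<le> N" "[:0, 1:] ^ Suc N dvd P \<phi>" using Suc unfolding P_def by blast
 obtain w where w: "P \<phi> = [:0, 1:] ^ Suc N * w" using \<phi>(3) by (rule dvdE)
 \<comment> \<open>Chosen to cancel the constant term of the cofactor w, so that one more power of
   the parameter divides.\<close>
 define c where "c = - coeff w 0 / D"
 define \<psi> where "\<psi> = \<phi> + monom c (Suc N)"
 have m0: "coeff (monom c (Suc N)) 0 = 0" by simp
 let ?I = "{f :: complex poly. coeff f 0 = 0}"
 have "\<exists>e\<in>?I. P \<psi> - P \<phi> = monom c (Suc N) * ([:D:] + e)"
  unfolding P_def D_def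
 proof (rule difference_quotient[OF cpx_hom_pconst, where S = UNIV])
  show "(\<chi> i. [:q $ i:] + \<psi> * [:p $ i:] + [:0, r $ i:]) $ i - [:q $ i:] \<in> ?I" for i
   using \<phi>(1) m0 by (simp add: \<psi>_def coeff_mult)
  show "(\<chi> i. [:q $ i:] + \<phi> * [:p $ i:] + [:0, r $ i:]) $ i - [:q $ i:] \<in> ?I" for i
   using \<phi>(1) by (simp add: coeff_mult)
  show "(\<chi> i. [:q $ i:] + \<psi> * [:p $ i:] + [:0, r $ i:]) $ i - (\<chi> i. [:q $ i:] + \<phi> * [:p $ i:] + [:0, r $ i:]) $ i = monom c (Suc N) * [:p $ i:]" for i
   by (simp add: \<psi>_def algebra_simps smult_add_right)
 qed (auto simp: coeff_mult)
 then obtain e where e: "coeff e 0 = 0" "P \<psi> - P \<phi> = monom c (Suc N) * ([:D:] + e)" by blast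
 have mc: "monom c (Suc N) = [:0, 1:] ^ Suc N * [:c:]" by (simp add: monom_altdef)
 have "P \<psi> = P \<phi> + monom c (Suc N) * ([:D:] + e)" using e(2) by (simp add: algebra_simps)
 also have "\<dots> = [:0, 1:] ^ Suc N * (w + [:c:] * ([:D:] + e))" unfolding w mc by (simp only: algebra_simps)
 finally have P: "P \<psi> = [:0, 1:] ^ Suc N * (w + [:c:] * ([:D:] + e))" .
 have "coeff (w + [:c:] * ([:D:] + e)) 0 = 0" using e(1) d by (simp add: c_def D_def)
 then have "[:0, 1:] dvd w + [:c:] * ([:D:] + e)" by (simp only: dvd_iff_coeff_0)
 then have "[:0, 1:] ^ Suc N * [:0, 1:] dvd P \<psi>" unfolding P by (intro mult_dvd_mono dvd_refl)
 then have "[:0, 1:] ^ Suc (Suc N) dvd P \<psi>" by (simp only: power_Suc2)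
 moreover have "coeff \<psi> 0 = 0" using \<phi>(1) by (simp add: \<psi>_def)
 moreover have "degree \<psi> \<le> Suc N" unfolding \<psi>_def using \<phi>(2) degree_monom_le[of c "Suc N"] by (intro degree_add_le) auto
 ultimately show ?case unfolding P_def by blast
qed

lemma positive_rational:
 assumes "x \<in> \<rat>" "x > (0 :: real)" shows "\<exists>A B :: nat. A > 0 & B > 0 & x = real B / real A"
proof -
 obtain m n :: nat where mn: "n ~= 0" "\<bar>x\<bar> = real m / real n" using Rats_abs_nat_div_natE[OF assms(1)] by metis
 then have "m ~= 0" using assms(2) by (intro notI) simp
 then show ?thesis using mn assms(2) by (intro exI[of _ n] exI[of _ m]) auto
qed

lemma lpoly_lin: "lpoly (lin a) w v = [:ev id (lin a) w, ev id (lin a) v:]"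
 unfolding lpoly_def pc.ev_lin idc.ev_lin by simp

lemma (in generic_point) val_rational:
 assumes "place V" "u \<in> K" "u ~= 0" shows "val V u \<in> \<rat>"
 using val_rel_val[OF assms] by (auto simp: val_rel_def)

context branch
begin

lemma mu_rational: "mu \<in> \<rat>"
 using mu_attained val_rational[OF V del_K] by metis

lemma val_ratio:
 assumes G: "homogeneous m G" "~ F dvd G" and H: "homogeneous m H" "~ F dvd H"
 shows "val V (ev emb G xi / ev emb H xi) = val V (ev emb G eta) - val V (ev emb H eta)"
proof -
 have e: "ev emb G xi / ev emb H xi = ev emb G eta / ev emb H eta" unfolding ev_eta[OF G(1)] ev_eta[OF H(1)] using xj by simp
 have "ev emb G eta ~= 0" "ev emb H eta ~= 0" using eta_eq_0 assms by blast+
 then show ?thesis unfolding e by (intro val_divide[OF V eta_K _ eta_K])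
qed

lemma val_power_mult:
 assumes "ev emb G eta ~= 0" "ev emb H eta ~= 0"
 shows "val V (ev emb (G ^ a * H ^ c) eta) = real a * val V (ev emb G eta) + real c * val V (ev emb H eta)"
 unfolding ev_mult ev_power
 using val_mult[OF V subring_power[OF K_subring eta_K] _ subring_power[OF K_subring eta_K], of G a H c] assms
  val_power[OF V eta_K] by simp

end

section \<open>Comparison of orders at the two places and the case of a line through P\<close>

context config
begin

text \<open>Stands in for the fact that a principal divisor has degree 0. If the orders at Q
  differed, one of G/H and H/G would be regular everywhere and vanish at Q, hence be 0.\<close>

lemma balance:
 assumes G: "homogeneous m G" "~ F dvd G" and H: "homogeneous m H" "~ F dvd H"
  and zero: "!!r. r \<in> C ==> vanishes_at G r \<or> vanishes_at H r ==> r \<in> {pt vp, pt vq}"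
  and P: "val VP (ev emb G P.eta) = val VP (ev emb H P.eta)"
 shows "val VQ (ev emb G Q.eta) = val VQ (ev emb H Q.eta)"
proof -
 have aux: "~ val VQ (ev emb H Q.eta) < val VQ (ev emb G Q.eta)"
  if G: "homogeneous m G" "~ F dvd G" and H: "homogeneous m H" "~ F dvd H"
   and zero: "!!r. r \<in> C ==> vanishes_at H r ==> r \<in> {pt vp, pt vq}"
   and P: "val VP (ev emb G P.eta) = val VP (ev emb H P.eta)" for G H
 proof
  assume lt: "val VQ (ev emb H Q.eta) < val VQ (ev emb G Q.eta)"
  have gP: "val_ge VP (ev emb G P.eta) (val VP (ev emb G P.eta))" and gQ: "val_ge VQ (ev emb G Q.eta) (val VQ (ev emb G Q.eta))"
   using P.eta_K Q.eta_K by (simp_all add: val_ge_def)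
  have reg: "unibranch r & (\<exists>V. place V & Ol r \<subseteq> V & ev emb G xi / ev emb H xi \<in> V)" if "r \<in> C" "vanishes_at H r" for r
   using regular[OF G(1) H zero[OF that] gP _ gQ] P lt by simp
  obtain c where c: "ev emb G xi / ev emb H xi = emb c" using constant_ratio[OF G(1) H reg] by blast
  have "emb c \<in> nonunits VQ" using Q.ratio_nonunit[OF G(1) H gQ lt] c by simp
  then have "c = 0" using emb_nonunit[OF Q.V] by blast
  then have "ev emb G xi = 0 \<or> ev emb H xi = 0" using c by simp
  then show False using gen G(2) H(2) by blast
 qed
 show ?thesis using aux[OF G H _ P] aux[OF H G _ P[symmetric]] zero by (meson linorder_neqE)
qed

text \<open>Lines through P are the fibres of v = z/y, and affinity along P means that the remaining
  coordinate is a rational function of v. The only candidate is the Taylor polynomial of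
  \<open>f k\<close> at Q. That it is exact on the curve follows from the excess contact at Q,
  against which the order of the pole at P is too small.\<close>

theorem hyperline:
 assumes bj: "b j = 1" and bk: "b k \<ge> 2"
 shows "affine_along F vp" "rational_curve C" "mult_at (pt vp) C = n - 1"
proof -
 interpret S: config emb xi F n f b VQ vq jq VP vp jp i k j by (rule swap)
 obtain z where z: "f i = lin z" using homogeneous_1_lin f[OF idx(1)] degree_i by metis
 obtain y where y: "f j = lin y" using homogeneous_1_lin f[OF idx(2)] bj by metis
 have zp: "ev id (lin z) vp = 0" "ev id (lin z) vq = 0" "ev id (lin y) vp = 0" using zeros(1-3) z y by auto
 have yq: "ev id (lin y) vq ~= 0"
 proof
  assume "ev id (lin y) vq = 0"
  then have "pt vq \<in> C \<inter> Z j" using vanishes_at_pt[OF homogeneous_lin Q.v_nz] Q.center_C y by simp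
  then show False using Zj ne by simp
 qed
 have fkp: "ev id (f k) vp ~= 0" using node_at[OF perm P.v_nz zeros(1,3)] by blast
 have ny: "~ F dvd lin y" and nz: "~ F dvd lin z" using nd[OF idx(2)] nd[OF idx(1)] y z by auto
 have y0: "y ~= 0" and z0: "z ~= 0" using ny nz lin_eq_0 dvd_0_right by metis+
 have lsc: "ev id (lin a) (c *s u) = c * ev id (lin a) u" for a c u using idc.ev_scale[OF homogeneous_lin, of a c u] by simp
 have sym: "ev id (lin a) u = ev id (lin u) a" for a u by (simp add: ev_lin_id mult.commute)

 have "pt y ~= pt z"
 proof
  assume "pt y = pt z"
  then obtain c where "c ~= 0" "z = c *s y" using pt_eq_iff[OF y0 z0] by blast
  then have "ev id (lin z) vq = c * ev id (lin y) vq" using lsc[of vq c y] sym by simp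
  then show False using yq zp \<open>c ~= 0\<close> by simp
 qed
 \<comment> \<open>Duality: a linear form on the dual plane that vanishes at y but not at z is a
   point of the line y off the line z. Rescaled to r, it completes q and \<open>vp\<close> to a
   basis with y, z as dual coordinates.\<close>
 then obtain a where a: "ev id (lin a) y = 0" "ev id (lin a) z ~= 0" using separating_line[OF y0 z0] by blast
 define r where "r = (1 / ev id (lin z) a) *s a"
 define q where "q = (1 / ev id (lin y) vq) *s vq"
 have r: "ev id (lin y) r = 0" "ev id (lin z) r = 1" using a sym[of a] by (simp_all add: r_def lsc)
 have q: "ev id (lin y) q = 1" "ev id (lin z) q = 0" using yq zp by (simp_all add: q_def lsc)
 have comb: "ev id (lin a) (c1 *s q + c2 *s r + c3 *s vp) = c1 * ev id (lin a) q + c2 * ev id (lin a) r + c3 * ev id (lin a) vp" for a c1 c2 c3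
  by (simp add: idc.ev_lin algebra_simps)
 have ind: "c1 = 0 & c2 = 0 & c3 = 0" if e: "c1 *s q + c2 *s r + c3 *s vp = 0" for c1 c2 c3
 proof -
  have 0: "ev id (lin a) 0 = 0" for a by (simp add: idc.ev_lin)
  have "c1 = 0" using comb[of y c1 c2 c3] unfolding e 0 using q r zp by simp
  moreover have "c2 = 0" using comb[of z c1 c2 c3] unfolding e 0 using q r zp by simp
  ultimately show ?thesis using e P.v_nz by (simp add: vsmult_eq_0)
 qed
 obtain M' where M': "cols q r vp ** M' = mat 1" "M' ** cols q r vp = mat 1" using independent_frame[OF ind] by blast
 define M where "M = cols q r vp"
 have col: "column 3 M = vp" by (simp add: M_def column_def vec_eq_iff)
 define x where "x = mv emb M' xi"
 have "mv emb M x = xi" unfolding x_def M_def mv_mv[OF cpx_hom_axioms] M'(1) by (rule mv_1[OF cpx_hom_axioms])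
 then have rep: "xi $ l = emb (q $ l) * x $ 1 + emb (r $ l) * x $ 2 + emb (vp $ l) * x $ 3" for l
  by (auto simp: mv_def M_def vec_eq_iff)
 have lrep: "ev emb (lin a) xi = emb (ev id (lin a) q) * x $ 1 + emb (ev id (lin a) r) * x $ 2 + emb (ev id (lin a) vp) * x $ 3" for a
  unfolding ev_lin idc.ev_lin rep[of 1] rep[of 2] rep[of 3] by (simp add: add mult algebra_simps)
 define X0 Y W where "X0 = ev emb (lin y) xi" and "Y = ev emb (lin z) xi" and "W = x $ 3"
 have x12: "x $ 1 = X0" "x $ 2 = Y" using lrep[of y] lrep[of z] q r zp one by (simp_all add: X0_def Y_def)
 define g where "g = M' $ 3"
 have W: "W = ev emb (lin g) xi" by (simp add: W_def x_def mv_def g_def ev_lin)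
 have "(M' ** M) $ 3 $ 1 = 0" "(M' ** M) $ 3 $ 3 = 1" unfolding M_def M'(2) by (simp_all add: mat_def)
 then have g: "ev id (lin g) q = 0" "ev id (lin g) vp = 1"
  by (simp_all add: matrix_matrix_mult_def g_def M_def ev_lin_id)
 have gq: "ev id (lin g) vq = 0" using g(1) yq by (simp add: q_def lsc)
 have X0: "X0 ~= 0" and Y0: "Y ~= 0" using ny nz gen by (auto simp: X0_def Y_def)
 \<comment> \<open>Affine coordinates centred at Q, in the chart where \<open>lin y\<close> is
   nonzero. The curve leaves this chart only at P, so P is the only possible pole of both, and v is
   the projection from P.\<close>
 define v \<zeta> where "v = Y / X0" and "\<zeta> = W / X0"
 have vK: "v \<in> K" unfolding v_def X0_def Y_def by (rule K_intro[OF homogeneous_lin homogeneous_lin]) (use X0 X0_def in simp)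
 have zK: "\<zeta> \<in> K" unfolding \<zeta>_def X0_def W by (rule K_intro[OF homogeneous_lin homogeneous_lin]) (use X0 X0_def in simp)
 have xrep: "inverse X0 * xi $ l = emb (q $ l) + \<zeta> * emb (vp $ l) + v * emb (r $ l)" for l
  unfolding rep[of l] x12 W_def[symmetric] v_def \<zeta>_def using X0 by (simp add: field_simps)

 define m e mQ where "m = P.mu" and "e = val VP (ev emb (lin y) P.eta)" and "mQ = Q.mu"
 have em: "m > 0" "e > m" "mQ > 0" using P.mu_pos Q.mu_pos P.tang_mu[OF uni(1) idx(2) Zj] y by (auto simp: m_def e_def mQ_def)
 note PY = P.eta_eq_0[OF homogeneous_lin, of y] and PZ = P.eta_eq_0[OF homogeneous_lin, of z]
  and QY = Q.eta_eq_0[OF homogeneous_lin, of y] and QZ = Q.eta_eq_0[OF homogeneous_lin, of z]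
 have eta0: "ev emb (lin y) P.eta ~= 0" "ev emb (lin z) P.eta ~= 0" "ev emb (lin y) Q.eta ~= 0" "ev emb (lin z) Q.eta ~= 0"
  "ev emb (f k) P.eta ~= 0" "ev emb (f k) Q.eta ~= 0"
  using PY PZ QY QZ ny nz P.f_eta[OF idx(3)] Q.f_eta[OF idx(3)] by auto
 have vals: "val VP (ev emb (lin z) P.eta) = m" "val VQ (ev emb (lin z) Q.eta) = mQ" "val VQ (ev emb (lin y) Q.eta) = 0"
  "val VP (ev emb (f k) P.eta) = 0"
  using f_i z Q.eta_val_0[OF yq] P.eta_val_0[OF fkp] by (auto simp: m_def mQ_def)
 \<comment> \<open>Up to normalization e and m are the orders of y and z at P, so e - m is the pole
   order of v. For the curves that finally occur, m/(e - m) = n - 1.\<close>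
 have "m / (e - m) \<in> \<rat>" using P.mu_rational val_rational[OF P.V P.eta_K eta0(1)] by (simp add: m_def e_def)
 then obtain A B :: nat where AB: "A > 0" "B > 0" "m / (e - m) = real B / real A" using positive_rational em by (metis diff_gt_0_iff_gt divide_pos_pos)
 have bal: "real B * (e - m) = real A * m" using AB em by (simp add: field_simps)

 have zeroZ: "t \<in> {pt vp, pt vq}" if "t \<in> C" "vanishes_at (lin z) t" for t using that Zi z by auto
 have zeroY: "t \<in> {pt vp, pt vq}" if "t \<in> C" "vanishes_at (lin y) t" for t using that Zj y by auto
 have zeroK: "t \<in> {pt vp, pt vq}" if "t \<in> C" "vanishes_at (f k) t" for t using that Zk by auto
 have vpow: "vanishes_at G t" if "homogeneous d G" "vanishes_at (G ^ c) t" for G d c t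
 proof -
  obtain u where u: "u ~= 0" "t = pt u" by (rule pt_cases)
  show ?thesis using that vanishes_at_pt[OF that(1) u(1)] vanishes_at_pt[OF homogeneous_power[OF that(1)] u(1), of c] u(2)
   by (auto simp: idc.ev_power)
 qed
 have hp: "homogeneous c (lin a ^ c)" for a c using homogeneous_power[OF homogeneous_lin[of a], of c] by simp
 have npow: "~ F dvd G ^ c * H ^ d" if "~ F dvd G" "~ F dvd H" for G H c d
  using that prime_F prime_elem_dvd_power prime_elem_dvd_mult_iff by metis

 define w where "w = val VQ (ev emb (f k) Q.eta)"
 have w: "real A * w = real (b k) * real (A + B) * mQ"
 proof -
  \<comment> \<open>With this exponent the two products have equal degree and, since (A + B)(e - m)
    = A e, equal order at P. Comparing them at Q gives w, a replacement for Bezout's theorem applied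
    to the curve and \<open>f k\<close>.\<close>
  define B1 where "B1 = b k * (A + B)"
  define G H where "G = lin y ^ B1 * f k ^ A" and "H = lin z ^ B1 * lin y ^ (b k * A)"
  have hG: "homogeneous (B1 + b k * A) G" and hH: "homogeneous (B1 + b k * A) H"
   unfolding G_def H_def by (intro homogeneous_mult hp homogeneous_power f idx)+
  have nG: "~ F dvd G" and nH: "~ F dvd H" unfolding G_def H_def by (intro npow ny nz nd idx)+
  have "t \<in> {pt vp, pt vq}" if t: "t \<in> C" "vanishes_at G t \<or> vanishes_at H t" for t
  proof -
   have "vanishes_at (lin y) t \<or> vanishes_at (f k) t \<or> vanishes_at (lin z) t"
    using t(2) unfolding G_def H_def vanishes_at_mult[OF hp homogeneous_power[OF f[OF idx(3)]]] vanishes_at_mult[OF hp hp]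
    using vpow homogeneous_lin f[OF idx(3)] by blast
   then show ?thesis using zeroY zeroZ zeroK t(1) by blast
  qed
  moreover have "(real A + real B) * (e - m) = real A * e" using bal by (simp add: algebra_simps)
  then have "real B1 * (e - m) = real (b k) * (real A * e)" by (simp add: B1_def mult.assoc)
  then have "val VP (ev emb G P.eta) = val VP (ev emb H P.eta)"
   unfolding G_def H_def P.val_power_mult[OF eta0(1,5)] P.val_power_mult[OF eta0(2,1)] vals e_def[symmetric] by (simp add: algebra_simps)
  ultimately have "val VQ (ev emb G Q.eta) = val VQ (ev emb H Q.eta)" using balance[OF hG nG hH nH] by blast
  then show ?thesis
   unfolding G_def H_def Q.val_power_mult[OF eta0(3,6)] Q.val_power_mult[OF eta0(4,3)] vals w_def[symmetric] by (simp add: B1_def)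
 qed

 \<comment> \<open>Thus A N0 is at most B and B is less than A N. The first inequality controls the
   form E at P, the second at Q.\<close>
 define N0 N where "N0 = B div A" and "N = Suc N0"
 have "A * (B div A) \<le> B" "B < A * Suc (B div A)" using AB(1) by (auto simp: dividend_less_times_div)
 then have "real (A * N0) \<le> real B" "real B < real (A * N)" unfolding N0_def N_def by (simp_all only: of_nat_le_iff of_nat_less_iff)
 then have N: "real A * real N0 \<le> real B" "real B < real A * real N" by simp_all
 have q': "q = (1 / ev id (lin y) vq) *s vq" "1 / ev id (lin y) vq ~= 0" using yq by (simp_all add: q_def)
 have fkq: "ev id (f k) q = 0" unfolding q'(1) idc.ev_scale[OF f[OF idx(3)]] zeros by simp
 have D0: "(\<Sum>l\<in>UNIV. grad (f k) q $ l * vp $ l) ~= 0"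
  unfolding q'(1) grad_scale[OF f[OF idx(3)] q'(2)] using S.tangent_nonzero q'(2) by simp
 obtain \<phi> where \<phi>: "coeff \<phi> 0 = 0" "degree \<phi> \<le> N"
  "[:0, 1:] ^ Suc N dvd ev (%c. [:c:]) (f k) (\<chi> l. [:q $ l:] + \<phi> * [:vp $ l:] + [:0, r $ l:])"
  using hensel[OF fkq D0] by blast
 obtain w2 where w2: "ev (%c. [:c:]) (f k) (\<chi> l. [:q $ l:] + \<phi> * [:vp $ l:] + [:0, r $ l:]) = [:0, 1:] ^ Suc N * w2"
  using \<phi>(3) by (rule dvdE)
 define u where "u = \<zeta> - evp \<phi> v"
 note Vr = place_valuation[OF Q.V] and Vs = place_subring[OF Q.V]
 have io: "range emb \<subseteq> VQ" using place_emb[OF Q.V] by blast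
 have vn: "v \<in> nonunits VQ" unfolding v_def X0_def Y_def
  using Q.ratio_nonunit[OF homogeneous_lin homogeneous_lin ny, of z mQ] Q.first_order[OF zp(2)] vals(3) em(3) by (simp add: mQ_def)
 have zn: "\<zeta> \<in> nonunits VQ" unfolding \<zeta>_def X0_def W
  using Q.ratio_nonunit[OF homogeneous_lin homogeneous_lin ny, of g mQ] Q.first_order[OF gq] vals(3) em(3) by (simp add: mQ_def)
 have vV: "v \<in> VQ" using vn nonunits_subset[OF Vr] by blast
 have phn: "evp \<phi> v \<in> nonunits VQ"
 proof -
  have "[:0, 1:] dvd \<phi>" using \<phi>(1) by (simp only: dvd_iff_coeff_0)
  then obtain \<psi> where "\<phi> = [:0, 1:] * \<psi>" by (rule dvdE)
  then have "evp \<phi> v = v * evp \<psi> v" by (simp add: evp_simps one)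
  then show ?thesis using nonunits_mult[OF Vr vn evp_subring[OF Vs io vV]] by simp
 qed
 have evpK: "evp p v \<in> K" for p by (rule evp_subring[OF K_subring _ vK]) (use K_emb in blast)
 have uK: "u \<in> K" unfolding u_def by (intro subring_diff[OF K_subring] zK evpK)
 \<comment> \<open>Compare the generic point of the curve with the point of the approximate branch
   that has the same v. They differ by u in the direction \<open>vp\<close>, where
   \<open>f k\<close> has nonzero derivative, so u has the order of the difference of the values of
   \<open>f k\<close>. These have order w and at least (N + 1) \<open>mQ\<close>.\<close>
 have uval: "val_ge VQ u (min w (real (Suc N) * mQ))"
 proof -
  let ?x = "\<chi> l. inverse X0 * xi $ l" and ?x' = "\<chi> l. emb (q $ l) + evp \<phi> v * emb (vp $ l) + v * emb (r $ l)"
  let ?D = "\<Sum>l\<in>UNIV. grad (f k) q $ l * vp $ l"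
  have iv: "emb c \<in> VQ" for c using io by blast
  have "\<exists>\<epsilon>\<in>nonunits VQ. ev emb (f k) ?x - ev emb (f k) ?x' = u * (emb ?D + \<epsilon>)"
  proof (rule difference_quotient[OF cpx_hom_axioms io])
   show "?x $ l - emb (q $ l) \<in> nonunits VQ" for l
    unfolding vec_lambda_beta xrep using nonunits_add[OF Vr nonunits_mult[OF Vr zn iv] nonunits_mult[OF Vr vn iv]] by simp
   show "?x' $ l - emb (q $ l) \<in> nonunits VQ" for l
    unfolding vec_lambda_beta using nonunits_add[OF Vr nonunits_mult[OF Vr phn iv] nonunits_mult[OF Vr vn iv]] by simp
   show "?x $ l - ?x' $ l = u * emb (vp $ l)" for l
    unfolding vec_lambda_beta xrep u_def by (simp add: algebra_simps)
  qed (use subring_add[OF Vs] nonunits_0[OF Vr] nonunits_subset[OF Vr] nonunits_add[OF Vr] nonunits_mult[OF Vr] in blast)+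
  then obtain \<epsilon> where eps: "\<epsilon> \<in> nonunits VQ" "ev emb (f k) ?x - ev emb (f k) ?x' = u * (emb ?D + \<epsilon>)" by blast
  have "emb ?D \<notin> nonunits VQ" using emb_nonunit[OF Q.V] D0 by blast
  then have un: "emb ?D + \<epsilon> \<in> VQ" "emb ?D + \<epsilon> \<notin> nonunits VQ" using unit_add_nonunit[OF Vr iv _ eps(1)] by blast+
  then have un': "emb ?D + \<epsilon> ~= 0" "inverse (emb ?D + \<epsilon>) \<in> VQ" using not_nonunit[OF Vr] by blast+
  have "?x = inverse X0 *s xi" by (simp add: vec_eq_iff)
  then have x1: "ev emb (f k) ?x = ev emb (f k) xi / ev emb (lin y ^ b k) xi"
   unfolding ev_power X0_def[symmetric] using ev_scale[OF f[OF idx(3)], of "inverse X0" xi] X0 by (simp add: field_simps)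
  have nyk: "~ F dvd lin y ^ b k" using npow[OF ny ny, of "b k" 0] by simp
  have x1K: "ev emb (f k) ?x \<in> K" unfolding x1 using K_intro[OF f[OF idx(3)] hp] nyk gen by blast
  have "val VQ (ev emb (lin y ^ b k) Q.eta) = 0" using Q.val_power_mult[OF eta0(3,3), of "b k" 0] vals(3) by simp
  then have "val VQ (ev emb (f k) ?x) = w" unfolding x1 w_def
   using Q.val_ratio[OF f[OF idx(3)] nd[OF idx(3)] hp nyk] by simp
  then have v1: "val_ge VQ (ev emb (f k) ?x) w" using x1K by (simp add: val_ge_def)
  have "ev (%c. evp [:c:] v) (f k) (\<chi> l. evp ((\<chi> l. [:q $ l:] + \<phi> * [:vp $ l:] + [:0, r $ l:]) $ l) v) = evp ([:0, 1:] ^ Suc N * w2) v"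
   unfolding w2[symmetric] by (rule ev_comp[OF cpx_hom_pconst evp_hom])
  moreover have "(\<chi> l. evp ((\<chi> l. [:q $ l:] + \<phi> * [:vp $ l:] + [:0, r $ l:]) $ l) v) = ?x'"
   unfolding vec_lambda_beta evp_simps(1,2) by (simp add: evp_simps vec_eq_iff)
  moreover have "(%c. evp [:c:] v) = emb" by (simp add: evp_simps)
  moreover have "evp ([:0, 1:] ^ Suc N * w2) v = v ^ Suc N * evp w2 v"
  proof -
   have pw: "evp ([:0, 1:] ^ c) v = v ^ c" for c by (induction c) (simp_all add: evp_simps one)
   show ?thesis unfolding evp_simps(2) pw ..
  qed
  ultimately have x2: "ev emb (f k) ?x' = v ^ Suc N * evp w2 v" by simp
  have "val VQ v = mQ" unfolding v_def X0_def Y_def using Q.val_ratio[OF homogeneous_lin nz homogeneous_lin ny] vals by simp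
  then have vm: "val_ge VQ v mQ" using vK by (simp add: val_ge_def)
  have vw: "val_ge VQ (evp w2 v) 0" using val_ge_V[OF Q.V] evpK evp_subring[OF Vs io vV] by blast
  have v2: "val_ge VQ (ev emb (f k) ?x') (real (Suc N) * mQ)"
   unfolding x2 using val_ge_mult[OF Q.V val_ge_power[OF Q.V vm, of "Suc N"] vw] by (simp only: add_0_right)
  have v12: "val_ge VQ (ev emb (f k) ?x - ev emb (f k) ?x') (min w (real (Suc N) * mQ))"
   by (intro val_ge_diff[OF Q.V] val_ge_mono[OF v1] val_ge_mono[OF v2]) auto
  show ?thesis
  proof (cases "u = 0")
   case False
   define d where "d = ev emb (f k) ?x - ev emb (f k) ?x'"
   have d: "d = u * (emb ?D + \<epsilon>)" "d \<in> K" using eps(2) v12 by (auto simp: d_def val_ge_def)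
   then have "emb ?D + \<epsilon> = d / u" using False by simp
   then have "inverse (emb ?D + \<epsilon>) \<in> K" using K_divide[OF d(2) uK] K_inverse by metis
   then have "val_ge VQ (inverse (emb ?D + \<epsilon>)) 0" using val_ge_V[OF Q.V] un'(2) by blast
   have "u * a * inverse a = u" if "a ~= 0" for a using that by simp
   from this[OF un'(1)] have "u * (emb ?D + \<epsilon>) * inverse (emb ?D + \<epsilon>) = u" .
   with val_ge_mult[OF Q.V v12 \<open>val_ge VQ (inverse (emb ?D + \<epsilon>)) 0\<close>] show ?thesis
    unfolding d_def[symmetric] d(1) by (simp only: add_0_right)
  qed (simp add: val_ge_0)
 qed

 \<comment> \<open>The difference of zeta and the approximating polynomial in v, cleared of its
   denominator: at \<open>xi\<close> it takes the value X0^N u.\<close>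
 define E where "E = lin g * lin y ^ N0 - (\<Sum>a\<le>N. cst (coeff \<phi> a) * (lin z ^ a * lin y ^ (N - a)))"
 have hz: "homogeneous N (lin z ^ a * lin y ^ (N - a))" if "a \<le> N" for a
 proof -
  have "homogeneous (a + (N - a)) (lin z ^ a * lin y ^ (N - a))" by (intro homogeneous_mult hp)
  then show ?thesis using that by simp
 qed
 have hE: "homogeneous N E" unfolding E_def
 proof (intro homogeneous_diff homogeneous_sum homogeneous_cst_mult hz)
  have "homogeneous (1 + N0) (lin g * lin y ^ N0)" by (intro homogeneous_mult hp homogeneous_lin)
  then show "homogeneous N (lin g * lin y ^ N0)" by (simp add: N_def)
 qed simp
 have "evp \<phi> v = (\<Sum>a\<le>degree \<phi>. emb (coeff \<phi> a) * v ^ a)" by (rule poly_map_poly_sum) simp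
 also have "\<dots> = (\<Sum>a\<le>N. emb (coeff \<phi> a) * v ^ a)"
  by (rule sum.mono_neutral_left) (use \<phi>(2) in \<open>auto simp: coeff_eq_0\<close>)
 finally have ph: "evp \<phi> v = (\<Sum>a\<le>N. emb (coeff \<phi> a) * v ^ a)" .
 have Ex: "ev emb E xi = X0 ^ N * u"
 proof -
  have "X0 ^ N * (emb (coeff \<phi> a) * v ^ a) = emb (coeff \<phi> a) * (Y ^ a * X0 ^ (N - a))" if "a \<le> N" for a
  proof -
   have "X0 ^ N = X0 ^ a * X0 ^ (N - a)" using that by (simp flip: power_add)
   then show ?thesis using X0 by (simp add: v_def power_divide)
  qed
  then have "X0 ^ N * evp \<phi> v = (\<Sum>a\<le>N. emb (coeff \<phi> a) * (Y ^ a * X0 ^ (N - a)))"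
   unfolding ph sum_distrib_left by (intro sum.cong) auto
  moreover have "X0 ^ N * \<zeta> = W * X0 ^ N0" using X0 by (simp add: \<zeta>_def N_def)
  ultimately show ?thesis
   unfolding E_def ev_diff ev_sum ev_mult ev_power ev_cst X0_def[symmetric] Y_def[symmetric] W[symmetric] u_def by (simp add: right_diff_distrib)
 qed

 have FE: "F dvd E"
 proof (rule ccontr)
  assume nE: "~ F dvd E"
  define eP eQ where "eP = val VP (ev emb E P.eta)" and "eQ = val VQ (ev emb E Q.eta)"
  have E0: "ev emb E P.eta ~= 0" "ev emb E Q.eta ~= 0" using nE P.eta_eq_0[OF hE] Q.eta_eq_0[OF hE] by auto
  have "val_ge VP (ev emb E P.eta) (min (real N0 * e) (real N * m))"
  proof -
   have vy: "val_ge VP (ev emb (lin y) P.eta) e" using P.eta_K by (simp add: val_ge_def e_def)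
   have vz: "val_ge VP (ev emb (lin z) P.eta) m" using P.eta_K vals by (simp add: val_ge_def)
   have 1: "val_ge VP (ev emb (lin g) P.eta * ev emb (lin y) P.eta ^ N0) (min (real N0 * e) (real N * m))"
    using val_ge_mult[OF P.V P.eta_val val_ge_power[OF P.V vy], of "lin g" N0] by (rule val_ge_mono) simp
   have 2: "val_ge VP (emb (coeff \<phi> a) * (ev emb (lin z) P.eta ^ a * ev emb (lin y) P.eta ^ (N - a))) (min (real N0 * e) (real N * m))" if "a \<le> N" for a
   proof -
    have "val_ge VP (ev emb (lin z) P.eta ^ a * ev emb (lin y) P.eta ^ (N - a)) (real a * m + real (N - a) * e)"
     by (rule val_ge_mult[OF P.V val_ge_power[OF P.V vz] val_ge_power[OF P.V vy]])
    moreover have "real N * m \<le> real a * m + real (N - a) * e"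
    proof -
     have "real (N - a) * m \<le> real (N - a) * e" using em by (intro mult_left_mono) auto
     then show ?thesis using that by (simp add: of_nat_diff algebra_simps)
    qed
    ultimately have "val_ge VP (ev emb (lin z) P.eta ^ a * ev emb (lin y) P.eta ^ (N - a)) (min (real N0 * e) (real N * m))"
     by (rule val_ge_mono[OF _ order_trans[OF min.cobounded2]])
    then show ?thesis by (rule P.val_ge_emb_mult)
   qed
   show ?thesis unfolding E_def ev_diff ev_sum ev_mult ev_power ev_cst
    by (intro val_ge_diff[OF P.V] val_ge_sum[OF P.V] 1 2) simp
  qed
  then have eP: "eP \<ge> min (real N0 * e) (real N * m)" using E0 by (simp add: val_ge_def eP_def)
  have nyN: "~ F dvd lin y ^ N" using npow[OF ny ny, of N 0] by simp
  have "u = ev emb E xi / ev emb (lin y ^ N) xi" unfolding Ex ev_power X0_def[symmetric] using X0 by simp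
  moreover have "val VQ (ev emb (lin y ^ N) Q.eta) = 0" using Q.val_power_mult[OF eta0(3,3), of N 0] vals(3) by simp
  ultimately have "val VQ u = eQ" using Q.val_ratio[OF hE nE hp nyN] by (simp add: eQ_def)
  moreover have "u ~= 0"
  proof
   assume "u = 0"
   then have "ev emb E xi = 0" using Ex by simp
   then show False using gen nE by blast
  qed
  ultimately have eQ: "eQ \<ge> min w (real (Suc N) * mQ)" using uval by (simp add: val_ge_def)
  \<comment> \<open>Both products have degree N A + B. The estimates below make G/H regular at P and
    vanishing at Q, so that F would divide G and hence E or y.\<close>
  define G H where "G = E ^ A * lin y ^ B" and "H = lin z ^ (A + B) * lin y ^ (N0 * A)"
  have "homogeneous (N * A + B) G" unfolding G_def by (intro homogeneous_mult homogeneous_power hE hp)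
  moreover have "homogeneous (A + B + N0 * A) H" unfolding H_def by (intro homogeneous_mult hp)
  moreover have "N * A + B = A + B + N0 * A" by (simp add: N_def)
  ultimately have hG: "homogeneous (A + B + N0 * A) G" and hH: "homogeneous (A + B + N0 * A) H" by simp_all
  have nG: "~ F dvd G" and nH: "~ F dvd H" unfolding G_def H_def by (intro npow nE ny nz)+
  have valG: "val VP (ev emb G P.eta) = real A * eP + real B * e" "val VQ (ev emb G Q.eta) = real A * eQ"
   unfolding G_def P.val_power_mult[OF E0(1) eta0(1)] Q.val_power_mult[OF E0(2) eta0(3)] vals by (simp_all add: eP_def eQ_def e_def)
  have valH: "val VP (ev emb H P.eta) = real (A + B) * m + real (N0 * A) * e" "val VQ (ev emb H Q.eta) = real (A + B) * mQ"
   unfolding H_def P.val_power_mult[OF eta0(2,1)] Q.val_power_mult[OF eta0(4,3)] vals by (simp_all add: e_def)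
  have leP: "val VP (ev emb H P.eta) \<le> val VP (ev emb G P.eta)"
  proof -
   have "real A * min (real N0 * e) (real N * m) \<le> real A * eP" using eP by (intro mult_left_mono) auto
   moreover have "real (A + B) * m + real (N0 * A) * e \<le> real A * (real N0 * e) + real B * e"
    using bal by (simp add: algebra_simps)
   moreover have "real (A + B) * m + real (N0 * A) * e \<le> real A * (real N * m) + real B * e"
   proof -
    have "0 \<le> (real B - real A * real N0) * (e - m)" using N em by (intro mult_nonneg_nonneg) auto
    then show ?thesis by (simp add: N_def algebra_simps)
   qed
   moreover have "real A * min (real N0 * e) (real N * m) = real A * (real N0 * e) \<or> real A * min (real N0 * e) (real N * m) = real A * (real N * m)"
    by (simp add: min_def)
   ultimately show ?thesis unfolding valG valH by linarith
  qed
  have ltQ: "val VQ (ev emb H Q.eta) < val VQ (ev emb G Q.eta)"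
  proof -
   have "real A * min w (real (Suc N) * mQ) \<le> real A * eQ" using eQ by (intro mult_left_mono) auto
   \<comment> \<open>As A w = \<open>b k\<close> (A + B) \<open>mQ\<close>, this is the point where
     \<open>b k\<close> must be at least 2.\<close>
   moreover have "real (A + B) * mQ < real A * w"
   proof -
    have "1 * (real (A + B) * mQ) < real (b k) * (real (A + B) * mQ)" using bk AB(1) em by (intro mult_strict_right_mono) auto
    then show ?thesis unfolding w by (simp add: mult.assoc)
   qed
   moreover have "real (A + B) * mQ < real A * (real (Suc N) * mQ)"
   proof -
    have "real (A + B) < real A * real (Suc N)" using N(2) by (simp add: algebra_simps)
    then have "real (A + B) * mQ < real A * real (Suc N) * mQ" using em by (intro mult_strict_right_mono) auto
    then show ?thesis by (simp only: mult.assoc)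
   qed
   ultimately show ?thesis unfolding valG valH by (auto simp: min_def split: if_splits)
  qed
  have gP: "val_ge VP (ev emb G P.eta) (val VP (ev emb G P.eta))" and gQ: "val_ge VQ (ev emb G Q.eta) (val VQ (ev emb G Q.eta))"
   using P.eta_K Q.eta_K by (simp_all add: val_ge_def)
  have reg: "unibranch t & (\<exists>V. place V & Ol t \<subseteq> V & ev emb G xi / ev emb H xi \<in> V)" if t: "t \<in> C" "vanishes_at H t" for t
  proof -
   have "vanishes_at (lin z) t \<or> vanishes_at (lin y) t"
    using t(2) unfolding H_def vanishes_at_mult[OF hp hp] using vpow homogeneous_lin by blast
   then have "t \<in> {pt vp, pt vq}" using zeroZ zeroY t(1) by blast
   then show ?thesis using regular[OF hG hH nH _ gP leP gQ] ltQ by simp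
  qed
  obtain c where c: "ev emb G xi / ev emb H xi = emb c" "F dvd G - cst c * H" using constant_ratio[OF hG hH nH reg] by blast
  have "emb c \<in> nonunits VQ" using Q.ratio_nonunit[OF hG hH nH gQ ltQ] c(1) by simp
  then have "c = 0" using emb_nonunit[OF Q.V] by blast
  then show False using c(2) nG by simp
 qed

 have "u = 0" using FE Ex X0 gen[of E] by simp
 then have zeta: "\<zeta> = evp \<phi> v" by (simp add: u_def)
 show "rational_curve C"
 proof (rule rational_parametrization[OF vK])
  show "inverse X0 ~= 0" using X0 by simp
  note R = subring_mult[OF ratfield_subring] subring_add[OF ratfield_subring] ratfield_emb ratfield_gen ratfield_evp
  show "inverse X0 * xi $ l \<in> ratfield emb v" for l unfolding xrep zeta by (intro R)
 qed

 \<comment> \<open>E is not the zero form. At q + \<open>vp\<close> the forms g and y are 1 and z is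
   0, and the term a = 0 of the sum drops out because the Taylor polynomial has no constant
   term.\<close>
 have Ev: "ev id E (q + 1 *s vp) = 1"
 proof -
  have l: "ev id (lin a) (q + 1 *s vp) = ev id (lin a) q + ev id (lin a) vp" for a
   using ev_lin_comb[of a 1 q 1 vp] by simp
  have "(\<Sum>a\<le>N. coeff \<phi> a * (0 ^ a * 1 ^ (N - a))) = 0"
   by (rule sum.neutral) (use \<phi>(1) in \<open>auto simp: power_0_left\<close>)
  then show ?thesis
   unfolding E_def idc.ev_diff idc.ev_sum idc.ev_mult idc.ev_power idc.ev_cst l q zp g by simp
 qed
 then have E0: "E ~= 0" by auto
 \<comment> \<open>The forms y and z vanish at \<open>vp\<close>, so only g varies in this
   direction, and it occurs to the first power.\<close>
 have aE: "affine_along E vp"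
  unfolding affine_along_def
 proof
  fix t
  have cp: "degree ([:c :: complex:] ^ d) = 0" for c d
  proof -
   have "[:c:] ^ d = [:c ^ d:]" by (induction d) (auto simp: one_pCons)
   then show ?thesis by simp
  qed
  have l: "lpoly (lin g) t vp = [:ev id (lin g) t, 1:]" "lpoly (lin y) t vp = [:ev id (lin y) t:]" "lpoly (lin z) t vp = [:ev id (lin z) t:]"
   unfolding lpoly_lin g zp by simp_all
  have "lpoly E t vp = [:ev id (lin g) t, 1:] * [:ev id (lin y) t:] ^ N0
   - (\<Sum>a\<le>N. [:coeff \<phi> a:] * ([:ev id (lin z) t:] ^ a * [:ev id (lin y) t:] ^ (N - a)))"
   unfolding l[symmetric] unfolding E_def lpoly_def pc.ev_diff pc.ev_sum pc.ev_mult pc.ev_power pc.ev_cst ..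
  moreover have "degree ([:ev id (lin g) t, 1:] * [:ev id (lin y) t:] ^ N0) \<le> 1"
   using degree_mult_le[of "[:ev id (lin g) t, 1:]" "[:ev id (lin y) t:] ^ N0"] cp by simp
  moreover have "degree (\<Sum>a\<le>N. [:coeff \<phi> a:] * ([:ev id (lin z) t:] ^ a * [:ev id (lin y) t:] ^ (N - a))) \<le> 1"
  proof (rule degree_sum_le)
   fix a
   have "degree ([:ev id (lin z) t:] ^ a * [:ev id (lin y) t:] ^ (N - a)) = 0"
    using degree_mult_le[of "[:ev id (lin z) t:] ^ a" "[:ev id (lin y) t:] ^ (N - a)"] cp by simp
   then show "degree ([:coeff \<phi> a:] * ([:ev id (lin z) t:] ^ a * [:ev id (lin y) t:] ^ (N - a))) \<le> 1"
    using degree_mult_le[of "[:coeff \<phi> a:]" "[:ev id (lin z) t:] ^ a * [:ev id (lin y) t:] ^ (N - a)"] by simp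
  qed simp
  ultimately show "degree (lpoly E t vp) \<le> 1" by (simp add: degree_diff_le)
 qed
 \<comment> \<open>F divides E, and degrees in the third frame coordinate add up in
   products.\<close>
 show aff: "affine_along F vp"
 proof -
  obtain H where H: "E = F * H" using FE by (rule dvdE)
  have MM: "M ** M' = mat 1" using M'(1) by (simp add: M_def)
  have "frame M' (frame M E) = E" unfolding frame_frame MM by (rule frame_mat_1)
  then have "frame M E ~= 0" using E0 frame_0 by metis
  then have "degree (frame M F) \<le> degree (frame M E)" unfolding H frame_mult by (simp add: degree_mult_eq)
  then show ?thesis using aE affine_frame[OF MM col] by (meson order_trans)
 qed
 show "mult_at (pt vp) C = n - 1"
 proof (rule mult_at_affine(2)[OF irr hom n2 C_def P.v_nz P.center_C aff])
  \<comment> \<open>A third point of the line PQ. The curve meets this line only in P and Q, so F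
    vanishes at \<open>vq\<close> but not here, and is not constant along \<open>vp\<close>.\<close>
  define s where "s = vq + 1 *s vp"
  have ys: "ev id (lin y) s = ev id (lin y) vq" "ev id (lin z) s = 0"
   using ev_lin_comb[of y 1 vq 1 vp] ev_lin_comb[of z 1 vq 1 vp] zp by (simp_all add: s_def)
  then have s0: "s ~= 0" using yq by (auto simp: idc.ev_lin)
  have "ev id F s ~= 0"
  proof
   assume "ev id F s = 0"
   then have "pt s \<in> C \<inter> Z i" using vanishes_at_pt[OF hom s0] vanishes_at_pt[OF homogeneous_lin s0, of z] ys(2) z by (simp add: C_def)
   then have "pt vp = pt s \<or> pt vq = pt s" using Zi by auto
   then show False
   proof
    assume "pt vp = pt s"
    then obtain c where "s = c *s vp" using pt_eq_iff[OF P.v_nz s0] by blast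
    then show False using ys(1) lsc[of y c vp] zp yq by simp
   next
    assume "pt vq = pt s"
    then obtain c where c: "s = c *s vq" using pt_eq_iff[OF Q.v_nz s0] by blast
    then have "c = 1" using ys(1) lsc[of y c vq] yq by simp
    then have "vp = 0" using c by (simp add: s_def)
    then show False using P.v_nz by blast
   qed
  qed
  moreover have "ev id F vq = 0" using Q.center_C vanishes_at_pt[OF hom Q.v_nz] by (simp add: C_def)
  ultimately show "ev id F (vq + 1 *s vp) ~= ev id F vq" by (simp add: s_def)
 qed
qed

end

section \<open>Proof of the theorem\<close>

lemma integral_curve_equation:
 assumes "integral_curve C"
 obtains F where "irred F" "homogeneous (curve_degree C) F" "C = {q. vanishes_at F q}"
proof -
 obtain F n where F: "homogeneous n F" "irred F" "C = {q. vanishes_at F q}"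
  using assms unfolding integral_curve_def by blast
 then have "curve_degree C = n" using curve_degree_eq[OF reduced_equation_irreducible] by blast
 then show ?thesis using that F by blast
qed

lemma permutation_distinct: "{i, j, k} = {1, 2, 3 :: nat} ==> i ~= j & j ~= k & i ~= k"
proof -
 assume "{i, j, k} = {1, 2, 3 :: nat}"
 then have "card {i, j, k} = 3" by simp
 then show ?thesis by (auto simp: card_insert_if split: if_splits)
qed

lemma Hyp2_two_points:
 assumes "integral_curve C" "C \<inter> D = {p, q}" "card (normalization_preimage C {p}) = 1" "card (normalization_preimage C {q}) = 1"
 shows "C \<in> Hyp2 D"
proof -
 obtain F where F: "irred F" "homogeneous (curve_degree C) F" "C = {q. vanishes_at F q}"
  using integral_curve_equation[OF assms(1)] by blast
 obtain xi where "generic_point tower_emb xi F (curve_degree C)" using generic_point_exists[OF F(1,2)] by blast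
 then interpret g: generic_point tower_emb xi F "curve_degree C" .
 have gC: "g.C = C" using F(3) g.C_def by simp
 have pq: "p \<in> g.C" "q \<in> g.C" using assms(2) gC by auto
 have "g.unibranch p" "g.unibranch q" using g.unibranch_iff pq assms(3,4) gC by auto
 then show ?thesis unfolding Hyp2_def using g.two_unibranch_points[OF pq] assms(1,2) gC by simp
qed

locale three_curves =
 fixes B :: "nat => proj_plane set" and f :: "nat => cpoly3" and b :: "nat => nat"
 assumes irr: "!!l. l \<in> {1, 2, 3} ==> irred (f l)" and hom: "!!l. l \<in> {1, 2, 3} ==> homogeneous (b l) (f l)"
  and B: "!!l. l \<in> {1, 2, 3} ==> B l = {q. vanishes_at (f l) q}"
  and distinct: "!!i j. i \<in> {1, 2, 3} ==> j \<in> {1, 2, 3} ==> i ~= j ==> B i ~= B j"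
  and nodes: "!!i j q. i \<in> {1, 2, 3} ==> j \<in> {1, 2, 3} ==> i ~= j ==> q \<in> B i \<inter> B j ==> is_node (B 1 \<union> B 2 \<union> B 3) q"
  and sorted: "b 1 \<le> b 2" "b 2 \<le> b 3"
begin

abbreviation "D \<equiv> B 1 \<union> B 2 \<union> B 3"

lemma b_pos: "l \<in> {1, 2, 3} ==> b l > 0"
 using irreducible_degree_pos irr hom by blast

lemma equation:
 assumes p: "{i, j, k} = {1, 2, 3}"
 shows "reduced_equation (f i * (f j * f k)) D" "homogeneous (b i + (b j + b k)) (f i * (f j * f k))"
proof -
 have ijk: "i \<in> {1, 2, 3}" "j \<in> {1, 2, 3}" "k \<in> {1, 2, 3}" using p by auto
 have d: "i ~= j" "j ~= k" "i ~= k" using permutation_distinct[OF p] by auto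
 have ne: "{q. vanishes_at (f i) q} ~= {q. vanishes_at (f j) q}" "{q. vanishes_at (f i) q} ~= {q. vanishes_at (f k) q}"
   "{q. vanishes_at (f j) q} ~= {q. vanishes_at (f k) q}"
  using distinct[OF ijk(1,2) d(1)] distinct[OF ijk(1,3) d(3)] distinct[OF ijk(2,3) d(2)] B ijk by auto
 note u = union_reduced_equation[of f i b j k, OF irr[OF ijk(1)] hom[OF ijk(1)] irr[OF ijk(2)] hom[OF ijk(2)] irr[OF ijk(3)] hom[OF ijk(3)] ne]
 have "B i \<union> B j \<union> B k = (\<Union>l\<in>{i, j, k}. B l)" by auto
 also have "\<dots> = D" unfolding p by auto
 finally show "reduced_equation (f i * (f j * f k)) D" using u(1) B[OF ijk(1)] B[OF ijk(2)] B[OF ijk(3)] by simp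
 show "homogeneous (b i + (b j + b k)) (f i * (f j * f k))" by (rule u(2))
qed

lemma degree_D: "curve_degree D = b 1 + b 2 + b 3"
 using curve_degree_eq[OF equation[of 1 2 3]] by simp

lemma transversal_node:
 assumes p: "{i, j, k} = {1, 2, 3}" and q: "vanishes_at (f i) q" "vanishes_at (f j) q"
 shows "~ vanishes_at (f k) q & (\<exists>v. v ~= 0 & pt v = q & transv (f i) (f j) v)"
proof -
 have ijk: "i \<in> {1, 2, 3}" "j \<in> {1, 2, 3}" "k \<in> {1, 2, 3}" using p by auto
 have "i ~= j" using permutation_distinct[OF p] by auto
 moreover have "q \<in> B i \<inter> B j" using q B ijk by auto
 ultimately have node: "is_node D q" using nodes ijk by blast
 obtain v where v: "v ~= 0" "pt v = q" "ev id (f k) v ~= 0"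
  "!!u. (\<Sum>l\<in>UNIV. grad (f i) v $ l * u $ l) = 0 ==> (\<Sum>l\<in>UNIV. grad (f j) v $ l * u $ l) = 0 ==> \<exists>c. u = c *s v"
  using node_transversal[OF equation(1)[OF p] hom[OF ijk(1)] hom[OF ijk(2)] hom[OF ijk(3)] node q] by blast
 have "transv (f i) (f j) v" unfolding transv_def using v(4) by blast
 moreover have "~ vanishes_at (f k) q" using vanishes_at_pt[OF hom[OF ijk(3)] v(1)] v(2,3) by blast
 ultimately show ?thesis using v(1,2) by blast
qed

lemma triI:
 assumes g: "generic_point emb xi F n" and C: "{q. vanishes_at F q} \<in> Hyp2 D" and n: "n \<ge> 2"
 shows "tri emb xi F n f b"
proof -
 interpret g: generic_point emb xi F n by (rule g)
 have CD: "g.C \<inter> D = g.C \<inter> {q. \<exists>l\<in>{1, 2, 3}. vanishes_at (f l) q}" using B by auto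
 have "g.C \<in> Hyp2 D" using C unfolding g.C_def .
 then have fin: "finite (normalization_preimage g.C (g.C \<inter> D))" "card (normalization_preimage g.C (g.C \<inter> D)) \<le> 2" by (auto simp: Hyp2_def)
 \<comment> \<open>A component of B would have all its infinitely many points over B, against at
   most two places.\<close>
 have nd: "~ F dvd f l" if l: "l \<in> {1, 2, 3}" for l
 proof
  assume "F dvd f l"
  then have "g.C = B l" using irreducible_dvd_zero_sets[OF g.irr g.hom irr[OF l] hom[OF l]] B[OF l] by (simp add: g.C_def)
  then have S: "g.C \<inter> D = g.C" using l by auto
  obtain p where p: "p \<in> g.C" using g.infinite_C by (metis finite.emptyI ex_in_conv)
  obtain q where q: "q \<in> g.C" "q ~= p" using exists_two_points[OF g.infinite_C] by blast
  have "g.C = {p, q}" using g.two_points[of g.C p q] fin p q unfolding S by blast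
  then show False using g.infinite_C by simp
 qed
 show ?thesis
 proof unfold_locales
  show "n \<ge> 2" by (rule n)
  show "homogeneous (b l) (f l)" if "l \<in> {1, 2, 3}" for l by (rule hom[OF that])
  show "b l > 0" if "l \<in> {1, 2, 3}" for l by (rule b_pos[OF that])
  show "~ F dvd f l" if "l \<in> {1, 2, 3}" for l by (rule nd[OF that])
  show "~ vanishes_at (f k) q & (\<exists>v. v ~= 0 & pt v = q & transv (f i) (f j) v)"
   if "{i, j, k} = {1, 2, 3}" "vanishes_at (f i) q" "vanishes_at (f j) q" for i j k q by (rule transversal_node[OF that])
 qed (rule fin[unfolded CD])+
qed

text \<open>Matching the configuration with the sorted degrees. The component through both places is
  a line, so b 1 = 1. For b 2 at least 2 it must be B 1, and \<open>conic\<close> applies to the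
  other two. For b 2 = 1 it is B 1 or B 2, and after exchanging the ends B 3 is the component met
  only at Q.\<close>

lemma forward:
 assumes C: "C \<in> Hyp2 D" "curve_degree C \<ge> 2" and b3: "b 3 \<ge> 2"
 shows "rational_curve C & b 1 = 1 &
  (b 2 = 1 \<longrightarrow> (\<exists>p i j q. {i, j} = {1, 2} & p \<in> B 1 \<inter> B 2 & q \<in> B j \<inter> B 3 &
    C \<in> Hyp_pt_deg_mult (curve_degree C) (curve_degree C - 1) (B i) p \<inter> Hyp_pt_deg (curve_degree C) (B 3) q)) &
  (b 2 \<ge> 2 \<longrightarrow> curve_degree C = 2 & (\<exists>p\<in>B 1 \<inter> B 2. \<exists>q\<in>B 1 \<inter> B 3. C \<in> Hyp_pt_deg 2 (B 2) p \<inter> Hyp_pt_deg 2 (B 3) q))"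
proof -
 define n where "n = curve_degree C"
 have int: "integral_curve C" using C(1) by (simp add: Hyp2_def)
 obtain F where F: "irred F" "homogeneous n F" "C = {q. vanishes_at F q}"
  using integral_curve_equation[OF int] unfolding n_def by blast
 obtain xi where g: "generic_point tower_emb xi F n" using generic_point_exists[OF F(1,2)] by blast
 interpret T: tri tower_emb xi F n f b by (rule triI[OF g]) (use C F(3) in \<open>auto simp: n_def\<close>)
 have TC: "T.C = C" using F(3) T.C_def by simp
 have TB: "T.Z l = B l" if "l \<in> {1, 2, 3}" for l using B that by simp
 obtain i j k p q where perm: "{i, j, k} = {1, 2, 3}" and pq: "p \<in> T.C" "q \<in> T.C" "p ~= q" "T.unibranch p" "T.unibranch q"
  and Z: "T.C \<inter> T.Z i = {p, q}" "T.C \<inter> T.Z j = {p}" "T.C \<inter> T.Z k = {q}" using T.configuration by blast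
 obtain VP vp jp where P: "branch tower_emb xi F n VP vp jp" "pt vp = p" using T.branch_exists[OF pq(1)] by blast
 obtain VQ vq jq where Q: "branch tower_emb xi F n VQ vq jq" "pt vq = q" using T.branch_exists[OF pq(2)] by blast
 interpret P: branch tower_emb xi F n VP vp jp by (rule P(1))
 interpret Q: branch tower_emb xi F n VQ vq jq by (rule Q(1))
 interpret P: tri_branch tower_emb xi F n f b VP vp jp ..
 interpret Q: tri_branch tower_emb xi F n f b VQ vq jq ..
 have cfg: "config tower_emb xi F n f b VP vp jp VQ vq jq i j k"
  by unfold_locales (use perm pq Z P(2) Q(2) in auto)
 then interpret c: config tower_emb xi F n f b VP vp jp VQ vq jq i j k .
 have hyp: "C \<in> Hyp_pt_deg n (B l) r" if "l \<in> {1, 2, 3}" "r \<in> T.C" "T.unibranch r" "T.C \<inter> T.Z l = {r}" for l r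
  using that TB int T.unibranch_iff unfolding Hyp_pt_deg_def Hyp_pt_def n_def TC by auto
 have bl: "b 1 \<le> b l" if "l \<in> {1, 2, 3}" for l using that sorted by auto
 have b1: "b 1 = 1" using c.degree_i bl[OF c.idx(1)] b_pos[of 1] by simp
 show ?thesis
 proof (cases "b 2 \<ge> 2")
  case True
  then have i: "i = 1" using c.idx(1) c.degree_i b3 by auto
  then have jk: "j = 2 & k = 3 \<or> j = 3 & k = 2" using c.idx(2,3) permutation_distinct[OF perm] by auto
  then have "b j \<ge> 2" "b k \<ge> 2" using True b3 by auto
  then have n: "n = 2" "rational_curve C" using c.conic TC by auto
  have "\<exists>p\<in>B 1 \<inter> B 2. \<exists>q\<in>B 1 \<inter> B 3. C \<in> Hyp_pt_deg 2 (B 2) p \<inter> Hyp_pt_deg 2 (B 3) q"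
  proof -
   have on: "p \<in> B i" "q \<in> B i" "p \<in> B j" "q \<in> B k" using Z TB c.idx by auto
   have h: "C \<in> Hyp_pt_deg 2 (B j) p" "C \<in> Hyp_pt_deg 2 (B k) q" using hyp c.idx pq Z n(1) by auto
   from jk show ?thesis
   proof
    assume "j = 2 & k = 3"
    then show ?thesis using on h i by (intro bexI[of _ p] bexI[of _ q]) simp_all
   next
    assume "j = 3 & k = 2"
    then show ?thesis using on h i by (intro bexI[of _ q] bexI[of _ p]) simp_all
   qed
  qed
  then show ?thesis using n b1 True by (simp add: n_def)
 next
  case False
  then have b2: "b 2 = 1" using b_pos[of 2] by simp
  have main: "rational_curve C & (\<exists>p i j q. {i, j} = {1, 2} & p \<in> B 1 \<inter> B 2 & q \<in> B j \<inter> B 3 &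
    C \<in> Hyp_pt_deg_mult n (n - 1) (B i) p \<inter> Hyp_pt_deg n (B 3) q)"
   if cfg: "config tower_emb xi F n f b VP vp jp VQ vq jq i j 3" for VP vp jp VQ vq jq i j
  proof -
   interpret c: config tower_emb xi F n f b VP vp jp VQ vq jq i j 3 by (rule cfg)
   have ij: "{i, j} = {1, 2}" using c.perm permutation_distinct[OF c.perm] by auto
   then have "b j = 1" using b1 b2 by (auto simp: doubleton_eq_iff)
   then have h: "rational_curve C" "mult_at (pt vp) C = n - 1" using c.hyperline b3 TC by auto
   have "pt vp \<in> B i" "pt vp \<in> B j" "pt vq \<in> B i" "pt vq \<in> B 3" using c.on TB c.idx by auto
   then have on: "pt vp \<in> B 1 \<inter> B 2" "pt vq \<in> B i \<inter> B 3" using ij by (auto simp: doubleton_eq_iff)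
   have "C \<in> Hyp_pt_deg n (B j) (pt vp)" "C \<in> Hyp_pt_deg n (B 3) (pt vq)"
    using hyp[OF c.idx(2) _ c.uni(1) c.Zj] hyp[OF _ _ c.uni(2) c.Zk] c.Zj c.Zk by auto
   then have m: "C \<in> Hyp_pt_deg_mult n (n - 1) (B j) (pt vp) \<inter> Hyp_pt_deg n (B 3) (pt vq)" using h(2) by (simp add: Hyp_pt_deg_mult_def)
   \<comment> \<open>In the conclusion the first index is the line that meets C only at P, here j,
     and the second index is the line PQ, here i.\<close>
   have ji: "{j, i} = {1, 2}" using ij by (simp add: insert_commute)
   from ji on m h(1) show ?thesis by blast
  qed
  have "i ~= 3" using c.degree_i b3 by auto
  then have "j = 3 \<or> k = 3" using perm by auto
  then have "rational_curve C & (\<exists>p i j q. {i, j} = {1, 2} & p \<in> B 1 \<inter> B 2 & q \<in> B j \<inter> B 3 &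
    C \<in> Hyp_pt_deg_mult n (n - 1) (B i) p \<inter> Hyp_pt_deg n (B 3) q)"
  proof
   assume "j = 3"
   then have "config tower_emb xi F n f b VQ vq jq VP vp jp i k 3" using c.swap by simp
   then show ?thesis by (rule main)
  next
   assume "k = 3"
   then have "config tower_emb xi F n f b VP vp jp VQ vq jq i j 3" using cfg by simp
   then show ?thesis by (rule main)
  qed
  then show ?thesis using b1 b2 unfolding n_def by simp
 qed
qed

text \<open>Affinity of C along p leaves room for only one further intersection with the line B j
  through p and q, so C meets B in p and q alone, with one place over each. Both converse inclusions
  of the theorem are instances.\<close>

lemma backward:
 assumes ij: "{i, j} = {1, 2}" and bj: "b j = 1" and p: "p \<in> B 1 \<inter> B 2" and q: "q \<in> B j \<inter> B 3" and d: "d \<ge> 2"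
  and C: "C \<in> Hyp_pt_deg d (B i) p" "C \<in> Hyp_pt_deg d (B 3) q"
  and aff: "!!F v. irred F ==> homogeneous d F ==> C = {q. vanishes_at F q} ==> v ~= 0 ==> pt v = p ==> affine_along F v"
 shows "C \<in> Hyp2_deg d D"
proof -
 have idx: "i \<in> {1, 2, 3}" "j \<in> {1, 2, 3}" "{i, j, 3} = {1, 2, 3}" using ij by (auto simp: doubleton_eq_iff)
 have CD: "integral_curve C" "curve_degree C = d" "C \<inter> B i = {p}" "C \<inter> B 3 = {q}"
  "card (normalization_preimage C {p}) = 1" "card (normalization_preimage C {q}) = 1"
  using C by (auto simp: Hyp_pt_deg_def Hyp_pt_def)
 obtain F where F: "irred F" "homogeneous d F" "C = {q. vanishes_at F q}"
  using integral_curve_equation[OF CD(1)] unfolding CD(2) by blast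
 have pij: "p \<in> B i" "p \<in> B j" using p ij by (auto simp: doubleton_eq_iff)
 have "p ~= q" using transversal_node[OF idx(3), of p] pij q B idx by auto
 obtain v where v: "v ~= 0" "p = pt v" by (rule pt_cases)
 obtain w where w: "w ~= 0" "q = pt w" by (rule pt_cases)
 obtain a where a: "f j = lin a" using homogeneous_1_lin hom[OF idx(2)] bj by metis
 have on: "ev id (lin a) v = 0" "ev id (lin a) w = 0"
  using pij(2) q vanishes_at_pt[OF homogeneous_lin v(1), of a] vanishes_at_pt[OF homogeneous_lin w(1), of a] B[OF idx(2)] a v w by auto
 have "p \<in> C" "q \<in> C" using CD by auto
 then have onF: "ev id F v = 0" "ev id F w = 0"
  using vanishes_at_pt[OF F(2) v(1)] vanishes_at_pt[OF F(2) w(1)] F(3) v w by auto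
 obtain c0 c1 where "!!s. ev id F (w + s *s v) = c0 + c1 * s" using affine_eval[OF aff[OF F v(1) v(2)[symmetric]]] by blast
 then have "{q. vanishes_at F q} \<inter> {q. vanishes_at (lin a) q} = {pt v, pt w}"
  using two_point_line[OF F(1,2) d irr[OF idx(2), unfolded a] v(1) w(1) _ on onF] \<open>p ~= q\<close> v w by blast
 then have Cj: "C \<inter> B j = {p, q}" using F(3) B[OF idx(2)] a v w by simp
 have "D = B i \<union> B j \<union> B 3" using ij by (auto simp: doubleton_eq_iff)
 then have "C \<inter> D = {p, q}" using CD Cj by blast
 then have "C \<in> Hyp2 D" using Hyp2_two_points CD by blast
 then show ?thesis using CD(2) by (simp add: Hyp2_deg_def)
qed

text \<open>The gradients of two linear equations are constant, so a second common point would be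
  killed by both and hence be a multiple of the first.\<close>

lemma lines_meet_once:
 assumes b: "b 1 = 1" "b 2 = 1" and p: "p \<in> B 1 \<inter> B 2" shows "B 1 \<inter> B 2 = {p}"
proof -
 obtain a1 where a1: "f 1 = lin a1" using homogeneous_1_lin hom[of 1] b by auto
 obtain a2 where a2: "f 2 = lin a2" using homogeneous_1_lin hom[of 2] b by auto
 obtain v where v: "v ~= 0" "pt v = p" "transv (f 1) (f 2) v" using transversal_node[of 1 2 3 p] p B by auto
 have "r = p" if r: "r \<in> B 1 \<inter> B 2" for r
 proof -
  obtain u where u: "u ~= 0" "r = pt u" by (rule pt_cases)
  have "ev id (lin a1) u = 0" "ev id (lin a2) u = 0"
   using r B[of 1] B[of 2] a1 a2 u vanishes_at_pt[OF homogeneous_lin u(1)] by auto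
  then obtain c where c: "u = c *s v" using v(3) unfolding transv_def a1 a2 grad_lin ev_lin_id by blast
  then have "c ~= 0" using u by auto
  then show ?thesis using pt_eq_iff[OF v(1) u(1)] c u v by metis
 qed
 then show ?thesis using p by blast
qed

lemma all_rational:
 assumes C: "C \<in> Hyp2 D" and b3: "b 3 \<ge> 2"
 shows "rational_curve C"
proof -
 have int: "integral_curve C" using C by (simp add: Hyp2_def)
 obtain F where F: "irred F" "homogeneous (curve_degree C) F" "C = {q. vanishes_at F q}"
  using integral_curve_equation[OF int] by blast
 show ?thesis
 proof (cases "curve_degree C \<ge> 2")
  case True then show ?thesis using forward[OF C _ b3] by blast
 next
  case False
  then have n: "curve_degree C = 1" using irreducible_degree_pos[OF F(1,2)] by simp
  obtain xi where "generic_point tower_emb xi F (curve_degree C)" using generic_point_exists[OF F(1,2)] by blast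
  then interpret g: generic_point tower_emb xi F "curve_degree C" .
  show ?thesis using g.line_rational[OF n] F(3) g.C_def by simp
 qed
qed

end

lemma three_curves_exist:
 assumes "three_C_curve B"
 obtains f where "three_curves B f (%l. curve_degree (B l))"
proof -
 note tc = assms[unfolded three_C_curve_def]
 have int: "\<forall>l\<in>{1, 2, 3}. integral_curve (B l)" by (rule tc[THEN conjunct1])
 have d: "\<forall>i\<in>{1, 2, 3}. \<forall>j\<in>{1, 2, 3}. i ~= j \<longrightarrow> B i ~= B j & (\<forall>q\<in>B i \<inter> B j. is_node (B 1 \<union> B 2 \<union> B 3) q)"
  by (rule tc[THEN conjunct2, THEN conjunct1])
 have "\<forall>l\<in>{1, 2, 3}. \<exists>F. irred F & homogeneous (curve_degree (B l)) F & B l = {q. vanishes_at F q}"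
 proof
  fix l :: nat assume "l \<in> {1, 2, 3}"
  then have "integral_curve (B l)" by (rule int[THEN bspec])
  from integral_curve_equation[OF this] show "\<exists>F. irred F & homogeneous (curve_degree (B l)) F & B l = {q. vanishes_at F q}" by blast
 qed
 from bchoice[OF this] obtain f
  where f: "\<forall>l\<in>{1, 2, 3}. irred (f l) & homogeneous (curve_degree (B l)) (f l) & B l = {q. vanishes_at (f l) q}" ..
 have "three_curves B f (%l. curve_degree (B l))"
 proof
  fix l :: nat assume l: "l \<in> {1, 2, 3}"
  note fl = f[THEN bspec, OF l]
  show "irred (f l)" "homogeneous (curve_degree (B l)) (f l)" "B l = {q. vanishes_at (f l) q}" using fl by blast+
 next
  fix i j :: nat and q assume ij: "i \<in> {1, 2, 3}" "j \<in> {1, 2, 3}" "i ~= j"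
  note dd = d[THEN bspec, OF ij(1), THEN bspec, OF ij(2), THEN mp, OF ij(3)]
  show "B i ~= B j" using dd by blast
  show "is_node (B 1 \<union> B 2 \<union> B 3) q" if "q \<in> B i \<inter> B j" using dd that by blast
 next
  show "curve_degree (B 1) \<le> curve_degree (B 2)" "curve_degree (B 2) \<le> curve_degree (B 3)" by (rule tc[THEN conjunct2, THEN conjunct2, THEN conjunct1] tc[THEN conjunct2, THEN conjunct2, THEN conjunct2])+
 qed
 then show ?thesis using that by blast
qed

theorem theorem3p3p1:
  fixes d :: nat and B :: "nat \<Rightarrow> proj_plane set"
  assumes "d \<ge> 2"
    and "three_C_curve B"
    and "curve_degree (B 1 \<union> B 2 \<union> B 3) \<ge> 4"
    and "Hyp2_deg d (B 1 \<union> B 2 \<union> B 3) \<noteq> {}"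
  shows "curve_degree (B 1) = 1 \<and>
    (curve_degree (B 2) = 1 \<longrightarrow>
       (\<exists>p. B 1 \<inter> B 2 = {p} \<and>
          Hyp2_deg d (B 1 \<union> B 2 \<union> B 3) =
            (\<Union>(i, j, q) \<in> {(i, j, q). {i, j} = {1, 2} \<and> q \<in> B j \<inter> B 3}.
               Hyp_pt_deg_mult d (d - 1) (B i) p \<inter> Hyp_pt_deg d (B 3) q))) \<and>
    (curve_degree (B 2) \<ge> 2 \<longrightarrow>
       (\<forall>d'\<ge>3. Hyp2_deg d' (B 1 \<union> B 2 \<union> B 3) = {}) \<and>
       Hyp2_deg 2 (B 1 \<union> B 2 \<union> B 3) =
         (\<Union>p \<in> B 1 \<inter> B 2. \<Union>q \<in> B 1 \<inter> B 3.
            Hyp_pt_deg 2 (B 2) p \<inter> Hyp_pt_deg 2 (B 3) q)) \<and>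
    (\<forall>C \<in> Hyp2_deg d (B 1 \<union> B 2 \<union> B 3). rational_curve C) \<and>
    E_set (B 1 \<union> B 2 \<union> B 3) = Hyp2 (B 1 \<union> B 2 \<union> B 3)"
proof -
 obtain f where "three_curves B f (%l. curve_degree (B l))" using three_curves_exist[OF assms(2)] by blast
 then interpret T: three_curves B f "%l. curve_degree (B l)" .
 \<comment> \<open>Three degrees with sum at least 4 are not all 1, and the third is the
   largest.\<close>
 have b3: "curve_degree (B 3) \<ge> 2" using assms(3) T.sorted unfolding T.degree_D by simp
 obtain C0 where C0: "C0 \<in> Hyp2 T.D" "curve_degree C0 = d" using assms(4) by (auto simp: Hyp2_deg_def)
 note fwd0 = T.forward[OF C0(1) _ b3, unfolded C0(2), OF assms(1)]
 have b1: "curve_degree (B 1) = 1" using fwd0 by blast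
 have rat: "rational_curve C" if "C \<in> Hyp2 T.D" for C using T.all_rational[OF that b3] .
 have a: "\<exists>p. B 1 \<inter> B 2 = {p} & Hyp2_deg d T.D =
      (\<Union>(i, j, q) \<in> {(i, j, q). {i, j} = {1, 2} & q \<in> B j \<inter> B 3}.
        Hyp_pt_deg_mult d (d - 1) (B i) p \<inter> Hyp_pt_deg d (B 3) q)" if b2: "curve_degree (B 2) = 1"
 proof -
  obtain p where "p \<in> B 1 \<inter> B 2" using fwd0 b2 by blast
  then have p: "B 1 \<inter> B 2 = {p}" using T.lines_meet_once[OF b1 b2] by blast
  have "C \<in> (\<Union>(i, j, q) \<in> {(i, j, q). {i, j} = {1, 2} & q \<in> B j \<inter> B 3}.
        Hyp_pt_deg_mult d (d - 1) (B i) p \<inter> Hyp_pt_deg d (B 3) q)" if C: "C \<in> Hyp2_deg d T.D" for C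
  proof -
   have Cd: "C \<in> Hyp2 T.D" "curve_degree C = d" using C by (auto simp: Hyp2_deg_def)
   obtain p' i j q where h: "{i, j} = {1, 2}" "p' \<in> B 1 \<inter> B 2" "q \<in> B j \<inter> B 3"
    "C \<in> Hyp_pt_deg_mult d (d - 1) (B i) p' \<inter> Hyp_pt_deg d (B 3) q"
    using T.forward[OF Cd(1) _ b3, unfolded Cd(2), OF assms(1)] b2 by blast
   have "p' = p" using h(2) p by blast
   then show ?thesis using h by blast
  qed
  moreover have "C \<in> Hyp2_deg d T.D" if h: "{i, j} = {1, 2}" "q \<in> B j \<inter> B 3"
   "C \<in> Hyp_pt_deg_mult d (d - 1) (B i) p" "C \<in> Hyp_pt_deg d (B 3) q" for C i j q
  proof (rule T.backward[OF h(1) _ _ h(2) assms(1) _ h(4)])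
   show "curve_degree (B j) = 1" using h(1) b1 b2 by (auto simp: doubleton_eq_iff)
   show "p \<in> B 1 \<inter> B 2" using p by blast
   show Ci: "C \<in> Hyp_pt_deg d (B i) p" using h(3) by (simp add: Hyp_pt_deg_mult_def)
   fix F v assume F: "irred F" "homogeneous d F" "C = {q. vanishes_at F q}" and v: "v ~= 0" "pt v = p"
   have "pt v \<in> C" using Ci v(2) by (auto simp: Hyp_pt_deg_def Hyp_pt_def)
   \<comment> \<open>The multiplicity condition in (a) supplies the affinity that
     \<open>backward\<close> asks for.\<close>
   moreover have "mult_at (pt v) C = d - 1" using h(3) v(2) by (simp add: Hyp_pt_deg_mult_def)
   ultimately show "affine_along F v" using mult_at_affine(1)[OF F(1,2) assms(1) F(3) v(1)] by blast
  qed
  ultimately show ?thesis using p by (intro exI[of _ p]) blast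
 qed
 have c: "(\<forall>d'\<ge>3. Hyp2_deg d' T.D = {}) & Hyp2_deg 2 T.D =
     (\<Union>p \<in> B 1 \<inter> B 2. \<Union>q \<in> B 1 \<inter> B 3. Hyp_pt_deg 2 (B 2) p \<inter> Hyp_pt_deg 2 (B 3) q)" if b2: "curve_degree (B 2) \<ge> 2"
 proof -
  have fwd: "curve_degree C = 2 & (\<exists>p\<in>B 1 \<inter> B 2. \<exists>q\<in>B 1 \<inter> B 3. C \<in> Hyp_pt_deg 2 (B 2) p \<inter> Hyp_pt_deg 2 (B 3) q)"
   if "C \<in> Hyp2 T.D" "curve_degree C \<ge> 2" for C using T.forward[OF that b3] b2 by blast
  have "Hyp2_deg d' T.D = {}" if "d' \<ge> 3" for d' using fwd that by (fastforce simp: Hyp2_deg_def)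
  moreover have "C \<in> (\<Union>p \<in> B 1 \<inter> B 2. \<Union>q \<in> B 1 \<inter> B 3. Hyp_pt_deg 2 (B 2) p \<inter> Hyp_pt_deg 2 (B 3) q)" if "C \<in> Hyp2_deg 2 T.D" for C
  proof -
   have "C \<in> Hyp2 T.D" "curve_degree C \<ge> 2" using that by (auto simp: Hyp2_deg_def)
   from fwd[OF this] show ?thesis by blast
  qed
  moreover have "C \<in> Hyp2_deg 2 T.D" if h: "p \<in> B 1 \<inter> B 2" "q \<in> B 1 \<inter> B 3" "C \<in> Hyp_pt_deg 2 (B 2) p" "C \<in> Hyp_pt_deg 2 (B 3) q" for C p q
  proof (rule T.backward[OF _ b1 h(1,2) _ h(3,4)])
   \<comment> \<open>Here the line B 1 takes the role of B j, and B 2 that of the component met at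
     p. No multiplicity condition is imposed, since a conic is affine along each of its
     points.\<close>
   show "{2, 1} = {1, 2 :: nat}" by auto
   fix F v assume F: "irred F" "homogeneous 2 F" "C = {q. vanishes_at F q}" and v: "v ~= 0" "pt v = p"
   have "pt v \<in> C" using h(3) v(2) by (auto simp: Hyp_pt_deg_def Hyp_pt_def)
   then have "ev id F v = 0" using vanishes_at_pt[OF F(2) v(1)] F(3) by simp
   then show "affine_along F v" using conic_affine[OF F(2) v(1)] by blast
  qed simp
  ultimately show ?thesis by blast
 qed
 have r1: "\<forall>C\<in>Hyp2_deg d T.D. rational_curve C" using rat by (simp add: Hyp2_deg_def)
 have r2: "E_set T.D = Hyp2 T.D" using rat by (auto simp: E_set_def)
 show ?thesis by (intro conjI impI b1 a r1 r2 conjunct1[OF c] conjunct2[OF c]) assumption+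
qed

end
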